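(* Let $d\geq1$ and let $\gamma\geq 1/2$ if $d=1$ and $\gamma>0$ if $d\geq 2$. There are constants $C_{\gamma,d}>0$ and $L_{\gamma,d}$ such that for every complex-valued $V\in L^{\gamma+d/2}(\mathbb{R}^d)$ the eigenvalues $E_j\in\mathbb{C}\setminus[0,\infty)$ of $-\Delta+V$, repeated according to their algebraic multiplicity, satisfy $$ \Bigg( \sum_{j:\ |E_j|^\gamma\leq C_{\gamma,d} \int |V|^{\gamma+d/2}\,dx} \delta(E_j)^{\gamma+d/2} \Bigg)^\frac{\gamma}{\gamma+d/2} \leq L_{\gamma,d} \int_{\mathbb{R}^d} |V|^{\gamma+d/2}\,dx , $$ and for every $0<\epsilon'<\gamma$ there is $L_{\gamma,d,\epsilon'}$ such that for every such $V$ and every $\mu\geq1$, $$ \Bigg( \sum_{j:\ |E_j|^\gamma\geq \mu C_{\gamma,d} \int |V|^{\gamma+d/2}\,dx} \frac{\delta(E_j)^{\gamma+d/2}}{|E_j|^{d/2 + \epsilon'}} \Bigg)^{\frac{\gamma}{\gamma-\epsilon'}} \leq L_{\gamma,d,\epsilon'}\, \mu^{-\frac{\epsilon'}{\gamma-\epsilon'}} \int_{\mathbb{R}^d} |V|^{\gamma+d/2}\,dx . $$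
   Context: For $z\in\mathbb{C}$, $\delta(z):=\operatorname{dist}(z,[0,\infty))$. For complex-valued $V\in L^{\gamma+d/2}(\mathbb{R}^d)$, $-\Delta+V$ is the $m$-sectorial operator in $L^2(\mathbb{R}^d)$ associated with the closed sectorial form $u\mapsto\int|\nabla u|^2+\int V|u|^2$ on $H^1(\mathbb{R}^d)$; its spectrum in $\mathbb{C}\setminus[0,\infty)$ consists of isolated eigenvalues of finite algebraic multiplicity (the rank of the Riesz projection). *)

theory Defs
  imports "HOL-Analysis.Analysis"
begin

definition partial_deriv :: "'n::finite \<Rightarrow> (real^'n \<Rightarrow> complex) \<Rightarrow> (real^'n \<Rightarrow> complex)" where
  "partial_deriv i \<phi> = (\<lambda>x. frechet_derivative \<phi> (at x) (axis i 1))"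

coinductive smooth_fun :: "(real^'n::finite \<Rightarrow> complex) \<Rightarrow> bool" where
  "(\<forall>x. \<phi> differentiable (at x)) \<Longrightarrow> (\<forall>i. smooth_fun (partial_deriv i \<phi>)) \<Longrightarrow> smooth_fun \<phi>"

definition test_fun :: "(real^'n::finite \<Rightarrow> complex) \<Rightarrow> bool" where
  "test_fun \<phi> \<longleftrightarrow> smooth_fun \<phi> \<and> compact (closure {x. \<phi> x \<noteq> 0})"

definition L2 :: "(real^'n::finite \<Rightarrow> complex) set" where
  "L2 = {u. u \<in> borel_measurable lborel \<and> integrable lborel (\<lambda>x. (norm (u x))\<^sup>2)}"

definition L2_inner :: "(real^'n::finite \<Rightarrow> complex) \<Rightarrow> (real^'n \<Rightarrow> complex) \<Rightarrow> complex" where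
  "L2_inner u v = (\<integral>x. u x * cnj (v x) \<partial>lborel)"

definition ae_eq :: "(real^'n::finite \<Rightarrow> complex) \<Rightarrow> (real^'n \<Rightarrow> complex) \<Rightarrow> bool" where
  "ae_eq u v \<longleftrightarrow> (AE x in lborel. u x = v x)"

definition weak_partial :: "'n::finite \<Rightarrow> (real^'n \<Rightarrow> complex) \<Rightarrow> (real^'n \<Rightarrow> complex) \<Rightarrow> bool" where
  "weak_partial i u g \<longleftrightarrow>
     (\<forall>\<phi>. test_fun \<phi> \<longrightarrow>
        integrable lborel (\<lambda>x. u x * partial_deriv i \<phi> x) \<and> integrable lborel (\<lambda>x. g x * \<phi> x) \<and>
        (\<integral>x. u x * partial_deriv i \<phi> x \<partial>lborel) = - (\<integral>x. g x * \<phi> x \<partial>lborel))"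

definition H1 :: "(real^'n::finite \<Rightarrow> complex) set" where
  "H1 = {u \<in> L2. \<forall>i. \<exists>g \<in> L2. weak_partial i u g}"

definition weak_grad :: "(real^'n::finite \<Rightarrow> complex) \<Rightarrow> 'n \<Rightarrow> (real^'n \<Rightarrow> complex)" where
  "weak_grad u i = (SOME g. g \<in> L2 \<and> weak_partial i u g)"

definition schr_form :: "(real^'n::finite \<Rightarrow> complex) \<Rightarrow> (real^'n \<Rightarrow> complex) \<Rightarrow> (real^'n \<Rightarrow> complex) \<Rightarrow> complex" where
  "schr_form V u v =
     (\<Sum>i\<in>UNIV. L2_inner (weak_grad u i) (weak_grad v i)) + (\<integral>x. V x * u x * cnj (v x) \<partial>lborel)"

text \<open>Graph of the associated m-sectorial operator H = -Laplacian + V: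
  (u, f) in the graph iff u in H^1, f in L^2 and form(u, v) = <f, v> for all v in H^1.\<close>
definition schr_graph :: "(real^'n::finite \<Rightarrow> complex) \<Rightarrow> ((real^'n \<Rightarrow> complex) \<times> (real^'n \<Rightarrow> complex)) set" where
  "schr_graph V = {(u, f). u \<in> H1 \<and> f \<in> L2 \<and> (\<forall>v \<in> H1. schr_form V u v = L2_inner f v)}"

definition schr_eigenvalues :: "(real^'n::finite \<Rightarrow> complex) \<Rightarrow> complex set" where
  "schr_eigenvalues V = {E. \<exists>u. (u, (\<lambda>x. E * u x)) \<in> schr_graph V \<and> \<not> ae_eq u (\<lambda>x. 0)}"

text \<open>Resolvent set: H - z is a bijection of its domain onto L^2 (modulo a.e. equality);
  since H is closed, the inverse is automatically bounded.\<close>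
definition schr_resolvent_set :: "(real^'n::finite \<Rightarrow> complex) \<Rightarrow> complex set" where
  "schr_resolvent_set V = {z. \<forall>f \<in> L2.
      (\<exists>u. (u, (\<lambda>x. f x + z * u x)) \<in> schr_graph V) \<and>
      (\<forall>u u'. (u, (\<lambda>x. f x + z * u x)) \<in> schr_graph V \<longrightarrow>
              (u', (\<lambda>x. f x + z * u' x)) \<in> schr_graph V \<longrightarrow> ae_eq u u')}"

definition schr_resolvent :: "(real^'n::finite \<Rightarrow> complex) \<Rightarrow> complex \<Rightarrow> (real^'n \<Rightarrow> complex) \<Rightarrow> (real^'n \<Rightarrow> complex)" where
  "schr_resolvent V z f = (SOME u. (u, (\<lambda>x. f x + z * u x)) \<in> schr_graph V)"

text \<open>Riesz projection P = -(1/(2 pi i)) contour-integral over the circle |z - E| = r of (H - z)^{-1} dz,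
  defined (weakly) as the element P f of L^2 with
  <P f, g> = -(1/(2 pi i)) int_0^{2pi} <(H - z(t))^{-1} f, g> z'(t) dt,   z(t) = E + r e^{it}.\<close>
definition riesz_proj :: "(real^'n::finite \<Rightarrow> complex) \<Rightarrow> complex \<Rightarrow> real \<Rightarrow> (real^'n \<Rightarrow> complex) \<Rightarrow> (real^'n \<Rightarrow> complex)" where
  "riesz_proj V E r f = (SOME u. u \<in> L2 \<and> (\<forall>g \<in> L2. L2_inner u g =
      - (1 / (2 * pi * \<i>)) * (LBINT t=0..2*pi.
          L2_inner (schr_resolvent V (E + r * exp (\<i> * t)) f) g * (\<i> * r * exp (\<i> * t)))))"

definition riesz_rank :: "(real^'n::finite \<Rightarrow> complex) \<Rightarrow> complex \<Rightarrow> real \<Rightarrow> enat" where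
  "riesz_rank V E r = Sup {enat n | n. \<exists>f :: nat \<Rightarrow> (real^'n \<Rightarrow> complex).
      (\<forall>k<n. f k \<in> L2) \<and>
      (\<forall>c :: nat \<Rightarrow> complex. ae_eq (\<lambda>x. \<Sum>k<n. c k * riesz_proj V E r (f k) x) (\<lambda>x. 0)
            \<longrightarrow> (\<forall>k<n. c k = 0))}"

text \<open>Algebraic multiplicity of an isolated point E of the spectrum: rank of the Riesz projection
  for a circle around E enclosing no other spectrum (independent of the radius).\<close>
definition alg_mult :: "(real^'n::finite \<Rightarrow> complex) \<Rightarrow> complex \<Rightarrow> enat" where
  "alg_mult V E = riesz_rank V E (SOME r. r > 0 \<and> cball E r - {E} \<subseteq> schr_resolvent_set V)"

definition delta :: "complex \<Rightarrow> real" where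
  "delta z = infdist z (complex_of_real ` {0..})"

end

theory Submission
  imports Defs "HOL-Complex_Analysis.Complex_Analysis"
begin

text \<open>
  Fix \<open>a > 0\<close> with \<open>a\<^sup>\<gamma>\<close> a large multiple of \<open>\<integral>|V|\<^sup>p\<close> and put \<open>K = (H + a)\<inverse>\<close> on \<open>H\<^sup>1\<close> with the inner product
  \<open>\<langle>u, v\<rangle>\<^sub>a = \<integral>\<nabla>u \<cdot> \<nabla>v\<^sup>* + a \<integral>u v\<^sup>*\<close>. On a finite-dimensional invariant subspace spanned by generalised
  eigenvectors choose a \<open>\<langle>\<cdot>, \<cdot>\<rangle>\<^sub>a\<close>-orthonormal basis \<open>e\<^sub>j\<close> that makes \<open>K\<close> triangular. Its diagonal entries
  \<open>1 / (E\<^sub>j + a)\<close> satisfy \<open>1 / (E\<^sub>j + a) + \<integral>V (K e\<^sub>j) e\<^sub>j\<^sup>* = \<parallel>e\<^sub>j\<parallel>\<^sup>2 \<in> [0, 1/a]\<close>, so \<open>\<delta>(E\<^sub>j) \<le> 6 a\<^sup>2 |\<integral>V (K e\<^sub>j) e\<^sub>j\<^sup>*|\<close>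
  when \<open>|E\<^sub>j| \<le> a\<close>. The \<open>p\<close>-th powers of the right-hand sides are summable because
  \<open>\<Sum>\<^sub>j (\<integral>|V| |g\<^sub>j|\<^sup>2)\<^sup>p \<le> const a\<^bsup>d/2 - p\<^esup> \<integral>|V|\<^sup>p\<close> for every family \<open>g\<^sub>j\<close> with \<open>\<parallel>\<Sum> c\<^sub>j g\<^sub>j\<parallel>\<^sub>a\<^sup>2 \<le> \<Sum> |c\<^sub>j|\<^sup>2\<close>; this is proved by
  decomposing functions into moving averages over cubes of side \<open>2\<^bsup>-k\<^esup> a\<^bsup>-1/2\<^esup>\<close>, which replaces the usual
  Fourier analytic (Kato--Seiler--Simon) argument. The result is
  \<open>\<Sum> \<delta>(E\<^sub>j)\<^sup>p \<le> const a\<^bsup>d/2\<^esup> \<integral>|V|\<^sup>p\<close> over \<open>|E\<^sub>j| \<le> a\<close>. The first inequality is the smallest admissible \<open>a\<close>, the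
  second one follows by summing over dyadic \<open>a\<close>.

  The same family bound makes \<open>V\<close> small off a finite-dimensional space, which yields the Fredholm
  alternative for \<open>H - z\<close>, and it bounds the length of Jordan-type flags. For a maximal flag at \<open>E\<close> the resolvent
  is holomorphic near \<open>E\<close> modulo the span of the flag, so the Riesz projection maps into that span.
\<close>

section \<open>Square-integrable functions\<close>

text \<open>The hypotheses on \<gamma> enter through \<open>p >= 1\<close> and
  \<open>2 p > d\<close>: the first makes the linearisation \<open>v <= v^p t^(1-p) + t\<close> of
  \<open>|V|\<close> available, the second makes the contributions of finer and finer scales
  summable. Working in \<open>H^1\<close> rather than \<open>L^2\<close> keeps the potential a form,
  as V need not map \<open>H^1\<close> into \<open>L^2\<close>; the condition on \<open>a\<close>
  says that this form is at most half of the unperturbed one. The interval \<open>[0, 1/a]\<close>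
  contains the numerical range of \<open>(-Delta + a)^-1\<close> for the product
  \<open><.,.>_a\<close>. The trace estimate thus compares the eigenvalues of a non-normal operator
  with diagonal entries of a self-adjoint one, vector by vector and without determinants. Algebraic
  multiplicity is the rank of a contour integral over some chosen circle, defined only weakly. The
  inequalities ask only for an upper bound of it, so it is enough to trap the range of the
  projection in a space whose dimension the trace estimate already counts. Finiteness of the
  multiplicity comes from the same estimate, because \<open>delta E > 0\<close>.\<close>

definition nsq :: "(real^'n::finite \<Rightarrow> complex) \<Rightarrow> ennreal" where
  "nsq u = (\<integral>\<^sup>+x. ennreal ((norm (u x))\<^sup>2) \<partial>lborel)"

lemma L2_measurable [measurable_dest]: "u \<in> L2 \<Longrightarrow> u \<in> borel_measurable borel"
  by (auto simp: L2_def)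

lemma L2_iff: "u \<in> L2 \<longleftrightarrow> u \<in> borel_measurable borel \<and> nsq u < \<infinity>"
  by (auto simp: L2_def nsq_def integrable_iff_bounded)

lemma nsq_eq: "u \<in> L2 \<Longrightarrow> nsq u = ennreal (\<integral>x. (norm (u x))\<^sup>2 \<partial>lborel)"
  unfolding nsq_def by (intro nn_integral_eq_integral) (auto simp: L2_def)

lemma nsq_add_le:
  fixes u v :: "real^'n::finite \<Rightarrow> complex"
  assumes [measurable]: "u \<in> borel_measurable borel" "v \<in> borel_measurable borel"
  shows "nsq (\<lambda>x. u x + v x) \<le> 2 * nsq u + 2 * nsq v"
proof -
  have "nsq (\<lambda>x. u x + v x) \<le> (\<integral>\<^sup>+x. 2 * ennreal ((norm (u x))\<^sup>2) + 2 * ennreal ((norm (v x))\<^sup>2) \<partial>lborel)"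
    unfolding nsq_def
  proof (rule nn_integral_mono)
    fix x :: "real^'n"
    have "(norm (u x + v x))\<^sup>2 \<le> (norm (u x) + norm (v x))\<^sup>2"
      by (intro power_mono norm_triangle_ineq) auto
    also have "\<dots> \<le> 2 * (norm (u x))\<^sup>2 + 2 * (norm (v x))\<^sup>2"
      using sum_squares_bound[of "norm (u x)" "norm (v x)"] by (simp add: power2_sum)
    finally have "ennreal ((norm (u x + v x))\<^sup>2) \<le> ennreal (2 * (norm (u x))\<^sup>2 + 2 * (norm (v x))\<^sup>2)" by (rule ennreal_leI)
    thus "ennreal ((norm (u x + v x))\<^sup>2) \<le> 2 * ennreal ((norm (u x))\<^sup>2) + 2 * ennreal ((norm (v x))\<^sup>2)"
      by (simp add: ennreal_mult)
  qed
  also have "\<dots> = 2 * nsq u + 2 * nsq v"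
    unfolding nsq_def by (simp add: nn_integral_add nn_integral_cmult)
  finally show ?thesis .
qed

lemma nsq_scale:
  assumes [measurable]: "u \<in> borel_measurable borel"
  shows "nsq (\<lambda>x. c * u x) = ennreal ((norm c)\<^sup>2) * nsq u"
  unfolding nsq_def by (simp add: norm_mult power_mult_distrib ennreal_mult nn_integral_cmult)

lemma L2_zero [simp]: "(\<lambda>x. 0) \<in> L2"
  by (simp add: L2_iff nsq_def)

lemma L2_add: assumes "u \<in> L2" "v \<in> L2" shows "(\<lambda>x. u x + v x) \<in> L2"
proof -
  have [measurable]: "u \<in> borel_measurable borel" "v \<in> borel_measurable borel" using assms by (auto simp: L2_iff)
  have "nsq (\<lambda>x. u x + v x) \<le> 2 * nsq u + 2 * nsq v" by (rule nsq_add_le) measurable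
  also have "\<dots> < \<infinity>" using assms by (auto simp: L2_iff ennreal_mult_less_top)
  finally show ?thesis by (auto simp: L2_iff)
qed

lemma L2_scale: assumes "u \<in> L2" shows "(\<lambda>x. c * u x) \<in> L2"
proof -
  have [measurable]: "u \<in> borel_measurable borel" using assms by (auto simp: L2_iff)
  show ?thesis using assms by (auto simp: L2_iff nsq_scale ennreal_mult_less_top)
qed

lemma L2_diff: assumes "u \<in> L2" "v \<in> L2" shows "(\<lambda>x. u x - v x) \<in> L2"
  using L2_add[OF assms(1) L2_scale[OF assms(2), of "-1"]] by simp

lemma L2_sum: assumes "\<And>i. i \<in> I \<Longrightarrow> u i \<in> L2" shows "(\<lambda>x. \<Sum>i\<in>I. u i x) \<in> L2"
  using assms by (induction I rule: infinite_finite_induct) (auto intro: L2_add)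

lemma L2_cnj: "u \<in> L2 \<Longrightarrow> (\<lambda>x. cnj (u x)) \<in> L2"
proof -
  assume u: "u \<in> L2"
  have [measurable]: "u \<in> borel_measurable borel" using u by (auto simp: L2_iff)
  have "(\<lambda>x. cnj (u x)) \<in> borel_measurable borel"
    by (rule measurable_compose[of u _ borel cnj]) (auto intro!: borel_measurable_continuous_onI continuous_intros)
  thus ?thesis using u by (auto simp: L2_iff nsq_def)
qed

lemma L2_mult_integrable:
  assumes "u \<in> L2" "v \<in> L2" shows "integrable lborel (\<lambda>x. u x * v x)"
proof (rule Bochner_Integration.integrable_bound[where f="\<lambda>x. (norm (u x))\<^sup>2 + (norm (v x))\<^sup>2"])
  show "integrable lborel (\<lambda>x. (norm (u x))\<^sup>2 + (norm (v x))\<^sup>2)" using assms by (auto simp: L2_def)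
  show "(\<lambda>x. u x * v x) \<in> borel_measurable lborel" using assms by (auto simp: L2_iff)
  have "norm (u x * v x) \<le> norm ((norm (u x))\<^sup>2 + (norm (v x))\<^sup>2)" for x
    using sum_squares_bound[of "norm (u x)" "norm (v x)"] mult_nonneg_nonneg[of "norm (u x)" "norm (v x)"]
    unfolding norm_mult real_norm_def by linarith
  thus "AE x in lborel. norm (u x * v x) \<le> norm ((norm (u x))\<^sup>2 + (norm (v x))\<^sup>2)" by auto
qed

lemma L2_inner_integrable:
  assumes "u \<in> L2" "v \<in> L2" shows "integrable lborel (\<lambda>x. u x * cnj (v x))"
  using L2_mult_integrable[OF assms(1) L2_cnj[OF assms(2)]] .

section \<open>Translations and dilations of Lebesgue measure\<close>

lemma nn_integral_translate:
  fixes f :: "real^'n::finite \<Rightarrow> ennreal"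
  assumes [measurable]: "f \<in> borel_measurable borel"
  shows "(\<integral>\<^sup>+x. f (x + h) \<partial>lborel) = (\<integral>\<^sup>+x. f x \<partial>lborel)"
proof -
  have "(\<integral>\<^sup>+x. f x \<partial>lborel) = (\<integral>\<^sup>+x. f x \<partial>distr lborel borel ((+) h))" by (simp add: lborel_distr_plus)
  also have "\<dots> = (\<integral>\<^sup>+x. f (h + x) \<partial>lborel)" by (subst nn_integral_distr) auto
  finally show ?thesis by (simp add: add.commute)
qed

lemma integral_translate:
  fixes f :: "real^'n::finite \<Rightarrow> complex"
  assumes [measurable]: "f \<in> borel_measurable borel"
  shows "(\<integral>x. f (x + h) \<partial>lborel) = (\<integral>x. f x \<partial>lborel)"
proof -
  have "(\<integral>x. f x \<partial>lborel) = (\<integral>x. f x \<partial>distr lborel borel ((+) h))" by (simp add: lborel_distr_plus)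
  also have "\<dots> = (\<integral>x. f (h + x) \<partial>lborel)" by (subst integral_distr) auto
  finally show ?thesis by (simp add: add.commute)
qed

lemma nn_integral_affine:
  fixes f :: "real^'n::finite \<Rightarrow> ennreal"
  assumes [measurable]: "f \<in> borel_measurable borel" and "l > 0"
  shows "(\<integral>\<^sup>+y. f (x + l *\<^sub>R y) \<partial>lborel) = ennreal (1 / l ^ CARD('n)) * (\<integral>\<^sup>+x. f x \<partial>lborel)"
proof -
  have "(\<integral>\<^sup>+x. f x \<partial>lborel) = (\<integral>\<^sup>+x. f x \<partial>density (distr lborel borel (\<lambda>y. x + l *\<^sub>R y)) (\<lambda>_. \<bar>l\<bar>^DIM(real^'n)))"
    using assms lborel_affine[of l x] by simp
  also have "\<dots> = ennreal (l ^ CARD('n)) * (\<integral>\<^sup>+y. f (x + l *\<^sub>R y) \<partial>lborel)"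
    using assms(2) by (subst nn_integral_density) (auto simp: nn_integral_distr nn_integral_cmult)
  finally show ?thesis using assms(2)
    by (simp add: mult.assoc[symmetric] ennreal_mult[symmetric])
qed

lemma nsq_translate: "u \<in> borel_measurable borel \<Longrightarrow> nsq (\<lambda>x. u (x + h)) = nsq u"
  unfolding nsq_def by (rule nn_integral_translate[of "\<lambda>x. ennreal ((norm (u x))\<^sup>2)"]) auto

lemma L2_translate: "u \<in> L2 \<Longrightarrow> (\<lambda>x. u (x + h)) \<in> L2"
  by (auto simp: L2_iff nsq_translate)

lemma L2_inner_nsq_bound:
  assumes "u \<in> L2" "v \<in> L2"
  shows "(\<integral>\<^sup>+x. ennreal (norm (u x * v x)) \<partial>lborel)\<^sup>2 \<le> nsq u * nsq v"
proof -
  have [measurable]: "u \<in> borel_measurable borel" "v \<in> borel_measurable borel" using assms by (auto simp: L2_iff)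
  show ?thesis
    using Cauchy_Schwarz_nn_integral[of "\<lambda>x. ennreal (norm (u x))" lborel "\<lambda>x. ennreal (norm (v x))"]
    by (simp add: nsq_def norm_mult ennreal_mult ennreal_power)
qed

lemma AE_zero_iff_nsq:
  assumes [measurable]: "u \<in> borel_measurable borel"
  shows "(AE x in lborel. u x = 0) \<longleftrightarrow> nsq u = 0"
  unfolding nsq_def by (subst nn_integral_0_iff_AE) (auto simp: ennreal_eq_0_iff)

lemma indicator_L2:
  assumes "A \<in> sets borel" "emeasure lborel A < \<infinity>"
  shows "(\<lambda>x. indicator A x :: complex) \<in> L2"
proof -
  have "nsq (\<lambda>x. indicator A x) = (\<integral>\<^sup>+x. indicator A x \<partial>lborel)"
    unfolding nsq_def by (intro nn_integral_cong) (auto simp: indicator_def)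
  thus ?thesis using assms by (auto simp: L2_iff)
qed

lemma indicator_box_L2:
  "(\<lambda>x. indicator (cbox a b) x :: complex) \<in> L2" "(\<lambda>x. indicator (box a b) x :: complex) \<in> L2"
  by (intro indicator_L2; simp add: emeasure_lborel_cbox_eq emeasure_lborel_box_eq)+

text \<open>Boxes form a generating system closed under intersection, so they already separate functions.\<close>
lemma L2_zero_if_box_integrals_zero:
  fixes w :: "real^'n::finite \<Rightarrow> complex"
  assumes w: "w \<in> L2" and z: "\<And>a b. (\<integral>x. indicator (box a b) x *\<^sub>R w x \<partial>lborel) = 0"
  shows "AE x in lborel. w x = 0"
proof -
  have [measurable]: "w \<in> borel_measurable borel" using w by (auto simp: L2_iff)
  \<comment> \<open>A square-integrable \<open>w\<close> need not be integrable, which the density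
    argument demands; cut off to boxes that exhaust the space it is.\<close>
  define Bx where "Bx k = box (- (real k) *\<^sub>R One) (real k *\<^sub>R One :: real^'n)" for k :: nat
  have int: "integrable lborel (\<lambda>x. indicator (box a b) x *\<^sub>R w x)" for a b
  proof -
    have "integrable lborel (\<lambda>x. indicator (box a b) x * w x)"
      by (intro L2_mult_integrable indicator_box_L2 w)
    moreover have "indicator (box a b) x * w x = indicator (box a b) x *\<^sub>R w x" for x by (auto simp: indicator_def)
    ultimately show ?thesis by simp
  qed
  have main: "AE x in lborel. indicator (Bx k) x *\<^sub>R w x = 0" for k
  proof (rule sigma_finite_measure.density_zero[OF sigma_finite_lborel])
    show i: "integrable lborel (\<lambda>x. indicator (Bx k) x *\<^sub>R w x)" unfolding Bx_def by (rule int)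
    fix A :: "(real^'n) set" assume "A \<in> sets lborel"
    hence A: "A \<in> sigma_sets UNIV (range (\<lambda>(a, b). box a b))" by (simp add: borel_eq_box)
    show "set_lebesgue_integral lborel A (\<lambda>x. indicator (Bx k) x *\<^sub>R w x) = 0"
    proof (rule sigma_sets_induct_disjoint[OF _ _ A])
      show "Int_stable (range (\<lambda>(a, b). box a b :: (real^'n) set))"
        by (auto simp: Int_stable_def box_Int_box)
      show "range (\<lambda>(a, b). box a b :: (real^'n) set) \<subseteq> Pow UNIV" by auto
      show "set_lebesgue_integral lborel {} (\<lambda>x. indicator (Bx k) x *\<^sub>R w x) = 0" by (simp add: set_lebesgue_integral_def)
    next
      fix A :: "(real^'n) set" assume "A \<in> range (\<lambda>(a, b). box a b)"
      then obtain a b where "A = box a b" by auto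
      then obtain c d where cd: "A \<inter> Bx k = box c d" by (auto simp: Bx_def box_Int_box)
      have "set_lebesgue_integral lborel A (\<lambda>x. indicator (Bx k) x *\<^sub>R w x) = (\<integral>x. indicator (A \<inter> Bx k) x *\<^sub>R w x \<partial>lborel)"
        by (simp add: set_lebesgue_integral_def indicator_inter_arith)
      thus "set_lebesgue_integral lborel A (\<lambda>x. indicator (Bx k) x *\<^sub>R w x) = 0" using z cd by simp
    next
      fix A :: "(real^'n) set" assume A: "A \<in> sigma_sets UNIV (range (\<lambda>(a, b). box a b))"
        and I: "set_lebesgue_integral lborel A (\<lambda>x. indicator (Bx k) x *\<^sub>R w x) = 0"
      have A': "A \<in> sets borel" using A by (simp add: borel_eq_box)
      have "set_lebesgue_integral lborel (UNIV - A) (\<lambda>x. indicator (Bx k) x *\<^sub>R w x)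
         = (\<integral>x. indicator (Bx k) x *\<^sub>R w x - indicator A x *\<^sub>R indicator (Bx k) x *\<^sub>R w x \<partial>lborel)"
        unfolding set_lebesgue_integral_def by (intro Bochner_Integration.integral_cong) (auto simp: indicator_def)
      also have "\<dots> = (\<integral>x. indicator (Bx k) x *\<^sub>R w x \<partial>lborel) - (\<integral>x. indicator A x *\<^sub>R indicator (Bx k) x *\<^sub>R w x \<partial>lborel)"
        using A' by (intro Bochner_Integration.integral_diff integrable_mult_indicator[OF _ i] i) auto
      also have "\<dots> = 0" using I z by (simp add: set_lebesgue_integral_def Bx_def)
      finally show "set_lebesgue_integral lborel (UNIV - A) (\<lambda>x. indicator (Bx k) x *\<^sub>R w x) = 0" .
    next
      fix A :: "nat \<Rightarrow> (real^'n) set" assume d: "disjoint_family A"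
        and A: "range A \<subseteq> sigma_sets UNIV (range (\<lambda>(a, b). box a b))"
        and I: "\<And>i. set_lebesgue_integral lborel (A i) (\<lambda>x. indicator (Bx k) x *\<^sub>R w x) = 0"
      have A': "A i \<in> sets borel" for i using A by (auto simp: borel_eq_box)
      have "set_lebesgue_integral lborel (\<Union>i. A i) (\<lambda>x. indicator (Bx k) x *\<^sub>R w x)
         = (\<Sum>i. set_lebesgue_integral lborel (A i) (\<lambda>x. indicator (Bx k) x *\<^sub>R w x))"
      proof (rule lebesgue_integral_countable_add)
        show "set_integrable lborel (\<Union>i. A i) (\<lambda>x. indicator (Bx k) x *\<^sub>R w x)"
          unfolding set_integrable_def using A' by (intro integrable_mult_indicator[OF _ i]) auto
      qed (use A' d in \<open>auto simp: disjoint_family_on_def\<close>)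
      thus "set_lebesgue_integral lborel (\<Union>i. A i) (\<lambda>x. indicator (Bx k) x *\<^sub>R w x) = 0" using I by simp
    qed
  qed
  have "AE x in lborel. \<forall>k. indicator (Bx k) x *\<^sub>R w x = 0" using main by (subst AE_all_countable) blast
  thus ?thesis
  proof (rule AE_mp, intro AE_I2 impI)
    fix x :: "real^'n" assume *: "\<forall>k. indicator (Bx k) x *\<^sub>R w x = 0"
    obtain k where k: "real k > norm x" using reals_Archimedean2 by blast
    have "\<bar>x \<bullet> i\<bar> < real k" if "i \<in> Basis" for i using Basis_le_norm[OF that, of x] k by linarith
    hence "x \<in> Bx k" by (force simp: Bx_def mem_box)
    thus "w x = 0" using *[rule_format, of k] by simp
  qed
qed

section \<open>Test functions\<close>

text \<open>The classical flat function \<open>exp (-1/x)\<close> with a polynomial in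
  \<open>1/x\<close> in front: the class obtained in this way is closed under
  differentiation.\<close>

definition flat_exp :: "real poly \<Rightarrow> real \<Rightarrow> real" where
  "flat_exp P x = (if x > 0 then poly P (1/x) * exp (-1/x) else 0)"

lemma poly_times_exp_minus_tendsto_0: "((\<lambda>y::real. poly P y * exp (- y)) \<longlongrightarrow> 0) at_top"
proof -
  have "((\<lambda>y::real. \<Sum>i\<le>degree P. coeff P i * (y ^ i / exp y)) \<longlongrightarrow> (\<Sum>i\<le>degree P. coeff P i * 0)) at_top"
    by (intro tendsto_intros tendsto_power_div_exp_0)
  thus ?thesis
    by (simp add: poly_altdef sum_distrib_right exp_minus divide_inverse mult.assoc)
qed

text \<open>Differentiating \<open>P(1/x) exp(-1/x)\<close> gives
  \<open>(1/x)^2 (P - P')(1/x) exp(-1/x)\<close>, hence the factor \<open>[:0,0,1:]\<close>. At 0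
  the right difference quotient is \<open>y P(y) exp(-y)\<close> at \<open>y = 1/x\<close>, which
  tends to 0.\<close>

lemma flat_exp_deriv:
  "(flat_exp P has_real_derivative flat_exp ([:0,0,1:] * (P - pderiv P)) x) (at x)"
proof -
  consider "x > 0" | "x < 0" | "x = 0" by linarith
  thus ?thesis
  proof cases
    case 1
    have "((\<lambda>x. poly P (1/x) * exp (-1/x)) has_real_derivative flat_exp ([:0,0,1:] * (P - pderiv P)) x) (at x)"
      using 1 unfolding flat_exp_def
      by (auto intro!: derivative_eq_intros DERIV_chain2[OF poly_DERIV] simp: field_simps power2_eq_square)
    thus ?thesis
      by (rule has_field_derivative_transform_within_open[where S="{0<..}"]) (use 1 in \<open>auto simp: flat_exp_def\<close>)
  next
    case 2
    have "((\<lambda>x. 0) has_real_derivative flat_exp ([:0,0,1:] * (P - pderiv P)) x) (at x)"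
      using 2 by (auto simp: flat_exp_def)
    thus ?thesis
      by (rule has_field_derivative_transform_within_open[where S="{..<0}"]) (use 2 in \<open>auto simp: flat_exp_def\<close>)
  next
    case 3
    have L: "((\<lambda>h. poly ([:0,1:] * P) (1/h) * exp (- (1/h))) \<longlongrightarrow> 0) (at_right 0)"
      by (rule filterlim_compose[OF poly_times_exp_minus_tendsto_0])
         (simp add: filterlim_inverse_at_top_right[unfolded inverse_eq_divide])
    have "((\<lambda>h. flat_exp P h / h) \<longlongrightarrow> 0) (at_right 0)"
      by (rule Lim_transform_eventually[OF L]) (auto simp: eventually_at_right[of 0 1] flat_exp_def intro!: exI[of _ 1])
    moreover have "((\<lambda>h. flat_exp P h / h) \<longlongrightarrow> 0) (at_left 0)"
      by (rule Lim_transform_eventually[OF tendsto_const]) (auto simp: eventually_at_left[of "-1" 0] flat_exp_def intro!: exI[of _ "-1"])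
    ultimately have "((\<lambda>h. flat_exp P h / h) \<longlongrightarrow> 0) (at 0)" by (simp add: filterlim_split_at)
    thus ?thesis using 3 by (simp add: DERIV_def flat_exp_def)
  qed
qed

text \<open>An algebra stable under all partial derivatives; membership is the invariant for the
  coinductive proof of smoothness.\<close>

inductive flat_alg :: "(real^'n::finite \<Rightarrow> complex) \<Rightarrow> bool" where
  base: "flat_alg (\<lambda>x. of_real (flat_exp P (s * x $ i + t)))"
| const: "flat_alg (\<lambda>x. c)"
| add: "flat_alg f \<Longrightarrow> flat_alg g \<Longrightarrow> flat_alg (\<lambda>x. f x + g x)"
| mult: "flat_alg f \<Longrightarrow> flat_alg g \<Longrightarrow> flat_alg (\<lambda>x. f x * g x)"

lemma partial_deriv_eqI: "(\<And>x. (f has_derivative f' x) (at x)) \<Longrightarrow> partial_deriv i f = (\<lambda>x. f' x (axis i 1))"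
  unfolding partial_deriv_def by (metis frechet_derivative_at)

lemma flat_alg_deriv:
  "flat_alg f \<Longrightarrow> (\<forall>x. f differentiable (at x)) \<and> (\<forall>i. flat_alg (partial_deriv i f))"
proof (induction rule: flat_alg.induct)
  case (base P s i t)
  let ?Q = "[:0,0,1:] * (P - pderiv P)"
  have D: "((\<lambda>x::real^'a. complex_of_real (flat_exp P (s * x $ i + t))) has_derivative
      (\<lambda>h. of_real (flat_exp ?Q (s * x $ i + t) * (s * h $ i)))) (at x)" for x
  proof -
    have "((\<lambda>x::real^'a. s * x $ i + t) has_derivative (\<lambda>h. s * h $ i)) (at x)"
      by (auto intro!: derivative_eq_intros bounded_linear.has_derivative[OF bounded_linear_vec_nth])
    from has_derivative_compose[OF this flat_exp_deriv[THEN has_field_derivative_imp_has_derivative]]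
    have "((\<lambda>x::real^'a. flat_exp P (s * x $ i + t)) has_derivative (\<lambda>h. flat_exp ?Q (s * x $ i + t) * (s * h $ i))) (at x)"
      by (simp add: o_def)
    from bounded_linear.has_derivative[OF bounded_linear_of_real this] show ?thesis .
  qed
  have "partial_deriv j (\<lambda>x::real^'a. complex_of_real (flat_exp P (s * x $ i + t)))
      = (\<lambda>x. of_real (if i = j then s else 0) * of_real (flat_exp ?Q (s * x $ i + t)))" for j
    by (subst partial_deriv_eqI[OF D]) (auto simp: axis_def)
  moreover have "flat_alg (\<lambda>x::real^'a. of_real (if i = j then s else 0) * of_real (flat_exp ?Q (s * x $ i + t)))" for j
    by (intro flat_alg.intros)
  ultimately show ?case using D by (auto simp: differentiable_def)
next
  case (const c)
  have "partial_deriv j (\<lambda>x::real^'a. c) = (\<lambda>x. 0)" for j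
    by (subst partial_deriv_eqI[of _ "\<lambda>x h. 0"]) auto
  thus ?case by (auto intro: flat_alg.const)
next
  case (add f g)
  have "partial_deriv i (\<lambda>x. f x + g x) = (\<lambda>x. partial_deriv i f x + partial_deriv i g x)" for i
    using add.IH
    by (subst partial_deriv_eqI[of _ "\<lambda>x h. frechet_derivative f (at x) h + frechet_derivative g (at x) h"])
       (auto intro!: has_derivative_add simp: frechet_derivative_works[symmetric] partial_deriv_def)
  thus ?case using add.IH by (auto intro: flat_alg.add)
next
  case (mult f g)
  have "partial_deriv i (\<lambda>x. f x * g x) = (\<lambda>x. f x * partial_deriv i g x + partial_deriv i f x * g x)" for i
    using mult.IH
    by (subst partial_deriv_eqI[of _ "\<lambda>x h. f x * frechet_derivative g (at x) h + frechet_derivative f (at x) h * g x"])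
       (auto intro!: has_derivative_mult simp: frechet_derivative_works[symmetric] partial_deriv_def)
  moreover have "flat_alg (\<lambda>x. f x * partial_deriv i g x + partial_deriv i f x * g x)" for i
    using mult.IH mult.hyps by (intro flat_alg.add flat_alg.mult) auto
  ultimately show ?case using mult.IH by auto
qed

lemma flat_alg_smooth: "flat_alg f \<Longrightarrow> smooth_fun f"
proof (coinduction arbitrary: f)
  case smooth_fun
  thus ?case using flat_alg_deriv[of f] by auto
qed

lemma flat_alg_prod: "(\<And>i. i \<in> I \<Longrightarrow> flat_alg (f i)) \<Longrightarrow> flat_alg (\<lambda>x. \<Prod>i\<in>I. f i x)"
  by (induction I rule: infinite_finite_induct) (auto intro: flat_alg.intros)

text \<open>For \<open>k > 0\<close> nonzero exactly on the open box from \<open>a\<close> to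
  \<open>b\<close>. The factor \<open>k\<close> sits inside the flat functions, so that growing
  \<open>k\<close> pushes each factor \<open>exp (-1/(k t))\<close> to 1 and the product to the
  indicator of the box.\<close>

definition bump :: "real \<Rightarrow> real^'n::finite \<Rightarrow> real^'n \<Rightarrow> real^'n \<Rightarrow> complex" where
  "bump k a b x = (\<Prod>i\<in>UNIV. of_real (flat_exp 1 (k * x $ i + - k * a $ i)) * of_real (flat_exp 1 (- k * x $ i + k * b $ i)))"

lemma bump_flat_alg: "flat_alg (bump k a b)"
  unfolding bump_def by (intro flat_alg_prod flat_alg.intros)

lemma bump_test_fun: assumes "k > 0" shows "test_fun (bump k a b)"
proof -
  have "flat_alg (bump k a b)" by (rule bump_flat_alg)
  moreover have "x \<in> cbox a b" if "bump k a b x \<noteq> 0" for x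
  proof -
    have "a $ i \<le> x $ i \<and> x $ i \<le> b $ i" for i
    proof -
      have "flat_exp 1 (k * x $ i + - k * a $ i) \<noteq> 0" "flat_exp 1 (- k * x $ i + k * b $ i) \<noteq> 0"
        using that by (auto simp: bump_def)
      hence "k * x $ i + - k * a $ i > 0" "- k * x $ i + k * b $ i > 0" by (auto simp: flat_exp_def split: if_splits)
      thus ?thesis using assms by auto
    qed
    thus ?thesis by (simp add: mem_box_cart)
  qed
  hence "closure {x. bump k a b x \<noteq> 0} \<subseteq> cbox a b" by (intro closure_minimal) auto
  hence "compact (closure {x. bump k a b x \<noteq> 0})"
    by (meson compact_cbox compact_eq_bounded_closed bounded_subset closed_closure)
  ultimately show ?thesis by (auto simp: test_fun_def flat_alg_smooth)
qed

lemma bump_tendsto: "(\<lambda>k. bump (real (Suc k)) a b x) \<longlonglongrightarrow> indicator (box a b) x"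
proof (cases "x \<in> box a b")
  case True
  have *: "(\<lambda>k. flat_exp 1 (real (Suc k) * t)) \<longlonglongrightarrow> 1" if "t > 0" for t
  proof -
    have "(\<lambda>k. exp (- (1 / t) / real (Suc k))) \<longlonglongrightarrow> exp 0"
      by (intro tendsto_exp LIMSEQ_Suc[OF lim_const_over_n])
    moreover have "flat_exp 1 (real (Suc k) * t) = exp (- (1 / t) / real (Suc k))" for k
      using that mult_pos_pos[of "real (Suc k)" t] unfolding flat_exp_def by (simp del: of_nat_Suc)
    ultimately show ?thesis by simp
  qed
  have "(\<lambda>k. bump (real (Suc k)) a b x) \<longlonglongrightarrow> (\<Prod>i\<in>(UNIV::'a set). of_real 1 * of_real 1)"
    unfolding bump_def
  proof (intro tendsto_intros)
    fix i
    have "x $ i - a $ i > 0" "b $ i - x $ i > 0" using True by (auto simp: mem_box_cart)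
    from *[OF this(1)] *[OF this(2)]
    show "(\<lambda>k. flat_exp 1 (real (Suc k) * x $ i + - real (Suc k) * a $ i)) \<longlonglongrightarrow> 1"
         "(\<lambda>k. flat_exp 1 (- real (Suc k) * x $ i + real (Suc k) * b $ i)) \<longlonglongrightarrow> 1"
      by (simp_all add: algebra_simps)
  qed
  thus ?thesis using True by simp
next
  case False
  then obtain i where i: "x $ i \<le> a $ i \<or> b $ i \<le> x $ i" by (auto simp: mem_box_cart not_less)
  have "bump (real (Suc k)) a b x = 0" for k
  proof -
    have "real (Suc k) * x $ i + - real (Suc k) * a $ i \<le> 0 \<or> - real (Suc k) * x $ i + real (Suc k) * b $ i \<le> 0"
      using i by (auto simp del: of_nat_Suc)
    thus ?thesis unfolding bump_def
      by (intro prod_zero bexI[of _ i]) (auto simp: flat_exp_def simp del: of_nat_Suc)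
  qed
  thus ?thesis using False by simp
qed

lemma bump_bound: "norm (bump (real (Suc k)) a b x) \<le> indicator (cbox a b) x"
proof (cases "x \<in> cbox a b")
  case True
  have "norm (flat_exp 1 t) \<le> 1" for t by (auto simp: flat_exp_def)
  hence "norm (bump (real (Suc k)) a b x) \<le> 1" unfolding bump_def prod_norm[symmetric]
    by (intro prod_le_1) (auto simp: norm_mult intro!: mult_le_one)
  thus ?thesis using True by simp
next
  case False
  then obtain i where i: "x $ i < a $ i \<or> b $ i < x $ i" by (auto simp: mem_box_cart not_le)
  have "real (Suc k) * x $ i + - real (Suc k) * a $ i \<le> 0 \<or> - real (Suc k) * x $ i + real (Suc k) * b $ i \<le> 0"
    using i by (auto simp del: of_nat_Suc)
  hence "bump (real (Suc k)) a b x = 0" unfolding bump_def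
    by (intro prod_zero bexI[of _ i]) (auto simp: flat_exp_def simp del: of_nat_Suc)
  thus ?thesis using False by simp
qed

text \<open>Bumps converge to indicators of boxes and are dominated by the indicator of the closed
  box, so dominated convergence reduces the claim to vanishing box integrals.\<close>

lemma fundamental_lemma:
  assumes w: "w \<in> L2" and z: "\<And>\<phi>. test_fun \<phi> \<Longrightarrow> (\<integral>x. w x * \<phi> x \<partial>lborel) = 0"
  shows "AE x in lborel. w x = 0"
proof (rule L2_zero_if_box_integrals_zero[OF w])
  fix a b
  have [measurable]: "w \<in> borel_measurable borel" using w by (auto simp: L2_iff)
  have "(\<lambda>k. \<integral>x. w x * bump (real (Suc k)) a b x \<partial>lborel) \<longlonglongrightarrow> (\<integral>x. w x * indicator (box a b) x \<partial>lborel)"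
  proof (rule integral_dominated_convergence[where w="\<lambda>x. norm (w x * indicator (cbox a b) x)"])
    show "integrable lborel (\<lambda>x. norm (w x * indicator (cbox a b) x))"
      by (intro integrable_norm L2_mult_integrable w indicator_box_L2)
    show "(\<lambda>x. w x * indicator (box a b) x) \<in> borel_measurable lborel" by measurable
    have "(\<lambda>x. bump (real (Suc k)) a b x) \<in> borel_measurable borel" for k
      using flat_alg_deriv[OF bump_flat_alg[of "real (Suc k)" a b]]
      by (intro borel_measurable_continuous_onI continuous_at_imp_continuous_on ballI differentiable_imp_continuous_within) auto
    thus "(\<lambda>x. w x * bump (real (Suc k)) a b x) \<in> borel_measurable lborel" for k by auto
    show "AE x in lborel. (\<lambda>k. w x * bump (real (Suc k)) a b x) \<longlonglongrightarrow> w x * indicator (box a b) x"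
      by (intro AE_I2 tendsto_intros bump_tendsto)
    show "AE x in lborel. norm (w x * bump (real (Suc k)) a b x) \<le> norm (w x * indicator (cbox a b) x)" for k
    proof (rule AE_I2)
      fix x show "norm (w x * bump (real (Suc k)) a b x) \<le> norm (w x * indicator (cbox a b) x)"
        using mult_left_mono[OF bump_bound[of k a b x] norm_ge_zero[of "w x"]]
        by (cases "x \<in> cbox a b") (auto simp: norm_mult)
    qed
  qed
  moreover have "(\<integral>x. w x * bump (real (Suc k)) a b x \<partial>lborel) = 0" for k by (intro z bump_test_fun) auto
  ultimately have "(\<integral>x. w x * indicator (box a b) x \<partial>lborel) = 0" by (simp add: LIMSEQ_const_iff)
  moreover have "w x * indicator (box a b) x = indicator (box a b) x *\<^sub>R w x" for x by (auto simp: indicator_def)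
  ultimately show "(\<integral>x. indicator (box a b) x *\<^sub>R w x \<partial>lborel) = 0" by simp
qed

lemma power_power_swap: "((a::'a::monoid_mult) ^ m) ^ n = (a ^ n) ^ m"
  by (metis mult.commute power_mult)

lemma mult_le_sum_squares: "(a::real) \<ge> 0 \<Longrightarrow> b \<ge> 0 \<Longrightarrow> a * b \<le> a\<^sup>2 + b\<^sup>2"
  using sum_squares_bound[of a b] mult_nonneg_nonneg[of a b] by linarith

lemma test_fun_differentiable: "test_fun \<phi> \<Longrightarrow> \<phi> differentiable (at x)"
  unfolding test_fun_def by (auto elim: smooth_fun.cases)

lemma test_fun_continuous: "test_fun \<phi> \<Longrightarrow> continuous_on S \<phi>"
  by (meson continuous_at_imp_continuous_on differentiable_imp_continuous_within test_fun_differentiable)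

lemma test_fun_partial: assumes "test_fun \<phi>" shows "test_fun (partial_deriv i \<phi>)"
proof -
  have "smooth_fun (partial_deriv i \<phi>)" using assms unfolding test_fun_def by (auto elim: smooth_fun.cases)
  moreover have "x \<in> closure {x. \<phi> x \<noteq> 0}" if "partial_deriv i \<phi> x \<noteq> 0" for x
  proof (rule ccontr)
    assume x: "x \<notin> closure {x. \<phi> x \<noteq> 0}"
    have "((\<lambda>x. 0) has_derivative (\<lambda>h. 0)) (at x)" by simp
    hence "(\<phi> has_derivative (\<lambda>h. 0)) (at x)"
      by (rule has_derivative_transform_within_open[of _ _ _ _ "- closure {x. \<phi> x \<noteq> 0}"])
         (use x closure_subset[of "{x. \<phi> x \<noteq> 0}"] in auto)
    hence "frechet_derivative \<phi> (at x) = (\<lambda>h. 0)" by (metis frechet_derivative_at)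
    thus False using that by (simp add: partial_deriv_def)
  qed
  hence "closure {x. partial_deriv i \<phi> x \<noteq> 0} \<subseteq> closure {x. \<phi> x \<noteq> 0}" by (intro closure_minimal) auto
  hence "compact (closure {x. partial_deriv i \<phi> x \<noteq> 0})" using assms unfolding test_fun_def
    by (meson compact_eq_bounded_closed bounded_subset closed_closure)
  ultimately show ?thesis by (simp add: test_fun_def)
qed

lemma test_fun_L2: assumes "test_fun \<phi>" shows "\<phi> \<in> L2"
proof -
  let ?K = "closure {x. \<phi> x \<noteq> 0}"
  have K: "compact ?K" using assms by (simp add: test_fun_def)
  have "bounded (\<phi> ` ?K)" by (intro compact_imp_bounded compact_continuous_image test_fun_continuous assms K)
  then obtain B where B: "\<And>x. x \<in> ?K \<Longrightarrow> norm (\<phi> x) \<le> B" by (auto simp: bounded_iff)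
  have [measurable]: "\<phi> \<in> borel_measurable borel" by (intro borel_measurable_continuous_onI test_fun_continuous assms)
  have "nsq \<phi> \<le> (\<integral>\<^sup>+x. ennreal (B\<^sup>2) * indicator ?K x \<partial>lborel)" unfolding nsq_def
  proof (rule nn_integral_mono)
    fix x show "ennreal ((norm (\<phi> x))\<^sup>2) \<le> ennreal (B\<^sup>2) * indicator ?K x"
    proof (cases "x \<in> ?K")
      case True thus ?thesis using B[OF True] by (auto intro!: ennreal_leI power_mono)
    next
      case False hence "\<phi> x = 0" using closure_subset by force
      thus ?thesis by simp
    qed
  qed
  also have "\<dots> = ennreal (B\<^sup>2) * emeasure lborel ?K" by (subst nn_integral_cmult_indicator) auto
  also have "\<dots> < \<infinity>" using emeasure_compact_finite[OF K] by (simp add: ennreal_mult_less_top)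
  finally show ?thesis by (simp add: L2_iff)
qed

lemma translated_has_derivative:
  assumes "\<And>x. \<phi> differentiable (at x)"
  shows "((\<lambda>x. \<phi> (x + c)) has_derivative frechet_derivative \<phi> (at (x + c))) (at x)"
proof -
  have a: "((\<lambda>x. x + c) has_derivative (\<lambda>h. h)) (at x)" by (auto intro!: derivative_eq_intros)
  have b: "(\<phi> has_derivative frechet_derivative \<phi> (at (x + c))) (at (x + c))"
    using assms by (simp add: frechet_derivative_works[symmetric])
  show ?thesis using has_derivative_compose[OF a b] by simp
qed

lemma partial_deriv_translate:
  assumes "\<And>x. \<phi> differentiable (at x)"
  shows "partial_deriv i (\<lambda>x. \<phi> (x + c)) = (\<lambda>x. partial_deriv i \<phi> (x + c))"
proof -
  have "((\<lambda>x. \<phi> (x + c)) has_derivative frechet_derivative \<phi> (at (x + c))) (at x)" for x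
    by (rule translated_has_derivative[OF assms])
  from partial_deriv_eqI[OF this] show ?thesis by (simp add: partial_deriv_def)
qed

lemma test_fun_translate: assumes "test_fun \<phi>" shows "test_fun (\<lambda>x. \<phi> (x + c))"
proof -
  have "smooth_fun (\<lambda>x. \<phi> (x + c))" if "smooth_fun \<phi>" for \<phi> :: "real^'a \<Rightarrow> complex"
    using that
  proof (coinduction arbitrary: \<phi>)
    case smooth_fun
    hence d: "\<forall>x. \<phi> differentiable (at x)" and s: "\<forall>i. smooth_fun (partial_deriv i \<phi>)" by (auto elim: smooth_fun.cases)
    have "(\<lambda>x. \<phi> (x + c)) differentiable (at x)" for x
      using translated_has_derivative[of \<phi> c x] d by (auto simp: differentiable_def)
    thus ?case using partial_deriv_translate[of \<phi> _ c] d s by fastforce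
  qed
  moreover have "closure {x. \<phi> (x + c) \<noteq> 0} = (\<lambda>x. x - c) ` closure {x. \<phi> x \<noteq> 0}"
  proof -
    have "{x. \<phi> (x + c) \<noteq> 0} = (+) (- c) ` {x. \<phi> x \<noteq> 0}"
      by (auto simp: image_iff intro!: exI[of _ "_ + c"])
    hence "closure {x. \<phi> (x + c) \<noteq> 0} = (+) (- c) ` closure {x. \<phi> x \<noteq> 0}" by (simp only: closure_translation)
    thus ?thesis by (simp add: image_def)
  qed
  ultimately show ?thesis using assms unfolding test_fun_def
    by (auto intro!: compact_continuous_image continuous_intros)
qed

section \<open>Weak derivatives\<close>

lemma weak_partial_iff:
  assumes "u \<in> L2" "g \<in> L2"
  shows "weak_partial i u g \<longleftrightarrow> (\<forall>\<phi>. test_fun \<phi> \<longrightarrow>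
     (\<integral>x. u x * partial_deriv i \<phi> x \<partial>lborel) = - (\<integral>x. g x * \<phi> x \<partial>lborel))"
  unfolding weak_partial_def using assms
  by (auto intro!: L2_mult_integrable test_fun_L2 test_fun_partial)

lemma weak_partialD:
  "weak_partial i u g \<Longrightarrow> test_fun \<phi> \<Longrightarrow> (\<integral>x. u x * partial_deriv i \<phi> x \<partial>lborel) = - (\<integral>x. g x * \<phi> x \<partial>lborel)"
  by (auto simp: weak_partial_def)

lemma weak_partial_unique:
  assumes "g \<in> L2" "g' \<in> L2" "weak_partial i u g" "weak_partial i u g'"
  shows "AE x in lborel. g x = g' x"
proof -
  have "AE x in lborel. g x - g' x = 0"
  proof (rule fundamental_lemma)
    show "(\<lambda>x. g x - g' x) \<in> L2" by (intro L2_diff assms)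
    fix \<phi> :: "real^'a \<Rightarrow> complex" assume \<phi>: "test_fun \<phi>"
    have "(\<integral>x. (g x - g' x) * \<phi> x \<partial>lborel) = (\<integral>x. g x * \<phi> x \<partial>lborel) - (\<integral>x. g' x * \<phi> x \<partial>lborel)"
      unfolding left_diff_distrib by (intro Bochner_Integration.integral_diff L2_mult_integrable assms test_fun_L2 \<phi>)
    also have "\<dots> = 0" using weak_partialD[OF assms(3) \<phi>] weak_partialD[OF assms(4) \<phi>] by simp
    finally show "(\<integral>x. (g x - g' x) * \<phi> x \<partial>lborel) = 0" .
  qed
  thus ?thesis by simp
qed

lemma weak_partial_add:
  assumes "u \<in> L2" "v \<in> L2" "f \<in> L2" "g \<in> L2" "weak_partial i u f" "weak_partial i v g"
  shows "weak_partial i (\<lambda>x. u x + v x) (\<lambda>x. f x + g x)"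
proof -
  have "(\<integral>x. (u x + v x) * partial_deriv i \<phi> x \<partial>lborel) = - (\<integral>x. (f x + g x) * \<phi> x \<partial>lborel)" if \<phi>: "test_fun \<phi>" for \<phi>
  proof -
    have "(\<integral>x. (u x + v x) * partial_deriv i \<phi> x \<partial>lborel)
      = (\<integral>x. u x * partial_deriv i \<phi> x \<partial>lborel) + (\<integral>x. v x * partial_deriv i \<phi> x \<partial>lborel)"
      unfolding distrib_right by (intro Bochner_Integration.integral_add L2_mult_integrable assms test_fun_L2 test_fun_partial \<phi>)
    moreover have "(\<integral>x. (f x + g x) * \<phi> x \<partial>lborel) = (\<integral>x. f x * \<phi> x \<partial>lborel) + (\<integral>x. g x * \<phi> x \<partial>lborel)"
      unfolding distrib_right by (intro Bochner_Integration.integral_add L2_mult_integrable assms test_fun_L2 \<phi>)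
    ultimately show ?thesis using weak_partialD[OF assms(5) \<phi>] weak_partialD[OF assms(6) \<phi>] by simp
  qed
  thus ?thesis using assms by (subst weak_partial_iff) (auto intro: L2_add)
qed

lemma weak_partial_scale:
  assumes "u \<in> L2" "f \<in> L2" "weak_partial i u f"
  shows "weak_partial i (\<lambda>x. c * u x) (\<lambda>x. c * f x)"
  using assms by (subst weak_partial_iff) (auto intro: L2_scale simp: mult.assoc weak_partialD)

lemma weak_partial_cong:
  assumes "u \<in> L2" "v \<in> L2" "g \<in> L2" "f \<in> L2" "ae_eq u v" "ae_eq f g" "weak_partial i u f"
  shows "weak_partial i v g"
proof -
  have [measurable]: "u \<in> borel_measurable borel" "v \<in> borel_measurable borel"
    "f \<in> borel_measurable borel" "g \<in> borel_measurable borel" using assms by (auto simp: L2_iff)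
  have "(\<integral>x. v x * partial_deriv i \<phi> x \<partial>lborel) = - (\<integral>x. g x * \<phi> x \<partial>lborel)" if \<phi>: "test_fun \<phi>" for \<phi>
  proof -
    have [measurable]: "\<phi> \<in> borel_measurable borel" "partial_deriv i \<phi> \<in> borel_measurable borel"
      using test_fun_L2[OF \<phi>] test_fun_L2[OF test_fun_partial[OF \<phi>]] by (auto simp: L2_iff)
    have "(\<integral>x. v x * partial_deriv i \<phi> x \<partial>lborel) = (\<integral>x. u x * partial_deriv i \<phi> x \<partial>lborel)"
      using assms(5) by (intro integral_cong_AE) (auto simp: ae_eq_def)
    moreover have "(\<integral>x. g x * \<phi> x \<partial>lborel) = (\<integral>x. f x * \<phi> x \<partial>lborel)"
      using assms(6) by (intro integral_cong_AE) (auto simp: ae_eq_def)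
    ultimately show ?thesis using weak_partialD[OF assms(7) \<phi>] by simp
  qed
  thus ?thesis using assms by (subst weak_partial_iff) auto
qed

lemma H1_L2: "u \<in> H1 \<Longrightarrow> u \<in> L2" by (simp add: H1_def)

lemma weak_grad_spec:
  assumes "u \<in> H1" shows "weak_grad u i \<in> L2" "weak_partial i u (weak_grad u i)"
proof -
  have "\<exists>g. g \<in> L2 \<and> weak_partial i u g" using assms by (auto simp: H1_def)
  from someI_ex[OF this] show "weak_grad u i \<in> L2" "weak_partial i u (weak_grad u i)" by (auto simp: weak_grad_def)
qed

text \<open>Uniqueness of weak derivatives makes the choice inside \<open>weak_grad\<close>
  harmless: modulo null sets it is the gradient, and the linearity laws below follow by exhibiting
  one weak derivative.\<close>

lemma weak_grad_AE_eqI: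
  assumes "u \<in> H1" "g \<in> L2" "weak_partial i u g" shows "ae_eq (weak_grad u i) g"
  unfolding ae_eq_def using assms weak_grad_spec[OF assms(1)] by (intro weak_partial_unique) auto

lemma H1_zero [simp]: "(\<lambda>x. 0) \<in> H1"
  by (auto simp: H1_def weak_partial_iff intro!: bexI[of _ "\<lambda>x. 0"])

lemma H1_I: "u \<in> L2 \<Longrightarrow> (\<And>i. g i \<in> L2) \<Longrightarrow> (\<And>i. weak_partial i u (g i)) \<Longrightarrow> u \<in> H1"
  by (auto simp: H1_def)

lemma H1_add: assumes "u \<in> H1" "v \<in> H1" shows "(\<lambda>x. u x + v x) \<in> H1"
  using assms
  by (rule_tac H1_I[where g="\<lambda>i x. weak_grad u i x + weak_grad v i x"]) (intro weak_partial_add L2_add weak_grad_spec H1_L2; assumption)+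

lemma H1_scale: assumes "u \<in> H1" shows "(\<lambda>x. c * u x) \<in> H1"
  using assms
  by (rule_tac H1_I[where g="\<lambda>i x. c * weak_grad u i x"]) (intro weak_partial_scale L2_scale weak_grad_spec H1_L2; assumption)+

lemma weak_grad_add:
  assumes "u \<in> H1" "v \<in> H1"
  shows "ae_eq (weak_grad (\<lambda>x. u x + v x) i) (\<lambda>x. weak_grad u i x + weak_grad v i x)"
  using assms by (intro weak_grad_AE_eqI H1_add L2_add weak_grad_spec weak_partial_add H1_L2)

lemma weak_grad_scale:
  assumes "u \<in> H1" shows "ae_eq (weak_grad (\<lambda>x. c * u x) i) (\<lambda>x. c * weak_grad u i x)"
  using assms by (intro weak_grad_AE_eqI H1_scale L2_scale weak_grad_spec weak_partial_scale H1_L2)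

lemma ae_eq_refl [simp]: "ae_eq u u" by (simp add: ae_eq_def)

lemma ae_eq_sym: "ae_eq u v \<Longrightarrow> ae_eq v u" by (auto simp: ae_eq_def elim: eventually_mono)

lemma ae_eq_trans: "ae_eq u v \<Longrightarrow> ae_eq v w \<Longrightarrow> ae_eq u w"
  unfolding ae_eq_def by (auto elim: eventually_elim2)

lemma weak_grad_cong:
  assumes "u \<in> H1" "v \<in> H1" "ae_eq u v" shows "ae_eq (weak_grad u i) (weak_grad v i)"
  using assms weak_grad_spec[OF assms(1)] weak_grad_spec[OF assms(2)]
  by (intro weak_grad_AE_eqI[OF assms(1)] weak_partial_cong[of v u "weak_grad v i" "weak_grad v i" i]) (auto intro: H1_L2 ae_eq_sym)

section \<open>Translation estimates for Sobolev functions\<close>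

definition gsq :: "(real^'n::finite \<Rightarrow> complex) \<Rightarrow> ennreal" where
  "gsq u = (\<Sum>i\<in>UNIV. nsq (weak_grad u i))"

text \<open>Joint integrability for the interchange of the integral along a segment with the
  integral over space. By translation invariance the bound \<open>nsq a + nsq b\<close> is uniform
  in \<open>t\<close>.\<close>

lemma integrable_segment_pair:
  fixes a b :: "real^'n::finite \<Rightarrow> complex"
  assumes "a \<in> L2" "b \<in> L2"
  shows "integrable (lborel \<Otimes>\<^sub>M lborel) (\<lambda>(t, x). indicator {0..1::real} t *\<^sub>R (a (x + t *\<^sub>R c) * b (x + t *\<^sub>R e)))"
proof -
  have [measurable]: "a \<in> borel_measurable borel" "b \<in> borel_measurable borel" using assms by (auto simp: L2_iff)
  let ?F = "\<lambda>(t, x). indicator {0..1::real} t *\<^sub>R (a (x + t *\<^sub>R c) * b (x + t *\<^sub>R e))"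
  have "(\<integral>\<^sup>+ p. ennreal (norm (?F p)) \<partial>(lborel \<Otimes>\<^sub>M lborel)) = (\<integral>\<^sup>+t. \<integral>\<^sup>+x. ennreal (norm (?F (t, x))) \<partial>lborel \<partial>lborel)"
    by (rule lborel.nn_integral_fst[symmetric]) measurable
  also have "\<dots> \<le> (\<integral>\<^sup>+t. (nsq a + nsq b) * indicator {0..1::real} t \<partial>lborel)"
  proof (rule nn_integral_mono)
    fix t :: real
    have "(\<integral>\<^sup>+x. ennreal (norm (?F (t, x))) \<partial>lborel)
       \<le> (\<integral>\<^sup>+x. (ennreal ((norm (a (x + t *\<^sub>R c)))\<^sup>2) + ennreal ((norm (b (x + t *\<^sub>R e)))\<^sup>2)) * indicator {0..1} t \<partial>lborel)"
    proof (rule nn_integral_mono)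
      fix x
      have "norm (a (x + t *\<^sub>R c)) * norm (b (x + t *\<^sub>R e)) \<le> (norm (a (x + t *\<^sub>R c)))\<^sup>2 + (norm (b (x + t *\<^sub>R e)))\<^sup>2"
        by (rule mult_le_sum_squares) auto
      thus "ennreal (norm (?F (t, x))) \<le> (ennreal ((norm (a (x + t *\<^sub>R c)))\<^sup>2) + ennreal ((norm (b (x + t *\<^sub>R e)))\<^sup>2)) * indicator {0..1} t"
        by (auto simp: norm_mult indicator_def ennreal_leI simp flip: ennreal_plus)
    qed
    also have "\<dots> = (nsq (\<lambda>x. a (x + t *\<^sub>R c)) + nsq (\<lambda>x. b (x + t *\<^sub>R e))) * indicator {0..1} t"
      unfolding nsq_def by (simp add: nn_integral_add nn_integral_multc)
    also have "\<dots> = (nsq a + nsq b) * indicator {0..1} t" by (simp add: nsq_translate)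
    finally show "(\<integral>\<^sup>+x. ennreal (norm (?F (t, x))) \<partial>lborel) \<le> (nsq a + nsq b) * indicator {0..1} t" .
  qed
  also have "\<dots> = nsq a + nsq b" by (simp add: nn_integral_cmult)
  also have "\<dots> < \<infinity>" using assms by (auto simp: L2_iff)
  finally show ?thesis by (subst integrable_iff_bounded) (auto simp: case_prod_unfold)
qed

lemma integral_segment_swap:
  fixes a b :: "real^'n::finite \<Rightarrow> complex"
  assumes "a \<in> L2" "b \<in> L2"
  shows "(\<integral>x. (\<integral>t. indicator {0..1::real} t *\<^sub>R (a (x + t *\<^sub>R c) * b (x + t *\<^sub>R e)) \<partial>lborel) \<partial>lborel)
       = (\<integral>t. indicator {0..1::real} t *\<^sub>R (\<integral>x. a (x + t *\<^sub>R c) * b (x + t *\<^sub>R e) \<partial>lborel) \<partial>lborel)"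
  using lborel_pair.Fubini_integral[OF integrable_segment_pair[OF assms, of c e]] by simp

lemma frechet_eq_sum_partial:
  assumes "\<phi> differentiable (at x)"
  shows "frechet_derivative \<phi> (at x) h = (\<Sum>i\<in>UNIV. of_real (h $ i) * partial_deriv i \<phi> x)"
proof -
  have lin: "linear (frechet_derivative \<phi> (at x))" using assms by (rule linear_frechet_derivative)
  have "frechet_derivative \<phi> (at x) h = frechet_derivative \<phi> (at x) (\<Sum>i\<in>UNIV. h $ i *\<^sub>R axis i 1)"
    by (simp only: basis_expansion[of h, unfolded scalar_mult_eq_scaleR])
  also have "\<dots> = (\<Sum>i\<in>UNIV. h $ i *\<^sub>R frechet_derivative \<phi> (at x) (axis i 1))"
    using lin by (simp only: linear_sum linear_scale)
  finally show ?thesis by (simp add: partial_deriv_def scaleR_conv_of_real)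
qed

text \<open>The fundamental theorem of calculus along the segment from \<open>x\<close> to
  \<open>x + h\<close>. Tested against \<phi>, all translations and the derivative move to \<phi>,
  where the classical theorem applies; the fundamental lemma then removes \<phi>. Square
  integrability of the right-hand side is supplied by the caller through
  \<open>nsq_average_le\<close>.\<close>

lemma H1_translation_formula:
  fixes u :: "real^'n::finite \<Rightarrow> complex" and h :: "real^'n"
  assumes u: "u \<in> H1"
  defines "k \<equiv> \<lambda>y. \<Sum>i\<in>UNIV. of_real (h $ i) * weak_grad u i y"
  assumes wL2: "(\<lambda>x. \<integral>t. indicator {0..1::real} t *\<^sub>R k (x + t *\<^sub>R h) \<partial>lborel) \<in> L2"
  shows "AE x in lborel. u (x + h) - u x = (\<integral>t. indicator {0..1::real} t *\<^sub>R k (x + t *\<^sub>R h) \<partial>lborel)"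
proof -
  let ?w = "\<lambda>x. \<integral>t. indicator {0..1::real} t *\<^sub>R k (x + t *\<^sub>R h) \<partial>lborel"
  have k: "k \<in> L2" unfolding k_def by (intro L2_sum L2_scale weak_grad_spec u)
  have uL: "u \<in> L2" by (rule H1_L2[OF u])
  have [measurable]: "u \<in> borel_measurable borel" "k \<in> borel_measurable borel" using k uL by (auto simp: L2_iff)
  have "AE x in lborel. (u (x + h) - u x) - ?w x = 0"
  proof (rule fundamental_lemma)
    show "(\<lambda>x. u (x + h) - u x - ?w x) \<in> L2" by (intro L2_diff L2_translate uL wL2)
    fix \<phi> :: "real^'n \<Rightarrow> complex" assume \<phi>: "test_fun \<phi>"
    define \<psi> where "\<psi> y = (\<Sum>i\<in>UNIV. of_real (h $ i) * partial_deriv i \<phi> y)" for y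
    have \<phi>L: "\<phi> \<in> L2" by (rule test_fun_L2[OF \<phi>])
    have \<psi>L: "\<psi> \<in> L2" unfolding \<psi>_def by (intro L2_sum L2_scale test_fun_L2 test_fun_partial \<phi>)
    have \<psi>c: "continuous_on S \<psi>" for S unfolding \<psi>_def by (intro continuous_intros test_fun_continuous test_fun_partial \<phi>)
    have [measurable]: "\<phi> \<in> borel_measurable borel" "\<psi> \<in> borel_measurable borel" using \<phi>L \<psi>L by (auto simp: L2_iff)
    \<comment> \<open>The definition of the weak gradient for a translated test function, contracted
      with \<open>h\<close>; below, \<open>c = - t h\<close> for each point \<open>t\<close> of the
      segment.\<close>
    have weak: "(\<integral>x. u x * \<psi> (x + c) \<partial>lborel) = - (\<integral>x. k x * \<phi> (x + c) \<partial>lborel)" for c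
    proof -
      have "(\<integral>x. u x * \<psi> (x + c) \<partial>lborel) = (\<integral>x. (\<Sum>i\<in>UNIV. of_real (h $ i) * (u x * partial_deriv i \<phi> (x + c))) \<partial>lborel)"
        unfolding \<psi>_def by (simp add: sum_distrib_left mult_ac)
      also have "\<dots> = (\<Sum>i\<in>UNIV. of_real (h $ i) * (\<integral>x. u x * partial_deriv i \<phi> (x + c) \<partial>lborel))"
        by (subst Bochner_Integration.integral_sum)
           (auto intro!: integrable_mult_right L2_mult_integrable L2_translate[of "partial_deriv _ \<phi>"] test_fun_L2[OF test_fun_partial] \<phi> uL)
      also have "\<dots> = (\<Sum>i\<in>UNIV. of_real (h $ i) * - (\<integral>x. weak_grad u i x * \<phi> (x + c) \<partial>lborel))"
        using weak_partialD[OF weak_grad_spec(2)[OF u] test_fun_translate[OF \<phi>, of c]]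
        by (simp add: partial_deriv_translate[OF test_fun_differentiable[OF \<phi>]])
      also have "\<dots> = - (\<integral>x. (\<Sum>i\<in>UNIV. of_real (h $ i) * (weak_grad u i x * \<phi> (x + c))) \<partial>lborel)"
        by (subst Bochner_Integration.integral_sum)
           (auto intro!: integrable_mult_right L2_mult_integrable L2_translate \<phi>L weak_grad_spec u simp: sum_negf)
      also have "\<dots> = - (\<integral>x. k x * \<phi> (x + c) \<partial>lborel)" unfolding k_def by (simp add: sum_distrib_right mult.assoc)
      finally show ?thesis .
    qed
    have ftc: "(\<integral>t. indicator {0..1::real} t *\<^sub>R \<psi> (x + t *\<^sub>R (- h)) \<partial>lborel) = \<phi> x - \<phi> (x - h)" for x
    proof -
      have "(\<integral>t. indicator {0..1::real} t *\<^sub>R \<psi> (x + t *\<^sub>R (- h)) \<partial>lborel) = - \<phi> (x + 1 *\<^sub>R (- h)) - - \<phi> (x + 0 *\<^sub>R (- h))"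
      proof (rule integral_FTC_Icc)
        show "continuous_on {0..1} (\<lambda>t. \<psi> (x + t *\<^sub>R (- h)))"
          by (rule continuous_on_compose2[OF \<psi>c[of UNIV]]) (auto intro!: continuous_intros)
        fix t :: real
        have "((\<lambda>t. \<phi> (x + t *\<^sub>R (- h))) has_derivative (\<lambda>s. frechet_derivative \<phi> (at (x + t *\<^sub>R (- h))) (s *\<^sub>R (- h)))) (at t within {0..1})"
          by (rule has_derivative_compose[of "\<lambda>t. x + t *\<^sub>R (- h)"])
             (auto intro!: derivative_eq_intros test_fun_differentiable[OF \<phi>] simp: frechet_derivative_works[symmetric])
        hence "((\<lambda>t. - \<phi> (x + t *\<^sub>R (- h))) has_derivative (\<lambda>s. - frechet_derivative \<phi> (at (x + t *\<^sub>R (- h))) (s *\<^sub>R (- h)))) (at t within {0..1})"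
          by (rule has_derivative_minus)
        moreover have "- frechet_derivative \<phi> (at (x + t *\<^sub>R (- h))) (s *\<^sub>R (- h)) = s *\<^sub>R \<psi> (x + t *\<^sub>R (- h))" for s
          unfolding frechet_eq_sum_partial[OF test_fun_differentiable[OF \<phi>]] \<psi>_def
          by (simp add: scaleR_conv_of_real[where 'a=complex] sum_distrib_left sum_negf mult_ac)
        ultimately show "((\<lambda>t. - \<phi> (x + t *\<^sub>R (- h))) has_vector_derivative \<psi> (x + t *\<^sub>R (- h))) (at t within {0..1})"
          by (simp add: has_vector_derivative_def)
      qed simp
      thus ?thesis by simp
    qed
    have "(\<integral>x. ?w x * \<phi> x \<partial>lborel) = (\<integral>x. (\<integral>t. indicator {0..1::real} t *\<^sub>R (k (x + t *\<^sub>R h) * \<phi> (x + t *\<^sub>R 0)) \<partial>lborel) \<partial>lborel)"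
      by (simp flip: integral_mult_left_zero)
    also have "\<dots> = (\<integral>t. indicator {0..1::real} t *\<^sub>R (\<integral>x. k (x + t *\<^sub>R h) * \<phi> (x + t *\<^sub>R 0) \<partial>lborel) \<partial>lborel)"
      by (rule integral_segment_swap[OF k \<phi>L])
    also have "\<dots> = (\<integral>t. indicator {0..1::real} t *\<^sub>R - (\<integral>x. u x * \<psi> (x + t *\<^sub>R (- h)) \<partial>lborel) \<partial>lborel)"
    proof -
      have "(\<integral>x. k (x + t *\<^sub>R h) * \<phi> (x + t *\<^sub>R 0) \<partial>lborel) = (\<integral>x. k x * \<phi> (x + t *\<^sub>R (- h)) \<partial>lborel)" for t
        using integral_translate[of "\<lambda>x. k x * \<phi> (x - t *\<^sub>R h)" "t *\<^sub>R h"] by simp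
      thus ?thesis by (simp only: weak minus_minus)
    qed
    also have "\<dots> = - (\<integral>t. indicator {0..1::real} t *\<^sub>R (\<integral>x. u (x + t *\<^sub>R 0) * \<psi> (x + t *\<^sub>R (- h)) \<partial>lborel) \<partial>lborel)"
      by simp
    also have "\<dots> = - (\<integral>x. (\<integral>t. indicator {0..1::real} t *\<^sub>R (u (x + t *\<^sub>R 0) * \<psi> (x + t *\<^sub>R (- h))) \<partial>lborel) \<partial>lborel)"
      by (subst integral_segment_swap[OF uL \<psi>L]) simp
    also have "\<dots> = - (\<integral>x. u x * (\<phi> x - \<phi> (x - h)) \<partial>lborel)"
      unfolding ftc[symmetric] by (simp flip: integral_mult_right_zero)
    also have "\<dots> = - ((\<integral>x. u x * \<phi> x \<partial>lborel) - (\<integral>x. u x * \<phi> (x + (- h)) \<partial>lborel))"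
      unfolding right_diff_distrib
      by (subst Bochner_Integration.integral_diff) (auto intro!: L2_mult_integrable L2_translate[where h="- h", simplified] uL \<phi>L)
    also have "(\<integral>x. u x * \<phi> (x + (- h)) \<partial>lborel) = (\<integral>x. u (x + h) * \<phi> x \<partial>lborel)"
      using integral_translate[of "\<lambda>x. u x * \<phi> (x - h)" h] by simp
    also have "- ((\<integral>x. u x * \<phi> x \<partial>lborel) - (\<integral>x. u (x + h) * \<phi> x \<partial>lborel)) = (\<integral>x. (u (x + h) - u x) * \<phi> x \<partial>lborel)"
      unfolding left_diff_distrib by (subst Bochner_Integration.integral_diff) (auto intro!: L2_mult_integrable L2_translate uL \<phi>L)
    finally have eq: "(\<integral>x. ?w x * \<phi> x \<partial>lborel) = (\<integral>x. (u (x + h) - u x) * \<phi> x \<partial>lborel)" .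
    have "(\<integral>x. (u (x + h) - u x - ?w x) * \<phi> x \<partial>lborel) = (\<integral>x. (u (x + h) - u x) * \<phi> x \<partial>lborel) - (\<integral>x. ?w x * \<phi> x \<partial>lborel)"
      unfolding left_diff_distrib[of "_ - _" "integral\<^sup>L _ _"]
      by (intro Bochner_Integration.integral_diff L2_mult_integrable L2_diff L2_translate uL \<phi>L wL2)
    thus "(\<integral>x. (u (x + h) - u x - ?w x) * \<phi> x \<partial>lborel) = 0" using eq by simp
  qed
  thus ?thesis by simp
qed

text \<open>Jensen for a probability measure, by Cauchy--Schwarz against the constant 1, followed by
  Tonelli. Where the inner integral diverges its value is 0 and the pointwise bound is
  trivial.\<close>

lemma nsq_integral_le:
  fixes F :: "real^'n::finite \<Rightarrow> 'b \<Rightarrow> complex" and M :: "'b measure"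
  assumes F[measurable]: "(\<lambda>(x, t). F x t) \<in> borel_measurable (borel \<Otimes>\<^sub>M M)" and M: "sigma_finite_measure M" "emeasure M (space M) = 1"
  shows "(\<lambda>x. \<integral>t. F x t \<partial>M) \<in> borel_measurable borel"
    and "nsq (\<lambda>x. \<integral>t. F x t \<partial>M) \<le> (\<integral>\<^sup>+t. nsq (\<lambda>x. F x t) \<partial>M)"
proof -
  interpret sigma_finite_measure M by fact
  interpret P: pair_sigma_finite M "lborel :: (real^'n) measure" ..
  show meas[measurable]: "(\<lambda>x. \<integral>t. F x t \<partial>M) \<in> borel_measurable borel"
    by measurable
  have "nsq (\<lambda>x. \<integral>t. F x t \<partial>M) \<le> (\<integral>\<^sup>+x. (\<integral>\<^sup>+t. ennreal ((norm (F x t))\<^sup>2) \<partial>M) \<partial>lborel)"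
    unfolding nsq_def
  proof (rule nn_integral_mono)
    fix x :: "real^'n"
    have [measurable]: "F x \<in> borel_measurable M" by measurable
    have "ennreal (norm (\<integral>t. F x t \<partial>M)) \<le> (\<integral>\<^sup>+t. ennreal (norm (F x t)) \<partial>M)"
      by (cases "integrable M (F x)") (auto intro: integral_norm_bound_ennreal simp: not_integrable_integral_eq)
    hence "ennreal ((norm (\<integral>t. F x t \<partial>M))\<^sup>2) \<le> (\<integral>\<^sup>+t. ennreal (norm (F x t)) * 1 \<partial>M)\<^sup>2"
      by (simp add: ennreal_power[symmetric] power_mono)
    also have "\<dots> \<le> (\<integral>\<^sup>+t. (ennreal (norm (F x t)))\<^sup>2 \<partial>M) * (\<integral>\<^sup>+t. 1\<^sup>2 \<partial>M)"
      by (intro Cauchy_Schwarz_nn_integral) auto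
    also have "\<dots> = (\<integral>\<^sup>+t. ennreal ((norm (F x t))\<^sup>2) \<partial>M)" using M(2) by (simp add: ennreal_power)
    finally show "ennreal ((norm (\<integral>t. F x t \<partial>M))\<^sup>2) \<le> (\<integral>\<^sup>+t. ennreal ((norm (F x t))\<^sup>2) \<partial>M)" .
  qed
  also have "\<dots> = (\<integral>\<^sup>+t. nsq (\<lambda>x. F x t) \<partial>M)" unfolding nsq_def
    by (rule P.Fubini') (simp add: case_prod_unfold, measurable)
  finally show "nsq (\<lambda>x. \<integral>t. F x t \<partial>M) \<le> (\<integral>\<^sup>+t. nsq (\<lambda>x. F x t) \<partial>M)" .
qed

lemma nsq_average_le:
  fixes k :: "real^'n::finite \<Rightarrow> complex" and M :: "'b measure" and c :: "'b \<Rightarrow> real^'n"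
  assumes [measurable]: "k \<in> borel_measurable borel" "c \<in> M \<rightarrow>\<^sub>M borel" and M: "sigma_finite_measure M" "emeasure M (space M) = 1"
  shows "(\<lambda>x. \<integral>t. k (x + c t) \<partial>M) \<in> borel_measurable borel"
    and "nsq (\<lambda>x. \<integral>t. k (x + c t) \<partial>M) \<le> nsq k"
  using nsq_integral_le[of "\<lambda>x t. k (x + c t)" M] M by (simp_all add: nsq_translate)

lemma nsq_directional_le:
  fixes u :: "real^'n::finite \<Rightarrow> complex" and h :: "real^'n"
  assumes u: "u \<in> H1"
  shows "nsq (\<lambda>y. \<Sum>i\<in>UNIV. of_real (h $ i) * weak_grad u i y) \<le> ennreal ((norm h)\<^sup>2) * gsq u"
proof -
  have [measurable]: "weak_grad u i \<in> borel_measurable borel" for i using weak_grad_spec[OF u] by (auto simp: L2_iff)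
  have "nsq (\<lambda>y. \<Sum>i\<in>UNIV. of_real (h $ i) * weak_grad u i y)
     \<le> (\<integral>\<^sup>+y. ennreal ((norm h)\<^sup>2) * (\<Sum>i\<in>UNIV. ennreal ((norm (weak_grad u i y))\<^sup>2)) \<partial>lborel)"
    unfolding nsq_def
  proof (rule nn_integral_mono)
    fix y
    have "norm (\<Sum>i\<in>UNIV. of_real (h $ i) * weak_grad u i y) \<le> (\<Sum>i\<in>UNIV. \<bar>h $ i\<bar> * norm (weak_grad u i y))"
      by (rule order_trans[OF norm_sum]) (simp add: norm_mult)
    hence "(norm (\<Sum>i\<in>UNIV. of_real (h $ i) * weak_grad u i y))\<^sup>2 \<le> (\<Sum>i\<in>UNIV. \<bar>h $ i\<bar> * norm (weak_grad u i y))\<^sup>2"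
      by (intro power_mono) auto
    also have "\<dots> \<le> (\<Sum>i\<in>UNIV. \<bar>h $ i\<bar>\<^sup>2) * (\<Sum>i\<in>UNIV. (norm (weak_grad u i y))\<^sup>2)"
      by (rule Cauchy_Schwarz_ineq_sum)
    also have "(\<Sum>i\<in>UNIV. \<bar>h $ i\<bar>\<^sup>2) = (norm h)\<^sup>2"
      by (simp add: norm_vec_def L2_set_def sum_nonneg)
    finally have "ennreal ((norm (\<Sum>i\<in>UNIV. of_real (h $ i) * weak_grad u i y))\<^sup>2)
        \<le> ennreal ((norm h)\<^sup>2 * (\<Sum>i\<in>UNIV. (norm (weak_grad u i y))\<^sup>2))" by (rule ennreal_leI)
    also have "\<dots> = ennreal ((norm h)\<^sup>2) * (\<Sum>i\<in>UNIV. ennreal ((norm (weak_grad u i y))\<^sup>2))"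
      by (subst ennreal_mult) (auto intro!: sum_nonneg)
    finally show "ennreal ((norm (\<Sum>i\<in>UNIV. of_real (h $ i) * weak_grad u i y))\<^sup>2)
        \<le> ennreal ((norm h)\<^sup>2) * (\<Sum>i\<in>UNIV. ennreal ((norm (weak_grad u i y))\<^sup>2))" .
  qed
  also have "\<dots> = ennreal ((norm h)\<^sup>2) * gsq u"
    unfolding gsq_def nsq_def by (simp add: nn_integral_cmult nn_integral_sum del: sum_ennreal)
  finally show ?thesis .
qed

lemma nsq_cong: "ae_eq u v \<Longrightarrow> nsq u = nsq v"
  unfolding nsq_def ae_eq_def by (intro nn_integral_cong_AE) auto

lemma gsq_finite: "u \<in> H1 \<Longrightarrow> gsq u < \<infinity>"
  unfolding gsq_def using weak_grad_spec(1)[of u] by (auto simp: L2_iff)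

text \<open>Takes the place of \<open>|exp(i \<xi> h) - 1| <= |\<xi>| |h|\<close> on the Fourier
  side; all later smoothing estimates rest on it.\<close>

lemma H1_translation_bound:
  fixes u :: "real^'n::finite \<Rightarrow> complex" and h :: "real^'n"
  assumes u: "u \<in> H1"
  shows "nsq (\<lambda>x. u (x + h) - u x) \<le> ennreal ((norm h)\<^sup>2) * gsq u"
proof -
  define k where "k = (\<lambda>y. \<Sum>i\<in>UNIV. of_real (h $ i) * weak_grad u i y)"
  have k: "k \<in> L2" unfolding k_def by (intro L2_sum L2_scale weak_grad_spec u)
  have [measurable]: "k \<in> borel_measurable borel" using k by (auto simp: L2_iff)
  define M where "M = restrict_space lborel {0..1::real}"
  have M: "sigma_finite_measure M" "emeasure M (space M) = 1"
    by (auto simp: M_def sigma_finite_measure_restrict_space sigma_finite_lborel emeasure_restrict_space space_restrict_space)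
  have eq: "(\<integral>t. indicator {0..1::real} t *\<^sub>R k (x + t *\<^sub>R h) \<partial>lborel) = (\<integral>t. k (x + t *\<^sub>R h) \<partial>M)" for x
    unfolding M_def by (subst integral_restrict_space) auto
  have c: "(\<lambda>t. t *\<^sub>R h) \<in> M \<rightarrow>\<^sub>M borel" unfolding M_def by (intro measurable_restrict_space1) auto
  note av = nsq_average_le[OF \<open>k \<in> borel_measurable borel\<close> c M]
  have "nsq (\<lambda>x. \<integral>t. indicator {0..1::real} t *\<^sub>R k (x + t *\<^sub>R h) \<partial>lborel) \<le> nsq k" unfolding eq by (rule av)
  moreover have "(\<lambda>x. \<integral>t. indicator {0..1::real} t *\<^sub>R k (x + t *\<^sub>R h) \<partial>lborel) \<in> borel_measurable borel" unfolding eq by (rule av)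
  ultimately have wL: "(\<lambda>x. \<integral>t. indicator {0..1::real} t *\<^sub>R k (x + t *\<^sub>R h) \<partial>lborel) \<in> L2"
    using k by (auto simp: L2_iff)
  have "nsq (\<lambda>x. u (x + h) - u x) = nsq (\<lambda>x. \<integral>t. indicator {0..1::real} t *\<^sub>R k (x + t *\<^sub>R h) \<partial>lborel)"
    using H1_translation_formula[OF u wL[unfolded k_def]] by (intro nsq_cong) (simp add: ae_eq_def k_def)
  also have "\<dots> \<le> nsq k" unfolding eq by (rule av)
  also have "\<dots> \<le> ennreal ((norm h)\<^sup>2) * gsq u" unfolding k_def by (rule nsq_directional_le[OF u])
  finally show ?thesis .
qed

section \<open>Completeness\<close>

lemma nsq_diff_commute: "nsq (\<lambda>x. u x - v x) = nsq (\<lambda>x. v x - u x)"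
  unfolding nsq_def by (simp add: norm_minus_commute)

text \<open>The weight \<open>4^k\<close> lies in between: against \<open>(1/8)^k\<close> it still
  leaves a convergent series of integrals, and boundedness of \<open>4^k |v k x|^2\<close> forces
  the terms to decay like \<open>2^-k\<close>.\<close>

lemma L2_fast_converge_AE:
  fixes v :: "nat \<Rightarrow> real^'n::finite \<Rightarrow> complex"
  assumes [measurable]: "\<And>k. v k \<in> borel_measurable borel" and b: "\<And>k. nsq (v k) \<le> ennreal ((1/8) ^ k)"
  shows "AE x in lborel. summable (\<lambda>k. v k x)"
proof -
  have "(\<integral>\<^sup>+x. (\<Sum>k. ennreal (4 ^ k * (norm (v k x))\<^sup>2)) \<partial>lborel) = (\<Sum>k. ennreal (4 ^ k) * nsq (v k))"
    unfolding nsq_def by (subst nn_integral_suminf) (auto simp: ennreal_mult nn_integral_cmult)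
  also have "\<dots> \<le> (\<Sum>k. ennreal ((1/2) ^ k))"
  proof (intro suminf_le summableI)
    fix k
    have "ennreal (4 ^ k) * nsq (v k) \<le> ennreal (4 ^ k) * ennreal ((1/8) ^ k)" by (intro mult_left_mono b) auto
    also have "\<dots> = ennreal ((1/2) ^ k)" by (simp add: ennreal_mult[symmetric] power_mult_distrib[symmetric])
    finally show "ennreal (4 ^ k) * nsq (v k) \<le> ennreal ((1/2) ^ k)" .
  qed
  also have "\<dots> < \<infinity>" by (subst suminf_ennreal2) (auto intro: summable_geometric)
  finally have "AE x in lborel. (\<Sum>k. ennreal (4 ^ k * (norm (v k x))\<^sup>2)) \<noteq> \<infinity>"
    by (intro nn_integral_noteq_infinite) auto
  thus ?thesis
  proof (rule AE_mp, intro AE_I2 impI)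
    fix x assume fin: "(\<Sum>k. ennreal (4 ^ k * (norm (v k x))\<^sup>2)) \<noteq> \<infinity>"
    have s: "summable (\<lambda>k. 4 ^ k * (norm (v k x))\<^sup>2)" using fin by (intro summable_suminf_not_top) auto
    have "Bseq (\<lambda>k. 4 ^ k * (norm (v k x))\<^sup>2)"
      by (rule convergent_imp_Bseq[OF convergentI[OF summable_LIMSEQ_zero[OF s]]])
    then obtain B where B: "\<And>k. norm (4 ^ k * (norm (v k x))\<^sup>2) \<le> B" unfolding Bseq_def by blast
    have "norm (v k x) \<le> sqrt B * (1/2) ^ k" for k
    proof -
      have "(2 ^ k)\<^sup>2 = (4::real) ^ k" using power_power_swap[of "2::real" k 2] by simp
      hence "(2 ^ k * norm (v k x))\<^sup>2 \<le> B" using B[of k] by (simp add: power_mult_distrib)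
      hence "2 ^ k * norm (v k x) \<le> sqrt B" by (rule real_le_rsqrt)
      thus ?thesis by (simp add: field_simps power_divide)
    qed
    moreover have "summable (\<lambda>k. sqrt B * (1/2) ^ k)" by (rule summable_mult) (simp add: summable_geometric)
    ultimately show "summable (\<lambda>k. v k x)"
      using summable_comparison_test'[of "\<lambda>k. sqrt B * (1/2) ^ k" 0 "\<lambda>k. v k x"] by blast
  qed
qed

text \<open>Riesz--Fischer: a rapidly converging subsequence has a pointwise limit, and Fatou's
  lemma carries the Cauchy estimate over to this limit for the whole sequence.\<close>

lemma L2_complete:
  fixes u :: "nat \<Rightarrow> real^'n::finite \<Rightarrow> complex"
  assumes u: "\<And>n. u n \<in> L2"
    and c: "\<And>e. e > 0 \<Longrightarrow> \<exists>N. \<forall>m\<ge>N. \<forall>n\<ge>N. nsq (\<lambda>x. u m x - u n x) \<le> ennreal e"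
  shows "\<exists>v\<in>L2. \<forall>e>0. \<exists>N. \<forall>n\<ge>N. nsq (\<lambda>x. u n x - v x) \<le> ennreal e"
proof -
  have [measurable]: "u n \<in> borel_measurable borel" for n using u[of n] by (auto simp: L2_iff)
  have "\<forall>k. \<exists>N. \<forall>m\<ge>N. \<forall>n\<ge>N. nsq (\<lambda>x. u m x - u n x) \<le> ennreal ((1/8) ^ k)" using c by simp
  then obtain N where N: "\<And>k m n. m \<ge> N k \<Longrightarrow> n \<ge> N k \<Longrightarrow> nsq (\<lambda>x. u m x - u n x) \<le> ennreal ((1/8) ^ k)" by metis
  \<comment> \<open>\<open>r k\<close> is nondecreasing and at least \<open>N k\<close> and
    \<open>k\<close>, so consecutive members of the subsequence obey the \<open>(1/8)^k\<close>
    bound and its tail runs through arbitrarily late indices.\<close>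
  define r where "r k = (\<Sum>j\<le>k. N j) + k" for k
  have rN: "N k \<le> r k" for k unfolding r_def by (simp add: trans_le_add1 member_le_sum)
  have rS: "r k \<le> r (Suc k)" for k by (simp add: r_def)
  have rk: "r k \<ge> k" for k by (simp add: r_def)
  define s where "s k = u (r k)" for k
  have [measurable]: "s k \<in> borel_measurable borel" for k by (simp add: s_def)
  have "AE x in lborel. summable (\<lambda>k. s (Suc k) x - s k x)"
    by (intro L2_fast_converge_AE) (auto simp: s_def intro!: N rN order_trans[OF rN rS])
  hence conv: "AE x in lborel. (\<lambda>k. s k x) \<longlonglongrightarrow> lim (\<lambda>k. s k x)"
  proof (rule AE_mp, intro AE_I2 impI)
    fix x assume "summable (\<lambda>k. s (Suc k) x - s k x)"
    hence "convergent (\<lambda>n. \<Sum>k<n. s (Suc k) x - s k x)" by (simp add: summable_iff_convergent)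
    hence "convergent (\<lambda>n. s n x - s 0 x)" by (simp add: sum_lessThan_telescope[of "\<lambda>k. s k x"])
    hence "convergent (\<lambda>n. s n x)" by (simp add: convergent_diff_const_right_iff)
    thus "(\<lambda>k. s k x) \<longlonglongrightarrow> lim (\<lambda>k. s k x)" by (simp add: convergent_LIMSEQ_iff)
  qed
  define v where "v x = lim (\<lambda>k. s k x)" for x
  have [measurable]: "v \<in> borel_measurable borel" unfolding v_def[abs_def] by measurable
  have lim: "\<exists>N. \<forall>n\<ge>N. nsq (\<lambda>x. u n x - v x) \<le> ennreal e" if e: "e > 0" for e
  proof -
    obtain M where M: "\<forall>m\<ge>M. \<forall>n\<ge>M. nsq (\<lambda>x. u m x - u n x) \<le> ennreal e" using c[OF e] by auto
    have "nsq (\<lambda>x. u n x - v x) \<le> ennreal e" if n: "n \<ge> M" for n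
    proof -
      have "nsq (\<lambda>x. u n x - v x) = (\<integral>\<^sup>+x. liminf (\<lambda>k. ennreal ((norm (u n x - s k x))\<^sup>2)) \<partial>lborel)"
        unfolding nsq_def
      proof (rule nn_integral_cong_AE, rule AE_mp[OF conv], intro AE_I2 impI)
        fix x assume "(\<lambda>k. s k x) \<longlonglongrightarrow> lim (\<lambda>k. s k x)"
        hence "(\<lambda>k. ennreal ((norm (u n x - s k x))\<^sup>2)) \<longlonglongrightarrow> ennreal ((norm (u n x - v x))\<^sup>2)"
          unfolding v_def by (intro tendsto_intros tendsto_ennrealI)
        from lim_imp_Liminf[OF _ this]
        show "ennreal ((norm (u n x - v x))\<^sup>2) = liminf (\<lambda>k. ennreal ((norm (u n x - s k x))\<^sup>2))" by simp
      qed
      also have "\<dots> \<le> liminf (\<lambda>k. nsq (\<lambda>x. u n x - s k x))" unfolding nsq_def by (intro nn_integral_liminf) measurable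
      also have "\<dots> \<le> ennreal e"
      proof (rule Liminf_le)
        show "\<forall>\<^sub>F k in sequentially. nsq (\<lambda>x. u n x - s k x) \<le> ennreal e"
          unfolding eventually_sequentially s_def using M n rk by (meson order_trans)
      qed simp
      finally show ?thesis .
    qed
    thus ?thesis by blast
  qed
  obtain n where "nsq (\<lambda>x. u n x - v x) \<le> ennreal 1" using lim[of 1] by auto
  hence "(\<lambda>x. u n x - v x) \<in> L2" by (auto simp: L2_iff intro: le_less_trans)
  from L2_diff[OF u[of n] this] have "v \<in> L2" by simp
  thus ?thesis using lim by auto
qed

lemma nsq_conv_integral:
  assumes u: "\<And>n::nat. u n \<in> L2" "v \<in> L2" and c: "\<And>e. e > 0 \<Longrightarrow> \<exists>N. \<forall>n\<ge>N. nsq (\<lambda>x. u n x - v x) \<le> ennreal e" and f: "f \<in> L2"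
  shows "(\<lambda>n. \<integral>x. u n x * f x \<partial>lborel) \<longlonglongrightarrow> (\<integral>x. v x * f x \<partial>lborel)"
proof (rule LIMSEQ_I)
  fix r :: real assume r: "r > 0"
  define F where "F = enn2real (nsq f)"
  have F: "nsq f = ennreal F" "F \<ge> 0" using f by (auto simp: F_def L2_iff)
  obtain N where N: "\<forall>n\<ge>N. nsq (\<lambda>x. u n x - v x) \<le> ennreal (r\<^sup>2 / (2 * (F + 1)))"
    using c[of "r\<^sup>2 / (2 * (F + 1))"] r F by auto
  have "norm ((\<integral>x. u n x * f x \<partial>lborel) - (\<integral>x. v x * f x \<partial>lborel)) < r" if n: "n \<ge> N" for n
  proof -
    have d: "(\<lambda>x. u n x - v x) \<in> L2" by (intro L2_diff u)
    have "(\<integral>x. u n x * f x \<partial>lborel) - (\<integral>x. v x * f x \<partial>lborel) = (\<integral>x. (u n x - v x) * f x \<partial>lborel)"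
      unfolding left_diff_distrib by (intro Bochner_Integration.integral_diff[symmetric] L2_mult_integrable u f)
    hence "ennreal (norm ((\<integral>x. u n x * f x \<partial>lborel) - (\<integral>x. v x * f x \<partial>lborel))) \<le> (\<integral>\<^sup>+x. norm ((u n x - v x) * f x) \<partial>lborel)"
      using integral_norm_bound_ennreal[OF L2_mult_integrable[OF d f]] by simp
    hence "ennreal (norm ((\<integral>x. u n x * f x \<partial>lborel) - (\<integral>x. v x * f x \<partial>lborel)) ^ 2) \<le> (\<integral>\<^sup>+x. norm ((u n x - v x) * f x) \<partial>lborel) ^ 2"
      by (simp add: ennreal_power[symmetric] power_mono)
    also have "\<dots> \<le> nsq (\<lambda>x. u n x - v x) * nsq f" by (rule L2_inner_nsq_bound[OF d f])
    also have "\<dots> \<le> ennreal (r\<^sup>2 / (2 * (F + 1))) * ennreal F" using N n F by (intro mult_mono) auto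
    also have "\<dots> = ennreal (r\<^sup>2 / (2 * (F + 1)) * F)" using F by (simp only: ennreal_mult' mult.commute)
    finally have "norm ((\<integral>x. u n x * f x \<partial>lborel) - (\<integral>x. v x * f x \<partial>lborel)) ^ 2 \<le> r\<^sup>2 / (2 * (F + 1)) * F"
      using F by (simp add: ennreal_le_iff)
    also have "\<dots> = r\<^sup>2 * (F / (2 * (F + 1)))" by simp
    also have "\<dots> < r\<^sup>2 * 1" using F r by (intro mult_strict_left_mono) (auto simp: field_simps)
    finally show ?thesis using r by (simp add: power_less_imp_less_base[of _ 2])
  qed
  thus "\<exists>no. \<forall>n\<ge>no. norm ((\<integral>x. u n x * f x \<partial>lborel) - (\<integral>x. v x * f x \<partial>lborel)) < r" by blast
qed

text \<open>Closedness of the weak derivative, since both sides of the defining identity are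
  continuous in \<open>L^2\<close>. It identifies the limit of the gradients when \<open>H^1\<close>
  is shown to be complete.\<close>

lemma weak_partial_limit:
  assumes u: "\<And>n::nat. u n \<in> L2" "v \<in> L2" "\<And>n. g n \<in> L2" "h \<in> L2" and w: "\<And>n. weak_partial i (u n) (g n)"
    and c: "\<And>e. e > 0 \<Longrightarrow> \<exists>N. \<forall>n\<ge>N. nsq (\<lambda>x. u n x - v x) \<le> ennreal e"
           "\<And>e. e > 0 \<Longrightarrow> \<exists>N. \<forall>n\<ge>N. nsq (\<lambda>x. g n x - h x) \<le> ennreal e"
  shows "weak_partial i v h"
proof -
  have "(\<integral>x. v x * partial_deriv i \<phi> x \<partial>lborel) = - (\<integral>x. h x * \<phi> x \<partial>lborel)" if \<phi>: "test_fun \<phi>" for \<phi>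
  proof -
    have "(\<lambda>n. - (\<integral>x. g n x * \<phi> x \<partial>lborel)) \<longlonglongrightarrow> - (\<integral>x. h x * \<phi> x \<partial>lborel)"
      by (intro tendsto_minus nsq_conv_integral u c test_fun_L2 \<phi>)
    moreover have "(\<lambda>n. - (\<integral>x. g n x * \<phi> x \<partial>lborel)) \<longlonglongrightarrow> (\<integral>x. v x * partial_deriv i \<phi> x \<partial>lborel)"
      unfolding weak_partialD[OF w \<phi>, symmetric] by (intro nsq_conv_integral u c test_fun_L2 test_fun_partial \<phi>)
    ultimately show ?thesis by (rule LIMSEQ_unique[symmetric])
  qed
  thus ?thesis by (subst weak_partial_iff[OF u(2,4)]) auto
qed

section \<open>Moving averages\<close>

definition cubeM :: "(real^'n::finite) measure" where "cubeM = restrict_space lborel (cbox 0 One)"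

text \<open>The mean over the cube \<open>x + l [0,1]^d\<close>, written over a fixed probability
  space so that Jensen and Fubini apply in the same way at every scale.\<close>

definition avg :: "real \<Rightarrow> (real^'n::finite \<Rightarrow> complex) \<Rightarrow> real^'n \<Rightarrow> complex" where
  "avg l u x = (\<integral>y. u (x + l *\<^sub>R y) \<partial>cubeM)"

lemma cubeM_props: "sigma_finite_measure (cubeM :: (real^'n::finite) measure)" "emeasure (cubeM :: (real^'n) measure) (space cubeM) = 1"
proof -
  show "sigma_finite_measure (cubeM :: (real^'n) measure)"
    unfolding cubeM_def by (auto intro!: sigma_finite_measure_restrict_space sigma_finite_lborel)
  show "emeasure (cubeM :: (real^'n) measure) (space cubeM) = 1"
    by (simp add: cubeM_def emeasure_restrict_space space_restrict_space emeasure_lborel_cbox_eq)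
qed

declare cubeM_props(2) [simp]

interpretation cubeM: sigma_finite_measure "cubeM :: (real^'n::finite) measure"
  by (rule cubeM_props)

lemma id_measurable_cubeM: "(\<lambda>y. y) \<in> cubeM \<rightarrow>\<^sub>M borel"
  unfolding cubeM_def by (intro measurable_restrict_space1) auto

lemma measurable_cubeM1: "f \<in> borel \<rightarrow>\<^sub>M N \<Longrightarrow> f \<in> cubeM \<rightarrow>\<^sub>M N"
  unfolding cubeM_def by (intro measurable_restrict_space1) auto

lemma le_one_plus_sq: "(t::real) \<le> 1 + t\<^sup>2"
proof -
  have "2 * t \<le> t\<^sup>2 + 1" using sum_squares_bound[of t 1] by simp
  thus ?thesis using zero_le_power2[of t] by linarith
qed

lemma nn_integral_cubeM_le:
  assumes [measurable]: "f \<in> borel_measurable borel"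
  shows "(\<integral>\<^sup>+y. f y \<partial>cubeM) \<le> (\<integral>\<^sup>+y. f y \<partial>lborel)"
  unfolding cubeM_def
  by (subst nn_integral_restrict_space) (auto intro!: nn_integral_mono simp: indicator_def)

lemma scale_measurable_cubeM: "(\<lambda>y::real^'n::finite. l *\<^sub>R y) \<in> cubeM \<rightarrow>\<^sub>M borel"
  by (intro measurable_cubeM1) measurable

lemma avg_measurable: "u \<in> borel_measurable borel \<Longrightarrow> avg l u \<in> borel_measurable borel"
  unfolding avg_def[abs_def] by (rule nsq_average_le(1)[OF _ scale_measurable_cubeM cubeM_props])

lemma nsq_avg_le: "u \<in> borel_measurable borel \<Longrightarrow> nsq (avg l u) \<le> nsq u"
  unfolding avg_def[abs_def] by (rule nsq_average_le(2)[OF _ scale_measurable_cubeM cubeM_props])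

lemma avg_L2: "u \<in> L2 \<Longrightarrow> avg l u \<in> L2"
  using avg_measurable[of u l] nsq_avg_le[of u l] by (auto simp: L2_iff)

lemma nn_integral_cube_sq_le:
  fixes u :: "real^'n::finite \<Rightarrow> complex"
  assumes [measurable]: "u \<in> borel_measurable borel" and "l > 0"
  shows "(\<integral>\<^sup>+y. ennreal ((norm (u (x + l *\<^sub>R y)))\<^sup>2) \<partial>cubeM) \<le> ennreal (1 / l ^ CARD('n)) * nsq u"
proof -
  have "(\<integral>\<^sup>+y. ennreal ((norm (u (x + l *\<^sub>R y)))\<^sup>2) \<partial>cubeM) \<le> (\<integral>\<^sup>+y. ennreal ((norm (u (x + l *\<^sub>R y)))\<^sup>2) \<partial>lborel)"
    by (rule nn_integral_cubeM_le) measurable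
  also have "\<dots> = ennreal (1 / l ^ CARD('n)) * nsq u" unfolding nsq_def
    by (rule nn_integral_affine) (use assms(2) in auto)
  finally show ?thesis .
qed

lemma cube_integrable:
  fixes u :: "real^'n::finite \<Rightarrow> complex"
  assumes u: "u \<in> L2" and "l > 0"
  shows "integrable cubeM (\<lambda>y. u (x + l *\<^sub>R y))"
proof (subst integrable_iff_bounded, intro conjI)
  note [measurable] = id_measurable_cubeM
  have [measurable]: "u \<in> borel_measurable borel" using u by (auto simp: L2_iff)
  show "(\<lambda>y. u (x + l *\<^sub>R y)) \<in> borel_measurable cubeM" by measurable
  have "(\<integral>\<^sup>+y. ennreal (norm (u (x + l *\<^sub>R y))) \<partial>cubeM) \<le> (\<integral>\<^sup>+y. 1 + ennreal ((norm (u (x + l *\<^sub>R y)))\<^sup>2) \<partial>cubeM)"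
  proof (rule nn_integral_mono)
    fix y
    have "norm (u (x + l *\<^sub>R y)) \<le> 1 + (norm (u (x + l *\<^sub>R y)))\<^sup>2"
      by (rule le_one_plus_sq)
    thus "ennreal (norm (u (x + l *\<^sub>R y))) \<le> 1 + ennreal ((norm (u (x + l *\<^sub>R y)))\<^sup>2)"
      by (metis ennreal_1 ennreal_leI ennreal_plus zero_le_one zero_le_power2)
  qed
  also have "\<dots> = 1 + (\<integral>\<^sup>+y. ennreal ((norm (u (x + l *\<^sub>R y)))\<^sup>2) \<partial>cubeM)" by (subst nn_integral_add) auto
  also have "\<dots> \<le> 1 + ennreal (1 / l ^ CARD('n)) * nsq u" by (intro add_left_mono nn_integral_cube_sq_le assms) measurable
  also have "\<dots> < \<infinity>" using u by (auto simp: L2_iff ennreal_mult_less_top)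
  finally show "(\<integral>\<^sup>+y. ennreal (norm (u (x + l *\<^sub>R y))) \<partial>cubeM) < \<infinity>" .
qed

text \<open>Averaging buys pointwise control: by Cauchy--Schwarz on the cube, evaluation of the
  average at a point is a bounded functional on \<open>L^2\<close> of norm at most
  \<open>l^(-d/2)\<close>. A cut-off to frequencies below \<open>1/l\<close> would give the
  same.\<close>

lemma avg_pointwise:
  fixes u :: "real^'n::finite \<Rightarrow> complex"
  assumes [measurable]: "u \<in> borel_measurable borel" and "l > 0"
  shows "ennreal ((norm (avg l u x))\<^sup>2) \<le> ennreal (1 / l ^ CARD('n)) * nsq u"
proof -
  note [measurable] = id_measurable_cubeM
  have "ennreal (norm (avg l u x)) \<le> (\<integral>\<^sup>+y. ennreal (norm (u (x + l *\<^sub>R y))) \<partial>cubeM)" unfolding avg_def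
    by (cases "integrable cubeM (\<lambda>y. u (x + l *\<^sub>R y))") (auto intro: integral_norm_bound_ennreal simp: not_integrable_integral_eq)
  hence "ennreal ((norm (avg l u x))\<^sup>2) \<le> (\<integral>\<^sup>+y. ennreal (norm (u (x + l *\<^sub>R y))) * 1 \<partial>cubeM)\<^sup>2"
    by (simp add: ennreal_power[symmetric] power_mono)
  also have "\<dots> \<le> (\<integral>\<^sup>+y. (ennreal (norm (u (x + l *\<^sub>R y))))\<^sup>2 \<partial>cubeM) * (\<integral>\<^sup>+y. 1\<^sup>2 \<partial>(cubeM :: (real^'n) measure))"
    by (intro Cauchy_Schwarz_nn_integral) measurable
  also have "\<dots> = (\<integral>\<^sup>+y. ennreal ((norm (u (x + l *\<^sub>R y)))\<^sup>2) \<partial>cubeM)" by (simp add: ennreal_power)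
  also have "\<dots> \<le> ennreal (1 / l ^ CARD('n)) * nsq u" by (intro nn_integral_cube_sq_le assms)
  finally show ?thesis .
qed

lemma avg_diff: "u \<in> L2 \<Longrightarrow> v \<in> L2 \<Longrightarrow> l > 0 \<Longrightarrow> avg l (\<lambda>x. u x - v x) x = avg l u x - avg l v x"
  unfolding avg_def by (intro Bochner_Integration.integral_diff cube_integrable)

lemma avg_sum:
  assumes "\<And>j. j \<in> J \<Longrightarrow> u j \<in> L2" "l > 0"
  shows "avg l (\<lambda>x. \<Sum>j\<in>J. c j * u j x) x = (\<Sum>j\<in>J. c j * avg l (u j) x)"
  unfolding avg_def using assms
  by (subst Bochner_Integration.integral_sum) (auto intro!: integrable_mult_right cube_integrable)

text \<open>Averages are convolutions; their commutation is what makes the multiscale sum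
  telescope.\<close>

lemma avg_commute:
  fixes u :: "real^'n::finite \<Rightarrow> complex"
  assumes u: "u \<in> L2" and l: "l > 0" "m > 0"
  shows "avg l (avg m u) x = avg m (avg l u) x"
proof -
  note [measurable] = id_measurable_cubeM
  have [measurable]: "u \<in> borel_measurable borel" using u by (auto simp: L2_iff)
  interpret P: pair_sigma_finite "cubeM :: (real^'n) measure" "cubeM :: (real^'n) measure" ..
  have int: "integrable (cubeM \<Otimes>\<^sub>M cubeM) (\<lambda>(y, z). u (x + l *\<^sub>R y + m *\<^sub>R z))"
  proof (subst integrable_iff_bounded, intro conjI)
    show "(\<lambda>(y, z). u (x + l *\<^sub>R y + m *\<^sub>R z)) \<in> borel_measurable (cubeM \<Otimes>\<^sub>M cubeM)" by measurable
    have "(\<integral>\<^sup>+p. ennreal (norm (case p of (y, z) \<Rightarrow> u (x + l *\<^sub>R y + m *\<^sub>R z))) \<partial>(cubeM \<Otimes>\<^sub>M cubeM))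
       = (\<integral>\<^sup>+y. \<integral>\<^sup>+z. ennreal (norm (u (x + l *\<^sub>R y + m *\<^sub>R z))) \<partial>cubeM \<partial>cubeM)"
      by (subst cubeM.nn_integral_fst[symmetric]) auto
    also have "\<dots> \<le> (\<integral>\<^sup>+y. \<integral>\<^sup>+z. 1 + ennreal ((norm (u (x + l *\<^sub>R y + m *\<^sub>R z)))\<^sup>2) \<partial>cubeM \<partial>cubeM)"
    proof (intro nn_integral_mono)
      fix y z
      have "norm (u (x + l *\<^sub>R y + m *\<^sub>R z)) \<le> 1 + (norm (u (x + l *\<^sub>R y + m *\<^sub>R z)))\<^sup>2"
        by (rule le_one_plus_sq)
      thus "ennreal (norm (u (x + l *\<^sub>R y + m *\<^sub>R z))) \<le> 1 + ennreal ((norm (u (x + l *\<^sub>R y + m *\<^sub>R z)))\<^sup>2)"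
        by (metis ennreal_1 ennreal_leI ennreal_plus zero_le_one zero_le_power2)
    qed
    also have "\<dots> \<le> (\<integral>\<^sup>+y. 1 + ennreal (1 / m ^ CARD('n)) * nsq u \<partial>(cubeM :: (real^'n) measure))"
      by (intro nn_integral_mono, subst nn_integral_add) (auto intro!: add_left_mono nn_integral_cube_sq_le l)
    also have "\<dots> < \<infinity>" using u by (auto simp: L2_iff ennreal_mult_less_top cubeM_props)
    finally show "(\<integral>\<^sup>+p. ennreal (norm (case p of (y, z) \<Rightarrow> u (x + l *\<^sub>R y + m *\<^sub>R z))) \<partial>(cubeM \<Otimes>\<^sub>M cubeM)) < \<infinity>" .
  qed
  have "avg m (avg l u) x = (\<integral>z. \<integral>y. u (x + l *\<^sub>R y + m *\<^sub>R z) \<partial>cubeM \<partial>cubeM)" by (simp add: avg_def add_ac)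
  also have "\<dots> = (\<integral>y. \<integral>z. u (x + l *\<^sub>R y + m *\<^sub>R z) \<partial>cubeM \<partial>cubeM)" by (rule P.Fubini_integral[OF int])
  also have "\<dots> = avg l (avg m u) x" by (simp add: avg_def)
  finally show ?thesis by simp
qed

lemma space_cubeM_norm:
  fixes y :: "real^'n::finite" assumes "y \<in> space cubeM" shows "(norm y)\<^sup>2 \<le> real CARD('n)"
proof -
  have "y \<in> cbox 0 One" using assms by (simp add: cubeM_def space_restrict_space)
  hence "0 \<le> y \<bullet> axis i 1 \<and> y \<bullet> axis i 1 \<le> One \<bullet> axis i (1::real)" for i
    by (auto simp: mem_box axis_in_Basis_iff)
  moreover have "One \<bullet> axis i (1::real) = 1" for i :: 'n by (rule inner_sum_Basis) (simp add: axis_in_Basis_iff)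
  ultimately have "0 \<le> y $ i \<and> y $ i \<le> 1" for i by (metis inner_axis inner_real_def mult.right_neutral)
  hence "(y $ i)\<^sup>2 \<le> 1" for i by (simp add: power_le_one)
  hence "(\<Sum>i\<in>UNIV. (y $ i)\<^sup>2) \<le> (\<Sum>i\<in>(UNIV::'n set). 1)" by (intro sum_mono)
  thus ?thesis by (simp add: norm_vec_def L2_set_def sum_nonneg)
qed

text \<open>The difference is a mean of translation differences by vectors \<open>l y\<close> with
  \<open>y\<close> in the unit cube, whose squared diameter is the dimension.\<close>

lemma nsq_avg_diff_le:
  fixes u :: "real^'n::finite \<Rightarrow> complex"
  assumes u: "u \<in> H1" and l: "l > 0"
  shows "nsq (\<lambda>x. avg l u x - u x) \<le> ennreal (real CARD('n) * l\<^sup>2) * gsq u"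
proof -
  note [measurable] = id_measurable_cubeM
  have [measurable]: "u \<in> borel_measurable borel" using H1_L2[OF u] by (auto simp: L2_iff)
  have "finite_measure (cubeM :: (real^'n) measure)" by (intro finite_measureI) (simp add: cubeM_props)
  then interpret fin: finite_measure "cubeM :: (real^'n) measure" .
  have "measure cubeM (space (cubeM :: (real^'n) measure)) = 1" by (simp add: measure_def cubeM_props)
  hence eq: "avg l u x - u x = (\<integral>y. u (x + l *\<^sub>R y) - u x \<partial>cubeM)" for x
    unfolding avg_def by (subst Bochner_Integration.integral_diff) (auto intro!: cube_integrable H1_L2 u l)
  have "nsq (\<lambda>x. avg l u x - u x) \<le> (\<integral>\<^sup>+y. nsq (\<lambda>x. u (x + l *\<^sub>R y) - u x) \<partial>cubeM)"
    unfolding eq by (intro nsq_integral_le cubeM_props) measurable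
  also have "\<dots> \<le> (\<integral>\<^sup>+y. ennreal (real CARD('n) * l\<^sup>2) * gsq u \<partial>(cubeM :: (real^'n) measure))"
  proof (rule nn_integral_mono)
    fix y :: "real^'n" assume "y \<in> space cubeM"
    hence "(norm (l *\<^sub>R y))\<^sup>2 \<le> real CARD('n) * l\<^sup>2"
      using mult_left_mono[OF space_cubeM_norm[of y], of "l\<^sup>2"] by (simp add: power_mult_distrib mult.commute)
    hence "ennreal ((norm (l *\<^sub>R y))\<^sup>2) * gsq u \<le> ennreal (real CARD('n) * l\<^sup>2) * gsq u"
      by (intro mult_right_mono ennreal_leI) auto
    thus "nsq (\<lambda>x. u (x + l *\<^sub>R y) - u x) \<le> ennreal (real CARD('n) * l\<^sup>2) * gsq u"
      using H1_translation_bound[OF u, of "l *\<^sub>R y"] by (rule order_trans[rotated])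
  qed
  finally show ?thesis by simp
qed

section \<open>Multiscale decomposition\<close>

definition scl :: "real \<Rightarrow> nat \<Rightarrow> real" where "scl s k = s / 2 ^ k"

text \<open>Write \<open>A k\<close> for the average at scale \<open>scl s k\<close>. The products
  \<open>A k A (k+1)\<close> telescope through \<open>A (k+1) (A (k+2) - A k)\<close>. The
  difference in \<open>blk0\<close> has small \<open>L^2\<close> norm, and the further average
  applied in \<open>blk\<close> gives the pointwise bound; two averages are needed to have both at
  once.\<close>

fun blk0 :: "real \<Rightarrow> nat \<Rightarrow> (real^'n::finite \<Rightarrow> complex) \<Rightarrow> real^'n \<Rightarrow> complex" where
  "blk0 s 0 u = avg (scl s 1) u"
| "blk0 s (Suc k) u = (\<lambda>x. avg (scl s (k + 2)) u x - avg (scl s k) u x)"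

definition blk :: "real \<Rightarrow> nat \<Rightarrow> (real^'n::finite \<Rightarrow> complex) \<Rightarrow> real^'n \<Rightarrow> complex" where
  "blk s k u = avg (scl s k) (blk0 s k u)"

text \<open>For \<open>s = 1 / sqrt a\<close> this is the square of the norm of
  \<open><.,.>_a\<close>; \<open>s\<close> is the length scale on which the gradient and the mass
  term balance.\<close>

definition esq :: "real \<Rightarrow> (real^'n::finite \<Rightarrow> complex) \<Rightarrow> ennreal" where
  "esq s u = gsq u + ennreal (1 / s\<^sup>2) * nsq u"

lemma scl_pos: "s > 0 \<Longrightarrow> scl s k > 0" by (simp add: scl_def)

lemma blk0_L2: "u \<in> L2 \<Longrightarrow> blk0 s k u \<in> L2"
  by (cases k) (auto intro!: avg_L2 L2_diff)

lemma blk_L2: "u \<in> L2 \<Longrightarrow> blk s k u \<in> L2"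
  by (simp add: blk_def avg_L2 blk0_L2)

lemma blk_partial_sums:
  assumes u: "u \<in> L2" and s: "s > 0"
  shows "(\<Sum>k<Suc K. blk s k u x) = avg (scl s K) (avg (scl s (Suc K)) u) x"
proof (induction K)
  case (Suc K)
  have "blk s (Suc K) u x = avg (scl s (Suc K)) (avg (scl s (K + 2)) u) x - avg (scl s (Suc K)) (avg (scl s K) u) x"
    unfolding blk_def by (simp add: avg_diff avg_L2 u scl_pos s)
  also have "avg (scl s (Suc K)) (avg (scl s K) u) x = avg (scl s K) (avg (scl s (Suc K)) u) x"
    by (rule avg_commute) (auto intro: u scl_pos s)
  finally show ?case using Suc by simp
qed (simp add: blk_def)

text \<open>The coarsest block uses the mass term of \<open>esq\<close>, all others the gradient:
  both averages are close to \<open>u\<close>, the worse one at the scale \<open>2 scl s k\<close>,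
  and the factor 16 absorbs the two errors.\<close>

lemma nsq_blk0_le:
  fixes u :: "real^'n::finite \<Rightarrow> complex"
  assumes u: "u \<in> H1" and s: "s > 0"
  shows "nsq (blk0 s k u) \<le> ennreal (16 * real CARD('n) * (scl s k)\<^sup>2) * esq s u"
proof (cases k)
  case 0
  have [measurable]: "u \<in> borel_measurable borel" using H1_L2[OF u] by (auto simp: L2_iff)
  have d1: "1 \<le> real CARD('n)" by (simp add: Suc_le_eq)
  have "nsq (blk0 s k u) \<le> nsq u" unfolding 0 by (auto intro!: nsq_avg_le)
  also have "\<dots> = ennreal (s\<^sup>2) * (ennreal (1 / s\<^sup>2) * nsq u)" using s by (simp add: mult.assoc[symmetric] ennreal_mult[symmetric])
  also have "\<dots> \<le> ennreal (16 * real CARD('n) * (scl s k)\<^sup>2) * esq s u"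
  proof (intro mult_mono ennreal_leI)
    have "1 * s\<^sup>2 \<le> (16 * real CARD('n)) * s\<^sup>2" using d1 by (intro mult_right_mono zero_le_power2) linarith
    thus "s\<^sup>2 \<le> 16 * real CARD('n) * (scl s k)\<^sup>2" by (simp add: 0 scl_def)
  qed (auto simp: esq_def)
  finally show ?thesis .
next
  case (Suc m)
  have [measurable]: "u \<in> borel_measurable borel" using H1_L2[OF u] by (auto simp: L2_iff)
  have [measurable]: "avg l u \<in> borel_measurable borel" for l by (rule avg_measurable) measurable
  let ?d = "real CARD('n)"
  have "blk0 s k u = (\<lambda>x. (avg (scl s (m + 2)) u x - u x) + (u x - avg (scl s m) u x))" by (simp add: Suc)
  hence "nsq (blk0 s k u) \<le> 2 * nsq (\<lambda>x. avg (scl s (m + 2)) u x - u x) + 2 * nsq (\<lambda>x. u x - avg (scl s m) u x)"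
    by (simp only:) (intro nsq_add_le; measurable)
  also have "nsq (\<lambda>x. u x - avg (scl s m) u x) = nsq (\<lambda>x. avg (scl s m) u x - u x)" by (rule nsq_diff_commute)
  also have "2 * nsq (\<lambda>x. avg (scl s (m + 2)) u x - u x) + 2 * \<dots>
     \<le> 2 * (ennreal (?d * (scl s (m + 2))\<^sup>2) * gsq u) + 2 * (ennreal (?d * (scl s m)\<^sup>2) * gsq u)"
    by (intro add_mono mult_left_mono nsq_avg_diff_le u scl_pos s) auto
  also have "\<dots> = ennreal (2 * (?d * (scl s (m + 2))\<^sup>2) + 2 * (?d * (scl s m)\<^sup>2)) * gsq u"
    by (simp add: ennreal_mult distrib_right mult.assoc)
  also have "\<dots> \<le> ennreal (16 * ?d * (scl s k)\<^sup>2) * esq s u"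
  proof (intro mult_mono ennreal_leI)
    have "2 * (?d * (scl s (m + 2))\<^sup>2) + 2 * (?d * (scl s m)\<^sup>2) = ?d * s\<^sup>2 * (2 / 16 + 2) / (2 ^ m)\<^sup>2"
      by (simp add: scl_def field_simps)
    also have "\<dots> \<le> ?d * s\<^sup>2 * 4 / (2 ^ m)\<^sup>2" by (intro divide_right_mono mult_left_mono) auto
    also have "\<dots> = 16 * ?d * (scl s k)\<^sup>2" by (simp add: scl_def Suc field_simps)
    finally show "2 * (?d * (scl s (m + 2))\<^sup>2) + 2 * (?d * (scl s m)\<^sup>2) \<le> 16 * ?d * (scl s k)\<^sup>2" .
  qed (auto simp: esq_def)
  finally show ?thesis .
qed

lemma nsq_blk_le:
  fixes u :: "real^'n::finite \<Rightarrow> complex"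
  assumes u: "u \<in> H1" and s: "s > 0"
  shows "nsq (blk s k u) \<le> ennreal (16 * real CARD('n) * (scl s k)\<^sup>2) * esq s u"
  unfolding blk_def using blk0_L2[OF H1_L2[OF u], of s k]
  by (intro order_trans[OF nsq_avg_le nsq_blk0_le] u s) (auto simp: L2_iff)

lemma blk_pointwise:
  fixes u :: "real^'n::finite \<Rightarrow> complex"
  assumes u: "u \<in> H1" and s: "s > 0"
  shows "ennreal ((norm (blk s k u x))\<^sup>2) \<le> ennreal (1 / scl s k ^ CARD('n)) * (ennreal (16 * real CARD('n) * (scl s k)\<^sup>2) * esq s u)"
proof -
  have "ennreal ((norm (blk s k u x))\<^sup>2) \<le> ennreal (1 / scl s k ^ CARD('n)) * nsq (blk0 s k u)"
    unfolding blk_def using blk0_L2[OF H1_L2[OF u], of s k] by (intro avg_pointwise scl_pos s) (auto simp: L2_iff)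
  also have "\<dots> \<le> ennreal (1 / scl s k ^ CARD('n)) * (ennreal (16 * real CARD('n) * (scl s k)\<^sup>2) * esq s u)"
    by (intro mult_left_mono nsq_blk0_le u s) auto
  finally show ?thesis .
qed

lemma blk_sum:
  assumes u: "\<And>j. j \<in> J \<Longrightarrow> u j \<in> L2" and s: "s > 0"
  shows "blk s k (\<lambda>x. \<Sum>j\<in>J. c j * u j x) x = (\<Sum>j\<in>J. c j * blk s k (u j) x)"
proof -
  have "blk0 s k (\<lambda>x. \<Sum>j\<in>J. c j * u j x) = (\<lambda>x. \<Sum>j\<in>J. c j * blk0 s k (u j) x)"
    using u s by (cases k) (auto simp: avg_sum[of J u] scl_pos sum_subtractf right_diff_distrib fun_eq_iff)
  thus ?thesis unfolding blk_def using u s by (simp add: avg_sum[of J "\<lambda>j. blk0 s k (u j)"] blk0_L2 scl_pos)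
qed

text \<open>The partial sums converge to \<open>u\<close> in \<open>L^2\<close>. Fatou turns this
  into a vanishing lower limit almost everywhere for the full sequence, which is enough for upper
  bounds on \<open>u\<close>.\<close>

lemma AE_liminf_partial_sums:
  fixes u :: "real^'n::finite \<Rightarrow> complex"
  assumes u: "u \<in> H1" and s: "s > 0"
  shows "AE x in lborel. liminf (\<lambda>K. ennreal ((norm (u x - (\<Sum>k<Suc K. blk s k u x)))\<^sup>2)) = 0"
proof -
  have uL: "u \<in> L2" by (rule H1_L2[OF u])
  have [measurable]: "u \<in> borel_measurable borel" using uL by (auto simp: L2_iff)
  have [measurable]: "blk s k u \<in> borel_measurable borel" for k using blk_L2[OF uL] by (auto simp: L2_iff)
  have [measurable]: "avg l u \<in> borel_measurable borel" for l by (rule avg_measurable) measurable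
  have [measurable]: "avg l (avg m u) \<in> borel_measurable borel" for l m by (rule avg_measurable) measurable
  define Df where "Df K x = u x - (\<Sum>k<Suc K. blk s k u x)" for K x
  have [measurable]: "Df K \<in> borel_measurable borel" for K
    unfolding Df_def using \<open>u \<in> borel_measurable borel\<close> \<open>\<And>k. blk s k u \<in> borel_measurable borel\<close>
    by (intro borel_measurable_diff borel_measurable_sum) auto
  let ?d = "real CARD('n)"
  have bd: "nsq (\<lambda>x. u x - (\<Sum>k<Suc K. blk s k u x)) \<le> ennreal (4 * ?d * s\<^sup>2 * (1 / 4) ^ K) * gsq u" for K
  proof -
    have "(\<lambda>x. u x - (\<Sum>k<Suc K. blk s k u x)) = (\<lambda>x. (u x - avg (scl s K) u x) + avg (scl s K) (\<lambda>x. u x - avg (scl s (Suc K)) u x) x)"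
      unfolding blk_partial_sums[OF uL s] by (simp add: avg_diff uL avg_L2 scl_pos s)
    hence "nsq (\<lambda>x. u x - (\<Sum>k<Suc K. blk s k u x))
       \<le> 2 * nsq (\<lambda>x. u x - avg (scl s K) u x) + 2 * nsq (avg (scl s K) (\<lambda>x. u x - avg (scl s (Suc K)) u x))"
      by (simp only:) (intro nsq_add_le; (intro avg_measurable)?; measurable)
    also have "\<dots> \<le> 2 * nsq (\<lambda>x. u x - avg (scl s K) u x) + 2 * nsq (\<lambda>x. u x - avg (scl s (Suc K)) u x)"
      by (intro add_left_mono mult_left_mono nsq_avg_le) auto
    also have "\<dots> = 2 * nsq (\<lambda>x. avg (scl s K) u x - u x) + 2 * nsq (\<lambda>x. avg (scl s (Suc K)) u x - u x)"
      by (simp only: nsq_diff_commute[of u])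
    also have "\<dots> \<le> 2 * (ennreal (?d * (scl s K)\<^sup>2) * gsq u) + 2 * (ennreal (?d * (scl s (Suc K))\<^sup>2) * gsq u)"
      by (intro add_mono mult_left_mono nsq_avg_diff_le u scl_pos s) auto
    also have "\<dots> = ennreal (2 * (?d * (scl s K)\<^sup>2) + 2 * (?d * (scl s (Suc K))\<^sup>2)) * gsq u"
      by (simp add: ennreal_mult distrib_right mult.assoc)
    also have "\<dots> \<le> ennreal (4 * ?d * s\<^sup>2 * (1 / 4) ^ K) * gsq u"
    proof (intro mult_right_mono ennreal_leI)
      have q: "(scl s K)\<^sup>2 = s\<^sup>2 * (1/4) ^ K" for K
        using power_power_swap[of "2::real" K 2] by (simp add: scl_def power_divide)
      have "2 * (?d * (scl s K)\<^sup>2) + 2 * (?d * (scl s (Suc K))\<^sup>2) = ?d * s\<^sup>2 * (1/4)^K * (2 + 2/4)" unfolding q by (simp add: field_simps)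
      also have "\<dots> \<le> ?d * s\<^sup>2 * (1/4)^K * 4" by (intro mult_left_mono) auto
      finally show "2 * (?d * (scl s K)\<^sup>2) + 2 * (?d * (scl s (Suc K))\<^sup>2) \<le> 4 * ?d * s\<^sup>2 * (1 / 4) ^ K" by simp
    qed auto
    finally show ?thesis .
  qed
  have "(\<integral>\<^sup>+x. liminf (\<lambda>K. ennreal ((norm (u x - (\<Sum>k<Suc K. blk s k u x)))\<^sup>2)) \<partial>lborel)
     \<le> liminf (\<lambda>K. nsq (\<lambda>x. u x - (\<Sum>k<Suc K. blk s k u x)))"
    unfolding nsq_def Df_def[symmetric] by (intro nn_integral_liminf) measurable
  also have "\<dots> \<le> liminf (\<lambda>K. ennreal (4 * ?d * s\<^sup>2 * (1 / 4) ^ K) * gsq u)"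
    by (intro Liminf_mono always_eventually allI bd)
  also have "\<dots> = 0"
  proof -
    have "(\<lambda>K. ennreal (4 * ?d * s\<^sup>2 * (1 / 4) ^ K)) \<longlonglongrightarrow> ennreal (4 * ?d * s\<^sup>2 * 0)"
      by (intro tendsto_ennrealI tendsto_intros LIMSEQ_realpow_zero) auto
    hence "(\<lambda>K. ennreal (4 * ?d * s\<^sup>2 * (1 / 4) ^ K) * gsq u) \<longlonglongrightarrow> ennreal (4 * ?d * s\<^sup>2 * 0) * gsq u"
      using gsq_finite[OF u] by (intro tendsto_mult_ennreal) auto
    from lim_imp_Liminf[OF _ this] show ?thesis by simp
  qed
  finally have "(\<integral>\<^sup>+x. liminf (\<lambda>K. ennreal ((norm (u x - (\<Sum>k<Suc K. blk s k u x)))\<^sup>2)) \<partial>lborel) = 0" by simp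
  thus ?thesis unfolding Df_def[symmetric] by (subst (asm) nn_integral_0_iff_AE) auto
qed

lemma norm_sum_sq_le_weighted:
  fixes z :: "nat \<Rightarrow> complex"
  assumes w: "\<And>k. w k > 0" and W: "\<And>n. (\<Sum>k<n. w k) \<le> W"
  shows "ennreal ((norm (\<Sum>k<n. z k))\<^sup>2) \<le> ennreal W * (\<Sum>k. ennreal (1 / w k) * ennreal ((norm (z k))\<^sup>2))"
proof -
  have W0: "W \<ge> 0" using W[of 0] by simp
  have "(norm (\<Sum>k<n. z k))\<^sup>2 \<le> (\<Sum>k<n. sqrt (w k) * (norm (z k) / sqrt (w k)))\<^sup>2"
  proof (intro power_mono norm_ge_zero)
    have "(\<Sum>k<n. sqrt (w k) * (norm (z k) / sqrt (w k))) = (\<Sum>k<n. norm (z k))"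
      using w by (intro sum.cong) (auto simp: less_imp_neq[symmetric])
    thus "norm (\<Sum>k<n. z k) \<le> (\<Sum>k<n. sqrt (w k) * (norm (z k) / sqrt (w k)))" by (simp add: norm_sum)
  qed
  also have "\<dots> \<le> (\<Sum>k<n. (sqrt (w k))\<^sup>2) * (\<Sum>k<n. (norm (z k) / sqrt (w k))\<^sup>2)" by (rule Cauchy_Schwarz_ineq_sum)
  also have "\<dots> = (\<Sum>k<n. w k) * (\<Sum>k<n. 1 / w k * (norm (z k))\<^sup>2)"
    using w by (simp add: less_imp_le power_divide)
  also have "\<dots> \<le> W * (\<Sum>k<n. 1 / w k * (norm (z k))\<^sup>2)"
    using w by (intro mult_right_mono W sum_nonneg) (auto intro!: mult_nonneg_nonneg simp: less_imp_le)
  finally have "ennreal ((norm (\<Sum>k<n. z k))\<^sup>2) \<le> ennreal (W * (\<Sum>k<n. 1 / w k * (norm (z k))\<^sup>2))" by (rule ennreal_leI)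
  also have "\<dots> = ennreal W * (\<Sum>k<n. ennreal (1 / w k) * ennreal ((norm (z k))\<^sup>2))"
  proof -
    have "ennreal (\<Sum>k<n. 1 / w k * (norm (z k))\<^sup>2) = (\<Sum>k<n. ennreal (1 / w k * (norm (z k))\<^sup>2))"
      using w by (intro sum_ennreal[symmetric]) (auto intro!: mult_nonneg_nonneg simp: less_imp_le)
    also have "\<dots> = (\<Sum>k<n. ennreal (1 / w k) * ennreal ((norm (z k))\<^sup>2))"
      using w by (intro sum.cong refl ennreal_mult) (auto simp: less_imp_le)
    finally show ?thesis using W0 w by (subst ennreal_mult) (auto intro!: sum_nonneg mult_nonneg_nonneg simp: less_imp_le)
  qed
  also have "\<dots> \<le> ennreal W * (\<Sum>k. ennreal (1 / w k) * ennreal ((norm (z k))\<^sup>2))"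
    by (intro mult_left_mono sum_le_suminf summableI) auto
  finally show ?thesis .
qed

text \<open>Weighted Cauchy--Schwarz bounds all partial sums by the same number; if
  \<open>norm (u x)\<close> exceeded it, the distance to the partial sums could not have lower limit
  0. The weights spend part of the decay in \<open>k\<close> on summability.\<close>

lemma AE_multiscale_bound:
  fixes u :: "real^'n::finite \<Rightarrow> complex"
  assumes u: "u \<in> H1" and s: "s > 0" and w: "\<And>k. w k > 0" and W: "\<And>n. (\<Sum>k<n. w k) \<le> W"
  shows "AE x in lborel. ennreal ((norm (u x))\<^sup>2) \<le> ennreal W * (\<Sum>k. ennreal (1 / w k) * ennreal ((norm (blk s k u x))\<^sup>2))"
  using AE_liminf_partial_sums[OF u s]
proof (rule AE_mp, intro AE_I2 impI)
  fix x assume 0: "liminf (\<lambda>K. ennreal ((norm (u x - (\<Sum>k<Suc K. blk s k u x)))\<^sup>2)) = 0"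
  let ?B = "ennreal W * (\<Sum>k. ennreal (1 / w k) * ennreal ((norm (blk s k u x))\<^sup>2))"
  show "ennreal ((norm (u x))\<^sup>2) \<le> ?B"
  proof (rule ccontr)
    assume "\<not> ennreal ((norm (u x))\<^sup>2) \<le> ?B"
    hence lt: "?B < ennreal ((norm (u x))\<^sup>2)" by simp
    hence "?B \<noteq> \<infinity>" using ennreal_less_top order_less_trans by (metis infinity_ennreal_def less_irrefl)
    then obtain b where b: "?B = ennreal b" "b \<ge> 0" by (cases ?B) auto
    have lt2: "b < (norm (u x))\<^sup>2" using lt b by (simp add: ennreal_less_iff)
    have sb: "sqrt b < norm (u x)" using lt2 b by (simp add: real_sqrt_less_iff real_less_lsqrt)
    have S: "norm (\<Sum>k<Suc K. blk s k u x) \<le> sqrt b" for K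
    proof -
      have "ennreal ((norm (\<Sum>k<Suc K. blk s k u x))\<^sup>2) \<le> ennreal b"
        using norm_sum_sq_le_weighted[of w W "\<lambda>k. blk s k u x" "Suc K", OF w W] b(1) by simp
      thus ?thesis using b by (intro real_le_rsqrt) simp
    qed
    have "ennreal ((norm (u x) - sqrt b)\<^sup>2) \<le> ennreal ((norm (u x - (\<Sum>k<Suc K. blk s k u x)))\<^sup>2)" for K
      using sb S[of K] norm_triangle_ineq2[of "u x" "\<Sum>k<Suc K. blk s k u x"]
      by (intro ennreal_leI power_mono) auto
    hence "ennreal ((norm (u x) - sqrt b)\<^sup>2) \<le> liminf (\<lambda>K. ennreal ((norm (u x - (\<Sum>k<Suc K. blk s k u x)))\<^sup>2))"
      by (intro Liminf_bounded always_eventually) blast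
    thus False using 0 sb by (simp add: ennreal_eq_0_iff)
  qed
qed

section \<open>The potential on almost orthonormal families\<close>

text \<open>If \<open>v > t\<close>, then \<open>(v / t)^(p-1) >= 1\<close>. This linear form of
  Hoelder's inequality can be applied with a different \<open>t\<close> at each scale and is
  optimised only after summation.\<close>

lemma le_powr_linearize:
  assumes "v \<ge> 0" "t > 0" "(p::real) \<ge> 1"
  shows "v \<le> v powr p * t powr (1 - p) + t"
proof (cases "v \<le> t")
  case False
  hence "v powr (1 - p) \<le> t powr (1 - p)" using assms by (intro powr_mono2') auto
  hence "v powr p * v powr (1 - p) \<le> v powr p * t powr (1 - p)" by (intro mult_left_mono) auto
  moreover have "v powr p * v powr (1 - p) = v" using False assms by (simp add: powr_add[symmetric])
  ultimately show ?thesis using assms by linarith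
next
  case True thus ?thesis using assms by (intro add_increasing) auto
qed

text \<open>The choice \<theta> \<open>= z^(1/p)\<close> balances the two terms; for
  \<open>z = 0\<close> it is not admissible and \<theta> tends to 0 instead.\<close>

lemma powr_le_of_linearized:
  assumes q: "q \<ge> 0" "z \<ge> 0" "W \<ge> 0" "(p::real) \<ge> 1" and h: "\<And>\<theta>. \<theta> > 0 \<Longrightarrow> q \<le> W * (\<theta> powr (1 - p) * z + \<theta> * W)"
  shows "q powr p \<le> (W * (1 + W)) powr p * z"
proof (cases "z = 0")
  case True
  have "q \<le> 0 + e" if "e > 0" for e
  proof -
    have "q \<le> W * (e / (W\<^sup>2 + 1) * W)" using h[of "e / (W\<^sup>2 + 1)"] that True by (simp add: add_nonneg_pos)
    also have "\<dots> = e * (W\<^sup>2 / (W\<^sup>2 + 1))" by (simp add: power2_eq_square)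
    also have "W\<^sup>2 / (W\<^sup>2 + 1) \<le> 1" using zero_le_power2[of W] by (subst divide_le_eq_1_pos) linarith+
    hence "e * (W\<^sup>2 / (W\<^sup>2 + 1)) \<le> e * 1" using that by (intro mult_left_mono) auto
    finally show ?thesis by simp
  qed
  hence "q \<le> 0" by (rule field_le_epsilon)
  thus ?thesis using q True by simp
next
  case False
  hence z: "z > 0" using q by simp
  let ?t = "z powr (1 / p)"
  have t: "?t > 0" using z by simp
  have "?t powr (1 - p) * z = ?t"
  proof -
    have "?t powr (1 - p) * z = z powr ((1 - p) / p) * z powr 1" using z by (simp add: powr_powr)
    also have "\<dots> = z powr ((1 - p) / p + 1)" by (rule powr_add[symmetric])
    also have "(1 - p) / p + 1 = 1 / p" using q by (simp add: field_simps)
    finally show ?thesis .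
  qed
  hence "q \<le> W * (1 + W) * ?t" using h[OF t] by (simp add: algebra_simps)
  hence "q powr p \<le> (W * (1 + W) * ?t) powr p" using q by (intro powr_mono2) auto
  also have "\<dots> = (W * (1 + W)) powr p * (?t powr p)" by (rule powr_mult)
  also have "?t powr p = z" using q z by (simp add: powr_powr)
  finally show ?thesis .
qed

lemma sq_powr: "x > 0 \<Longrightarrow> ((x::real)\<^sup>2) powr a = x powr (2 * a)"
  using powr_powr[of x 2 a] by simp

definition Vsq :: "(real^'n::finite \<Rightarrow> complex) \<Rightarrow> (real^'n \<Rightarrow> complex) \<Rightarrow> ennreal" where
  "Vsq V u = (\<integral>\<^sup>+x. ennreal (norm (V x) * (norm (u x))\<^sup>2) \<partial>lborel)"

lemma geometric_powr:
  assumes "\<sigma> > 0"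
  defines "w \<equiv> \<lambda>k::nat. 2 powr (- \<sigma> * real k)"
  shows "w k > 0" "w sums (1 / (1 - 2 powr (- \<sigma>)))" "(\<Sum>k<n. w k) \<le> 1 / (1 - 2 powr (- \<sigma>))"
proof -
  show "w k > 0" for k by (simp add: w_def)
  have w: "w k = (2 powr (- \<sigma>)) ^ k" for k unfolding w_def by (simp add: powr_power mult.commute)
  have "2 powr (- \<sigma>) < 2 powr (0::real)" using assms by (intro powr_less_mono) auto
  hence "norm (2 powr (- \<sigma>)) < 1" by simp
  from geometric_sums[OF this] show s: "w sums (1 / (1 - 2 powr (- \<sigma>)))" by (simp add: w[abs_def])
  show "(\<Sum>k<n. w k) \<le> 1 / (1 - 2 powr (- \<sigma>))"
    using sum_le_suminf[OF sums_summable[OF s], of "{..<n}"] sums_unique[OF s] by (simp add: w_def)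
qed

text \<open>Bessel's inequality by duality. Evaluation of a block at \<open>x\<close> is a bounded
  functional; applied to the combination whose coefficients are the conjugates of the values
  themselves, it gives \<open>T^2 <= Q T\<close>. The bound does not depend on the number of
  functions.\<close>

lemma synthesis_pointwise:
  fixes g :: "nat \<Rightarrow> real^'n::finite \<Rightarrow> complex"
  assumes s: "s > 0" and g: "\<And>j. j < N \<Longrightarrow> g j \<in> H1" and b: "b \<ge> 0"
    and syn: "\<And>c. esq s (\<lambda>x. \<Sum>j<N. c j * g j x) \<le> ennreal (b\<^sup>2 * (\<Sum>j<N. (norm (c j))\<^sup>2))"
    and H: "\<And>c. (\<lambda>x. \<Sum>j<N. c j * g j x) \<in> H1"
  shows "(\<Sum>j<N. (norm (blk s k (g j) x))\<^sup>2) \<le> 1 / scl s k ^ CARD('n) * (16 * real CARD('n) * (scl s k)\<^sup>2 * b\<^sup>2)"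
proof -
  define T where "T = (\<Sum>j<N. (norm (blk s k (g j) x))\<^sup>2)"
  define Q where "Q = 1 / scl s k ^ CARD('n) * (16 * real CARD('n) * (scl s k)\<^sup>2 * b\<^sup>2)"
  have sp: "scl s k > 0" by (rule scl_pos[OF s])
  have T0: "T \<ge> 0" unfolding T_def by (intro sum_nonneg) auto
  have Q0: "Q \<ge> 0" unfolding Q_def using sp by auto
  define c where "c j = cnj (blk s k (g j) x)" for j
  have "blk s k (\<lambda>x. \<Sum>j<N. c j * g j x) x = (\<Sum>j<N. c j * blk s k (g j) x)"
    by (rule blk_sum) (auto intro: H1_L2 g s)
  also have "\<dots> = of_real T" unfolding c_def T_def of_real_sum
    by (intro sum.cong refl) (simp only: complex_norm_square mult.commute)
  finally have e: "blk s k (\<lambda>x. \<Sum>j<N. c j * g j x) x = of_real T" .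
  have "ennreal (T\<^sup>2) = ennreal ((norm (blk s k (\<lambda>x. \<Sum>j<N. c j * g j x) x))\<^sup>2)" unfolding e using T0 by simp
  also have "\<dots> \<le> ennreal (1 / scl s k ^ CARD('n)) * (ennreal (16 * real CARD('n) * (scl s k)\<^sup>2) * esq s (\<lambda>x. \<Sum>j<N. c j * g j x))"
    by (rule blk_pointwise[OF H s])
  also have "\<dots> \<le> ennreal (1 / scl s k ^ CARD('n)) * (ennreal (16 * real CARD('n) * (scl s k)\<^sup>2) * ennreal (b\<^sup>2 * T))"
    using syn[of c] by (intro mult_left_mono) (auto simp: T_def c_def)
  also have "\<dots> = ennreal (Q * T)" unfolding Q_def using T0 sp by (simp add: ennreal_mult[symmetric] mult.assoc)
  finally have "T * T \<le> Q * T" using T0 Q0 by (simp add: power2_eq_square)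
  hence "T \<le> Q" using T0 Q0 by (cases "T = 0") (auto simp: mult_le_cancel_right)
  thus ?thesis unfolding T_def Q_def .
qed

text \<open>Each function is split into blocks and \<open>|V|\<close> is linearised on each block
  with its own threshold. The part with \<open>|V|^p\<close> is summed over \<open>j\<close> under
  the integral, where Bessel's inequality holds pointwise; the remaining part needs only the mass of
  a single block. At scale \<open>k\<close> the total is of order \<open>l k powr (2 p - d)\<close>,
  and \<sigma> is chosen so that this equals \<open>w k powr (2 p)\<close> up to a constant.\<close>

theorem family_bound:
  fixes g :: "nat \<Rightarrow> real^'n::finite \<Rightarrow> complex" and V :: "real^'n \<Rightarrow> complex"
  assumes p: "p \<ge> 1" "2 * p > real CARD('n)"
    and V[measurable]: "V \<in> borel_measurable borel" and I: "integrable lborel (\<lambda>x. norm (V x) powr p)"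
    and s: "s > 0" and b: "b > 0" and g: "\<And>j. j < N \<Longrightarrow> g j \<in> H1"
    and syn: "\<And>c. esq s (\<lambda>x. \<Sum>j<N. c j * g j x) \<le> ennreal (b\<^sup>2 * (\<Sum>j<N. (norm (c j))\<^sup>2))"
    and H: "\<And>c. (\<lambda>x. \<Sum>j<N. c j * g j x) \<in> H1"
  defines "\<sigma> \<equiv> (2 * p - real CARD('n)) / (2 * p)"
  defines "W \<equiv> 1 / (1 - 2 powr (- \<sigma>))"
  defines "D \<equiv> (16 * real CARD('n)) powr p * b powr (2 * p) * s powr (2 * p - real CARD('n)) * (\<integral>x. norm (V x) powr p \<partial>lborel)"
  shows "\<And>j. j < N \<Longrightarrow> Vsq V (g j) < \<infinity>"
    and "(\<Sum>j<N. enn2real (Vsq V (g j)) powr p) \<le> (W * (1 + W)) powr p * (D * W)"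
proof -
  let ?d = "real CARD('n)"
  define w where "w k = 2 powr (- \<sigma> * real k)" for k :: nat
  define l where "l k = scl s k" for k
  \<comment> \<open>The mass of a block of one function; divided by \<open>l k ^ d\<close> it is
    also the pointwise bound for the whole family.\<close>
  define m where "m k = 16 * ?d * (l k)\<^sup>2 * b\<^sup>2" for k
  define A where "A k j = (\<integral>\<^sup>+x. ennreal (norm (V x) powr p) * ennreal ((norm (blk s k (g j) x))\<^sup>2) \<partial>lborel)" for k j
  define Z where "Z j = (\<Sum>k. ennreal (w k powr (1 - 2 * p) * m k powr (p - 1)) * A k j)" for j
  have \<sigma>: "\<sigma> > 0" unfolding \<sigma>_def using p by simp
  have w0: "w k > 0" for k unfolding w_def by simp
  note gp = geometric_powr[OF \<sigma>, folded w_def, folded W_def]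
  have W0: "W \<ge> 0" using gp(3)[of 0] by simp
  have l0: "l k > 0" for k unfolding l_def by (rule scl_pos[OF s])
  have m0: "m k > 0" for k unfolding m_def using l0[of k] b by (simp add: Suc_le_eq)
  have gL: "j < N \<Longrightarrow> g j \<in> L2" for j by (rule H1_L2[OF g])
  have gm[measurable]: "j < N \<Longrightarrow> g j \<in> borel_measurable borel" for j using gL by (auto simp: L2_iff)
  have bm[measurable]: "j < N \<Longrightarrow> blk s k (g j) \<in> borel_measurable borel" for j k using blk_L2[OF gL] by (auto simp: L2_iff)
  have B: "nsq (blk s k (g j)) \<le> ennreal (m k)" if j: "j < N" for j k
  proof -
    \<comment> \<open>The synthesis bound for the \<open>j\<close>-th unit vector of
      coefficients.\<close>
    have "esq s (g j) = esq s (\<lambda>x. \<Sum>i<N. (if i = j then 1 else 0) * g i x)"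
      using j by (intro arg_cong[of _ _ "esq s"]) (auto simp: if_distrib[of "\<lambda>t. t * _"] cong: if_cong)
    also have "\<dots> \<le> ennreal (b\<^sup>2 * (\<Sum>i<N. (norm (if i = j then 1 else 0 :: complex))\<^sup>2))" by (rule syn)
    also have "(\<Sum>i<N. (norm (if i = j then 1 else 0 :: complex))\<^sup>2) = (\<Sum>i<N. if i = j then 1 else 0)"
      by (intro sum.cong) auto
    also have "\<dots> = 1" using j by simp
    finally have "esq s (g j) \<le> ennreal (b\<^sup>2)" by simp
    hence "ennreal (16 * ?d * (scl s k)\<^sup>2) * esq s (g j) \<le> ennreal (16 * ?d * (scl s k)\<^sup>2) * ennreal (b\<^sup>2)" by (intro mult_left_mono) auto
    also have "\<dots> = ennreal (m k)" unfolding m_def l_def by (simp add: ennreal_mult[symmetric])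
    finally show ?thesis using nsq_blk_le[OF g[OF j] s, of k] by (rule order_trans[rotated])
  qed
  have C: "Vsq V (g j) \<le> ennreal W * (ennreal (\<theta> powr (1 - p)) * Z j + ennreal (\<theta> * W))" if j: "j < N" and \<theta>: "\<theta> > 0" for j \<theta>
  proof -
    note [measurable] = gm[OF j] bm[OF j]
    \<comment> \<open>Chosen so that \<tau> \<open>k * m k\<close> equals \<theta>
      \<open>(w k)^2\<close>: after division by the weight, the mass part is the summable \<theta>
      \<open>w k\<close>.\<close>
    define \<tau> where "\<tau> k = \<theta> * (w k)\<^sup>2 / m k" for k
    have \<tau>0: "\<tau> k > 0" for k unfolding \<tau>_def using \<theta> w0[of k] m0[of k] by simp
    have "Vsq V (g j) \<le> (\<integral>\<^sup>+x. ennreal W * (\<Sum>k. ennreal (1 / w k) * (ennreal (norm (V x)) * ennreal ((norm (blk s k (g j) x))\<^sup>2))) \<partial>lborel)"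
      unfolding Vsq_def
    proof (rule nn_integral_mono_AE, rule AE_mp[OF AE_multiscale_bound[OF g[OF j] s w0 gp(3)]], intro AE_I2 impI)
      fix x assume "ennreal ((norm (g j x))\<^sup>2) \<le> ennreal W * (\<Sum>k. ennreal (1 / w k) * ennreal ((norm (blk s k (g j) x))\<^sup>2))"
      hence "ennreal (norm (V x)) * ennreal ((norm (g j x))\<^sup>2) \<le> ennreal (norm (V x)) * (ennreal W * (\<Sum>k. ennreal (1 / w k) * ennreal ((norm (blk s k (g j) x))\<^sup>2)))"
        by (intro mult_left_mono) auto
      also have "\<dots> = ennreal W * (ennreal (norm (V x)) * (\<Sum>k. ennreal (1 / w k) * ennreal ((norm (blk s k (g j) x))\<^sup>2)))"
        by (simp only: mult.left_commute)
      also have "ennreal (norm (V x)) * (\<Sum>k. ennreal (1 / w k) * ennreal ((norm (blk s k (g j) x))\<^sup>2))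
          = (\<Sum>k. ennreal (1 / w k) * (ennreal (norm (V x)) * ennreal ((norm (blk s k (g j) x))\<^sup>2)))"
        unfolding ennreal_suminf_cmult[symmetric] by (simp only: mult.left_commute)
      finally show "ennreal (norm (V x) * (norm (g j x))\<^sup>2) \<le> ennreal W * (\<Sum>k. ennreal (1 / w k) * (ennreal (norm (V x)) * ennreal ((norm (blk s k (g j) x))\<^sup>2)))"
        by (simp only: ennreal_mult[OF norm_ge_zero zero_le_power2])
    qed
    also have "\<dots> = ennreal W * (\<Sum>k. ennreal (1 / w k) * (\<integral>\<^sup>+x. ennreal (norm (V x)) * ennreal ((norm (blk s k (g j) x))\<^sup>2) \<partial>lborel))"
      by (simp add: nn_integral_cmult nn_integral_suminf)
    also have "\<dots> \<le> ennreal W * (\<Sum>k. ennreal (\<theta> powr (1 - p)) * (ennreal (w k powr (1 - 2 * p) * m k powr (p - 1)) * A k j) + ennreal (\<theta> * w k))"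
    proof (intro mult_left_mono suminf_le summableI)
      fix k
      have "(\<integral>\<^sup>+x. ennreal (norm (V x)) * ennreal ((norm (blk s k (g j) x))\<^sup>2) \<partial>lborel)
         \<le> (\<integral>\<^sup>+x. ennreal (\<tau> k powr (1 - p)) * (ennreal (norm (V x) powr p) * ennreal ((norm (blk s k (g j) x))\<^sup>2)) + ennreal (\<tau> k) * ennreal ((norm (blk s k (g j) x))\<^sup>2) \<partial>lborel)"
      proof (rule nn_integral_mono)
        fix x
        have "norm (V x) \<le> norm (V x) powr p * \<tau> k powr (1 - p) + \<tau> k"
          by (rule le_powr_linearize) (use \<tau>0 p in auto)
        hence "ennreal (norm (V x)) \<le> ennreal (\<tau> k powr (1 - p)) * ennreal (norm (V x) powr p) + ennreal (\<tau> k)"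
          using \<tau>0[of k] by (simp add: ennreal_mult[symmetric] mult.commute flip: ennreal_plus)
        hence "ennreal (norm (V x)) * ennreal ((norm (blk s k (g j) x))\<^sup>2)
           \<le> (ennreal (\<tau> k powr (1 - p)) * ennreal (norm (V x) powr p) + ennreal (\<tau> k)) * ennreal ((norm (blk s k (g j) x))\<^sup>2)"
          by (intro mult_right_mono) auto
        thus "ennreal (norm (V x)) * ennreal ((norm (blk s k (g j) x))\<^sup>2) \<le> ennreal (\<tau> k powr (1 - p)) * (ennreal (norm (V x) powr p) * ennreal ((norm (blk s k (g j) x))\<^sup>2)) + ennreal (\<tau> k) * ennreal ((norm (blk s k (g j) x))\<^sup>2)"
          by (simp add: distrib_right mult.assoc)
      qed
      also have "\<dots> = ennreal (\<tau> k powr (1 - p)) * A k j + ennreal (\<tau> k) * nsq (blk s k (g j))"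
        unfolding A_def nsq_def by (simp add: nn_integral_add nn_integral_cmult)
      also have "\<dots> \<le> ennreal (\<tau> k powr (1 - p)) * A k j + ennreal (\<tau> k) * ennreal (m k)"
        by (intro add_left_mono mult_left_mono B j) auto
      finally have "ennreal (1 / w k) * (\<integral>\<^sup>+x. ennreal (norm (V x)) * ennreal ((norm (blk s k (g j) x))\<^sup>2) \<partial>lborel)
         \<le> ennreal (1 / w k) * (ennreal (\<tau> k powr (1 - p)) * A k j + ennreal (\<tau> k) * ennreal (m k))"
        by (intro mult_left_mono) auto
      also have "\<dots> = ennreal (1 / w k * \<tau> k powr (1 - p)) * A k j + ennreal (1 / w k * (\<tau> k * m k))"
      proof -
        have "ennreal (1 / w k * \<tau> k powr (1 - p)) = ennreal (1 / w k) * ennreal (\<tau> k powr (1 - p))"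
          using w0[of k] by (intro ennreal_mult) auto
        moreover have "ennreal (1 / w k * (\<tau> k * m k)) = ennreal (1 / w k) * ennreal (\<tau> k * m k)"
          using w0[of k] \<tau>0[of k] m0[of k] by (intro ennreal_mult) auto
        moreover have "ennreal (\<tau> k * m k) = ennreal (\<tau> k) * ennreal (m k)"
          using \<tau>0[of k] m0[of k] by (intro ennreal_mult) auto
        ultimately show ?thesis by (simp only: distrib_left mult.assoc)
      qed
      also have "1 / w k * (\<tau> k * m k) = \<theta> * w k" unfolding \<tau>_def using w0[of k] m0[of k] by (simp add: power2_eq_square)
      also have "1 / w k * \<tau> k powr (1 - p) = \<theta> powr (1 - p) * (w k powr (1 - 2 * p) * m k powr (p - 1))"
      proof -
        have "\<tau> k powr (1 - p) = \<theta> powr (1 - p) * (w k)\<^sup>2 powr (1 - p) / m k powr (1 - p)"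
          unfolding \<tau>_def using \<theta> w0[of k] m0[of k] by (simp add: powr_divide powr_mult)
        also have "(w k)\<^sup>2 powr (1 - p) = w k powr (2 * (1 - p))"
          by (rule sq_powr[OF w0])
        also have "m k powr (1 - p) = 1 / m k powr (p - 1)" using powr_minus_divide[of "m k" "p - 1"] by simp
        finally have "1 / w k * \<tau> k powr (1 - p) = \<theta> powr (1 - p) * (w k powr (- 1) * w k powr (2 * (1 - p))) * m k powr (p - 1)"
          using w0[of k] by (simp add: powr_minus_divide)
        also have "w k powr (- 1) * w k powr (2 * (1 - p)) = w k powr (- 1 + 2 * (1 - p))" by (rule powr_add[symmetric])
        also have "- 1 + 2 * (1 - p) = 1 - 2 * p" by simp
        finally show ?thesis by simp
      qed
      also have "ennreal (\<theta> powr (1 - p) * (w k powr (1 - 2 * p) * m k powr (p - 1))) * A k j = ennreal (\<theta> powr (1 - p)) * (ennreal (w k powr (1 - 2 * p) * m k powr (p - 1)) * A k j)"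
        by (simp add: ennreal_mult mult.assoc)
      finally show "ennreal (1 / w k) * (\<integral>\<^sup>+x. ennreal (norm (V x)) * ennreal ((norm (blk s k (g j) x))\<^sup>2) \<partial>lborel)
        \<le> ennreal (\<theta> powr (1 - p)) * (ennreal (w k powr (1 - 2 * p) * m k powr (p - 1)) * A k j) + ennreal (\<theta> * w k)" .
    qed auto
    also have "\<dots> = ennreal W * (ennreal (\<theta> powr (1 - p)) * Z j + ennreal (\<theta> * W))"
    proof -
      have "(\<Sum>k. ennreal (\<theta> * w k)) = ennreal (\<theta> * W)"
        using sums_mult[OF gp(2), of \<theta>] \<theta> w0 by (intro suminf_ennreal_eq) (auto simp: less_imp_le)
      thus ?thesis unfolding Z_def by (simp add: suminf_add[symmetric] summableI ennreal_suminf_cmult)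
    qed
    finally show ?thesis .
  qed
  have D0: "D \<ge> 0" unfolding D_def by (auto intro!: mult_nonneg_nonneg integral_nonneg_AE)
  \<comment> \<open>Only the part with \<open>|V|^p\<close> is ever summed over the family; \<theta>
    stays free until the end and may then depend on \<open>j\<close>.\<close>
  have SZ: "(\<Sum>j<N. Z j) \<le> ennreal (D * W)"
  proof -
    have "(\<Sum>j<N. Z j) = (\<Sum>k. \<Sum>j<N. ennreal (w k powr (1 - 2 * p) * m k powr (p - 1)) * A k j)"
      unfolding Z_def by (rule suminf_sum[symmetric]) (auto intro: summableI)
    also have "\<dots> \<le> (\<Sum>k. ennreal (D * w k))"
    proof (intro suminf_le summableI)
      fix k
      have "(\<Sum>j<N. A k j) = (\<integral>\<^sup>+x. (\<Sum>j<N. ennreal (norm (V x) powr p) * ennreal ((norm (blk s k (g j) x))\<^sup>2)) \<partial>lborel)"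
        unfolding A_def by (subst nn_integral_sum) auto
      also have "\<dots> \<le> (\<integral>\<^sup>+x. ennreal (norm (V x) powr p) * ennreal (1 / l k ^ CARD('n) * m k) \<partial>lborel)"
      proof (rule nn_integral_mono)
        fix x
        have "(\<Sum>j<N. ennreal (norm (V x) powr p) * ennreal ((norm (blk s k (g j) x))\<^sup>2))
           = ennreal (norm (V x) powr p) * ennreal (\<Sum>j<N. (norm (blk s k (g j) x))\<^sup>2)"
          by (simp add: sum_distrib_left[symmetric])
        also have "\<dots> \<le> ennreal (norm (V x) powr p) * ennreal (1 / l k ^ CARD('n) * m k)"
          unfolding l_def m_def using b by (intro mult_left_mono ennreal_leI synthesis_pointwise[OF s g _ syn H]) auto
        finally show "(\<Sum>j<N. ennreal (norm (V x) powr p) * ennreal ((norm (blk s k (g j) x))\<^sup>2)) \<le> ennreal (norm (V x) powr p) * ennreal (1 / l k ^ CARD('n) * m k)" .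
      qed
      also have "\<dots> = ennreal (\<integral>x. norm (V x) powr p \<partial>lborel) * ennreal (1 / l k ^ CARD('n) * m k)"
        using I by (simp add: nn_integral_multc nn_integral_eq_integral)
      finally have SA: "(\<Sum>j<N. A k j) \<le> ennreal (\<integral>x. norm (V x) powr p \<partial>lborel) * ennreal (1 / l k ^ CARD('n) * m k)" .
      have "(\<Sum>j<N. ennreal (w k powr (1 - 2 * p) * m k powr (p - 1)) * A k j) = ennreal (w k powr (1 - 2 * p) * m k powr (p - 1)) * (\<Sum>j<N. A k j)"
        by (simp add: sum_distrib_left)
      also have "\<dots> \<le> ennreal (w k powr (1 - 2 * p) * m k powr (p - 1)) * (ennreal (\<integral>x. norm (V x) powr p \<partial>lborel) * ennreal (1 / l k ^ CARD('n) * m k))"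
        by (intro mult_left_mono SA) auto
      also have "\<dots> = ennreal (w k powr (1 - 2 * p) * m k powr (p - 1) * ((\<integral>x. norm (V x) powr p \<partial>lborel) * (1 / l k ^ CARD('n) * m k)))"
        using l0[of k] m0[of k] by (simp add: ennreal_mult[symmetric] less_imp_le)
      also have "w k powr (1 - 2 * p) * m k powr (p - 1) * ((\<integral>x. norm (V x) powr p \<partial>lborel) * (1 / l k ^ CARD('n) * m k)) = D * w k"
      proof -
        have lk: "l k = s * 2 powr (- real k)" unfolding l_def scl_def by (simp add: powr_minus_divide powr_realpow)
        have "m k powr (p - 1) * m k = m k powr p" using m0[of k] by (simp add: powr_diff)
        also have "m k powr p = (16 * ?d) powr p * (l k)\<^sup>2 powr p * (b\<^sup>2) powr p"
          unfolding m_def using l0[of k] b by (simp add: powr_mult)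
        also have "(l k)\<^sup>2 powr p = l k powr (2 * p)" by (rule sq_powr[OF l0])
        also have "(b\<^sup>2) powr p = b powr (2 * p)" by (rule sq_powr[OF b])
        finally have mm: "m k powr (p - 1) * m k = (16 * ?d) powr p * l k powr (2 * p) * b powr (2 * p)" .
        have e1: "1 / l k ^ CARD('n) = l k powr (- ?d)" using l0[of k] by (simp add: powr_minus_divide powr_realpow)
        have e2: "l k powr (2 * p) * l k powr (- ?d) = l k powr (2 * p - ?d)" by (simp add: powr_add[symmetric])
        have e3: "l k powr (2 * p - ?d) = s powr (2 * p - ?d) * 2 powr (- real k * (2 * p - ?d))"
          unfolding lk using s by (simp add: powr_mult powr_powr)
        \<comment> \<open>Here the choice of \<sigma> pays off: the scale factor is
          \<open>w k powr (2 p)\<close>, which leaves exactly one power of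
          \<open>w k\<close>.\<close>
        have e4: "w k powr (1 - 2 * p) * 2 powr (- real k * (2 * p - ?d)) = w k"
        proof -
          have e: "2 * p - ?d = \<sigma> * (2 * p)" unfolding \<sigma>_def using p by simp
          have "w k powr (1 - 2 * p) * 2 powr (- real k * (2 * p - ?d)) = 2 powr ((- \<sigma> * real k) * (1 - 2 * p) + - real k * (\<sigma> * (2 * p)))"
            unfolding e w_def powr_powr powr_add ..
          also have "(- \<sigma> * real k) * (1 - 2 * p) + - real k * (\<sigma> * (2 * p)) = - \<sigma> * real k" by (simp add: algebra_simps)
          finally show ?thesis by (simp add: w_def)
        qed
        let ?I = "\<integral>x. norm (V x) powr p \<partial>lborel"
        have "w k powr (1 - 2 * p) * m k powr (p - 1) * (?I * (1 / l k ^ CARD('n) * m k))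
           = w k powr (1 - 2 * p) * (m k powr (p - 1) * m k) * (1 / l k ^ CARD('n)) * ?I" by (simp only: mult_ac)
        also have "\<dots> = w k powr (1 - 2 * p) * ((16 * ?d) powr p * b powr (2 * p)) * (l k powr (2 * p) * l k powr (- ?d)) * ?I"
          unfolding mm e1 by (simp only: mult_ac)
        also have "\<dots> = (w k powr (1 - 2 * p) * 2 powr (- real k * (2 * p - ?d))) * ((16 * ?d) powr p * b powr (2 * p)) * s powr (2 * p - ?d) * ?I"
          unfolding e2 e3 by (simp only: mult_ac)
        also have "\<dots> = D * w k" unfolding e4 D_def by (simp only: mult_ac)
        finally show ?thesis .
      qed
      finally show "(\<Sum>j<N. ennreal (w k powr (1 - 2 * p) * m k powr (p - 1)) * A k j) \<le> ennreal (D * w k)" .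
    qed
    also have "\<dots> = ennreal (D * W)"
      using sums_mult[OF gp(2), of D] D0 w0 by (intro suminf_ennreal_eq) (auto simp: less_imp_le)
    finally show ?thesis .
  qed
  have Zfin: "Z j < \<infinity>" if "j < N" for j
  proof -
    have "Z j \<le> (\<Sum>j<N. Z j)" using that by (intro member_le_sum) auto
    also have "\<dots> \<le> ennreal (D * W)" by (rule SZ)
    also have "\<dots> < \<infinity>" by simp
    finally show ?thesis .
  qed
  define z where "z j = enn2real (Z j)" for j
  have zZ: "Z j = ennreal (z j)" "z j \<ge> 0" if "j < N" for j using Zfin[OF that] by (auto simp: z_def)
  have C': "Vsq V (g j) \<le> ennreal (W * (\<theta> powr (1 - p) * z j + \<theta> * W))" if j: "j < N" "\<theta> > 0" for j \<theta>
  proof -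
    have "ennreal W * (ennreal (\<theta> powr (1 - p)) * Z j + ennreal (\<theta> * W)) = ennreal (W * (\<theta> powr (1 - p) * z j + \<theta> * W))"
      using zZ[OF j(1)] W0 j(2) by (simp add: ennreal_mult[symmetric] ennreal_plus[symmetric] del: ennreal_plus)
    thus ?thesis using C[OF j] by simp
  qed
  show fin: "Vsq V (g j) < \<infinity>" if "j < N" for j
    using C'[OF that, of 1] by (auto intro: le_less_trans)
  have each: "enn2real (Vsq V (g j)) powr p \<le> (W * (1 + W)) powr p * z j" if j: "j < N" for j
  proof (rule powr_le_of_linearized)
    fix \<theta> :: real assume t: "\<theta> > 0"
    have "0 \<le> W * (\<theta> powr (1 - p) * z j + \<theta> * W)" using zZ(2)[OF j] W0 t by simp
    thus "enn2real (Vsq V (g j)) \<le> W * (\<theta> powr (1 - p) * z j + \<theta> * W)"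
      using C'[OF j t] by (simp add: enn2real_leI)
  qed (use zZ(2)[OF j] W0 p in auto)
  have "(\<Sum>j<N. enn2real (Vsq V (g j)) powr p) \<le> (\<Sum>j<N. (W * (1 + W)) powr p * z j)" by (intro sum_mono each) auto
  also have "\<dots> = (W * (1 + W)) powr p * (\<Sum>j<N. z j)" by (simp add: sum_distrib_left)
  also have "\<dots> \<le> (W * (1 + W)) powr p * (D * W)"
  proof (intro mult_left_mono)
    have "ennreal (\<Sum>j<N. z j) = (\<Sum>j<N. Z j)" using zZ by (subst sum_ennreal[symmetric]) auto
    hence "ennreal (\<Sum>j<N. z j) \<le> ennreal (D * W)" using SZ by simp
    thus "(\<Sum>j<N. z j) \<le> D * W" using D0 W0 by (simp add: ennreal_le_iff)
  qed auto
  finally show "(\<Sum>j<N. enn2real (Vsq V (g j)) powr p) \<le> (W * (1 + W)) powr p * (D * W)" .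
qed

section \<open>Complex Hilbert spaces\<close>

text \<open>Built over the real structure so that completeness, fixed points and minimisation are
  available directly; the complex product is linear in its first argument and its real part is the
  given real one.\<close>

class chilbert = real_inner + banach +
  fixes cscale :: "complex \<Rightarrow> 'a \<Rightarrow> 'a" (infixr "*\<^sub>C" 75)
    and cinner :: "'a \<Rightarrow> 'a \<Rightarrow> complex"
  assumes cscale_add_right: "c *\<^sub>C (x + y) = c *\<^sub>C x + c *\<^sub>C y"
    and cscale_add_left: "(b + c) *\<^sub>C x = b *\<^sub>C x + c *\<^sub>C x"
    and cscale_cscale: "b *\<^sub>C c *\<^sub>C x = (b * c) *\<^sub>C x"
    and cscale_of_real: "of_real r *\<^sub>C x = r *\<^sub>R x"
    and cinner_add_left: "cinner (x + y) z = cinner x z + cinner y z"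
    and cinner_cscale_left: "cinner (c *\<^sub>C x) y = c * cinner x y"
    and cinner_commute: "cinner x y = cnj (cinner y x)"
    and Re_cinner: "Re (cinner x y) = inner x y"

lemma cscale_one: "1 *\<^sub>C x = (x::'a::chilbert)"
  using cscale_of_real[of 1 x] by simp

interpretation cvs: vector_space "cscale :: complex \<Rightarrow> 'a::chilbert \<Rightarrow> 'a"
  by unfold_locales (auto simp: cscale_add_right cscale_add_left cscale_cscale cscale_one)

lemma cinner_cscale_right: "cinner x (c *\<^sub>C y) = cnj c * cinner x (y::'a::chilbert)"
  by (metis cinner_cscale_left cinner_commute complex_cnj_mult)

lemma cinner_zero [simp]: "cinner 0 x = 0" "cinner (x::'a::chilbert) 0 = 0"
  using cinner_cscale_left[of 0 0 x] cinner_cscale_right[of x 0 0] by auto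

lemma cinner_minus_left: "cinner (- x) y = - cinner (x::'a::chilbert) y"
  using cinner_add_left[of x "- x" y] by (simp add: eq_neg_iff_add_eq_0 add.commute)

lemma cinner_diff_left: "cinner (x - y) z = cinner x z - cinner y (z::'a::chilbert)"
  using cinner_add_left[of x "- y" z] by (simp add: cinner_minus_left)

lemma cinner_sum_left: "cinner (\<Sum>i\<in>I. f i) (y::'a::chilbert) = (\<Sum>i\<in>I. cinner (f i) y)"
  by (induction I rule: infinite_finite_induct) (auto simp: cinner_add_left)

lemma cinner_self: "cinner x x = of_real ((norm (x::'a::chilbert))\<^sup>2)"
proof (rule complex_eqI)
  show "Re (cinner x x) = Re (of_real ((norm x)\<^sup>2))" by (simp add: Re_cinner power2_norm_eq_inner)
  have "Im (cinner x x) = - Im (cinner x x)" by (metis cinner_commute cnj.simps(2))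
  thus "Im (cinner x x) = Im (of_real ((norm x)\<^sup>2))" by simp
qed

lemma norm_cscale [simp]: "norm (c *\<^sub>C x) = norm c * norm (x::'a::chilbert)"
proof -
  have "of_real ((norm (c *\<^sub>C x))\<^sup>2) = c * cnj c * of_real ((norm x)\<^sup>2)"
    unfolding cinner_self[symmetric] by (simp add: cinner_cscale_left cinner_cscale_right)
  also have "\<dots> = of_real ((norm c * norm x)\<^sup>2)" by (simp add: complex_norm_square[symmetric] power_mult_distrib)
  finally have "(norm (c *\<^sub>C x))\<^sup>2 = (norm c * norm x)\<^sup>2" by (simp only: of_real_eq_iff)
  thus ?thesis by (simp add: power2_eq_iff_nonneg)
qed

lemma norm_cinner_le: "norm (cinner x y) \<le> norm x * norm (y::'a::chilbert)"
proof (cases "cinner x y = 0")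
  case False
  define c where "c = cnj (cinner x y) / norm (cinner x y)"
  have nc: "norm c = 1" using False by (simp add: c_def norm_divide)
  have "cinner (c *\<^sub>C x) y = of_real (norm (cinner x y))"
    using False unfolding c_def cinner_cscale_left
    by (simp add: field_simps complex_norm_square[symmetric] power2_eq_square flip: of_real_mult)
  hence "norm (cinner x y) = inner (c *\<^sub>C x) y" by (metis Re_cinner Re_complex_of_real)
  also have "\<dots> \<le> norm (c *\<^sub>C x) * norm y" by (rule norm_cauchy_schwarz)
  finally show ?thesis by (simp add: nc)
qed simp

lemma cinner_eqI: "(\<And>z. cinner x z = cinner y z) \<Longrightarrow> x = (y::'a::chilbert)"
  using cinner_self[of "x - y"] by (simp add: cinner_diff_left)

definition bclinear :: "('a::chilbert \<Rightarrow> 'a) \<Rightarrow> bool" where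
  "bclinear T \<longleftrightarrow> bounded_linear T \<and> (\<forall>c x. T (c *\<^sub>C x) = c *\<^sub>C T x)"

lemma bclinearI:
  assumes "\<And>x y. T (x + y) = T x + T y" "\<And>c x. T (c *\<^sub>C x) = c *\<^sub>C T x" "\<And>x. norm (T x) \<le> norm x * B"
  shows "bclinear T"
  unfolding bclinear_def
proof (intro conjI allI)
  show "bounded_linear T"
    by (rule bounded_linear_intro[of T B]) (use assms in \<open>auto simp: cscale_of_real[symmetric]\<close>)
qed (rule assms)

lemma bclinearD:
  assumes "bclinear T"
  shows "T (x + y) = T x + T y" "T (c *\<^sub>C x) = c *\<^sub>C T x" "T (x - y) = T x - T y" "T 0 = 0" "T (- x) = - T x" "bounded_linear T"
  using assms unfolding bclinear_def by (auto simp: bounded_linear.linear linear_add linear_diff linear_0 linear_neg)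

lemma bclinear_module_hom: "bclinear T \<Longrightarrow> module_hom cscale cscale T"
  by (unfold_locales) (auto simp: bclinear_def bounded_linear.linear linear_add cscale_add_right cscale_add_left cscale_cscale cscale_one)

lemma bclinear_id: "bclinear (\<lambda>x. x)" by (auto simp: bclinear_def)

lemma bounded_linear_cscale: "bounded_linear (\<lambda>x::'a::chilbert. c *\<^sub>C x)"
  by (rule bounded_linear_intro[of _ "norm c"])
     (auto simp: cscale_add_right cscale_of_real[symmetric] cscale_cscale mult.commute)

lemma bclinear_cscale: "bclinear T \<Longrightarrow> bclinear (\<lambda>x. c *\<^sub>C T x)"
  unfolding bclinear_def using bounded_linear_compose[OF bounded_linear_cscale[of c], of T]
  by (auto simp: cscale_cscale mult.commute)

lemma bclinear_add: "bclinear S \<Longrightarrow> bclinear T \<Longrightarrow> bclinear (\<lambda>x. S x + T x)"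
  unfolding bclinear_def by (auto intro: bounded_linear_add simp: cscale_add_right)

lemma bclinear_diff: "bclinear S \<Longrightarrow> bclinear T \<Longrightarrow> bclinear (\<lambda>x. S x - T x)"
  unfolding bclinear_def by (auto intro: bounded_linear_sub simp: cvs.scale_right_diff_distrib)

lemma bclinear_compose: "bclinear S \<Longrightarrow> bclinear T \<Longrightarrow> bclinear (\<lambda>x. S (T x))"
  unfolding bclinear_def by (auto intro: bounded_linear_compose)

lemma bclinear_sum: "(\<And>i. i \<in> I \<Longrightarrow> bclinear (T i)) \<Longrightarrow> bclinear (\<lambda>x. \<Sum>i\<in>I. T i x)"
proof (induction I rule: infinite_finite_induct)
  case (insert i I) thus ?case by (simp add: bclinear_add)
qed (auto simp: bclinear_def)

lemma bclinear_rank1: "bclinear (\<lambda>x. cinner x e *\<^sub>C f)"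
  by (rule bclinearI[where B="norm e * norm f"])
     (auto simp: cinner_add_left cscale_add_left cinner_cscale_left cscale_cscale mult.assoc[symmetric] intro!: mult_right_mono norm_cinner_le)

lemma bounded_linear_cinner: "bounded_linear (\<lambda>x. cinner x (y::'a::chilbert))"
  by (rule bounded_linear_intro[of _ "norm y"])
     (auto simp: cinner_add_left cscale_of_real[symmetric] cinner_cscale_left scaleR_conv_of_real norm_cinner_le)

section \<open>Riesz representation and Lax--Milgram\<close>

text \<open>For small \<open>t\<close> of sign opposite to \<open>B\<close> the linear term
  dominates; \<open>- B / (|A| + 1)\<close> is small enough.\<close>

lemma nonneg_quadratic_linear_zero:
  assumes "\<And>t::real. t\<^sup>2 * A + 2 * t * B \<ge> 0" shows "B = 0"
proof (rule ccontr)
  assume B: "B \<noteq> 0"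
  have id: "(- B / k)\<^sup>2 * A + 2 * (- B / k) * B = B\<^sup>2 / k * (A / k - 2)" if "k > 0" for k
    using that by (simp add: power2_eq_square field_simps)
  have "(- B / (\<bar>A\<bar> + 1))\<^sup>2 * A + 2 * (- B / (\<bar>A\<bar> + 1)) * B = B\<^sup>2 / (\<bar>A\<bar> + 1) * (A / (\<bar>A\<bar> + 1) - 2)"
    by (rule id) simp
  moreover have "A / (\<bar>A\<bar> + 1) \<le> 1" by (subst divide_le_eq_1_pos) linarith+
  moreover have "B\<^sup>2 / (\<bar>A\<bar> + 1) > 0" using B by simp
  ultimately have "(- B / (\<bar>A\<bar> + 1))\<^sup>2 * A + 2 * (- B / (\<bar>A\<bar> + 1)) * B < 0"
    using mult_pos_neg[of "B\<^sup>2 / (\<bar>A\<bar> + 1)" "A / (\<bar>A\<bar> + 1) - 2"] by linarith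
  thus False using assms[of "- B / (\<bar>A\<bar> + 1)"] by linarith
qed

text \<open>The representing vector minimises \<open>\<parallel>x\<parallel>\<^sup>2 - 2 f(x)\<close>.\<close>
lemma riesz_representation:
  fixes f :: "'a::{real_inner,banach} \<Rightarrow> real"
  assumes f: "bounded_linear f"
  shows "\<exists>y. \<forall>x. f x = inner y x"
proof -
  interpret f: bounded_linear f by fact
  obtain M where M: "\<And>x. norm (f x) \<le> norm x * M" using f.bounded by blast
  define \<phi> where "\<phi> x = (norm x)\<^sup>2 - 2 * f x" for x
  have lb: "\<phi> x \<ge> - (M\<^sup>2)" for x
  proof -
    have "f x \<le> norm x * M" using M[of x] by simp
    hence "\<phi> x \<ge> (norm x)\<^sup>2 - 2 * (norm x * M)" by (simp add: \<phi>_def)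
    moreover have "(norm x)\<^sup>2 - 2 * (norm x * M) + M\<^sup>2 = (norm x - M)\<^sup>2" by (simp add: power2_diff)
    ultimately show ?thesis using zero_le_power2[of "norm x - M"] by linarith
  qed
  define m where "m = Inf (range \<phi>)"
  have bdd: "bdd_below (range \<phi>)" using lb by (intro bdd_belowI[of _ "- (M\<^sup>2)"]) auto
  have m: "m \<le> \<phi> x" for x unfolding m_def by (intro cInf_lower bdd) auto
  have "\<exists>x. \<phi> x < m + 1 / real (Suc n)" for n
    using cInf_lessD[of "range \<phi>" "m + 1 / real (Suc n)"] by (auto simp: m_def)
  then obtain x where x: "\<And>n. \<phi> (x n) < m + 1 / real (Suc n)" by metis
  \<comment> \<open>The parallelogram law: the linear part of \<phi> cancels, so minimising
    sequences are Cauchy.\<close>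
  have par: "(norm (u - v))\<^sup>2 = 2 * \<phi> u + 2 * \<phi> v - 4 * \<phi> ((1/2) *\<^sub>R (u + v))" for u v
    unfolding \<phi>_def f.scaleR f.add
    unfolding power2_norm_eq_inner by (simp add: inner_simps inner_commute) (simp add: field_simps inner_commute)
  have cau: "(norm (x n - x k))\<^sup>2 \<le> 2 / real (Suc n) + 2 / real (Suc k)" for n k
    using x[of n] x[of k] m[of "(1/2) *\<^sub>R (x n + x k)"] par[of "x n" "x k"] by simp
  have "Cauchy x"
  proof (rule CauchyI)
    fix e :: real assume e: "e > 0"
    obtain N where N: "real N > 4 / e\<^sup>2" using reals_Archimedean2 by blast
    have "norm (x n - x k) < e" if "n \<ge> N" "k \<ge> N" for n k
    proof -
      have a: "2 / real (Suc j) < e\<^sup>2 / 2" if "j \<ge> N" for j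
      proof -
        have "real (Suc j) > 4 / e\<^sup>2" using N that by simp
        thus ?thesis using e by (simp add: field_simps)
      qed
      have "(norm (x n - x k))\<^sup>2 < e\<^sup>2" using cau[of n k] a[of n] a[of k] that by linarith
      thus ?thesis using e by (simp add: power_less_imp_less_base)
    qed
    thus "\<exists>M. \<forall>m\<ge>M. \<forall>n\<ge>M. norm (x m - x n) < e" by blast
  qed
  then obtain y where y: "x \<longlonglongrightarrow> y" using Cauchy_convergent convergent_def by blast
  have "(\<lambda>n. \<phi> (x n)) \<longlonglongrightarrow> \<phi> y" unfolding \<phi>_def by (intro tendsto_intros y f.tendsto)
  moreover have "(\<lambda>n. m + 1 / real (Suc n)) \<longlonglongrightarrow> m + 0" by (intro tendsto_intros LIMSEQ_Suc[OF lim_const_over_n])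
  ultimately have ym: "\<phi> y \<le> m" using x by (intro LIMSEQ_le[of "\<lambda>n. \<phi> (x n)" _ "\<lambda>n. m + 1 / real (Suc n)"]) (auto intro: less_imp_le)
  have "f u = inner y u" for u
  proof -
    have "inner y u - f u = 0"
    proof (rule nonneg_quadratic_linear_zero)
      fix t :: real
      have "\<phi> (y + t *\<^sub>R u) = \<phi> y + (t\<^sup>2 * (norm u)\<^sup>2 + 2 * t * (inner y u - f u))"
        unfolding \<phi>_def f.add f.scaleR
        by (simp add: power2_norm_eq_inner inner_simps inner_commute) (simp add: algebra_simps power2_eq_square)
      thus "t\<^sup>2 * (norm u)\<^sup>2 + 2 * t * (inner y u - f u) \<ge> 0" using ym m[of "y + t *\<^sub>R u"] by linarith
    qed
    thus ?thesis by simp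
  qed
  thus ?thesis by blast
qed

text \<open>The real part of \<open>g\<close> is represented over the reals; testing with
  \<open>\<i> *\<^sub>C x\<close> recovers the imaginary part.\<close>

lemma criesz_representation:
  fixes g :: "'a::chilbert \<Rightarrow> complex"
  assumes add: "\<And>x y. g (x + y) = g x + g y" and sc: "\<And>c x. g (c *\<^sub>C x) = cnj c * g x" and bd: "\<And>x. norm (g x) \<le> M * norm x"
  shows "\<exists>y. \<forall>x. cinner y x = g x"
proof -
  have "bounded_linear (\<lambda>x. Re (g x))"
  proof (rule bounded_linear_intro[of _ M])
    fix r x show "Re (g (r *\<^sub>R x)) = r *\<^sub>R Re (g x)" unfolding cscale_of_real[symmetric] sc by simp
  next
    fix x show "norm (Re (g x)) \<le> norm x * M"
      using order_trans[OF abs_Re_le_cmod[of "g x"] bd[of x]] by (simp add: mult.commute)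
  qed (simp add: add)
  then obtain y where y: "\<And>x. Re (g x) = inner y x" using riesz_representation by blast
  have "cinner y x = g x" for x
  proof (rule complex_eqI)
    show "Re (cinner y x) = Re (g x)" by (simp add: Re_cinner y)
    have "Re (cinner y (\<i> *\<^sub>C x)) = Re (g (\<i> *\<^sub>C x))" by (simp add: Re_cinner y)
    thus "Im (cinner y x) = Im (g x)" by (simp add: cinner_cscale_right sc)
  qed
  thus ?thesis by blast
qed

lemma form_operator:
  fixes b :: "'a::chilbert \<Rightarrow> 'a \<Rightarrow> complex"
  assumes al: "\<And>x y z. b (x + y) z = b x z + b y z" and ar: "\<And>x y z. b x (y + z) = b x y + b x z"
    and sl: "\<And>c x y. b (c *\<^sub>C x) y = c * b x y" and sr: "\<And>c x y. b x (c *\<^sub>C y) = cnj c * b x y"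
    and bd: "\<And>x y. norm (b x y) \<le> M * norm x * norm y"
  shows "\<exists>T. bclinear T \<and> (\<forall>x y. cinner (T x) y = b x y)"
proof -
  have "\<forall>x. \<exists>y. \<forall>z. cinner y z = b x z"
    by (intro allI criesz_representation) (auto simp: ar sr intro: bd)
  then obtain T where T: "\<And>x z. cinner (T x) z = b x z" by metis
  have "bclinear T"
  proof (rule bclinearI[where B="M"])
    fix x y show "T (x + y) = T x + T y" by (rule cinner_eqI) (simp add: T cinner_add_left al)
  next
    fix c x show "T (c *\<^sub>C x) = c *\<^sub>C T x" by (rule cinner_eqI) (simp add: T cinner_cscale_left sl)
  next
    fix x
    have "(norm (T x))\<^sup>2 = norm (b x (T x))" using T[of x "T x"] by (metis cinner_self norm_of_real abs_of_nonneg zero_le_power2)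
    also have "\<dots> \<le> M * norm x * norm (T x)" by (rule bd)
    finally have le: "norm (T x) * norm (T x) \<le> (M * norm x) * norm (T x)" by (simp add: power2_eq_square)
    show "norm (T x) \<le> norm x * M"
    proof (cases "T x = 0")
      case True
      have "0 \<le> (M * norm x) * norm x" using order_trans[OF norm_ge_zero bd[of x x]] .
      hence "0 \<le> M * norm x" by (cases "x = 0") (auto simp: zero_le_mult_iff)
      thus ?thesis using True by (simp add: mult.commute)
    next
      case False
      thus ?thesis using mult_right_le_imp_le[OF le] by (simp add: mult.commute)
    qed
  qed
  thus ?thesis using T by blast
qed

lemma lax_milgram:
  fixes T :: "'a::{real_inner,banach} \<Rightarrow> 'a"
  assumes T: "bounded_linear T" and c: "c > 0" and co: "\<And>u. inner (T u) u \<ge> c * (norm u)\<^sup>2"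
  shows "bij T"
proof -
  interpret T: bounded_linear T by fact
  obtain M where M: "M > 0" "\<And>x. norm (T x) \<le> norm x * M" using T.pos_bounded by blast
  \<comment> \<open>Minimises \<open>1 - 2 \<rho> c + \<rho>^2 M^2\<close>, the bound for the square
    of the contraction factor of the map sending \<open>u\<close> to
    \<open>u - \<rho> (T u - f)\<close>.\<close>
  define \<rho> where "\<rho> = c / M\<^sup>2"
  have r: "\<rho> > 0" using c M by (simp add: \<rho>_def)
  have step: "(norm (u - \<rho> *\<^sub>R T u))\<^sup>2 \<le> (1 - c\<^sup>2 / M\<^sup>2) * (norm u)\<^sup>2" for u
  proof -
    have "(norm (u - \<rho> *\<^sub>R T u))\<^sup>2 = (norm u)\<^sup>2 - 2 * \<rho> * inner (T u) u + \<rho>\<^sup>2 * (norm (T u))\<^sup>2"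
      unfolding power2_norm_eq_inner by (simp add: inner_simps inner_commute power2_eq_square algebra_simps)
    also have "\<dots> \<le> (norm u)\<^sup>2 - 2 * \<rho> * (c * (norm u)\<^sup>2) + \<rho>\<^sup>2 * (norm u * M)\<^sup>2"
      using r by (intro add_mono diff_mono mult_left_mono power_mono M co) auto
    also have "\<dots> = (1 - c\<^sup>2 / M\<^sup>2) * (norm u)\<^sup>2"
      using M(1) unfolding \<rho>_def by (simp add: field_simps power2_eq_square)
    finally show ?thesis .
  qed
  \<comment> \<open>The maximum with 0 covers the trivial space, the only one in which
    \<open>M\<close> may lie below \<open>c\<close>.\<close>
  define q where "q = sqrt (max 0 (1 - c\<^sup>2 / M\<^sup>2))"
  have q: "0 \<le> q" "q < 1" using c M by (auto simp: q_def real_sqrt_lt_1_iff)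
  have step': "norm (u - \<rho> *\<^sub>R T u) \<le> q * norm u" for u
  proof -
    have "(norm (u - \<rho> *\<^sub>R T u))\<^sup>2 \<le> max 0 (1 - c\<^sup>2 / M\<^sup>2) * (norm u)\<^sup>2"
      using step[of u] by (rule order_trans) (intro mult_right_mono, auto)
    hence "(norm (u - \<rho> *\<^sub>R T u))\<^sup>2 \<le> (q * norm u)\<^sup>2" by (simp add: q_def power_mult_distrib)
    thus ?thesis using q by (simp add: power2_le_iff_abs_le)
  qed
  have ex1: "\<exists>!u. u - \<rho> *\<^sub>R T u + \<rho> *\<^sub>R f = u" for f
  proof (rule banach_fix_type[OF q], intro allI)
    fix x y
    show "dist (x - \<rho> *\<^sub>R T x + \<rho> *\<^sub>R f) (y - \<rho> *\<^sub>R T y + \<rho> *\<^sub>R f) \<le> q * dist x y"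
      using step'[of "x - y"] by (simp add: dist_norm T.diff algebra_simps)
  qed
  have eq: "u - \<rho> *\<^sub>R T u + \<rho> *\<^sub>R f = u \<longleftrightarrow> T u = f" for u f
  proof -
    have "u - \<rho> *\<^sub>R T u + \<rho> *\<^sub>R f = u \<longleftrightarrow> \<rho> *\<^sub>R f = \<rho> *\<^sub>R T u" by (auto simp: algebra_simps)
    thus ?thesis using r by auto
  qed
  show ?thesis unfolding bij_iff using ex1[unfolded eq] by auto
qed

section \<open>Open mapping\<close>

text \<open>The bounded inverse theorem. By Baire's theorem the closure of the image of some ball
  contains a ball, so every \<open>z\<close> can be solved up to half its norm with controlled cost;
  iterating on the remainder solves it exactly by a geometric series, and injectivity identifies the
  solution.\<close>

lemma bij_bounded_below:
  fixes T :: "'a::banach \<Rightarrow> 'b::banach"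
  assumes T: "bounded_linear T" and b: "bij T"
  shows "\<exists>c>0. \<forall>u. c * norm u \<le> norm (T u)"
proof -
  interpret T: bounded_linear T by fact
  define A where "A n = closure (T ` cball 0 (real n))" for n :: nat
  have "\<exists>n. interior (A n) \<noteq> {}"
  proof (rule ccontr)
    assume "\<not> ?thesis"
    hence "Met_TC.mtopology interior_of \<Union>(range A) = {}"
      by (intro Met_TC.metric_Baire_category_alt)
         (auto simp: A_def complete_UNIV simp flip: closed_closedin)
    moreover have "\<Union>(range A) = UNIV"
    proof -
      have "z \<in> \<Union>(range A)" for z
      proof -
        obtain u where u: "z = T u" using b by (metis bij_pointE)
        obtain n where "norm u \<le> real n" using real_arch_simple by blast
        hence "z \<in> A n" using u closure_subset[of "T ` cball 0 (real n)"] by (auto simp: A_def)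
        thus ?thesis by blast
      qed
      thus ?thesis by blast
    qed
    ultimately show False by simp
  qed
  then obtain n y where "y \<in> interior (A n)" by blast
  then obtain r where r: "r > 0" "ball y r \<subseteq> A n" by (meson mem_interior)
  \<comment> \<open>Subtracting approximate preimages of \<open>y + z\<close> and \<open>y\<close>
    moves the ball to the origin and doubles the radius of the preimages.\<close>
  have cl: "\<exists>u. norm u \<le> 2 * real n \<and> norm (z - T u) < e" if z: "norm z < r" and e: "e > 0" for z e
  proof -
    have "y + z \<in> A n" "y \<in> A n" using r z by (auto simp: dist_norm)
    moreover have "\<exists>p. norm p \<le> real n \<and> dist (T p) v < e / 2" if "v \<in> A n" for v
    proof -
      have "\<exists>w\<in>T ` cball 0 (real n). dist w v < e / 2" using that half_gt_zero[OF e] unfolding A_def closure_approachable by blast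
      thus ?thesis by auto
    qed
    ultimately obtain p q where p: "norm p \<le> real n" "dist (T p) (y + z) < e / 2" and q: "norm q \<le> real n" "dist (T q) y < e / 2"
      by blast
    have "norm (z - T (p - q)) = norm ((y + z - T p) - (y - T q))" by (simp add: T.diff algebra_simps)
    also have "\<dots> \<le> norm (y + z - T p) + norm (y - T q)" by (rule norm_triangle_ineq4)
    also have "\<dots> < e" using p(2) q(2) by (simp add: dist_norm norm_minus_commute)
    finally show ?thesis using p(1) q(1) norm_triangle_ineq4[of p q] by (intro exI[of _ "p - q"]) auto
  qed
  define K where "K = 4 * real n / r"
  have K0: "K \<ge> 0" using r by (simp add: K_def)
  have half: "\<exists>u. norm u \<le> K * norm z \<and> norm (z - T u) \<le> norm z / 2" for z
  proof (cases "z = 0")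
    case False
    define t where "t = r / (2 * norm z)"
    have t: "t > 0" using False r by (simp add: t_def)
    have "norm (t *\<^sub>R z) < r" using False r by (simp add: t_def)
    then obtain u where u: "norm u \<le> 2 * real n" "norm (t *\<^sub>R z - T u) < t * (norm z / 2)"
      using cl[of "t *\<^sub>R z" "t * (norm z / 2)"] t False by auto
    have "norm ((1/t) *\<^sub>R u) \<le> K * norm z" using u(1) t r False by (simp add: K_def t_def field_simps)
    moreover have "norm (z - T ((1/t) *\<^sub>R u)) \<le> norm z / 2"
    proof -
      have "z - T ((1/t) *\<^sub>R u) = (1/t) *\<^sub>R (t *\<^sub>R z - T u)" using t by (simp add: T.scaleR scaleR_diff_right)
      hence "norm (z - T ((1/t) *\<^sub>R u)) = norm (t *\<^sub>R z - T u) / t" using t by simp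
      also have "\<dots> \<le> norm z / 2" using u(2) t by (simp add: field_simps)
      finally show ?thesis .
    qed
    ultimately show ?thesis by blast
  qed (auto intro!: exI[of _ 0] simp: T.zero)
  then obtain h where h: "\<And>z. norm (h z) \<le> K * norm z" "\<And>z. norm (z - T (h z)) \<le> norm z / 2" by metis
  have bound: "norm u \<le> 2 * K * norm (T u)" for u
  proof -
    define z where "z = rec_nat (T u) (\<lambda>_ z. z - T (h z))"
    have z0: "z 0 = T u" and zS: "z (Suc k) = z k - T (h (z k))" for k by (simp_all add: z_def)
    have zn: "norm (z k) \<le> norm (T u) * (1/2) ^ k" for k
    proof (induction k)
      case (Suc k) thus ?case using h(2)[of "z k"] by (simp add: zS)
    qed (simp add: z0)
    have hn: "norm (h (z k)) \<le> K * norm (T u) * (1/2) ^ k" for k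
      using order_trans[OF h(1) mult_left_mono[OF zn K0]] by (simp add: mult.assoc)
    have sg: "summable (\<lambda>k. K * norm (T u) * (1/2) ^ k)" by (intro summable_mult) (simp add: summable_geometric)
    have sn: "summable (\<lambda>k. norm (h (z k)))" by (rule summable_comparison_test'[OF sg]) (use hn in auto)
    hence s: "summable (\<lambda>k. h (z k))" by (rule summable_norm_cancel)
    have "(\<lambda>k. z k - z (Suc k)) sums (z 0 - 0)"
    proof (rule telescope_sums')
      have "(\<lambda>k. norm (T u) * (1/2) ^ k) \<longlonglongrightarrow> norm (T u) * 0" by (intro tendsto_intros LIMSEQ_realpow_zero) auto
      thus "z \<longlonglongrightarrow> 0" using zn by (intro Lim_null_comparison[of z "\<lambda>k. norm (T u) * (1/2) ^ k"]) auto
    qed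
    hence "(\<lambda>k. T (h (z k))) sums T u" by (simp add: zS z0)
    moreover have "(\<lambda>k. T (h (z k))) sums T (\<Sum>k. h (z k))" by (intro T.sums summable_sums s)
    ultimately have "u = (\<Sum>k. h (z k))" using b by (metis bij_def inj_eq sums_unique2)
    hence "norm u \<le> (\<Sum>k. norm (h (z k)))" using summable_norm[OF sn] by simp
    also have "\<dots> \<le> (\<Sum>k. K * norm (T u) * (1/2) ^ k)" by (intro suminf_le hn sn sg)
    also have "\<dots> = K * norm (T u) * 2" by (subst suminf_mult) (auto simp: suminf_geometric summable_geometric)
    finally show ?thesis by (simp add: mult_ac)
  qed
  have "1 / (2 * K + 1) * norm u \<le> norm (T u)" for u
  proof -
    have "norm u \<le> (2 * K + 1) * norm (T u)" using bound[of u] norm_ge_zero[of "T u"] unfolding distrib_right by linarith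
    thus ?thesis using K0 by (simp add: field_simps)
  qed
  thus ?thesis using K0 by (intro exI[of _ "1 / (2 * K + 1)"]) auto
qed

section \<open>Fredholm alternative and holomorphic inverses\<close>

abbreviation cspan :: "'a::chilbert set \<Rightarrow> 'a set" where "cspan \<equiv> cvs.span"

text \<open>An injective map sends a basis to equally many independent vectors; a vector outside
  their span would be one too many.\<close>

lemma cspan_finite_inj_surj:
  fixes f :: "'a::chilbert \<Rightarrow> 'a"
  assumes f: "module_hom cscale cscale f" and B: "finite B" and im: "\<And>x. x \<in> cspan B \<Longrightarrow> f x \<in> cspan B"
    and inj: "\<And>x. x \<in> cspan B \<Longrightarrow> f x = 0 \<Longrightarrow> x = 0" and y: "y \<in> cspan B"
  shows "\<exists>x\<in>cspan B. f x = y"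
proof -
  interpret f: module_hom cscale cscale f by fact
  obtain C where C: "C \<subseteq> B" "\<not> cvs.dependent C" "B \<subseteq> cspan C" using cvs.maximal_independent_subset by blast
  have sp: "cspan C = cspan B"
    using C by (metis cvs.span_mono cvs.span_minimal cvs.subspace_span subset_antisym)
  have fC: "finite C" using C(1) B finite_subset by blast
  have injo: "inj_on f (cspan C)"
  proof (rule inj_onI)
    fix u v assume "u \<in> cspan C" "v \<in> cspan C" "f u = f v"
    hence "u - v \<in> cspan B" "f (u - v) = 0" by (auto simp: sp cvs.span_diff f.diff)
    thus "u = v" using inj[of "u - v"] by simp
  qed
  have ind: "\<not> cvs.dependent (f ` C)" using f.dependent_inj_imageD[OF _ injo] C(2) by blast
  have sub: "f ` C \<subseteq> cspan C" using im sp cvs.span_base C(1) by blast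
  have "y \<in> cspan (f ` C)"
  proof (rule ccontr)
    assume ny: "y \<notin> cspan (f ` C)"
    have i: "\<not> cvs.dependent (insert y (f ` C))" by (rule cvs.independent_insertI[OF ny ind])
    have "insert y (f ` C) \<subseteq> cspan C" using sub y sp by auto
    from cvs.independent_span_bound[OF fC i this] have "card (insert y (f ` C)) \<le> card C" by (rule conjunct2)
    moreover have "y \<notin> f ` C" using ny by (metis cvs.span_base)
    moreover have "card (f ` C) = card C" by (rule card_image[OF inj_on_subset[OF injo cvs.span_superset]])
    ultimately show False using fC by simp
  qed
  hence "y \<in> f ` cspan C" by (simp add: f.span_image)
  thus ?thesis using sp by auto
qed

lemma bclinear_inv:
  assumes T: "bclinear T" "bij T" shows "bclinear (inv T)"
proof -
  obtain c where c: "c > 0" "\<And>u. c * norm u \<le> norm (T u)" using bij_bounded_below[OF bclinearD(6)[OF T(1)] T(2)] by blast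
  have Ti: "T (inv T x) = x" for x using T(2) by (simp add: bij_is_surj surj_f_inv_f)
  have it: "inv T (T x) = x" for x using T(2) by (simp add: bij_is_inj inv_f_f)
  show ?thesis
  proof (rule bclinearI[where B="1/c"])
    fix x y show "inv T (x + y) = inv T x + inv T y" by (metis Ti it bclinearD(1)[OF T(1)])
  next
    fix k x show "inv T (k *\<^sub>C x) = k *\<^sub>C inv T x" by (metis Ti it bclinearD(2)[OF T(1)])
  next
    fix x show "norm (inv T x) \<le> norm x * (1 / c)" using c(2)[of "inv T x"] c(1) by (simp add: Ti field_simps)
  qed
qed

text \<open>Applying the inverse \<open>g\<close> of \<open>T\<close> leaves the identity plus
  \<open>g P\<close>, whose range lies in the finite-dimensional span of \<open>g F\<close>. The
  equation is thereby reduced to that span, where injectivity suffices.\<close>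

lemma fredholm_finite_rank:
  assumes T: "bclinear T" "bij T" and P: "bclinear P" and F: "finite F" "\<And>u. P u \<in> cspan F"
    and inj: "\<And>u. T u + P u = 0 \<Longrightarrow> u = 0"
  shows "bij (\<lambda>u. T u + P u)"
proof -
  define g where "g = inv T"
  have g: "bclinear g" unfolding g_def by (rule bclinear_inv[OF T])
  interpret gh: module_hom cscale cscale g by (rule bclinear_module_hom[OF g])
  have Tg: "T (g x) = x" for x unfolding g_def using T(2) by (simp add: bij_is_surj surj_f_inv_f)
  have gP: "g (P x) \<in> cspan (g ` F)" for x using F(2)[of x] by (auto simp: gh.span_image)
  define f where "f w = w + g (P w)" for w
  have f: "bclinear f" unfolding f_def by (intro bclinear_add bclinear_id bclinear_compose[OF g P])
  have "\<exists>x. T x + P x = k" for k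
  proof -
    have "\<exists>w\<in>cspan (g ` F). f w = - g (P (g k))"
    proof (rule cspan_finite_inj_surj[OF bclinear_module_hom[OF f]])
      show "finite (g ` F)" using F by simp
      show "f x \<in> cspan (g ` F)" if "x \<in> cspan (g ` F)" for x
        unfolding f_def using that gP by (rule cvs.span_add)
      show "x = 0" if "x \<in> cspan (g ` F)" "f x = 0" for x
      proof (rule inj)
        have "T (f x) = T x + P x" unfolding f_def by (simp add: bclinearD[OF T(1)] Tg)
        thus "T x + P x = 0" using that by (simp add: bclinearD[OF T(1)])
      qed
      show "- g (P (g k)) \<in> cspan (g ` F)" using gP by (rule cvs.span_neg)
    qed
    then obtain w where w: "f w = - g (P (g k))" by blast
    have "T w + P w = - P (g k)"
    proof -
      have "T (f w) = T w + P w" unfolding f_def by (simp add: bclinearD[OF T(1)] Tg)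
      thus ?thesis by (simp add: w bclinearD[OF T(1)] Tg)
    qed
    moreover have "T (g k + w) + P (g k + w) = k + (T w + P w) + P (g k)" by (simp add: bclinearD[OF T(1)] bclinearD[OF P] Tg add_ac)
    ultimately have "T (g k + w) + P (g k + w) = k" by simp
    thus ?thesis by blast
  qed
  moreover have "inj (\<lambda>u. T u + P u)"
  proof (rule injI)
    fix x y assume "T x + P x = T y + P y"
    moreover have "T (x - y) + P (x - y) = (T x + P x) - (T y + P y)" by (simp add: bclinearD[OF T(1)] bclinearD[OF P])
    ultimately have "T (x - y) + P (x - y) = 0" by simp
    thus "x = y" using inj[of "x - y"] by simp
  qed
  ultimately show ?thesis unfolding bij_def surj_def by metis
qed

text \<open>A Neumann argument: near \<open>z0\<close> the pencil stays bounded below and is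
  inverted by a contraction. The resolvent identity then gives Lipschitz continuity and, fed back
  into itself, the complex derivative of the scalar functions. A general \<open>A\<close> is allowed
  because a projection will be added to the identity.\<close>

lemma holomorphic_inverse:
  fixes A K :: "'a::chilbert \<Rightarrow> 'a"
  assumes A: "bclinear A" and K: "bclinear K" and b: "bij (\<lambda>u. A u - z0 *\<^sub>C K u)"
  shows "\<exists>e>0. (\<forall>z\<in>ball z0 e. bij (\<lambda>u. A u - z *\<^sub>C K u)) \<and>
     (\<forall>k. continuous_on (ball z0 e) (\<lambda>z. inv (\<lambda>u. A u - z *\<^sub>C K u) k)) \<and>
     (\<forall>k y. (\<lambda>z. cinner (inv (\<lambda>u. A u - z *\<^sub>C K u) k) y) holomorphic_on ball z0 e)"
proof -
  define T where "T z u = A u - z *\<^sub>C K u" for z u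
  have Tl: "bclinear (T z)" for z unfolding T_def by (intro bclinear_diff A bclinear_cscale K)
  obtain c where c: "c > 0" "\<And>u. c * norm u \<le> norm (T z0 u)"
    using bij_bounded_below[OF bclinearD(6)[OF Tl[of z0]]] b unfolding T_def by blast
  obtain M where M: "M > 0" "\<And>u. norm (K u) \<le> norm u * M"
    using bounded_linear.pos_bounded[OF bclinearD(6)[OF K]] by blast
  \<comment> \<open>Within this radius the perturbation costs at most half of the lower bound
    \<open>c\<close>.\<close>
  define e where "e = c / (2 * M)"
  have e: "e > 0" using c M by (simp add: e_def)
  have small: "norm ((z - z0) *\<^sub>C K u) \<le> c / 2 * norm u" if "z \<in> ball z0 e" for z u
  proof -
    have "norm (z - z0) \<le> c / (2 * M)" using that by (simp add: e_def dist_norm norm_minus_commute)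
    hence "norm (z - z0) * norm (K u) \<le> c / (2 * M) * (norm u * M)" using M c by (intro mult_mono M) auto
    thus ?thesis using M by simp
  qed
  have Tz: "T z u = T z0 u - (z - z0) *\<^sub>C K u" for z u unfolding T_def by (simp add: cvs.scale_left_diff_distrib)
  have low: "c / 2 * norm u \<le> norm (T z u)" if "z \<in> ball z0 e" for z u
    using c(2)[of u] small[OF that, of u] norm_triangle_ineq2[of "T z0 u" "(z - z0) *\<^sub>C K u"] unfolding Tz[of z u] by simp
  have b0: "bij (T z0)" using b by (simp add: T_def[abs_def])
  have bz: "bij (T z)" if z: "z \<in> ball z0 e" for z
  proof -
    have T0i: "T z0 (inv (T z0) x) = x" for x using b0 by (simp add: bij_is_surj surj_f_inv_f)
    have i0: "bclinear (inv (T z0))" by (rule bclinear_inv[OF Tl b0])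
    have "\<exists>u. T z u = k" for k
    proof -
      have "\<exists>!u. inv (T z0) (k + (z - z0) *\<^sub>C K u) = u"
      proof (rule banach_fix_type[of "1/2"], simp, simp, intro allI)
        fix x y
        have "c * norm (inv (T z0) (k + (z - z0) *\<^sub>C K x) - inv (T z0) (k + (z - z0) *\<^sub>C K y))
            = c * norm (inv (T z0) ((z - z0) *\<^sub>C K (x - y)))"
          by (simp add: bclinearD(3)[OF i0, symmetric] bclinearD(3)[OF K] cvs.scale_right_diff_distrib)
        also have "\<dots> \<le> norm ((z - z0) *\<^sub>C K (x - y))" using c(2)[of "inv (T z0) ((z - z0) *\<^sub>C K (x - y))"] by (simp only: T0i)
        also have "\<dots> \<le> c * (1 / 2 * norm (x - y))" using small[OF z, of "x - y"] by simp
        finally show "dist (inv (T z0) (k + (z - z0) *\<^sub>C K x)) (inv (T z0) (k + (z - z0) *\<^sub>C K y)) \<le> 1 / 2 * dist x y"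
          using c(1) by (simp add: dist_norm)
      qed
      then obtain u where "inv (T z0) (k + (z - z0) *\<^sub>C K u) = u" by blast
      hence "T z0 u = k + (z - z0) *\<^sub>C K u" by (metis T0i)
      thus ?thesis using Tz[of z u] by (intro exI[of _ u]) simp
    qed
    moreover have "inj (T z)"
    proof (rule injI)
      fix x y assume "T z x = T z y"
      hence "T z (x - y) = 0" by (simp add: bclinearD[OF Tl])
      hence "c / 2 * norm (x - y) \<le> 0" using low[OF z, of "x - y"] by simp
      thus "x = y" using c(1) by (simp add: mult_le_0_iff)
    qed
    ultimately show ?thesis unfolding bij_def surj_def by metis
  qed
  define S where "S z = inv (T z)" for z
  have TS: "T z (S z k) = k" if "z \<in> ball z0 e" for z k unfolding S_def using bz[OF that] by (simp add: bij_is_surj surj_f_inv_f)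
  have ST: "S z (T z k) = k" if "z \<in> ball z0 e" for z k unfolding S_def using bz[OF that] by (simp add: bij_is_inj inv_f_f)
  have Sn: "norm (S z k) \<le> 2 / c * norm k" if "z \<in> ball z0 e" for z k
    using low[OF that, of "S z k"] c(1) unfolding TS[OF that] by (simp add: field_simps)
  have res: "S z k - S w k = (z - w) *\<^sub>C S z (K (S w k))" if z: "z \<in> ball z0 e" and w: "w \<in> ball z0 e" for z w k
  proof -
    have Sl: "bclinear (S z)" unfolding S_def by (rule bclinear_inv[OF Tl bz[OF z]])
    have "T z (S w k) = T w (S w k) - (z - w) *\<^sub>C K (S w k)" unfolding T_def by (simp add: cvs.scale_left_diff_distrib)
    hence "k - T z (S w k) = (z - w) *\<^sub>C K (S w k)" using TS[OF w, of k] by simp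
    hence "S z (k - T z (S w k)) = S z ((z - w) *\<^sub>C K (S w k))" by simp
    thus ?thesis by (simp add: bclinearD[OF Sl] ST[OF z])
  qed
  have cont: "continuous_on (ball z0 e) (\<lambda>z. S z k)" for k
  proof -
    define L where "L = 2 / c * (2 / c * norm k * M)"
    have "L-lipschitz_on (ball z0 e) (\<lambda>z. S z k)"
    proof (rule lipschitz_onI)
      show "0 \<le> L" using c(1) M(1) by (simp add: L_def)
      fix z w assume z: "z \<in> ball z0 e" and w: "w \<in> ball z0 e"
      have "norm (S z k - S w k) \<le> norm (z - w) * (2 / c * (norm (S w k) * M))"
        unfolding res[OF z w] norm_cscale
        using order_trans[OF Sn[OF z] mult_left_mono[OF M(2)[of "S w k"], of "2 / c"]] c(1) by (intro mult_left_mono) auto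
      also have "\<dots> \<le> norm (z - w) * L" unfolding L_def using Sn[OF w, of k] c(1) M(1)
        by (intro mult_left_mono mult_right_mono) auto
      finally show "dist (S z k) (S w k) \<le> L * dist z w" by (simp add: dist_norm mult.commute)
    qed
    thus ?thesis by (rule lipschitz_on_continuous_on)
  qed
  have hol: "(\<lambda>z. cinner (S z k) y) holomorphic_on ball z0 e" for k y
  proof (rule holomorphic_onI)
    fix w assume w: "w \<in> ball z0 e"
    have "((\<lambda>z. cinner (S z (K (S w k))) y) \<longlongrightarrow> cinner (S w (K (S w k))) y) (at w within ball z0 e)"
      using cont[of "K (S w k)"] w by (intro bounded_linear.tendsto[OF bounded_linear_cinner]) (auto simp: continuous_on_def)
    moreover have "\<forall>\<^sub>F z in at w within ball z0 e. cinner (S z (K (S w k))) y = (cinner (S z k) y - cinner (S w k) y) / (z - w)"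
    proof -
      have "cinner (S z (K (S w k))) y = (cinner (S z k) y - cinner (S w k) y) / (z - w)" if "z \<in> ball z0 e" "z \<noteq> w" for z
        using that unfolding cinner_diff_left[symmetric] res[OF that(1) w] cinner_cscale_left by simp
      thus ?thesis by (auto simp: eventually_at intro!: exI[of _ 1])
    qed
    ultimately have "((\<lambda>z. (cinner (S z k) y - cinner (S w k) y) / (z - w)) \<longlongrightarrow> cinner (S w (K (S w k))) y) (at w within ball z0 e)"
      by (rule Lim_transform_eventually)
    thus "(\<lambda>z. cinner (S z k) y) field_differentiable at w within ball z0 e"
      unfolding field_differentiable_def has_field_derivative_iff by blast
  qed
  show ?thesis
    by (rule exI[of _ e]) (use e bz cont hol in \<open>simp add: S_def T_def[abs_def]\<close>)
qed

section \<open>Triangular flags\<close>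

text \<open>A triangular basis together with the diagonal entries of \<open>K\<close>, newest vector
  first: each vector is an eigenvector modulo the span of the tail. Generalised eigenvectors are
  captured without powers of \<open>K - l\<close>.\<close>

inductive flag :: "('a::chilbert \<Rightarrow> 'a) \<Rightarrow> ('a \<times> complex) list \<Rightarrow> bool" for K where
  Nil: "flag K []"
| Cons: "flag K fs \<Longrightarrow> K u - l *\<^sub>C u \<in> cspan (fst ` set fs) \<Longrightarrow> u \<notin> cspan (fst ` set fs) \<Longrightarrow> flag K ((u, l) # fs)"

abbreviation fspan :: "('a::chilbert \<times> complex) list \<Rightarrow> 'a set" where "fspan fs \<equiv> cspan (fst ` set fs)"

lemma fspan_Cons: "x \<in> fspan ((u, l) # fs) \<longleftrightarrow> (\<exists>c. x - c *\<^sub>C u \<in> fspan fs)"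
  by (simp add: cvs.span_breakdown_eq)

lemma fspan_mono: "set gs \<subseteq> set fs \<Longrightarrow> fspan gs \<subseteq> fspan fs"
  by (intro cvs.span_mono) auto

lemma flag_shift:
  assumes K: "bclinear K"
  shows "flag K fs \<Longrightarrow> x \<in> fspan fs \<Longrightarrow> K x \<in> fspan fs"
proof (induction arbitrary: x rule: flag.induct)
  case Nil thus ?case by (simp add: bclinearD[OF K])
next
  case (Cons fs u l)
  obtain c where c: "x - c *\<^sub>C u \<in> fspan fs" using Cons.prems by (auto simp: fspan_Cons simp del: set_simps)
  have "K (x - c *\<^sub>C u) + c *\<^sub>C (K u - l *\<^sub>C u) \<in> fspan fs" by (intro cvs.span_add cvs.span_scale Cons c)
  moreover have "K (x - c *\<^sub>C u) + c *\<^sub>C (K u - l *\<^sub>C u) = K x - (c * l) *\<^sub>C u"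
    by (simp add: bclinearD[OF K] cvs.scale_right_diff_distrib)
  ultimately show ?case unfolding fspan_Cons by auto
qed

text \<open>A triangular map has no eigenvalues beyond its diagonal entries: modulo the tail, the
  eigenvalue equation forces the coefficient \<open>c\<close> of the head to satisfy
  \<open>c (m - l) = 0\<close>.\<close>

lemma flag_inj:
  assumes K: "bclinear K"
  shows "flag K fs \<Longrightarrow> m \<notin> snd ` set fs \<Longrightarrow> x \<in> fspan fs \<Longrightarrow> K x = m *\<^sub>C x \<Longrightarrow> x = 0"
proof (induction arbitrary: x rule: flag.induct)
  case Nil thus ?case by simp
next
  case (Cons fs u l)
  obtain c where c: "x - c *\<^sub>C u \<in> fspan fs" using Cons.prems(2) by (auto simp: fspan_Cons simp del: set_simps)
  let ?y = "x - c *\<^sub>C u"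
  have lm: "l \<noteq> m" using Cons.prems(1) by auto
  have "K ?y - m *\<^sub>C ?y + c *\<^sub>C (K u - l *\<^sub>C u) \<in> fspan fs"
    by (intro cvs.span_add cvs.span_scale cvs.span_diff flag_shift[OF K] Cons c)
  moreover have "K ?y - m *\<^sub>C ?y + c *\<^sub>C (K u - l *\<^sub>C u) = (c * (m - l)) *\<^sub>C u"
    using Cons.prems(3) by (simp add: bclinearD[OF K] cvs.scale_right_diff_distrib cvs.scale_left_diff_distrib right_diff_distrib mult.commute)
  ultimately have "(c * (m - l)) *\<^sub>C u \<in> fspan fs" by simp
  hence "c = 0"
  proof (rule_tac ccontr)
    assume a: "(c * (m - l)) *\<^sub>C u \<in> fspan fs" "c \<noteq> 0"
    have "(1 / (c * (m - l))) *\<^sub>C (c * (m - l)) *\<^sub>C u \<in> fspan fs" by (rule cvs.span_scale[OF a(1)])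
    thus False using Cons.hyps(3) a lm by simp
  qed
  hence "x \<in> fspan fs" using c by simp
  thus ?case using Cons by auto
qed

text \<open>On the span of \<open>gs\<close> the map \<open>K - l\<close> is nilpotent, on the span
  of \<open>fs\<close> it is injective. Applying it to a common vector gives a common vector with a
  shorter \<open>gs\<close>.\<close>

lemma flag_disjoint:
  assumes K: "bclinear K" and fs: "flag K fs" "l \<notin> snd ` set fs"
  shows "flag K gs \<Longrightarrow> snd ` set gs \<subseteq> {l} \<Longrightarrow> x \<in> fspan gs \<Longrightarrow> x \<in> fspan fs \<Longrightarrow> x = 0"
proof (induction arbitrary: x rule: flag.induct)
  case Nil thus ?case by simp
next
  case (Cons gs u m)
  have m: "m = l" using Cons.prems(1) by auto
  obtain c where c: "x - c *\<^sub>C u \<in> fspan gs" using Cons.prems(2) by (auto simp: fspan_Cons simp del: set_simps)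
  let ?y = "x - c *\<^sub>C u"
  have "K ?y - l *\<^sub>C ?y + c *\<^sub>C (K u - l *\<^sub>C u) \<in> fspan gs"
    using Cons.hyps(2) unfolding m
    by (rule cvs.span_add[OF cvs.span_diff[OF flag_shift[OF K Cons.hyps(1) c] cvs.span_scale[OF c]] cvs.span_scale])
  moreover have "K ?y - l *\<^sub>C ?y + c *\<^sub>C (K u - l *\<^sub>C u) = K x - l *\<^sub>C x"
    by (simp add: bclinearD[OF K] cvs.scale_right_diff_distrib mult.commute)
  ultimately have "K x - l *\<^sub>C x \<in> fspan gs" by simp
  moreover have "K x - l *\<^sub>C x \<in> fspan fs" using Cons.prems(3) by (intro cvs.span_diff cvs.span_scale flag_shift[OF K fs(1)])
  moreover have "snd ` set gs \<subseteq> {l}" using Cons.prems(1) by auto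
  ultimately have "K x - l *\<^sub>C x = 0" by (intro Cons.IH)
  thus ?case using flag_inj[OF K fs(1,2) Cons.prems(3)] by simp
qed

text \<open>Joins the flags of different eigenvalues into a single triangular basis, so that one
  trace estimate covers all of them.\<close>

lemma flag_append:
  assumes K: "bclinear K" and fs: "flag K fs" "l \<notin> snd ` set fs"
  shows "flag K gs \<Longrightarrow> snd ` set gs \<subseteq> {l} \<Longrightarrow> flag K (gs @ fs)"
proof (induction rule: flag.induct)
  case Nil thus ?case using fs by simp
next
  case (Cons gs u m)
  have f: "flag K ((u, m) # gs)" by (intro flag.Cons Cons)
  have "u \<notin> fspan (gs @ fs)"
  proof
    assume "u \<in> fspan (gs @ fs)"
    hence "u \<in> cspan (fst ` set gs \<union> fst ` set fs)" by (simp add: image_Un)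
    then obtain x y where xy: "u = x + y" "x \<in> fspan gs" "y \<in> fspan fs" by (auto simp: cvs.span_Un)
    have "y = u - x" using xy by simp
    moreover have "u - x \<in> fspan ((u, m) # gs)"
    proof (rule cvs.span_diff)
      show "u \<in> fspan ((u, m) # gs)" by (intro cvs.span_base) auto
      show "x \<in> fspan ((u, m) # gs)" using xy(2) fspan_mono[of gs "(u, m) # gs"] by auto
    qed
    ultimately have "y \<in> fspan ((u, m) # gs)" by (simp only:)
    hence "y = 0" by (rule flag_disjoint[OF K fs f Cons.prems _ xy(3)])
    thus False using xy Cons.hyps(3) by simp
  qed
  moreover have "K u - m *\<^sub>C u \<in> fspan (gs @ fs)" using Cons.hyps(2) fspan_mono[of gs "gs @ fs"] by auto
  ultimately have "flag K ((u, m) # (gs @ fs))" using Cons by (intro flag.Cons) auto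
  thus ?case by simp
qed

text \<open>Gram--Schmidt along the flag keeps the spans of the initial segments, hence also
  triangularity and diagonal entries (Schur's theorem). The product \<open>B\<close> is left free:
  \<open>cinner\<close> serves the Riesz projection, \<open>ipa a\<close> the trace bound. The basis
  is numbered from the oldest vector, hence \<open>rev fs\<close>.\<close>

lemma orthonormal_flag_basis:
  fixes B :: "'a::chilbert \<Rightarrow> 'a \<Rightarrow> complex"
  assumes al: "\<And>x y z. B (x + y) z = B x z + B y z" and sl: "\<And>c x y. B (c *\<^sub>C x) y = c * B x y"
    and co: "\<And>x y. B x y = cnj (B y x)" and pos: "\<And>x. x \<noteq> 0 \<Longrightarrow> Re (B x x) > 0" and K: "bclinear K"
  shows "flag K fs \<Longrightarrow> \<exists>e. (\<forall>i<length fs. \<forall>j<length fs. B (e i) (e j) = (if i = j then 1 else 0)) \<and>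
     cspan (e ` {..<length fs}) = fspan fs \<and>
     (\<forall>i<length fs. K (e i) - snd (rev fs ! i) *\<^sub>C e i \<in> cspan (e ` {..<i}))"
proof (induction rule: flag.induct)
  case Nil thus ?case by simp
next
  case (Cons fs u l)
  define N where "N = length fs"
  obtain e where e: "\<And>i j. i < N \<Longrightarrow> j < N \<Longrightarrow> B (e i) (e j) = (if i = j then 1 else 0)"
     "cspan (e ` {..<N}) = fspan fs" "\<And>i. i < N \<Longrightarrow> K (e i) - snd (rev fs ! i) *\<^sub>C e i \<in> cspan (e ` {..<i})"
    using Cons.IH unfolding N_def by auto
  have B0: "B 0 x = 0" for x using sl[of 0 0 x] by simp
  have Bsum: "B (\<Sum>i\<in>I. f i) y = (\<Sum>i\<in>I. B (f i) y)" for I f y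
    by (induction I rule: infinite_finite_induct) (auto simp: al B0)
  define v where "v = u - (\<Sum>i<N. B u (e i) *\<^sub>C e i)"
  have proj: "(\<Sum>i<N. B u (e i) *\<^sub>C e i) \<in> fspan fs" unfolding e(2)[symmetric]
    by (intro cvs.span_sum cvs.span_scale cvs.span_base) auto
  have v0: "v \<noteq> 0" using proj Cons.hyps(3) by (auto simp: v_def)
  have vo: "B v (e j) = 0" if "j < N" for j
  proof -
    have "B u (e j) = B (v + (\<Sum>i<N. B u (e i) *\<^sub>C e i)) (e j)" by (simp add: v_def)
    also have "\<dots> = B v (e j) + (\<Sum>i<N. B u (e i) * B (e i) (e j))" by (simp add: al Bsum sl)
    also have "(\<Sum>i<N. B u (e i) * B (e i) (e j)) = (\<Sum>i<N. if i = j then B u (e i) else 0)"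
      using e(1) that by (intro sum.cong) auto
    also have "\<dots> = B u (e j)" using that by simp
    finally show ?thesis by simp
  qed
  define n where "n = sqrt (Re (B v v))"
  have n0: "n > 0" using pos[OF v0] by (simp add: n_def)
  have Bvv: "B v v = of_real (n\<^sup>2)"
  proof (rule complex_eqI)
    show "Re (B v v) = Re (of_real (n\<^sup>2))" using pos[OF v0] by (simp add: n_def)
    have "Im (B v v) = - Im (B v v)" by (metis co cnj.simps(2))
    thus "Im (B v v) = Im (of_real (n\<^sup>2))" by simp
  qed
  define w where "w = of_real (1 / n) *\<^sub>C v"
  have sr: "B x (c *\<^sub>C y) = cnj c * B x y" for c x y by (metis co sl complex_cnj_mult complex_cnj_cnj)
  have ww: "B w w = 1" unfolding w_def sl sr Bvv using n0 by (simp add: power2_eq_square)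
  have wo: "B w (e j) = 0" "B (e j) w = 0" if "j < N" for j
    using vo[OF that] co[of "e j" w] by (auto simp: w_def sl)
  define e' where "e' i = (if i = N then w else e i)" for i
  have im: "e' ` {..<i} = e ` {..<i}" if "i \<le> N" for i using that by (auto simp: e'_def image_def)
  have wsp: "w \<in> fspan ((u, l) # fs)"
  proof -
    have "u \<in> fspan ((u, l) # fs)" by (intro cvs.span_base) auto
    moreover have "(\<Sum>i<N. B u (e i) *\<^sub>C e i) \<in> fspan ((u, l) # fs)" using proj fspan_mono[of fs "(u, l) # fs"] by auto
    ultimately show ?thesis unfolding w_def v_def by (intro cvs.span_scale cvs.span_diff)
  qed
  have uw: "u = of_real n *\<^sub>C w + (\<Sum>i<N. B u (e i) *\<^sub>C e i)" using n0 by (simp add: w_def v_def)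
  have span': "cspan (e' ` {..<Suc N}) = fspan ((u, l) # fs)"
  proof -
    have set: "e' ` {..<Suc N} = insert w (e ` {..<N})" using im[of N] by (auto simp: lessThan_Suc e'_def)
    have "e i \<in> fspan fs" if "i < N" for i unfolding e(2)[symmetric] using that by (intro cvs.span_base) auto
    hence 1: "insert w (e ` {..<N}) \<subseteq> fspan ((u, l) # fs)" using wsp fspan_mono[of fs "(u, l) # fs"] by auto
    have "x \<in> cspan (insert w (e ` {..<N}))" if "x \<in> fspan fs" for x
      using that unfolding e(2)[symmetric] using cvs.span_mono[of "e ` {..<N}" "insert w (e ` {..<N})"] by auto
    moreover have "u \<in> cspan (insert w (e ` {..<N}))"
      by (subst uw) (intro cvs.span_add cvs.span_scale cvs.span_sum cvs.span_base; auto)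
    ultimately have 2: "fst ` set ((u, l) # fs) \<subseteq> cspan (insert w (e ` {..<N}))" by (auto intro: cvs.span_base)
    show ?thesis unfolding set using 1 2 by (metis cvs.span_minimal cvs.subspace_span subset_antisym)
  qed
  have Kw: "K w - l *\<^sub>C w \<in> cspan (e ` {..<N})"
  proof -
    let ?q = "\<Sum>i<N. B u (e i) *\<^sub>C e i"
    have "K w - l *\<^sub>C w = of_real (1 / n) *\<^sub>C ((K u - l *\<^sub>C u) - (K ?q - l *\<^sub>C ?q))"
      unfolding w_def v_def by (simp add: bclinearD[OF K] cvs.scale_right_diff_distrib mult.commute)
    thus ?thesis unfolding e(2)
      by (simp only:) (intro cvs.span_scale cvs.span_diff flag_shift[OF K Cons.hyps(1)] Cons.hyps(2) proj)
  qed
  have "\<forall>i<Suc N. \<forall>j<Suc N. B (e' i) (e' j) = (if i = j then 1 else 0)"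
    using e(1) ww wo by (auto simp: e'_def less_Suc_eq)
  moreover have "\<forall>i<Suc N. K (e' i) - snd (rev ((u, l) # fs) ! i) *\<^sub>C e' i \<in> cspan (e' ` {..<i})"
  proof (intro allI impI)
    fix i assume "i < Suc N"
    show "K (e' i) - snd (rev ((u, l) # fs) ! i) *\<^sub>C e' i \<in> cspan (e' ` {..<i})"
    proof (cases "i = N")
      case True
      thus ?thesis using Kw im[of N] by (simp add: e'_def nth_append N_def)
    next
      case False
      hence "i < N" using \<open>i < Suc N\<close> by simp
      thus ?thesis using e(3)[of i] im[of i] by (simp add: e'_def nth_append N_def)
    qed
  qed
  ultimately show ?case using span' by (intro exI[of _ e']) (simp add: N_def)
qed

section \<open>Riesz projections of linear pencils\<close>

text \<open>The pencil \<open>1 - z K\<close> instead of a resolvent of \<open>K\<close>: if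
  \<open>K\<close> is \<open>(H + a)^-1\<close>, then \<open>H + a - z = (H + a) (1 - z K)\<close>,
  so the spectral parameter of \<open>H\<close> is only shifted by \<open>a\<close> and circles
  remain circles.\<close>

definition res :: "('a::chilbert \<Rightarrow> 'a) \<Rightarrow> complex \<Rightarrow> 'a \<Rightarrow> 'a" where
  "res K z = inv (\<lambda>u. u - z *\<^sub>C K u)"

definition rset :: "('a::chilbert \<Rightarrow> 'a) \<Rightarrow> complex set" where
  "rset K = {z. bij (\<lambda>u. u - z *\<^sub>C K u)}"

lemma res_props:
  assumes "z \<in> rset K" shows "res K z k - z *\<^sub>C K (res K z k) = k" "x - z *\<^sub>C K x = k \<Longrightarrow> x = res K z k"
proof -
  have b: "bij (\<lambda>u. u - z *\<^sub>C K u)" using assms by (simp add: rset_def)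
  show "res K z k - z *\<^sub>C K (res K z k) = k"
    unfolding res_def using surj_f_inv_f[OF bij_is_surj[OF b]] .
  show "x - z *\<^sub>C K x = k \<Longrightarrow> x = res K z k"
    unfolding res_def using inv_f_f[OF bij_is_inj[OF b], of x] by simp
qed

lemma rset_local:
  assumes K: "bclinear K" and z: "z \<in> rset K"
  shows "\<exists>e>0. ball z e \<subseteq> rset K \<and> (\<forall>k. continuous_on (ball z e) (\<lambda>z. res K z k)) \<and>
     (\<forall>k y. (\<lambda>z. cinner (res K z k) y) holomorphic_on ball z e)"
  using holomorphic_inverse[OF bclinear_id K, of z] z unfolding res_def rset_def by auto

text \<open>Adding the projection onto the flag makes the pencil invertible at the critical point, so the
  resolvent is the sum of a holomorphic part and a part with values in the span of the flag.\<close>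
lemma pencil_isolated:
  fixes K :: "'a::chilbert \<Rightarrow> 'a"
  assumes K: "bclinear K" and fs: "flag K fs" "snd ` set fs \<subseteq> {1 / v}" and v: "v \<noteq> 0"
    and mx: "\<And>u. K u - (1 / v) *\<^sub>C u \<in> fspan fs \<Longrightarrow> u \<in> fspan fs"
    and fred: "\<And>P F. bclinear P \<Longrightarrow> finite F \<Longrightarrow> (\<And>u. P u \<in> cspan F) \<Longrightarrow>
       (\<And>u. u - v *\<^sub>C K u + P u = 0 \<Longrightarrow> u = 0) \<Longrightarrow> bij (\<lambda>u. u - v *\<^sub>C K u + P u)"
  shows "\<exists>e>0. ball v e - {v} \<subseteq> rset K \<and>
     (\<forall>k y. (\<forall>x\<in>fspan fs. cinner x y = 0) \<longrightarrow>
        (\<exists>h. h holomorphic_on ball v e \<and> (\<forall>z\<in>ball v e - {v}. h z = cinner (res K z k) y)))"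
proof -
  define N where "N = length fs"
  obtain e where e: "\<And>i j. i < N \<Longrightarrow> j < N \<Longrightarrow> cinner (e i) (e j) = (if i = j then 1 else 0)"
     "cspan (e ` {..<N}) = fspan fs"
    using orthonormal_flag_basis[of cinner K fs, OF cinner_add_left cinner_cscale_left cinner_commute _ K fs(1)]
    unfolding N_def by (auto simp: cinner_self)
  define P where "P u = (\<Sum>i<N. cinner u (e i) *\<^sub>C e i)" for u
  have P: "bclinear P" unfolding P_def by (intro bclinear_sum bclinear_rank1)
  have Psp: "P u \<in> fspan fs" for u unfolding P_def e(2)[symmetric] by (intro cvs.span_sum cvs.span_scale cvs.span_base) auto
  have Pid: "P u = u" if "u \<in> fspan fs" for u
  proof -
    have "u \<in> cspan (e ` {..<N})" using that e(2) by simp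
    thus ?thesis
    proof (induction rule: cvs.span_induct_alt)
      case base show ?case by (simp add: bclinearD[OF P])
    next
      case (step c x y)
      then obtain j where j: "j < N" "x = e j" by auto
      have "P (e j) = (\<Sum>i<N. (if i = j then 1 else 0) *\<^sub>C e i)" unfolding P_def using e(1) j by (intro sum.cong) auto
      also have "\<dots> = (\<Sum>i<N. if i = j then e i else 0)" by (intro sum.cong) auto
      also have "\<dots> = e j" using j by simp
      finally show ?case using step j by (simp add: bclinearD[OF P])
    qed
  qed
  define A where "A u = u + P u" for u
  have A: "bclinear A" unfolding A_def by (intro bclinear_add bclinear_id P)
  have inv: "K x \<in> fspan fs" if "x \<in> fspan fs" for x by (rule flag_shift[OF K fs(1) that])
  have "bij (\<lambda>u. u - v *\<^sub>C K u + P u)"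
  proof (rule fred[OF P])
    show "finite (fst ` set fs)" by simp
    show "P u \<in> fspan fs" for u by (rule Psp)
    \<comment> \<open>Such a \<open>u\<close> is an eigenvector modulo the flag, hence lies in its
      span by maximality. There \<open>P\<close> is the identity, which makes \<open>u\<close> an
      eigenvector for \<open>2 / v\<close>, a value off the diagonal of the flag.\<close>
    fix u assume 0: "u - v *\<^sub>C K u + P u = 0"
    have "K u - (1 / v) *\<^sub>C u = (1 / v) *\<^sub>C P u"
    proof -
      have "v *\<^sub>C K u = u + P u" using 0 by (simp add: algebra_simps)
      hence "(1 / v) *\<^sub>C v *\<^sub>C K u = (1 / v) *\<^sub>C (u + P u)" by simp
      thus ?thesis using v by (simp add: cscale_add_right)
    qed
    hence "K u - (1 / v) *\<^sub>C u \<in> fspan fs" using cvs.span_scale[OF Psp] by simp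
    hence u: "u \<in> fspan fs" by (rule mx)
    have "v *\<^sub>C K u = 2 *\<^sub>C u" using 0 Pid[OF u] cscale_add_left[of 1 1 u] by (simp add: algebra_simps cscale_one)
    hence "(1 / v) *\<^sub>C v *\<^sub>C K u = (1 / v) *\<^sub>C 2 *\<^sub>C u" by simp
    hence "K u = (2 / v) *\<^sub>C u" using v by simp
    moreover have "2 / v \<notin> snd ` set fs" using fs(2) v by auto
    ultimately show "u = 0" using flag_inj[OF K fs(1) _ u] by blast
  qed
  hence "bij (\<lambda>u. A u - v *\<^sub>C K u)" unfolding A_def by (simp add: algebra_simps)
  from holomorphic_inverse[OF A K this] obtain e0 where e0: "e0 > 0" "\<And>z. z \<in> ball v e0 \<Longrightarrow> bij (\<lambda>u. A u - z *\<^sub>C K u)"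
    "\<And>k y. (\<lambda>z. cinner (inv (\<lambda>u. A u - z *\<^sub>C K u) k) y) holomorphic_on ball v e0" by blast
  \<comment> \<open>Keeps 0 out of the disc, so that \<open>1 / z\<close> can be compared with the
    diagonal entry \<open>1 / v\<close>.\<close>
  define d where "d = min e0 (norm v)"
  have d: "d > 0" using e0(1) v by (simp add: d_def)
  have nz: "z \<noteq> 0" if "z \<in> ball v d" for z using that by (auto simp: d_def dist_norm)
  have injM: "x = 0" if z: "z \<in> ball v d - {v}" and x: "x \<in> fspan fs" "x - z *\<^sub>C K x = 0" for z x
  proof -
    have "z \<noteq> 0" using nz z by auto
    have "z *\<^sub>C K x = x" using x by simp
    hence "(1 / z) *\<^sub>C z *\<^sub>C K x = (1 / z) *\<^sub>C x" by simp
    hence "K x = (1 / z) *\<^sub>C x" using \<open>z \<noteq> 0\<close> by simp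
    moreover have "1 / z \<notin> snd ` set fs" using fs(2) z \<open>z \<noteq> 0\<close> v by auto
    ultimately show ?thesis using flag_inj[OF K fs(1) _ x(1)] by blast
  qed
  have hom: "module_hom cscale cscale (\<lambda>u. u - z *\<^sub>C K u)" "module_hom cscale cscale (\<lambda>u. A u - z *\<^sub>C K u)" for z
    by (intro bclinear_module_hom bclinear_diff bclinear_id bclinear_cscale K A)+
  have solve: "\<exists>m\<in>fspan fs. res K z k = inv (\<lambda>u. A u - z *\<^sub>C K u) k + m" and bz: "z \<in> rset K" if z: "z \<in> ball v d - {v}" for z k
  proof -
    have bj: "bij (\<lambda>u. A u - z *\<^sub>C K u)" using e0(2) z by (auto simp: d_def)
    have inj: "x = 0" if x: "x - z *\<^sub>C K x = 0" for x
    proof -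
      have "\<exists>m\<in>fspan fs. A m - z *\<^sub>C K m = P x"
      proof (rule cspan_finite_inj_surj[OF hom(2)])
        show "A y - z *\<^sub>C K y \<in> fspan fs" if "y \<in> fspan fs" for y
          unfolding A_def using that by (intro cvs.span_diff cvs.span_add cvs.span_scale inv Psp)
        show "y = 0" if "A y - z *\<^sub>C K y = 0" for y
          using bij_is_inj[OF bj, THEN injD, of y 0] that by (simp add: bclinearD[OF A] bclinearD[OF K])
      qed (auto intro: Psp)
      then obtain m where m: "m \<in> fspan fs" "A m - z *\<^sub>C K m = P x" by blast
      have "A x - z *\<^sub>C K x = P x" using x unfolding A_def by (simp add: algebra_simps)
      hence "x = m" using bij_is_inj[OF bj, THEN injD, of x m] m by simp
      thus ?thesis using injM[OF z] m(1) x by blast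
    qed
    \<comment> \<open>A solution \<open>y\<close> of the modified pencil misses the original
      equation by \<open>P y\<close>; this defect lies in the span of the flag and is corrected
      there.\<close>
    have surj: "\<exists>m\<in>fspan fs. (inv (\<lambda>u. A u - z *\<^sub>C K u) k + m) - z *\<^sub>C K (inv (\<lambda>u. A u - z *\<^sub>C K u) k + m) = k" for k
    proof -
      define y where "y = inv (\<lambda>u. A u - z *\<^sub>C K u) k"
      have y: "A y - z *\<^sub>C K y = k" unfolding y_def using surj_f_inv_f[OF bij_is_surj[OF bj]] .
      have "\<exists>m\<in>fspan fs. m - z *\<^sub>C K m = P y"
      proof (rule cspan_finite_inj_surj[OF hom(1)])
        show "u - z *\<^sub>C K u \<in> fspan fs" if "u \<in> fspan fs" for u
          using that by (intro cvs.span_diff cvs.span_scale inv)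
        show "u = 0" if "u \<in> fspan fs" "u - z *\<^sub>C K u = 0" for u using injM[OF z] that by blast
      qed (auto intro: Psp)
      then obtain m where m: "m \<in> fspan fs" "m - z *\<^sub>C K m = P y" by blast
      have "(y + m) - z *\<^sub>C K (y + m) = (y - z *\<^sub>C K y) + (m - z *\<^sub>C K m)"
        by (simp add: bclinearD[OF K] cscale_add_right)
      also have "\<dots> = A y - z *\<^sub>C K y" unfolding m(2) A_def by simp
      finally show ?thesis using m(1) y unfolding y_def[symmetric] by auto
    qed
    show bz: "z \<in> rset K" unfolding rset_def bij_def surj_def
    proof (safe, rule injI)
      fix x y assume "x - z *\<^sub>C K x = y - z *\<^sub>C K y"
      hence "(x - y) - z *\<^sub>C K (x - y) = 0" by (simp add: bclinearD[OF K] cvs.scale_right_diff_distrib algebra_simps)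
      thus "x = y" using inj[of "x - y"] by simp
    next
      fix k show "\<exists>x. k = x - z *\<^sub>C K x" using surj[of k] by metis
    qed
    show "\<exists>m\<in>fspan fs. res K z k = inv (\<lambda>u. A u - z *\<^sub>C K u) k + m" using surj[of k] res_props(2)[OF bz] by metis
  qed
  show ?thesis
  proof (intro exI[of _ d] conjI d allI impI)
    show "ball v d - {v} \<subseteq> rset K" using bz by blast
    fix k y assume o: "\<forall>x\<in>fspan fs. cinner x y = 0"
    show "\<exists>h. h holomorphic_on ball v d \<and> (\<forall>z\<in>ball v d - {v}. h z = cinner (res K z k) y)"
    proof (intro exI conjI ballI)
      show "(\<lambda>z. cinner (inv (\<lambda>u. A u - z *\<^sub>C K u) k) y) holomorphic_on ball v d"
        by (rule holomorphic_on_subset[OF e0(3)]) (auto simp: d_def)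
      fix z assume z: "z \<in> ball v d - {v}"
      obtain m where "m \<in> fspan fs" "res K z k = inv (\<lambda>u. A u - z *\<^sub>C K u) k + m" using solve[OF z] by blast
      thus "cinner (inv (\<lambda>u. A u - z *\<^sub>C K u) k) y = cinner (res K z k) y" using o by (simp add: cinner_add_left)
    qed
  qed
qed

text \<open>Against a vector orthogonal to the flag the resolvent has a removable singularity at
  \<open>v\<close>, so Cauchy's theorem annihilates the contour integral. Taking for this vector the
  component of the integral \<open>w\<close> orthogonal to the flag shows that the component is
  0.\<close>

lemma riesz_integral_in_flag:
  fixes K :: "'a::chilbert \<Rightarrow> 'a"
  assumes K: "bclinear K" and fs: "flag K fs" and e: "e > 0" "ball v e - {v} \<subseteq> rset K"
    and rem: "\<And>k y. (\<forall>x\<in>fspan fs. cinner x y = 0) \<Longrightarrow>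
        (\<exists>h. h holomorphic_on ball v e \<and> (\<forall>z\<in>ball v e - {v}. h z = cinner (res K z k) y))"
    and r: "r > 0" "cball v r - {v} \<subseteq> rset K"
  shows "continuous_on {0..2*pi} (\<lambda>t. res K (v + of_real r * cis t) k)"
    and "\<exists>w\<in>fspan fs. \<forall>y. integral {0..2*pi} (\<lambda>t. cinner (res K (v + of_real r * cis t) k) y * (\<i> * of_real r * cis t)) = cinner w y"
proof -
  have onc: "v + of_real r * cis t \<in> rset K" for t
    using r by (intro subsetD[OF r(2)]) (auto simp: dist_norm norm_mult)
  have contR: "continuous_on (rset K) (\<lambda>z. res K z k)"
  proof (rule continuous_at_imp_continuous_on, rule ballI)
    fix z assume "z \<in> rset K"
    from rset_local[OF K this] obtain e where "e > 0" "continuous_on (ball z e) (\<lambda>z. res K z k)" by blast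
    thus "isCont (\<lambda>z. res K z k) z" by (simp add: continuous_on_eq_continuous_at)
  qed
  show cont: "continuous_on {0..2*pi} (\<lambda>t. res K (v + of_real r * cis t) k)"
    by (rule continuous_on_compose2[OF contR]) (auto intro!: continuous_intros onc)
  define F where "F t = (\<i> * of_real r * cis t) *\<^sub>C res K (v + of_real r * cis t) k" for t
  have bb: "bounded_bilinear (cscale :: complex \<Rightarrow> 'a \<Rightarrow> 'a)"
    by (unfold_locales)
       (auto simp: cscale_add_right cscale_add_left scaleR_conv_of_real cscale_of_real[symmetric] cscale_cscale mult.commute intro!: exI[of _ 1])
  have cF: "continuous_on {0..2*pi} F" unfolding F_def
    by (intro bounded_bilinear.continuous_on[OF bb] cont continuous_intros)
  hence iF: "F integrable_on {0..2*pi}" by (rule integrable_continuous_interval)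
  define w where "w = integral {0..2*pi} F"
  have wi: "integral {0..2*pi} (\<lambda>t. cinner (res K (v + of_real r * cis t) k) y * (\<i> * of_real r * cis t)) = cinner w y" for y
  proof -
    have "integral {0..2*pi} ((\<lambda>x. cinner x y) \<circ> F) = cinner w y"
      unfolding w_def by (rule integral_linear[OF iF bounded_linear_cinner])
    thus ?thesis by (simp add: o_def F_def cinner_cscale_left mult.commute)
  qed
  define N where "N = length fs"
  obtain b where b: "\<And>i j. i < N \<Longrightarrow> j < N \<Longrightarrow> cinner (b i) (b j) = (if i = j then 1 else 0)"
     "cspan (b ` {..<N}) = fspan fs"
    using orthonormal_flag_basis[of cinner K fs, OF cinner_add_left cinner_cscale_left cinner_commute _ K fs]
    unfolding N_def by (auto simp: cinner_self)
  define p where "p = (\<Sum>i<N. cinner w (b i) *\<^sub>C b i)"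
  have psp: "p \<in> fspan fs" unfolding p_def b(2)[symmetric] by (intro cvs.span_sum cvs.span_scale cvs.span_base) auto
  have pb: "cinner (w - p) (b j) = 0" if j: "j < N" for j
  proof -
    have "cinner p (b j) = (\<Sum>i<N. cinner w (b i) * cinner (b i) (b j))" unfolding p_def by (simp add: cinner_sum_left cinner_cscale_left)
    also have "\<dots> = (\<Sum>i<N. if i = j then cinner w (b i) else 0)" using b(1) j by (intro sum.cong) auto
    also have "\<dots> = cinner w (b j)" using j by simp
    finally show ?thesis by (simp add: cinner_diff_left)
  qed
  have o: "\<forall>x\<in>fspan fs. cinner x (w - p) = 0"
  proof
    fix x assume "x \<in> fspan fs"
    hence "x \<in> cspan (b ` {..<N})" by (simp add: b)
    thus "cinner x (w - p) = 0"
    proof (induction rule: cvs.span_induct_alt)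
      case (step c x y)
      then obtain j where "j < N" "x = b j" by auto
      hence "cinner x (w - p) = 0" using pb[of j] cinner_commute[of x "w - p"] by simp
      thus ?case using step by (simp add: cinner_add_left cinner_cscale_left)
    qed simp
  qed
  obtain h where h: "h holomorphic_on ball v e" "\<And>z. z \<in> ball v e - {v} \<Longrightarrow> h z = cinner (res K z k) (w - p)"
    using rem[OF o] by blast
  \<comment> \<open>The value of \<open>h\<close> fills the singularity. The radii \<open>e\<close>
    and \<open>r\<close> are unrelated: \<phi> is holomorphic at \<open>v\<close> because of
    \<open>h\<close>, and elsewhere in the closed disc because of the resolvent.\<close>
  define \<phi> where "\<phi> z = (if z = v then h v else cinner (res K z k) (w - p))" for z
  have hol: "\<phi> holomorphic_on cball v r"
  proof (rule holomorphic_onI)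
    fix z assume z: "z \<in> cball v r"
    have "\<phi> field_differentiable at z"
    proof (cases "z = v")
      case True
      have "h field_differentiable at v" using e by (intro holomorphic_on_imp_differentiable_at[OF h(1)]) auto
      moreover have "\<phi> y = h y" if "y \<in> ball v e" for y using h(2)[of y] that by (auto simp: \<phi>_def)
      ultimately have "\<phi> field_differentiable at v"
        by (intro field_differentiable_transform_within[of e v UNIV h \<phi>]) (use e in \<open>auto simp: dist_commute\<close>)
      thus ?thesis using True by simp
    next
      case False
      hence "z \<in> rset K" using z r by auto
      then obtain d where d: "d > 0" "(\<lambda>z. cinner (res K z k) (w - p)) holomorphic_on ball z d" using rset_local[OF K] by blast
      hence fd: "(\<lambda>z. cinner (res K z k) (w - p)) field_differentiable at z" by (intro holomorphic_on_imp_differentiable_at[OF d(2)]) auto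
      show ?thesis
        by (rule field_differentiable_transform_within[OF _ _ _ fd, of "dist z v"]) (use False in \<open>auto simp: \<phi>_def dist_commute\<close>)
    qed
    thus "\<phi> field_differentiable at z within cball v r" by (rule field_differentiable_at_within)
  qed
  have "(\<phi> has_contour_integral 0) (part_circlepath v r 0 (2 * pi))"
  proof (rule Cauchy_theorem_convex_simple[OF hol])
    show "path_image (part_circlepath v r 0 (2 * pi)) \<subseteq> cball v r"
      using path_image_part_circlepath_subset[of 0 "2 * pi" r v] r sphere_cball[of v r] by auto
  qed (auto simp: exp_two_pi_i' mult.commute)
  hence "contour_integral (part_circlepath v r 0 (2 * pi)) \<phi> = 0" by (rule contour_integral_unique)
  hence "integral {0..2*pi} (\<lambda>t. \<phi> (v + r * cis t) * r * \<i> * cis t) = 0"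
    by (subst (asm) contour_integral_part_circlepath_eq) auto
  moreover have "\<phi> (v + r * cis t) * r * \<i> * cis t = cinner (res K (v + of_real r * cis t) k) (w - p) * (\<i> * of_real r * cis t)" for t
    using r by (simp add: \<phi>_def)
  \<comment> \<open>Cauchy's theorem makes \<open>w\<close> orthogonal to \<open>w - p\<close>, and
    so is \<open>p\<close> as an element of the span; hence \<open>w - p\<close> is orthogonal to
    itself.\<close>
  ultimately have "cinner w (w - p) = 0" using wi[of "w - p"] by simp
  moreover have "cinner p (w - p) = 0" using o psp by blast
  ultimately have "cinner (w - p) (w - p) = 0" by (simp add: cinner_diff_left)
  hence "w = p" by (simp add: cinner_self)
  thus "\<exists>w\<in>fspan fs. \<forall>y. integral {0..2*pi} (\<lambda>t. cinner (res K (v + of_real r * cis t) k) y * (\<i> * of_real r * cis t)) = cinner w y"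
    using psp wi by auto
qed

section \<open>The Sobolev space as a Hilbert space\<close>

lemma L2_inner_cong:
  assumes "u \<in> L2" "u' \<in> L2" "v \<in> L2" "v' \<in> L2" "ae_eq u u'" "ae_eq v v'"
  shows "L2_inner u v = L2_inner u' v'"
proof -
  have "AE x in lborel. u x * cnj (v x) = u' x * cnj (v' x)"
    using assms(5,6) unfolding ae_eq_def by (elim eventually_elim2) auto
  thus ?thesis unfolding L2_inner_def using assms
    by (intro integral_cong_AE) (auto dest: L2_inner_integrable borel_measurable_integrable)
qed

lemma L2_inner_add_left:
  "u \<in> L2 \<Longrightarrow> v \<in> L2 \<Longrightarrow> w \<in> L2 \<Longrightarrow> L2_inner (\<lambda>x. u x + v x) w = L2_inner u w + L2_inner v w"
  unfolding L2_inner_def distrib_right by (intro Bochner_Integration.integral_add L2_inner_integrable)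

lemma L2_inner_scale_left: "L2_inner (\<lambda>x. c * u x) w = c * L2_inner u w"
  unfolding L2_inner_def mult.assoc by simp

lemma L2_inner_commute: "L2_inner u v = cnj (L2_inner v u)"
  unfolding L2_inner_def by (subst Bochner_Integration.integral_cnj[symmetric]) (simp add: mult.commute)

lemma L2_inner_self: "L2_inner u u = of_real (\<integral>x. (norm (u x))\<^sup>2 \<partial>lborel)"
proof -
  have "L2_inner u u = (\<integral>x. of_real ((norm (u x))\<^sup>2) \<partial>lborel)"
    unfolding L2_inner_def by (simp only: complex_norm_square)
  thus ?thesis by (simp only: integral_complex_of_real)
qed

lemma nsq_L2_inner: "u \<in> L2 \<Longrightarrow> nsq u = ennreal (Re (L2_inner u u))"
  by (simp add: nsq_eq L2_inner_self)

definition hin :: "(real^'n::finite \<Rightarrow> complex) \<Rightarrow> (real^'n \<Rightarrow> complex) \<Rightarrow> complex" where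
  "hin u v = (\<Sum>i\<in>UNIV. L2_inner (weak_grad u i) (weak_grad v i)) + L2_inner u v"

lemma grad_inner_cong:
  assumes "u \<in> H1" "u' \<in> H1" "v \<in> H1" "v' \<in> H1" "ae_eq u u'" "ae_eq v v'"
  shows "(\<Sum>i\<in>UNIV. L2_inner (weak_grad u i) (weak_grad v i)) = (\<Sum>i\<in>UNIV. L2_inner (weak_grad u' i) (weak_grad v' i))"
  using assms by (intro sum.cong refl L2_inner_cong weak_grad_spec weak_grad_cong)

lemma grad_inner_add_left:
  assumes "u \<in> H1" "v \<in> H1" "w \<in> H1"
  shows "(\<Sum>i\<in>UNIV. L2_inner (weak_grad (\<lambda>x. u x + v x) i) (weak_grad w i))
    = (\<Sum>i\<in>UNIV. L2_inner (weak_grad u i) (weak_grad w i)) + (\<Sum>i\<in>UNIV. L2_inner (weak_grad v i) (weak_grad w i))"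
proof -
  have "L2_inner (weak_grad (\<lambda>x. u x + v x) i) (weak_grad w i) = L2_inner (weak_grad u i) (weak_grad w i) + L2_inner (weak_grad v i) (weak_grad w i)" for i
    using L2_inner_cong[of "weak_grad (\<lambda>x. u x + v x) i" "\<lambda>x. weak_grad u i x + weak_grad v i x" "weak_grad w i" "weak_grad w i"]
    by (simp add: weak_grad_spec H1_add assms L2_add weak_grad_add L2_inner_add_left)
  thus ?thesis by (simp add: sum.distrib)
qed

lemma grad_inner_scale_left:
  assumes "u \<in> H1" "w \<in> H1"
  shows "(\<Sum>i\<in>UNIV. L2_inner (weak_grad (\<lambda>x. c * u x) i) (weak_grad w i))
    = c * (\<Sum>i\<in>UNIV. L2_inner (weak_grad u i) (weak_grad w i))"
proof -
  have "L2_inner (weak_grad (\<lambda>x. c * u x) i) (weak_grad w i) = c * L2_inner (weak_grad u i) (weak_grad w i)" for i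
    using L2_inner_cong[of "weak_grad (\<lambda>x. c * u x) i" "\<lambda>x. c * weak_grad u i x" "weak_grad w i" "weak_grad w i"]
    by (simp add: weak_grad_spec H1_scale assms L2_scale weak_grad_scale L2_inner_scale_left)
  thus ?thesis by (simp add: sum_distrib_left)
qed

text \<open>Passing to classes modulo null sets makes the norm definite, so that the abstract
  Hilbert space results apply; \<open>mk\<close> and \<open>rp\<close> below move between functions
  and classes.\<close>

definition h1_class :: "(real^'n::finite \<Rightarrow> complex) \<Rightarrow> (real^'n \<Rightarrow> complex) set" where
  "h1_class u = {v \<in> H1. ae_eq u v}"

typedef (overloaded) 'n h1 = "h1_class ` (H1 :: (real^'n::finite \<Rightarrow> complex) set)"
  by (auto intro: H1_zero)

definition mk :: "(real^'n::finite \<Rightarrow> complex) \<Rightarrow> 'n h1" where "mk u = Abs_h1 (h1_class u)"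

definition rp :: "'n::finite h1 \<Rightarrow> (real^'n \<Rightarrow> complex)" where "rp x = (SOME u. u \<in> H1 \<and> mk u = x)"

lemma mk_eq_iff: assumes "u \<in> H1" "v \<in> H1" shows "mk u = mk v \<longleftrightarrow> ae_eq u v"
proof -
  have "mk u = mk v \<longleftrightarrow> h1_class u = h1_class v" unfolding mk_def using assms by (intro Abs_h1_inject) auto
  also have "\<dots> \<longleftrightarrow> ae_eq u v"
  proof
    assume a: "h1_class u = h1_class v"
    have "v \<in> h1_class v" using assms by (simp add: h1_class_def)
    hence "v \<in> h1_class u" by (simp only: a)
    thus "ae_eq u v" by (simp add: h1_class_def)
  next
    assume "ae_eq u v"
    hence "ae_eq u f \<longleftrightarrow> ae_eq v f" for f using ae_eq_trans[of u v f] ae_eq_trans[of v u f] ae_eq_sym[of u v] by blast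
    thus "h1_class u = h1_class v" by (simp add: h1_class_def)
  qed
  finally show ?thesis .
qed

lemma rp_H1: "rp x \<in> H1" and mk_rp [simp]: "mk (rp x) = x"
proof -
  have "\<exists>u. u \<in> H1 \<and> mk u = x" unfolding mk_def using Rep_h1[of x] Rep_h1_inverse[of x] by force
  from someI_ex[OF this] show "rp x \<in> H1" "mk (rp x) = x" by (auto simp: rp_def)
qed

lemma rp_L2: "rp x \<in> L2" by (rule H1_L2[OF rp_H1])

lemma rp_mk: "u \<in> H1 \<Longrightarrow> ae_eq (rp (mk u)) u"
  using mk_eq_iff[of "rp (mk u)" u] by (simp add: rp_H1)

lemma h1_cases: obtains u where "u \<in> H1" "x = mk u"
  using rp_H1[of x] mk_rp[of x] by metis

instantiation h1 :: (finite) real_inner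
begin

definition "(0::'a h1) = mk (\<lambda>x. 0)"
definition "x + y = mk (\<lambda>t. rp x t + rp y t)" for x y :: "'a h1"
definition "r *\<^sub>R x = mk (\<lambda>t. of_real r * rp x t)" for x :: "'a h1"
definition "- x = mk (\<lambda>t. - 1 * rp x t)" for x :: "'a h1"
definition "x - y = x + - y" for x y :: "'a h1"
definition "inner x y = Re (hin (rp x) (rp y))" for x y :: "'a h1"
definition "norm x = sqrt (inner x x)" for x :: "'a h1"
definition "dist x y = norm (x - y)" for x y :: "'a h1"
definition "sgn x = inverse (norm x) *\<^sub>R x" for x :: "'a h1"
definition [code del]: "(uniformity :: ('a h1 \<times> 'a h1) filter) = (INF e\<in>{0<..}. principal {(x, y). dist x y < e})"
definition [code del]: "open U \<longleftrightarrow> (\<forall>x\<in>U. eventually (\<lambda>(x', y). x' = x \<longrightarrow> y \<in> U) uniformity)" for U :: "'a h1 set"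

lemma mk_add: assumes "u \<in> H1" "v \<in> H1" shows "mk u + mk v = mk (\<lambda>t. u t + v t)"
proof -
  have "ae_eq (\<lambda>t. rp (mk u) t + rp (mk v) t) (\<lambda>t. u t + v t)"
    using rp_mk[OF assms(1)] rp_mk[OF assms(2)] unfolding ae_eq_def by (elim eventually_elim2) auto
  thus ?thesis unfolding plus_h1_def by (subst mk_eq_iff) (auto intro: H1_add rp_H1 assms)
qed

lemma mk_scale: assumes "u \<in> H1" shows "mk (\<lambda>t. c * rp (mk u) t) = mk (\<lambda>t. c * u t)"
proof -
  have "ae_eq (\<lambda>t. c * rp (mk u) t) (\<lambda>t. c * u t)"
    using rp_mk[OF assms] unfolding ae_eq_def by (elim eventually_mono) auto
  thus ?thesis by (subst mk_eq_iff) (auto intro: H1_scale rp_H1 assms)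
qed

lemma mk_scaleR: "u \<in> H1 \<Longrightarrow> r *\<^sub>R mk u = mk (\<lambda>t. of_real r * u t)"
  by (simp only: scaleR_h1_def mk_scale)

lemma hin_mk: assumes "u \<in> H1" "v \<in> H1" shows "hin (rp (mk u)) (rp (mk v)) = hin u v"
  unfolding hin_def using assms rp_mk rp_H1
  by (intro arg_cong2[of _ _ _ _ "(+)"] grad_inner_cong L2_inner_cong) (auto intro: H1_L2 rp_mk rp_H1)

lemma hin_add: "u \<in> H1 \<Longrightarrow> v \<in> H1 \<Longrightarrow> w \<in> H1 \<Longrightarrow> hin (\<lambda>t. u t + v t) w = hin u w + hin v w"
  unfolding hin_def by (simp add: grad_inner_add_left L2_inner_add_left H1_L2)

lemma hin_scale: "u \<in> H1 \<Longrightarrow> w \<in> H1 \<Longrightarrow> hin (\<lambda>t. c * u t) w = c * hin u w"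
  unfolding hin_def by (simp add: grad_inner_scale_left L2_inner_scale_left distrib_left)

lemma hin_commute: "hin u v = cnj (hin v u)"
  unfolding hin_def using L2_inner_commute by (simp add: L2_inner_commute[symmetric])

lemma hin_self_ge: "Re (hin u u) \<ge> (\<integral>x. (norm (u x))\<^sup>2 \<partial>lborel)" "(\<integral>x. (norm (u x))\<^sup>2 \<partial>lborel) \<ge> 0"
  unfolding hin_def by (auto simp: L2_inner_self intro!: sum_nonneg)

lemma hin_definite: assumes "u \<in> H1" shows "Re (hin u u) = 0 \<longleftrightarrow> ae_eq u (\<lambda>x. 0)"
proof
  assume "Re (hin u u) = 0"
  hence "(\<integral>x. (norm (u x))\<^sup>2 \<partial>lborel) = 0" using hin_self_ge[of u] by simp
  hence "nsq u = 0" using nsq_eq[OF H1_L2[OF assms]] by simp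
  thus "ae_eq u (\<lambda>x. 0)" unfolding ae_eq_def using AE_zero_iff_nsq[of u] H1_L2[OF assms] by (auto simp: L2_iff)
next
  assume a: "ae_eq u (\<lambda>x. 0)"
  have "hin u u = hin (\<lambda>x. 0 * u x) u" unfolding hin_def using a assms
    by (intro arg_cong2[of _ _ _ _ "(+)"] grad_inner_cong L2_inner_cong) (auto intro: H1_L2)
  also have "\<dots> = 0" by (subst hin_scale) (auto intro: assms)
  finally show "Re (hin u u) = 0" by simp
qed

instance
proof
  fix x y z :: "'a h1" and a b r :: real
  obtain u v w where uvw: "u \<in> H1" "x = mk u" "v \<in> H1" "y = mk v" "w \<in> H1" "z = mk w" by (metis h1_cases)
  note s = mk_add mk_scale H1_add H1_scale hin_mk hin_add hin_scale
  show "x + y + z = x + (y + z)" using uvw by (simp add: s add.assoc)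
  show "x + y = y + x" using uvw by (simp add: s add.commute)
  show "0 + x = x" using uvw by (simp add: s zero_h1_def)
  have "- x = mk (\<lambda>t. - 1 * u t)" using mk_scale[OF uvw(1), of "-1"] by (simp only: uvw(2) uminus_h1_def)
  thus "- x + x = 0" using mk_add[OF H1_scale[OF uvw(1), of "-1"] uvw(1)] by (simp add: uvw(2) zero_h1_def)
  show "x - y = x + - y" by (simp add: minus_h1_def)
  show "a *\<^sub>R (x + y) = a *\<^sub>R x + a *\<^sub>R y" using uvw by (simp add: s mk_scaleR distrib_left)
  show "(a + b) *\<^sub>R x = a *\<^sub>R x + b *\<^sub>R x" using uvw by (simp add: s mk_scaleR distrib_right)
  show "a *\<^sub>R b *\<^sub>R x = (a * b) *\<^sub>R x" using uvw by (simp add: s mk_scaleR mult.assoc)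
  show "1 *\<^sub>R x = x" using uvw by (simp add: s mk_scaleR)
  show "dist x y = norm (x - y)" by (simp add: dist_h1_def)
  show "sgn x = inverse (norm x) *\<^sub>R x" by (simp add: sgn_h1_def)
  show "uniformity = (INF e\<in>{0<..}. principal {(x, y::'a h1). dist x y < e})" by (rule uniformity_h1_def)
  show "open U = (\<forall>x\<in>U. \<forall>\<^sub>F (x', y) in uniformity. x' = x \<longrightarrow> y \<in> U)" for U :: "'a h1 set" by (rule open_h1_def)
  show "inner x y = inner y x" unfolding inner_h1_def by (subst hin_commute) simp
  show "inner (x + y) z = inner x z + inner y z" using uvw by (simp add: inner_h1_def s)
  show "inner (r *\<^sub>R x) y = r * inner x y" using uvw by (simp add: inner_h1_def mk_scaleR s)
  show "0 \<le> inner x x" using order_trans[OF hin_self_ge(2) hin_self_ge(1), of "rp x"] by (simp add: inner_h1_def)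
  show "inner x x = 0 \<longleftrightarrow> x = 0" using uvw mk_eq_iff[of u "\<lambda>x. 0"] by (simp add: inner_h1_def s zero_h1_def hin_definite)
  show "norm x = sqrt (inner x x)" by (simp add: norm_h1_def)
qed

end

lemma h1_norm_ennreal: assumes "u \<in> H1" shows "ennreal ((norm (mk u))\<^sup>2) = gsq u + nsq u"
proof -
  have "(norm (mk u))\<^sup>2 = Re (hin u u)"
    using order_trans[OF hin_self_ge(2) hin_self_ge(1), of u] by (simp add: norm_h1_def inner_h1_def hin_mk assms)
  also have "ennreal (Re (hin u u)) = gsq u + nsq u"
    unfolding hin_def gsq_def using assms
    by (simp add: nsq_L2_inner weak_grad_spec H1_L2 L2_inner_self sum_nonneg flip: of_real_sum)
  finally show ?thesis .
qed

lemma mk_diff: assumes "u \<in> H1" "v \<in> H1" shows "mk u - mk v = mk (\<lambda>t. u t - v t)"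
  using mk_add[OF assms(1) H1_scale[OF assms(2), of "-1"]] mk_scale[OF assms(2), of "-1"]
  by (simp add: minus_h1_def uminus_h1_def)

lemma H1_diff: "u \<in> H1 \<Longrightarrow> v \<in> H1 \<Longrightarrow> (\<lambda>x. u x - v x) \<in> H1"
  using H1_add[OF _ H1_scale[of v "-1"], of u] by simp

lemma weak_grad_diff_nsq:
  assumes "u \<in> H1" "v \<in> H1" shows "nsq (weak_grad (\<lambda>x. u x - v x) i) = nsq (\<lambda>x. weak_grad u i x - weak_grad v i x)"
proof -
  have "ae_eq (weak_grad (\<lambda>x. u x + - 1 * v x) i) (\<lambda>x. weak_grad u i x + - 1 * weak_grad v i x)"
    using assms by (intro weak_grad_AE_eqI weak_partial_add weak_partial_scale H1_add H1_scale L2_add L2_scale weak_grad_spec H1_L2)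
  thus ?thesis by (simp add: nsq_cong)
qed

instantiation h1 :: (finite) chilbert
begin

definition "c *\<^sub>C x = mk (\<lambda>t. c * rp x t)" for x :: "'a h1"
definition "cinner x y = hin (rp x) (rp y)" for x y :: "'a h1"

lemma mk_cscale: "u \<in> H1 \<Longrightarrow> c *\<^sub>C mk u = mk (\<lambda>t. c * u t)"
  by (simp only: cscale_h1_def mk_scale)

instance
proof
  \<comment> \<open>Completeness: the functions and each of their weak derivatives converge
    separately in \<open>L^2\<close>, and closedness of the weak derivative joins the
    limits.\<close>
  fix X :: "nat \<Rightarrow> 'a h1" assume X: "Cauchy X"
  define u where "u n = rp (X n)" for n
  have u: "u n \<in> H1" "X n = mk (u n)" for n by (auto simp: u_def rp_H1)
  have nn: "gsq (\<lambda>x. u m x - u n x) + nsq (\<lambda>x. u m x - u n x) = ennreal ((norm (X m - X n))\<^sup>2)" for m n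
    using h1_norm_ennreal[OF H1_diff[OF u(1)[of m] u(1)[of n]]] by (simp add: u(2) mk_diff u(1))
  have cau: "\<exists>N. \<forall>m\<ge>N. \<forall>n\<ge>N. (norm (X m - X n))\<^sup>2 \<le> e" if e: "e > 0" for e
  proof -
    have se: "sqrt e > 0" using e by simp
    obtain N where "\<forall>m\<ge>N. \<forall>n\<ge>N. norm (X m - X n) < sqrt e" using CauchyD[OF X se] by blast
    hence "\<forall>m\<ge>N. \<forall>n\<ge>N. (norm (X m - X n))\<^sup>2 \<le> (sqrt e)\<^sup>2" by (meson less_imp_le norm_ge_zero power_mono)
    thus ?thesis using that by auto
  qed
  have "\<exists>v\<in>L2. \<forall>e>0. \<exists>N. \<forall>n\<ge>N. nsq (\<lambda>x. u n x - v x) \<le> ennreal e"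
  proof (rule L2_complete)
    show "u n \<in> L2" for n using u H1_L2 by auto
    fix e :: real assume "e > 0"
    then obtain N where N: "\<forall>m\<ge>N. \<forall>n\<ge>N. (norm (X m - X n))\<^sup>2 \<le> e" using cau by blast
    have "nsq (\<lambda>x. u m x - u n x) \<le> ennreal e" if "m \<ge> N" "n \<ge> N" for m n
    proof -
      have "nsq (\<lambda>x. u m x - u n x) \<le> gsq (\<lambda>x. u m x - u n x) + nsq (\<lambda>x. u m x - u n x)" by simp
      also have "\<dots> \<le> ennreal e" unfolding nn using N that by (intro ennreal_leI) auto
      finally show ?thesis .
    qed
    thus "\<exists>N. \<forall>m\<ge>N. \<forall>n\<ge>N. nsq (\<lambda>x. u m x - u n x) \<le> ennreal e" by blast
  qed
  then obtain v where v: "v \<in> L2" "\<And>e. e > 0 \<Longrightarrow> \<exists>N. \<forall>n\<ge>N. nsq (\<lambda>x. u n x - v x) \<le> ennreal e" by blast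
  have "\<exists>g\<in>L2. \<forall>e>0. \<exists>N. \<forall>n\<ge>N. nsq (\<lambda>x. weak_grad (u n) i x - g x) \<le> ennreal e" for i
  proof (rule L2_complete)
    show "weak_grad (u n) i \<in> L2" for n using u weak_grad_spec by auto
    fix e :: real assume "e > 0"
    then obtain N where N: "\<forall>m\<ge>N. \<forall>n\<ge>N. (norm (X m - X n))\<^sup>2 \<le> e" using cau by blast
    have "nsq (\<lambda>x. weak_grad (u m) i x - weak_grad (u n) i x) \<le> ennreal e" if "m \<ge> N" "n \<ge> N" for m n
    proof -
      have "nsq (\<lambda>x. weak_grad (u m) i x - weak_grad (u n) i x) \<le> gsq (\<lambda>x. u m x - u n x)"
        unfolding gsq_def weak_grad_diff_nsq[OF u(1) u(1)]
        by (rule member_le_sum[of i UNIV "\<lambda>i. nsq (\<lambda>x. weak_grad (u m) i x - weak_grad (u n) i x)"]) auto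
      also have "\<dots> \<le> gsq (\<lambda>x. u m x - u n x) + nsq (\<lambda>x. u m x - u n x)" by simp
      also have "\<dots> \<le> ennreal e" unfolding nn using N that by (intro ennreal_leI) auto
      finally show ?thesis .
    qed
    thus "\<exists>N. \<forall>m\<ge>N. \<forall>n\<ge>N. nsq (\<lambda>x. weak_grad (u m) i x - weak_grad (u n) i x) \<le> ennreal e" by blast
  qed
  then obtain g where g: "\<And>i. g i \<in> L2" "\<And>i e. e > 0 \<Longrightarrow> \<exists>N. \<forall>n\<ge>N. nsq (\<lambda>x. weak_grad (u n) i x - g i x) \<le> ennreal e" by metis
  have wp: "weak_partial i v (g i)" for i
    by (rule weak_partial_limit[of u v "\<lambda>n. weak_grad (u n) i" "g i"]) (auto intro: u H1_L2 weak_grad_spec g v)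
  have vH: "v \<in> H1" by (rule H1_I[OF v(1) g(1) wp])
  have "X \<longlonglongrightarrow> mk v"
  proof (rule LIMSEQ_I)
    fix r :: real assume r: "r > 0"
    \<comment> \<open>One error \<open>e\<close> for every partial derivative and one for the
      function itself; with \<open>e = r^2 / (2 D)\<close> they add up to
      \<open>r^2 / 2\<close>.\<close>
    define D where "D = real CARD('a) + 1"
    define e where "e = r\<^sup>2 / (2 * D)"
    have D: "D > 0" by (simp add: D_def add_nonneg_pos)
    have e: "e > 0" using r D by (simp add: e_def)
    obtain N0 where N0: "\<forall>n\<ge>N0. nsq (\<lambda>x. u n x - v x) \<le> ennreal e" using v(2)[OF e] by blast
    obtain Ni where Ni: "\<And>i n. n \<ge> Ni i \<Longrightarrow> nsq (\<lambda>x. weak_grad (u n) i x - g i x) \<le> ennreal e" using g(2)[OF e] by metis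
    define N where "N = Max (insert N0 (range Ni))"
    have "norm (X n - mk v) < r" if n: "n \<ge> N" for n
    proof -
      have NM: "j \<le> N" if "j \<in> insert N0 (range Ni)" for j unfolding N_def using that by (intro Max_ge) auto
      have n0: "n \<ge> N0" by (rule order_trans[OF NM n]) simp
      have ni: "n \<ge> Ni i" for i by (rule order_trans[OF NM n]) simp
      have wg: "nsq (weak_grad (\<lambda>x. u n x - v x) i) = nsq (\<lambda>x. weak_grad (u n) i x - g i x)" for i
      proof -
        have "ae_eq (weak_grad v i) (g i)" by (rule weak_grad_AE_eqI[OF vH g(1) wp])
        hence "ae_eq (\<lambda>x. weak_grad (u n) i x - weak_grad v i x) (\<lambda>x. weak_grad (u n) i x - g i x)"
          unfolding ae_eq_def by (elim eventually_mono) auto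
        from nsq_cong[OF this] show ?thesis using weak_grad_diff_nsq[OF u(1)[of n] vH, of i] by (rule trans[rotated])
      qed
      have "ennreal ((norm (X n - mk v))\<^sup>2) = gsq (\<lambda>x. u n x - v x) + nsq (\<lambda>x. u n x - v x)"
        using h1_norm_ennreal[OF H1_diff[OF u(1) vH]] by (simp add: u(2) mk_diff u(1) vH)
      also have "\<dots> \<le> (\<Sum>i\<in>(UNIV::'a set). ennreal e) + ennreal e"
        unfolding gsq_def wg using N0 n0 Ni ni by (intro add_mono sum_mono) auto
      also have "\<dots> = ennreal (D * e)" using e by (simp add: D_def distrib_right ennreal_mult ennreal_of_nat_eq_real_of_nat)
      finally have "(norm (X n - mk v))\<^sup>2 \<le> D * e" using D e by simp
      also have "\<dots> = r\<^sup>2 / 2" using D by (simp add: e_def)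
      also have "\<dots> < r\<^sup>2" using r by simp
      finally show ?thesis using r by (simp add: power_less_imp_less_base)
    qed
    thus "\<exists>no. \<forall>n\<ge>no. norm (X n - mk v) < r" by blast
  qed
  thus "convergent X" by (rule convergentI)
next
  fix x y z :: "'a h1" and b c :: complex and r :: real
  obtain u v w where uvw: "u \<in> H1" "x = mk u" "v \<in> H1" "y = mk v" "w \<in> H1" "z = mk w" by (metis h1_cases)
  note s = mk_add mk_scale H1_add H1_scale hin_mk hin_add hin_scale
  show "c *\<^sub>C (x + y) = c *\<^sub>C x + c *\<^sub>C y" using uvw by (simp add: s mk_cscale distrib_left)
  show "(b + c) *\<^sub>C x = b *\<^sub>C x + c *\<^sub>C x" using uvw by (simp add: s mk_cscale distrib_right)
  show "b *\<^sub>C c *\<^sub>C x = (b * c) *\<^sub>C x" using uvw by (simp add: s mk_cscale mult.assoc)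
  show "of_real r *\<^sub>C x = r *\<^sub>R x" by (simp add: cscale_h1_def scaleR_h1_def)
  show "cinner (x + y) z = cinner x z + cinner y z" using uvw by (simp add: cinner_h1_def s)
  show "cinner (c *\<^sub>C x) y = c * cinner x y" using uvw by (simp add: cinner_h1_def mk_cscale s)
  show "cinner x y = cnj (cinner y x)" unfolding cinner_h1_def by (rule hin_commute)
  show "Re (cinner x y) = inner x y" by (simp add: cinner_h1_def inner_h1_def)
qed

end

section \<open>The forms of the Schroedinger operator\<close>

definition Gf :: "'n::finite h1 \<Rightarrow> 'n h1 \<Rightarrow> complex" where
  "Gf x y = (\<Sum>i\<in>UNIV. L2_inner (weak_grad (rp x) i) (weak_grad (rp y) i))"

definition Lf :: "'n::finite h1 \<Rightarrow> 'n h1 \<Rightarrow> complex" where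
  "Lf x y = L2_inner (rp x) (rp y)"

definition Vf :: "(real^'n::finite \<Rightarrow> complex) \<Rightarrow> 'n h1 \<Rightarrow> 'n h1 \<Rightarrow> complex" where
  "Vf V x y = (\<integral>t. V t * rp x t * cnj (rp y t) \<partial>lborel)"

definition Vq :: "(real^'n::finite \<Rightarrow> complex) \<Rightarrow> 'n h1 \<Rightarrow> real" where
  "Vq V x = enn2real (Vsq V (rp x))"

lemma cinner_eq_forms: "cinner x y = Gf x y + Lf x y"
  by (simp add: cinner_h1_def hin_def Gf_def Lf_def)

lemma rp_add: "ae_eq (rp (x + y)) (\<lambda>t. rp x t + rp y t)"
  using rp_mk[OF H1_add[OF rp_H1[of x] rp_H1[of y]]] by (simp only: plus_h1_def)

lemma rp_cscale: "ae_eq (rp (c *\<^sub>C x)) (\<lambda>t. c * rp x t)"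
  using rp_mk[OF H1_scale[OF rp_H1[of x], of c]] by (simp only: cscale_h1_def)

lemma rp_zero: "ae_eq (rp 0) (\<lambda>t. 0)"
  using rp_mk[OF H1_zero] by (simp only: zero_h1_def)

lemma Lf_mk: "u \<in> H1 \<Longrightarrow> v \<in> H1 \<Longrightarrow> Lf (mk u) (mk v) = L2_inner u v"
  unfolding Lf_def by (intro L2_inner_cong) (auto intro: H1_L2 rp_H1 rp_mk)

lemma Gf_mk: "u \<in> H1 \<Longrightarrow> v \<in> H1 \<Longrightarrow> Gf (mk u) (mk v) = (\<Sum>i\<in>UNIV. L2_inner (weak_grad u i) (weak_grad v i))"
  unfolding Gf_def by (intro grad_inner_cong) (auto intro: rp_H1 rp_mk)

lemma L2_inner_rp_add_left: "g \<in> L2 \<Longrightarrow> L2_inner (rp (x + y)) g = L2_inner (rp x) g + L2_inner (rp y) g"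
  using L2_inner_cong[of "rp (x + y)" "\<lambda>t. rp x t + rp y t" g g] by (simp add: rp_L2 L2_add rp_add L2_inner_add_left)

lemma L2_inner_rp_cscale_left: "g \<in> L2 \<Longrightarrow> L2_inner (rp (c *\<^sub>C x)) g = c * L2_inner (rp x) g"
  using L2_inner_cong[of "rp (c *\<^sub>C x)" "\<lambda>t. c * rp x t" g g] by (simp add: rp_L2 L2_scale rp_cscale L2_inner_scale_left)

lemma Lf_add: "Lf (x + y) z = Lf x z + Lf y z" and Lf_scale: "Lf (c *\<^sub>C x) z = c * Lf x z"
  unfolding Lf_def by (simp_all add: L2_inner_rp_add_left L2_inner_rp_cscale_left rp_L2)

lemma Lf_commute: "Lf x y = cnj (Lf y x)"
  unfolding Lf_def by (rule L2_inner_commute)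

lemma Gf_commute: "Gf x y = cnj (Gf y x)"
  unfolding Gf_def using L2_inner_commute by (simp add: L2_inner_commute[symmetric])

lemma Gf_add: "Gf (x + y) z = Gf x z + Gf y z"
  using cinner_add_left[of x y z] by (simp add: cinner_eq_forms Lf_add algebra_simps)

lemma Gf_scale: "Gf (c *\<^sub>C x) z = c * Gf x z"
  using cinner_cscale_left[of c x z] by (simp add: cinner_eq_forms Lf_scale algebra_simps)

lemma nsq_rp: "nsq (rp x) = ennreal (Re (Lf x x))" and Lf_self: "Lf x x = of_real (Re (Lf x x))" and Lf_nonneg: "Re (Lf x x) \<ge> 0"
  unfolding Lf_def by (auto simp: nsq_L2_inner rp_L2 L2_inner_self)

lemma Gf_self: "Gf x x = of_real (Re (Gf x x))" and Gf_nonneg: "Re (Gf x x) \<ge> 0"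
  unfolding Gf_def by (auto simp: L2_inner_self intro!: sum_nonneg)

lemma gsq_rp: "gsq (rp x) = ennreal (Re (Gf x x))"
  unfolding gsq_def Gf_def by (simp add: nsq_L2_inner weak_grad_spec rp_H1 L2_inner_self)

lemma norm_sq_forms: "(norm x)\<^sup>2 = Re (Gf x x) + Re (Lf x x)"
  using cinner_self[of x] by (metis cinner_eq_forms Re_complex_of_real plus_complex.simps(1))

lemma Lf_definite: "Re (Lf x x) = 0 \<Longrightarrow> x = 0"
proof -
  assume "Re (Lf x x) = 0"
  hence "nsq (rp x) = 0" by (simp add: nsq_rp)
  hence "ae_eq (rp x) (\<lambda>t. 0)" unfolding ae_eq_def using AE_zero_iff_nsq[of "rp x"] rp_L2[of x] by (auto simp: L2_iff)
  hence "mk (rp x) = mk (\<lambda>t. 0)" by (subst mk_eq_iff) (auto intro: rp_H1)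
  thus ?thesis by (simp add: zero_h1_def)
qed

definition ipa :: "real \<Rightarrow> 'n::finite h1 \<Rightarrow> 'n h1 \<Rightarrow> complex" where
  "ipa a x y = Gf x y + of_real a * Lf x y"

lemma ipa_add: "ipa a (x + y) z = ipa a x z + ipa a y z" and ipa_scale: "ipa a (c *\<^sub>C x) z = c * ipa a x z"
  by (simp_all add: ipa_def Gf_add Lf_add Gf_scale Lf_scale algebra_simps)

lemma ipa_commute: "ipa a x y = cnj (ipa a y x)"
  unfolding ipa_def by (subst Gf_commute, subst Lf_commute) simp

lemma Re_ipa: "Re (ipa a x x) = Re (Gf x x) + a * Re (Lf x x)"
  by (simp add: ipa_def)

lemma ipa_pos: "a > 0 \<Longrightarrow> x \<noteq> 0 \<Longrightarrow> Re (ipa a x x) > 0"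
  using Lf_definite[of x] Lf_nonneg[of x] Gf_nonneg[of x] unfolding Re_ipa
  by (metis add_nonneg_pos less_eq_real_def mult_pos_pos)

lemma ipa_nonneg: "a > 0 \<Longrightarrow> Re (ipa a x x) \<ge> 0"
  unfolding Re_ipa using Lf_nonneg[of x] Gf_nonneg[of x] by simp

lemma esq_rp: "a > 0 \<Longrightarrow> esq (1 / sqrt a) (rp x) = ennreal (Re (ipa a x x))"
  unfolding esq_def Re_ipa using Lf_nonneg[of x] Gf_nonneg[of x]
  by (simp add: gsq_rp nsq_rp ennreal_mult ennreal_plus power_divide)

lemma esq_cong: assumes "u \<in> H1" "v \<in> H1" "ae_eq u v" shows "esq s u = esq s v"
proof -
  have "gsq u = gsq v" unfolding gsq_def using assms by (intro sum.cong refl nsq_cong weak_grad_cong)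
  thus ?thesis by (simp add: esq_def nsq_cong[OF assms(3)])
qed

lemma H1_sum_rp: "(\<lambda>t. \<Sum>j<(N::nat). c j * rp (e j) t) \<in> H1"
  by (induction N) (auto intro!: H1_add H1_scale rp_H1)

lemma mk_sum_rp: "mk (\<lambda>t. \<Sum>j<(N::nat). c j * rp (e j) t) = (\<Sum>j<N. c j *\<^sub>C e j)"
proof (induction N)
  case 0 show ?case by (simp add: zero_h1_def)
next
  case (Suc N)
  have "mk (\<lambda>t. (\<Sum>j<N. c j * rp (e j) t) + c N * rp (e N) t) = mk (\<lambda>t. \<Sum>j<N. c j * rp (e j) t) + mk (\<lambda>t. c N * rp (e N) t)"
    by (rule mk_add[symmetric, OF H1_sum_rp H1_scale[OF rp_H1]])
  thus ?case using Suc by (simp add: cscale_h1_def)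
qed

lemma Vsq_cong: "ae_eq u v \<Longrightarrow> Vsq V u = Vsq V v"
  unfolding Vsq_def ae_eq_def by (intro nn_integral_cong_AE) auto

definition famC :: "real \<Rightarrow> real \<Rightarrow> real" where
  "famC p d = (let W = 1 / (1 - 2 powr (- ((2 * p - d) / (2 * p)))) in (W * (1 + W)) powr p * ((16 * d) powr p * W))"

lemma famC_nonneg: assumes "p \<ge> 1" "2 * p > d" shows "famC p d \<ge> 0"
proof -
  have "2 powr (- ((2 * p - d) / (2 * p))) < 2 powr (0::real)" using assms by (intro powr_less_mono) auto
  thus ?thesis by (simp add: famC_def Let_def)
qed

section \<open>The form of a potential in \<open>L^p\<close>\<close>

locale schr_potential =
  fixes V :: "real^'n::finite \<Rightarrow> complex" and p :: real
  assumes p: "p \<ge> 1" "2 * p > real CARD('n)"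
    and Vm [measurable]: "V \<in> borel_measurable borel" and VI: "integrable lborel (\<lambda>x. norm (V x) powr p)"
begin

definition "I = (\<integral>x. norm (V x) powr p \<partial>lborel)"

lemma I_nonneg: "I \<ge> 0" unfolding I_def by (intro integral_nonneg_AE) auto

text \<open>\<open>family_bound\<close> at the length scale \<open>1 / sqrt a\<close>, which turns
  \<open>s powr (2 p - d)\<close> into \<open>a powr (d/2 - p)\<close>: large shifts make the
  potential small.\<close>

lemma h1_family_bound:
  fixes e :: "nat \<Rightarrow> 'n h1"
  assumes a: "a > 0" and b: "b > 0"
    and syn: "\<And>c. Re (ipa a (\<Sum>j<N. c j *\<^sub>C e j) (\<Sum>j<N. c j *\<^sub>C e j)) \<le> b\<^sup>2 * (\<Sum>j<N. (norm (c j))\<^sup>2)"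
  shows "\<And>j. j < N \<Longrightarrow> Vsq V (rp (e j)) < \<infinity>"
    and "(\<Sum>j<N. Vq V (e j) powr p) \<le> famC p (real CARD('n)) * b powr (2 * p) * a powr (real CARD('n) / 2 - p) * I"
proof -
  let ?s = "1 / sqrt a"
  have s: "?s > 0" using a by simp
  have syn': "esq ?s (\<lambda>t. \<Sum>j<N. c j * rp (e j) t) \<le> ennreal (b\<^sup>2 * (\<Sum>j<N. (norm (c j))\<^sup>2))" for c
  proof -
    have "ae_eq (rp (\<Sum>j<N. c j *\<^sub>C e j)) (\<lambda>t. \<Sum>j<N. c j * rp (e j) t)"
      unfolding mk_sum_rp[symmetric] by (rule rp_mk[OF H1_sum_rp])
    hence "esq ?s (\<lambda>t. \<Sum>j<N. c j * rp (e j) t) = esq ?s (rp (\<Sum>j<N. c j *\<^sub>C e j))"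
      by (intro esq_cong[symmetric] rp_H1 H1_sum_rp)
    also have "\<dots> = ennreal (Re (ipa a (\<Sum>j<N. c j *\<^sub>C e j) (\<Sum>j<N. c j *\<^sub>C e j)))" by (rule esq_rp[OF a])
    also have "\<dots> \<le> ennreal (b\<^sup>2 * (\<Sum>j<N. (norm (c j))\<^sup>2))" by (intro ennreal_leI syn)
    finally show ?thesis .
  qed
  note fb = family_bound[OF p Vm VI s b, of N "\<lambda>j. rp (e j)", OF rp_H1 syn' H1_sum_rp]
  show "\<And>j. j < N \<Longrightarrow> Vsq V (rp (e j)) < \<infinity>" by (rule fb(1))
  have "?s powr (2 * p - real CARD('n)) = a powr (real CARD('n) / 2 - p)"
  proof -
    have "?s = a powr (- (1/2))" using a by (simp add: powr_minus_divide powr_half_sqrt)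
    hence "?s powr (2 * p - real CARD('n)) = a powr (- (1/2) * (2 * p - real CARD('n)))" by (simp add: powr_powr)
    also have "- (1/2) * (2 * p - real CARD('n)) = real CARD('n) / 2 - p" by (simp add: field_simps)
    finally show ?thesis .
  qed
  thus "(\<Sum>j<N. Vq V (e j) powr p) \<le> famC p (real CARD('n)) * b powr (2 * p) * a powr (real CARD('n) / 2 - p) * I"
    using fb(2) unfolding Vq_def famC_def Let_def I_def by (simp only: mult_ac)
qed

lemma Vq_single:
  assumes a: "a > 0"
  shows "Vsq V (rp x) < \<infinity>" "Vq V x powr p \<le> famC p (real CARD('n)) * a powr (real CARD('n) / 2 - p) * I * (Re (ipa a x x)) powr p"
proof -
  have syn: "Re (ipa a (\<Sum>j<1. c j *\<^sub>C x) (\<Sum>j<1. c j *\<^sub>C x)) \<le> b\<^sup>2 * (\<Sum>j<1. (norm (c j))\<^sup>2)"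
    if b: "Re (ipa a x x) \<le> b\<^sup>2" for c :: "nat \<Rightarrow> complex" and b
  proof -
    have "ipa a (c 0 *\<^sub>C x) (c 0 *\<^sub>C x) = of_real ((norm (c 0))\<^sup>2) * ipa a x x"
      unfolding ipa_scale by (subst ipa_commute, subst ipa_scale) (use complex_norm_square[of "c 0"] in \<open>simp add: ipa_commute[symmetric]\<close>)
    hence "Re (ipa a (c 0 *\<^sub>C x) (c 0 *\<^sub>C x)) = (norm (c 0))\<^sup>2 * Re (ipa a x x)" by simp
    also have "\<dots> \<le> (norm (c 0))\<^sup>2 * b\<^sup>2" by (intro mult_left_mono b) auto
    finally show ?thesis by (simp add: mult.commute)
  qed
  \<comment> \<open>The summand 1 keeps \<open>b\<close> positive for \<open>x = 0\<close> as well;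
    finiteness is insensitive to it.\<close>
  define b where "b = sqrt (Re (ipa a x x) + 1)"
  have b: "b > 0" "Re (ipa a x x) \<le> b\<^sup>2" using ipa_nonneg[OF a, of x] by (auto simp: b_def)
  show fin: "Vsq V (rp x) < \<infinity>" using h1_family_bound(1)[OF a b(1) syn[OF b(2)], of 0] by simp
  show "Vq V x powr p \<le> famC p (real CARD('n)) * a powr (real CARD('n) / 2 - p) * I * (Re (ipa a x x)) powr p"
  proof (cases "x = 0")
    case True
    have "Vsq V (rp x) = Vsq V (\<lambda>t. 0)" unfolding True by (intro Vsq_cong rp_zero)
    hence "Vq V x = 0" by (simp add: Vq_def Vsq_def)
    thus ?thesis using p famC_nonneg[OF p] I_nonneg by simp
  next
    case False
    define r where "r = Re (ipa a x x)"
    have r: "r > 0" using ipa_pos[OF a False] by (simp add: r_def)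
    have b: "sqrt r > 0" "Re (ipa a x x) \<le> (sqrt r)\<^sup>2" using r by (auto simp: r_def)
    have "sqrt r powr (2 * p) = r powr p" using r by (simp add: powr_half_sqrt[symmetric] powr_powr)
    thus ?thesis using h1_family_bound(2)[OF a b(1) syn[OF b(2)]] by (simp add: r_def mult_ac)
  qed
qed

lemma Vsq_fin: "Vsq V (rp x) < \<infinity>" using Vq_single(1)[of 1] by simp

lemma Vsq_Vq: "Vsq V (rp x) = ennreal (Vq V x)" "Vq V x \<ge> 0"
  using Vsq_fin[of x] by (auto simp: Vq_def)

lemma V_integrable:
  fixes x y :: "'n h1"
  shows "integrable lborel (\<lambda>t. V t * rp x t * cnj (rp y t))"
    and "norm (Vf V x y)^2 \<le> Vq V x * Vq V y"
proof -
  have [measurable]: "rp z \<in> borel_measurable borel" for z :: "'n h1" using rp_L2[of z] by (auto simp: L2_iff)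
  have [measurable]: "(\<lambda>t. cnj (rp z t)) \<in> borel_measurable borel" for z :: "'n h1" using L2_cnj[OF rp_L2[of z]] by (auto simp: L2_iff)
  let ?N = "\<integral>\<^sup>+t. ennreal (norm (V t * rp x t * cnj (rp y t))) \<partial>lborel"
  have "?N\<^sup>2 = (\<integral>\<^sup>+t. ennreal (sqrt (norm (V t)) * norm (rp x t)) * ennreal (sqrt (norm (V t)) * norm (rp y t)) \<partial>lborel)\<^sup>2"
  proof -
    have "ennreal (norm (V t * rp x t * cnj (rp y t))) = ennreal (sqrt (norm (V t)) * norm (rp x t)) * ennreal (sqrt (norm (V t)) * norm (rp y t))" for t
    proof -
      have "(sqrt (norm (V t)) * norm (rp x t)) * (sqrt (norm (V t)) * norm (rp y t)) = (sqrt (norm (V t)) * sqrt (norm (V t))) * (norm (rp x t) * norm (rp y t))"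
        by (simp only: mult_ac)
      also have "\<dots> = norm (V t * rp x t * cnj (rp y t))" by (simp add: norm_mult)
      finally show ?thesis by (simp add: ennreal_mult[symmetric])
    qed
    thus ?thesis by simp
  qed
  also have "\<dots> \<le> (\<integral>\<^sup>+t. (ennreal (sqrt (norm (V t)) * norm (rp x t)))\<^sup>2 \<partial>lborel) * (\<integral>\<^sup>+t. (ennreal (sqrt (norm (V t)) * norm (rp y t)))\<^sup>2 \<partial>lborel)"
    by (rule Cauchy_Schwarz_nn_integral) measurable
  also have "\<dots> = Vsq V (rp x) * Vsq V (rp y)" unfolding Vsq_def by (simp add: ennreal_power power_mult_distrib)
  finally have N: "?N\<^sup>2 \<le> ennreal (Vq V x * Vq V y)" by (simp add: Vsq_Vq ennreal_mult[symmetric])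
  hence "?N\<^sup>2 < \<infinity>" by (auto intro: le_less_trans)
  hence "?N < \<infinity>" by (auto simp: power2_eq_square ennreal_mult_less_top)
  thus int: "integrable lborel (\<lambda>t. V t * rp x t * cnj (rp y t))" by (subst integrable_iff_bounded) auto
  have "ennreal (norm (Vf V x y)) \<le> ?N" unfolding Vf_def by (rule integral_norm_bound_ennreal[OF int])
  hence "ennreal ((norm (Vf V x y))\<^sup>2) \<le> ?N\<^sup>2" by (simp add: ennreal_power[symmetric] power_mono)
  hence "ennreal ((norm (Vf V x y))\<^sup>2) \<le> ennreal (Vq V x * Vq V y)" using N by (rule order_trans)
  thus "norm (Vf V x y)^2 \<le> Vq V x * Vq V y" using Vsq_Vq(2) by simp
qed

lemma Vf_mk:
  assumes "u \<in> H1" "v \<in> H1" shows "Vf V (mk u) (mk v) = (\<integral>t. V t * u t * cnj (v t) \<partial>lborel)"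
proof -
  have [measurable]: "u \<in> borel_measurable borel" "rp z \<in> borel_measurable borel"
     "(\<lambda>t. cnj (rp z t)) \<in> borel_measurable borel" "(\<lambda>t. cnj (v t)) \<in> borel_measurable borel" for z :: "'n h1"
    using rp_L2[of z] L2_cnj[OF rp_L2[of z]] H1_L2[OF assms(1)] L2_cnj[OF H1_L2[OF assms(2)]] by (auto simp: L2_iff)
  show ?thesis unfolding Vf_def
  proof (intro integral_cong_AE)
    show "AE t in lborel. V t * rp (mk u) t * cnj (rp (mk v) t) = V t * u t * cnj (v t)"
      using rp_mk[OF assms(1)] rp_mk[OF assms(2)] unfolding ae_eq_def by (elim eventually_elim2) auto
  qed measurable
qed

lemma Vf_add_left: "Vf V (x + y) z = Vf V x z + Vf V y z"
proof -
  have "Vf V (x + y) z = Vf V (mk (\<lambda>t. rp x t + rp y t)) (mk (rp z))" by (simp add: plus_h1_def)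
  also have "\<dots> = (\<integral>t. V t * rp x t * cnj (rp z t) + V t * rp y t * cnj (rp z t) \<partial>lborel)"
    by (subst Vf_mk) (auto intro!: H1_add rp_H1 simp: algebra_simps)
  also have "\<dots> = Vf V x z + Vf V y z" unfolding Vf_def by (intro Bochner_Integration.integral_add V_integrable)
  finally show ?thesis .
qed

lemma Vf_add_right: "Vf V z (x + y) = Vf V z x + Vf V z y"
proof -
  have "Vf V z (x + y) = Vf V (mk (rp z)) (mk (\<lambda>t. rp x t + rp y t))" by (simp add: plus_h1_def)
  also have "\<dots> = (\<integral>t. V t * rp z t * cnj (rp x t) + V t * rp z t * cnj (rp y t) \<partial>lborel)"
    by (subst Vf_mk) (auto intro!: H1_add rp_H1 simp: algebra_simps)
  also have "\<dots> = Vf V z x + Vf V z y" unfolding Vf_def by (intro Bochner_Integration.integral_add V_integrable)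
  finally show ?thesis .
qed

lemma Vf_scale_left: "Vf V (c *\<^sub>C x) z = c * Vf V x z"
proof -
  have "Vf V (c *\<^sub>C x) z = Vf V (mk (\<lambda>t. c * rp x t)) (mk (rp z))" by (simp add: cscale_h1_def)
  also have "\<dots> = (\<integral>t. c * (V t * rp x t * cnj (rp z t)) \<partial>lborel)"
    by (subst Vf_mk) (auto intro!: H1_scale rp_H1 simp: mult_ac)
  finally show ?thesis unfolding Vf_def by simp
qed

lemma Vf_scale_right: "Vf V z (c *\<^sub>C x) = cnj c * Vf V z x"
proof -
  have "Vf V z (c *\<^sub>C x) = Vf V (mk (rp z)) (mk (\<lambda>t. c * rp x t))" by (simp add: cscale_h1_def)
  also have "\<dots> = (\<integral>t. cnj c * (V t * rp z t * cnj (rp x t)) \<partial>lborel)"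
    by (subst Vf_mk) (auto intro!: H1_scale rp_H1 simp: mult_ac)
  finally show ?thesis unfolding Vf_def by simp
qed

lemma Vf_self_le: "norm (Vf V x x) \<le> Vq V x"
  using V_integrable(2)[of x x] Vsq_Vq(2)[of x] by (simp add: power2_eq_square[symmetric] power2_le_iff_abs_le)

lemma schr_form_mk: "u \<in> H1 \<Longrightarrow> v \<in> H1 \<Longrightarrow> schr_form V u v = Gf (mk u) (mk v) + Vf V (mk u) (mk v)"
  by (simp add: schr_form_def Gf_mk Vf_mk)

lemma Vq_scale: "Vq V (c *\<^sub>C x) = (norm c)\<^sup>2 * Vq V x"
proof -
  have [measurable]: "rp x \<in> borel_measurable borel" using rp_L2[of x] by (auto simp: L2_iff)
  have "Vsq V (rp (c *\<^sub>C x)) = Vsq V (\<lambda>t. c * rp x t)" by (intro Vsq_cong rp_cscale)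
  also have "\<dots> = (\<integral>\<^sup>+t. ennreal ((norm c)\<^sup>2) * ennreal (norm (V t) * (norm (rp x t))\<^sup>2) \<partial>lborel)"
    unfolding Vsq_def by (intro nn_integral_cong) (simp add: norm_mult power_mult_distrib ennreal_mult[symmetric] mult_ac)
  also have "\<dots> = ennreal ((norm c)\<^sup>2) * Vsq V (rp x)" unfolding Vsq_def by (intro nn_integral_cmult) measurable
  finally show ?thesis by (simp add: Vq_def enn2real_mult)
qed

lemma Vq_add: "Vq V (x + y) \<le> 2 * Vq V x + 2 * Vq V y"
proof -
  have [measurable]: "rp z \<in> borel_measurable borel" for z :: "'n h1" using rp_L2[of z] by (auto simp: L2_iff)
  have "Vsq V (rp (x + y)) = Vsq V (\<lambda>t. rp x t + rp y t)" by (intro Vsq_cong rp_add)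
  also have "\<dots> \<le> (\<integral>\<^sup>+t. 2 * ennreal (norm (V t) * (norm (rp x t))\<^sup>2) + 2 * ennreal (norm (V t) * (norm (rp y t))\<^sup>2) \<partial>lborel)"
    unfolding Vsq_def
  proof (rule nn_integral_mono)
    fix t
    have "(norm (rp x t + rp y t))\<^sup>2 \<le> (norm (rp x t) + norm (rp y t))\<^sup>2"
      by (intro power_mono norm_triangle_ineq) auto
    also have "\<dots> \<le> 2 * (norm (rp x t))\<^sup>2 + 2 * (norm (rp y t))\<^sup>2"
      using sum_squares_bound[of "norm (rp x t)" "norm (rp y t)"] by (simp add: power2_sum)
    finally have "norm (V t) * (norm (rp x t + rp y t))\<^sup>2 \<le> norm (V t) * (2 * (norm (rp x t))\<^sup>2 + 2 * (norm (rp y t))\<^sup>2)"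
      by (intro mult_left_mono) auto
    hence "ennreal (norm (V t) * (norm (rp x t + rp y t))\<^sup>2) \<le> ennreal (2 * (norm (V t) * (norm (rp x t))\<^sup>2) + 2 * (norm (V t) * (norm (rp y t))\<^sup>2))"
      by (intro ennreal_leI) (simp add: algebra_simps)
    thus "ennreal (norm (V t) * (norm (rp x t + rp y t))\<^sup>2) \<le> 2 * ennreal (norm (V t) * (norm (rp x t))\<^sup>2) + 2 * ennreal (norm (V t) * (norm (rp y t))\<^sup>2)"
      by (simp add: ennreal_mult)
  qed
  also have "\<dots> = 2 * Vsq V (rp x) + 2 * Vsq V (rp y)" unfolding Vsq_def by (simp add: nn_integral_add nn_integral_cmult)
  also have "\<dots> = ennreal (2 * Vq V x + 2 * Vq V y)" using Vsq_Vq by (simp add: ennreal_mult)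
  finally have "ennreal (Vq V (x + y)) \<le> ennreal (2 * Vq V x + 2 * Vq V y)" by (simp only: Vsq_Vq)
  thus ?thesis using Vsq_Vq(2)[of x] Vsq_Vq(2)[of y] by (subst (asm) ennreal_le_iff) auto
qed

end

section \<open>Trace bound for triangular flags\<close>

lemma ipa_cauchy_schwarz:
  fixes x y :: "'n::finite h1"
  shows "norm (Lf x y) \<le> sqrt (Re (Lf x x)) * sqrt (Re (Lf y y))"
proof -
  have [measurable]: "rp z \<in> borel_measurable borel" for z :: "'n h1" using rp_L2[of z] by (auto simp: L2_iff)
  have i: "integrable lborel (\<lambda>t. rp x t * cnj (rp y t))" by (intro L2_inner_integrable rp_L2)
  have "ennreal (norm (Lf x y)) \<le> (\<integral>\<^sup>+t. norm (rp x t * cnj (rp y t)) \<partial>lborel)"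
    unfolding Lf_def L2_inner_def by (rule integral_norm_bound_ennreal[OF i])
  also have "\<dots> = (\<integral>\<^sup>+t. norm (rp x t * rp y t) \<partial>lborel)" by (simp add: norm_mult)
  finally have "(ennreal (norm (Lf x y)))\<^sup>2 \<le> (\<integral>\<^sup>+t. norm (rp x t * rp y t) \<partial>lborel)\<^sup>2" by (rule power_mono) simp
  also have "\<dots> \<le> nsq (rp x) * nsq (rp y)" by (intro L2_inner_nsq_bound rp_L2)
  also have "\<dots> = ennreal (Re (Lf x x) * Re (Lf y y))" by (simp add: nsq_rp ennreal_mult Lf_nonneg)
  finally have "(norm (Lf x y))\<^sup>2 \<le> Re (Lf x x) * Re (Lf y y)"
    by (simp add: ennreal_power Lf_nonneg)
  hence "norm (Lf x y) \<le> sqrt (Re (Lf x x) * Re (Lf y y))" by (rule real_le_rsqrt)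
  thus ?thesis by (simp add: real_sqrt_mult)
qed

lemma Lf_le_norm: "Re (Lf x x) \<le> (norm x)\<^sup>2" "Re (Gf x x) \<le> (norm x)\<^sup>2"
  using norm_sq_forms[of x] Gf_nonneg[of x] Lf_nonneg[of x] by auto

lemma norm_Lf_le: "norm (Lf x y) \<le> norm x * norm y"
proof -
  have "sqrt (Re (Lf z z)) \<le> norm z" for z :: "'a h1" using Lf_le_norm(1)[of z] by (simp add: real_le_lsqrt)
  hence "sqrt (Re (Lf x x)) * sqrt (Re (Lf y y)) \<le> norm x * norm y" by (intro mult_mono) (auto simp: Lf_nonneg)
  thus ?thesis using ipa_cauchy_schwarz[of x y] by linarith
qed

lemma norm_Gf_le: "norm (Gf x y) \<le> 2 * norm x * norm y"
proof -
  have "Gf x y = cinner x y - Lf x y" by (simp add: cinner_eq_forms)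
  hence "norm (Gf x y) \<le> norm (cinner x y) + norm (Lf x y)" by (simp add: norm_triangle_ineq4)
  thus ?thesis using norm_cinner_le[of x y] norm_Lf_le[of x y] by linarith
qed

lemma Lf_add_right: "Lf z (x + y) = Lf z x + Lf z y" and Lf_scale_right: "Lf z (c *\<^sub>C x) = cnj c * Lf z x"
  by (metis Lf_add Lf_commute complex_cnj_add) (metis Lf_scale Lf_commute complex_cnj_mult)

lemma Gf_add_right: "Gf z (x + y) = Gf z x + Gf z y" and Gf_scale_right: "Gf z (c *\<^sub>C x) = cnj c * Gf z x"
  by (metis Gf_add Gf_commute complex_cnj_add) (metis Gf_scale Gf_commute complex_cnj_mult)

text \<open>The map \<open>1 / (z + a)\<close> takes \<open>[0, \<infinity>)\<close> onto
  \<open>(0, 1/a]\<close>, so \<open>t\<close> is the image of \<open>x = 1/t - a\<close>, with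
  \<open>t = 0\<close> standing for infinity. Distances change by the factor
  \<open>|E + a| (x + a)\<close>; the 6 is a 2 from \<open>|E + a| <= 2 a\<close> times a 3 for the
  factor \<open>x + a\<close>.\<close>

lemma delta_le_inverse_distance:
  assumes a: "a > 0" and E: "norm E \<le> a" "E + of_real a \<noteq> 0" and t: "0 \<le> t" "t \<le> 1 / a"
  shows "delta E \<le> 6 * a\<^sup>2 * norm (1 / (E + of_real a) - of_real t)"
proof -
  define D where "D = norm (E + of_real a)"
  have D: "D > 0" "D \<le> 2 * a" using E a norm_triangle_ineq[of E "of_real a"] by (auto simp: D_def)
  have dE: "delta E \<le> norm (E - of_real x)" if "x \<ge> 0" for x
    unfolding delta_def using infdist_le[of "of_real x" "complex_of_real ` {0..}" E] that by (auto simp: dist_norm)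
  have da: "delta E \<le> a" using dE[of 0] E by simp
  show ?thesis
  proof (cases "t = 0")
    case True
    have "norm (1 / (E + of_real a) - of_real t) = 1 / D" by (simp add: True D_def norm_divide)
    moreover have "a \<le> 6 * a\<^sup>2 * (1 / D)"
    proof -
      have "a * D \<le> a * (2 * a)" using D a by (intro mult_left_mono) auto
      also have "\<dots> \<le> 6 * a\<^sup>2" by (simp add: power2_eq_square)
      finally show ?thesis using D by (simp add: field_simps)
    qed
    ultimately show ?thesis using da by simp
  next
    case False
    define x where "x = 1 / t - a"
    have t0: "t > 0" using t False by simp
    have x: "x \<ge> 0" using t0 t a by (simp add: x_def field_simps)
    have tx: "t = 1 / (x + a)" by (simp add: x_def)
    have xa: "x + a > 0" using x a by simp
    have "1 / (E + of_real a) - of_real t = (of_real x - E) / ((E + of_real a) * of_real (x + a))"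
    proof -
      have nz: "of_real (x + a) \<noteq> (0::complex)" using xa by (simp del: of_real_add)
      have "1 / (E + of_real a) - 1 / of_real (x + a) = (of_real (x + a) - (E + of_real a)) / ((E + of_real a) * of_real (x + a))"
        using diff_frac_eq[OF E(2) nz, of 1 1] by (simp only: mult_1)
      thus ?thesis by (simp add: tx)
    qed
    hence n: "norm (1 / (E + of_real a) - of_real t) = norm (E - of_real x) / (D * (x + a))"
      using xa by (simp add: norm_divide norm_mult D_def norm_minus_commute del: of_real_add)
    \<comment> \<open>For \<open>x <= 2 a\<close> one has \<open>x + a <= 3 a\<close>. For larger
      \<open>x\<close> the distance from \<open>E\<close> to \<open>x\<close> is itself at least
      \<open>(x + a) / 3\<close>, while \<open>delta E <= norm E <= a\<close>.\<close>
    have k: "delta E * (x + a) \<le> 3 * a * norm (E - of_real x)"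
    proof (cases "x \<le> 2 * a")
      case True
      have "delta E * (x + a) \<le> norm (E - of_real x) * (3 * a)"
        using dE[OF x] True xa by (intro mult_mono) auto
      thus ?thesis by (simp add: mult_ac)
    next
      case False
      have "x \<le> norm (E - of_real x) + norm E" using norm_triangle_ineq3[of "of_real x" E] norm_triangle_ineq2[of "of_real x" E] x by (simp add: norm_minus_commute)
      hence "x + a \<le> 3 * norm (E - of_real x)" using False E by linarith
      hence "a * (x + a) \<le> a * (3 * norm (E - of_real x))" using a by (intro mult_left_mono) auto
      moreover have "delta E * (x + a) \<le> a * (x + a)" using da xa by (intro mult_right_mono) auto
      ultimately show ?thesis by (simp add: mult_ac)
    qed
    have "delta E * (D * (x + a)) \<le> D * (3 * a * norm (E - of_real x))" using mult_left_mono[OF k, of D] D by (simp add: mult_ac)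
    also have "\<dots> \<le> (2 * a) * (3 * a * norm (E - of_real x))" using D a by (intro mult_right_mono) auto
    finally have "delta E \<le> (2 * a) * (3 * a * norm (E - of_real x)) / (D * (x + a))"
      using D xa by (subst pos_le_divide_eq) auto
    thus ?thesis unfolding n by (simp add: power2_eq_square)
  qed
qed

text \<open>The smallness condition is the one that \<open>Vq_single\<close> turns into a relative
  form bound 1/2 of the potential with respect to \<open>ipa a\<close>; it makes the form of
  \<open>H + a\<close> coercive.\<close>

locale schr_shift = schr_potential V p for V :: "real^'n::finite \<Rightarrow> complex" and p +
  fixes a :: real
  assumes a: "a > 0" and small: "famC p (real CARD('n)) * a powr (real CARD('n) / 2 - p) * I \<le> (1 / 2) powr p"
begin

lemma Vq_half: "Vq V x \<le> 1 / 2 * Re (ipa a x x)"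
proof -
  have "Vq V x powr p \<le> (1 / 2) powr p * (Re (ipa a x x)) powr p"
    using Vq_single(2)[OF a, of x] small by (meson mult_right_mono order_trans powr_ge_zero)
  also have "\<dots> = (1 / 2 * Re (ipa a x x)) powr p" by (rule powr_mult[symmetric])
  finally have le: "Vq V x powr p \<le> (1 / 2 * Re (ipa a x x)) powr p" .
  show ?thesis
  proof (rule ccontr)
    assume "\<not> ?thesis"
    hence "(1 / 2 * Re (ipa a x x)) powr p < Vq V x powr p"
      using p ipa_nonneg[OF a, of x] by (intro powr_less_mono2) auto
    thus False using le by simp
  qed
qed

section \<open>The shifted form and its inverse\<close>

definition ba :: "'n h1 \<Rightarrow> 'n h1 \<Rightarrow> complex" where "ba x y = ipa a x y + Vf V x y"

definition "m0 = min 1 a"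

lemma m0: "m0 > 0" "m0 * (norm x)\<^sup>2 \<le> Re (ipa a x x)" "Re (ipa a x x) \<le> (1 + a) * (norm x)\<^sup>2"
proof -
  show "m0 > 0" using a by (simp add: m0_def)
  have "m0 * Re (Gf x x) \<le> 1 * Re (Gf x x)" "m0 * Re (Lf x x) \<le> a * Re (Lf x x)"
    by (intro mult_right_mono; simp add: m0_def Gf_nonneg Lf_nonneg)+
  thus "m0 * (norm x)\<^sup>2 \<le> Re (ipa a x x)" unfolding norm_sq_forms Re_ipa distrib_left by linarith
  show "Re (ipa a x x) \<le> (1 + a) * (norm x)\<^sup>2"
    unfolding norm_sq_forms Re_ipa using a Gf_nonneg[of x] Lf_nonneg[of x] by (simp add: algebra_simps)
qed

lemma Vf_bound: "norm (Vf V x y) \<le> (1 + a) * norm x * norm y"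
proof -
  have q: "Vq V z \<le> (1 + a) * (norm z)\<^sup>2" for z
    using Vq_half[of z] m0(3)[of z] ipa_nonneg[OF a, of z] by linarith
  have "(norm (Vf V x y))\<^sup>2 \<le> ((1 + a) * (norm x)\<^sup>2) * ((1 + a) * (norm y)\<^sup>2)"
    using V_integrable(2)[of x y] mult_mono[OF q[of x] q[of y]] Vsq_Vq(2) a by fastforce
  also have "\<dots> = ((1 + a) * norm x * norm y)\<^sup>2" by (simp add: power2_eq_square mult_ac)
  finally show ?thesis using a by (simp add: power2_le_iff_abs_le)
qed

lemma ba_forms:
  "ba (x + y) z = ba x z + ba y z" "ba z (x + y) = ba z x + ba z y"
  "ba (c *\<^sub>C x) z = c * ba x z" "ba z (c *\<^sub>C x) = cnj c * ba z x"
  "norm (ba x y) \<le> (3 + 2 * a) * norm x * norm y" "Re (ba x x) \<ge> m0 / 2 * (norm x)\<^sup>2"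
proof -
  show "ba (x + y) z = ba x z + ba y z" "ba z (x + y) = ba z x + ba z y"
    "ba (c *\<^sub>C x) z = c * ba x z" "ba z (c *\<^sub>C x) = cnj c * ba z x"
    unfolding ba_def ipa_def
    by (simp_all add: Gf_add Lf_add Gf_scale Lf_scale Gf_add_right Lf_add_right Gf_scale_right Lf_scale_right
       Vf_add_left Vf_add_right Vf_scale_left Vf_scale_right algebra_simps)
  have "norm (ba x y) \<le> norm (Gf x y) + norm (of_real a * Lf x y) + norm (Vf V x y)"
    unfolding ba_def ipa_def by (intro norm_triangle_le add_mono norm_triangle_ineq order_refl)
  also have "norm (of_real a * Lf x y) \<le> a * (norm x * norm y)" using a norm_Lf_le[of x y] by (simp add: norm_mult)
  finally show "norm (ba x y) \<le> (3 + 2 * a) * norm x * norm y"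
    using norm_Gf_le[of x y] Vf_bound[of x y] by (simp add: algebra_simps)
  have "Re (Vf V x x) \<ge> - Vq V x" using Vf_self_le[of x] abs_Re_le_cmod[of "Vf V x x"] by linarith
  thus "Re (ba x x) \<ge> m0 / 2 * (norm x)\<^sup>2" unfolding ba_def using Vq_half[of x] m0(2)[of x] by simp
qed

definition Fa :: "'n h1 \<Rightarrow> 'n h1" where "Fa = (SOME T. bclinear T \<and> (\<forall>x y. cinner (T x) y = ba x y))"

lemma Fa: "bclinear Fa" "cinner (Fa x) y = ba x y"
proof -
  have "\<exists>T. bclinear T \<and> (\<forall>x y. cinner (T x) y = ba x y)" by (rule form_operator[OF ba_forms(1-5)])
  from someI_ex[OF this] show "bclinear Fa" "cinner (Fa x) y = ba x y" by (auto simp: Fa_def)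
qed

lemma bij_Fa: "bij Fa"
proof (rule lax_milgram[OF bclinearD(6)[OF Fa(1)]])
  show "m0 / 2 > 0" using m0 by simp
  show "inner (Fa u) u \<ge> m0 / 2 * (norm u)\<^sup>2" for u
    unfolding Re_cinner[symmetric] Fa(2) by (rule ba_forms)
qed

lemma ba_unique: assumes "\<And>y. ba x y = ba x' y" shows "x = x'"
proof -
  have "Fa x = Fa x'" by (rule cinner_eqI) (simp only: Fa(2) assms)
  thus ?thesis using bij_is_inj[OF bij_Fa] by (simp add: inj_eq)
qed

text \<open>The weak solution \<open>(H + a)^-1 f\<close> for \<open>f\<close> in
  \<open>L^2\<close>; \<open>K\<close> is the same map fed with elements of \<open>H^1\<close>, so
  that it acts inside a single Hilbert space.\<close>

definition kvec :: "(real^'n \<Rightarrow> complex) \<Rightarrow> 'n h1" where "kvec f = (SOME k. \<forall>y. ba k y = L2_inner f (rp y))"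

lemma L2_inner_rp_bound: "f \<in> L2 \<Longrightarrow> norm (L2_inner f (rp y)) \<le> sqrt (\<integral>x. (norm (f x))\<^sup>2 \<partial>lborel) * norm y"
proof -
  assume f: "f \<in> L2"
  have i: "integrable lborel (\<lambda>t. f t * cnj (rp y t))" by (intro L2_inner_integrable rp_L2 f)
  have "ennreal (norm (L2_inner f (rp y))) \<le> (\<integral>\<^sup>+t. norm (f t * cnj (rp y t)) \<partial>lborel)"
    unfolding L2_inner_def by (rule integral_norm_bound_ennreal[OF i])
  also have "\<dots> = (\<integral>\<^sup>+t. norm (f t * rp y t) \<partial>lborel)" by (simp add: norm_mult)
  finally have "(ennreal (norm (L2_inner f (rp y))))\<^sup>2 \<le> (\<integral>\<^sup>+t. norm (f t * rp y t) \<partial>lborel)\<^sup>2" by (rule power_mono) simp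
  also have "\<dots> \<le> nsq f * nsq (rp y)" by (intro L2_inner_nsq_bound rp_L2 f)
  also have "\<dots> = ennreal ((\<integral>x. (norm (f x))\<^sup>2 \<partial>lborel) * Re (Lf y y))" by (simp add: nsq_rp nsq_eq f ennreal_mult Lf_nonneg)
  finally have "(norm (L2_inner f (rp y)))\<^sup>2 \<le> (\<integral>x. (norm (f x))\<^sup>2 \<partial>lborel) * Re (Lf y y)"
    by (simp add: ennreal_power Lf_nonneg)
  also have "\<dots> \<le> (\<integral>x. (norm (f x))\<^sup>2 \<partial>lborel) * (norm y)\<^sup>2" by (intro mult_left_mono Lf_le_norm) auto
  finally have "norm (L2_inner f (rp y)) \<le> sqrt ((\<integral>x. (norm (f x))\<^sup>2 \<partial>lborel) * (norm y)\<^sup>2)" by (rule real_le_rsqrt)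
  thus ?thesis by (simp add: real_sqrt_mult)
qed

lemma L2_representer: assumes f: "f \<in> L2" shows "\<exists>k. \<forall>y. cinner k y = L2_inner f (rp y)"
proof (rule criesz_representation)
  have c: "L2_inner f (rp z) = cnj (L2_inner (rp z) f)" for z by (rule L2_inner_commute)
  show "L2_inner f (rp (x + y)) = L2_inner f (rp x) + L2_inner f (rp y)" for x y
    unfolding c by (simp add: L2_inner_rp_add_left f)
  show "L2_inner f (rp (k *\<^sub>C x)) = cnj k * L2_inner f (rp x)" for k x
    unfolding c by (simp add: L2_inner_rp_cscale_left f)
  show "norm (L2_inner f (rp y)) \<le> sqrt (\<integral>x. (norm (f x))\<^sup>2 \<partial>lborel) * norm y" for y by (rule L2_inner_rp_bound[OF f])
qed

lemma kvec: assumes "f \<in> L2" shows "ba (kvec f) y = L2_inner f (rp y)"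
proof -
  obtain k where k: "\<And>y. cinner k y = L2_inner f (rp y)" using L2_representer[OF assms] by blast
  obtain x where "Fa x = k" using bij_Fa by (metis bij_pointE)
  hence "\<exists>k. \<forall>y. ba k y = L2_inner f (rp y)" using k Fa(2) by metis
  from someI_ex[OF this] show ?thesis by (simp add: kvec_def)
qed

definition K :: "'n h1 \<Rightarrow> 'n h1" where "K x = kvec (rp x)"

lemma ba_K: "ba (K x) y = Lf x y"
  unfolding K_def Lf_def by (rule kvec[OF rp_L2])

lemma bclinear_K: "bclinear K"
proof (rule bclinearI[where B="2 / m0"])
  show "K (x + y) = K x + K y" for x y by (rule ba_unique) (simp add: ba_forms ba_K Lf_add)
  show "K (c *\<^sub>C x) = c *\<^sub>C K x" for c x by (rule ba_unique) (simp add: ba_forms ba_K Lf_scale)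
  fix x
  have "m0 / 2 * (norm (K x))\<^sup>2 \<le> Re (ba (K x) (K x))" by (rule ba_forms)
  also have "\<dots> \<le> norm x * norm (K x)" unfolding ba_K using abs_Re_le_cmod[of "Lf x (K x)"] norm_Lf_le[of x "K x"] by linarith
  finally have "(m0 / 2 * norm (K x)) * norm (K x) \<le> norm x * norm (K x)" by (simp add: power2_eq_square)
  hence "m0 / 2 * norm (K x) \<le> norm x" by (cases "K x = 0") (auto dest: mult_right_le_imp_le)
  thus "norm (K x) \<le> norm x * (2 / m0)" using m0(1) by (simp add: field_simps)
qed

text \<open>Coercivity loses a factor 2 and each of the two passages from the \<open>L^2\<close>
  norm to the form norm gains \<open>1 / sqrt a\<close>, so \<open>K\<close> has norm at most
  \<open>2 / a\<close> for \<open>ipa a\<close>. This is the bound \<open>b\<close> for the family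
  \<open>K e j\<close>.\<close>

lemma K_ipa_bound:
  "Re (ipa a (K y) (K y)) \<le> (2 / a)\<^sup>2 * Re (ipa a y y)"
proof -
  let ?w = "K y"
  define A where "A = Re (ipa a ?w ?w)"
  have A0: "A \<ge> 0" unfolding A_def by (rule ipa_nonneg[OF a])
  have LA: "Re (Lf z z) \<le> Re (ipa a z z) / a" for z
    unfolding Re_ipa using a Gf_nonneg[of z] by (simp add: field_simps)
  have "Re (ba ?w ?w) = A + Re (Vf V ?w ?w)" by (simp add: ba_def A_def)
  moreover have "Re (Vf V ?w ?w) \<ge> - Vq V ?w" using Vf_self_le[of ?w] abs_Re_le_cmod[of "Vf V ?w ?w"] by linarith
  ultimately have "A / 2 \<le> Re (ba ?w ?w)" using Vq_half[of ?w] unfolding A_def by linarith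
  also have "\<dots> \<le> norm (Lf y ?w)" unfolding ba_K by (rule complex_Re_le_cmod)
  also have "\<dots> \<le> sqrt (Re (Lf y y)) * sqrt (Re (Lf ?w ?w))" by (rule ipa_cauchy_schwarz)
  also have "\<dots> \<le> sqrt (Re (ipa a y y) / a) * sqrt (A / a)" unfolding A_def
    using LA by (intro mult_mono real_sqrt_le_mono) (auto simp: Lf_nonneg ipa_nonneg[OF a] less_imp_le[OF a])
  finally have "(A / 2)\<^sup>2 \<le> (sqrt (Re (ipa a y y) / a) * sqrt (A / a))\<^sup>2" using A0 by (intro power_mono) auto
  also have "\<dots> = (Re (ipa a y y) / a) * (A / a)" using A0 a ipa_nonneg[OF a, of y] by (simp add: power_mult_distrib)
  finally have "A * A \<le> ((2 / a)\<^sup>2 * Re (ipa a y y)) * A" by (simp add: power2_eq_square field_simps)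
  thus ?thesis unfolding A_def[symmetric] using A0 ipa_nonneg[OF a, of y] by (cases "A = 0") (auto dest: mult_right_le_imp_le)
qed

text \<open>The \<open>4 powr p\<close> belongs to the family \<open>K e j\<close>, whose synthesis
  bound is \<open>2 / a\<close>; the 1 belongs to the orthonormal family \<open>e j\<close>
  itself.\<close>

definition "traceC = famC p (real CARD('n)) * (4 powr p + 1)"

lemma ipa_sum_orthonormal:
  fixes N :: nat
  assumes "\<And>i j. i < N \<Longrightarrow> j < N \<Longrightarrow> ipa a (e i) (e j) = (if i = j then 1 else 0)"
  shows "Re (ipa a (\<Sum>j<N. c j *\<^sub>C e j) (\<Sum>j<N. c j *\<^sub>C e j)) = (\<Sum>j<N. (norm (c j))\<^sup>2)"
proof -
  have z: "ipa a 0 y = 0" for y using ipa_scale[of a 0 0 y] by simp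
  have sl: "ipa a (\<Sum>j\<in>J. f j) y = (\<Sum>j\<in>J. ipa a (f j) y)" for J f y
    by (induction J rule: infinite_finite_induct) (auto simp: ipa_add z)
  have "ipa a (e i) (\<Sum>j<N. c j *\<^sub>C e j) = cnj (c i)" if i: "i < N" for i
  proof -
    have "ipa a (\<Sum>j<N. c j *\<^sub>C e j) (e i) = (\<Sum>j<N. if j = i then c j else 0)"
      unfolding sl ipa_scale using assms i by (intro sum.cong) auto
    also have "\<dots> = c i" using i by simp
    finally show ?thesis by (subst ipa_commute) simp
  qed
  hence "ipa a (\<Sum>j<N. c j *\<^sub>C e j) (\<Sum>j<N. c j *\<^sub>C e j) = (\<Sum>j<N. c j * cnj (c j))"
    unfolding sl ipa_scale by (intro sum.cong) auto
  also have "\<dots> = of_real (\<Sum>j<N. (norm (c j))\<^sup>2)" unfolding of_real_sum complex_norm_square ..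
  finally show ?thesis by simp
qed

text \<open>On a basis that is orthonormal for \<open>ipa a\<close> and triangularises \<open>K\<close>, the diagonal entry \<open>l\<close> of \<open>K\<close>
  satisfies \<open>l + Vf (K e) e = \<parallel>e\<parallel>\<^sup>2\<close>, so its distance to \<open>[0, 1/a]\<close> is controlled by the potential.\<close>
lemma flag_trace_bound:
  assumes fs: "flag K fs"
  shows "\<exists>t. (\<forall>i<length fs. 0 \<le> t i \<and> t i \<le> 1 / a) \<and>
    (\<Sum>i<length fs. norm (snd (rev fs ! i) - of_real (t i)) powr p) \<le> traceC * a powr (real CARD('n) / 2 - 2 * p) * I"
proof -
  define N where "N = length fs"
  obtain e where e: "\<And>i j. i < N \<Longrightarrow> j < N \<Longrightarrow> ipa a (e i) (e j) = (if i = j then 1 else 0)"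
     "\<And>i. i < N \<Longrightarrow> K (e i) - snd (rev fs ! i) *\<^sub>C e i \<in> cspan (e ` {..<i})"
    using orthonormal_flag_basis[of "ipa a" K fs, OF ipa_add ipa_scale ipa_commute ipa_pos[OF a] bclinear_K fs]
    unfolding N_def by auto
  define l where "l i = snd (rev fs ! i)" for i
  define t where "t i = Re (Lf (e i) (e i))" for i
  define g where "g i = K (e i)" for i
  have z: "ipa a 0 y = 0" for y using ipa_scale[of a 0 0 y] by simp
  have lt: "l i - of_real (t i) = - Vf V (g i) (e i)" and t01: "0 \<le> t i \<and> t i \<le> 1 / a" if i: "i < N" for i
  proof -
    have orth: "ipa a x (e i) = 0" if "x \<in> cspan (e ` {..<i})" for x using that
    proof (induction rule: cvs.span_induct_alt)
      case (step c x y)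
      then obtain j where "j < i" "x = e j" by auto
      thus ?case using step e(1)[of j i] i by (simp add: ipa_add ipa_scale)
    qed (rule z)
    have "ipa a (g i) (e i) = ipa a ((g i - l i *\<^sub>C e i) + l i *\<^sub>C e i) (e i)" by simp
    also have "\<dots> = ipa a (g i - l i *\<^sub>C e i) (e i) + l i * ipa a (e i) (e i)" by (simp only: ipa_add ipa_scale)
    also have "\<dots> = l i" using orth[OF e(2)[OF i]] e(1)[OF i i] by (simp add: g_def l_def)
    finally have "l i + Vf V (g i) (e i) = of_real (t i)"
      using ba_K[of "e i" "e i"] Lf_self[of "e i"] by (simp add: ba_def g_def t_def)
    thus "l i - of_real (t i) = - Vf V (g i) (e i)" by (simp add: algebra_simps eq_neg_iff_add_eq_0)
    have "Re (ipa a (e i) (e i)) = 1" using e(1)[OF i i] by simp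
    thus "0 \<le> t i \<and> t i \<le> 1 / a" using Lf_nonneg[of "e i"] Gf_nonneg[of "e i"] a
      unfolding Re_ipa t_def by (simp add: field_simps)
  qed
  let ?d = "real CARD('n)"
  let ?c = "famC p ?d"
  have sumsq: "Re (ipa a (\<Sum>j<N. c j *\<^sub>C e j) (\<Sum>j<N. c j *\<^sub>C e j)) = (\<Sum>j<N. (norm (c j))\<^sup>2)" for c
    by (rule ipa_sum_orthonormal) (use e(1) in auto)
  have E1: "(\<Sum>j<N. Vq V (e j) powr p) \<le> ?c * a powr (?d / 2 - p) * I"
    using h1_family_bound(2)[OF a, where b=1 and N=N and e=e] sumsq by simp
  have E2: "(\<Sum>j<N. Vq V (g j) powr p) \<le> ?c * (2 / a) powr (2 * p) * a powr (?d / 2 - p) * I"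
  proof (rule h1_family_bound(2)[OF a])
    show "2 / a > 0" using a by simp
    fix c
    have Ks: "(\<Sum>j<N. c j *\<^sub>C g j) = K (\<Sum>j<N. c j *\<^sub>C e j)"
      unfolding g_def by (induction N) (auto simp: bclinearD[OF bclinear_K])
    show "Re (ipa a (\<Sum>j<N. c j *\<^sub>C g j) (\<Sum>j<N. c j *\<^sub>C g j)) \<le> (2 / a)\<^sup>2 * (\<Sum>j<N. (norm (c j))\<^sup>2)"
      unfolding Ks using K_ipa_bound[of "\<Sum>j<N. c j *\<^sub>C e j"] by (simp only: sumsq)
  qed
  \<comment> \<open>The energy of \<open>K e i\<close> is smaller than that of \<open>e i\<close> by
    a factor of order \<open>1/a^2\<close>, so the weights \<open>a\<close> and \<open>1/a\<close>
    balance the two factors of Cauchy--Schwarz. The geometric mean is at most the maximum, whose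
    \<open>p\<close>-th power is at most the sum of the \<open>p\<close>-th powers.\<close>
  have each: "norm (l i - of_real (t i)) powr p \<le> a powr p * Vq V (g i) powr p + a powr (- p) * Vq V (e i) powr p" if i: "i < N" for i
  proof -
    have "norm (l i - of_real (t i)) = norm (Vf V (g i) (e i))" unfolding lt[OF i] by simp
    also have "\<dots> \<le> max (a * Vq V (g i)) (Vq V (e i) / a)"
    proof -
      let ?m = "max (a * Vq V (g i)) (Vq V (e i) / a)"
      have "(norm (Vf V (g i) (e i)))\<^sup>2 \<le> (a * Vq V (g i)) * (Vq V (e i) / a)" using V_integrable(2)[of "g i" "e i"] a by simp
      also have "\<dots> \<le> ?m * ?m" using Vsq_Vq(2)[of "g i"] Vsq_Vq(2)[of "e i"] a by (intro mult_mono) (auto simp: le_max_iff_disj)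
      finally have "(norm (Vf V (g i) (e i)))\<^sup>2 \<le> ?m\<^sup>2" by (simp add: power2_eq_square)
      moreover have "?m \<ge> 0" using Vsq_Vq(2)[of "g i"] a by (simp add: le_max_iff_disj)
      ultimately show ?thesis by (simp add: power2_le_iff_abs_le)
    qed
    finally have "norm (l i - of_real (t i)) powr p \<le> (max (a * Vq V (g i)) (Vq V (e i) / a)) powr p"
      using p by (intro powr_mono2) auto
    also have "\<dots> \<le> (a * Vq V (g i)) powr p + (Vq V (e i) / a) powr p" by (auto simp: max_def)
    also have "(a * Vq V (g i)) powr p = a powr p * Vq V (g i) powr p" by (rule powr_mult)
    also have "(Vq V (e i) / a) powr p = a powr (- p) * Vq V (e i) powr p"
      using a Vsq_Vq(2)[of "e i"] by (simp add: powr_divide powr_minus_divide)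
    finally show ?thesis .
  qed
  have "(\<Sum>i<N. norm (l i - of_real (t i)) powr p) \<le> (\<Sum>i<N. a powr p * Vq V (g i) powr p + a powr (- p) * Vq V (e i) powr p)"
    by (intro sum_mono each) auto
  also have "\<dots> = a powr p * (\<Sum>i<N. Vq V (g i) powr p) + a powr (- p) * (\<Sum>i<N. Vq V (e i) powr p)"
    by (simp add: sum.distrib sum_distrib_left)
  also have "\<dots> \<le> a powr p * (?c * (2 / a) powr (2 * p) * a powr (?d / 2 - p) * I) + a powr (- p) * (?c * a powr (?d / 2 - p) * I)"
    by (intro add_mono mult_left_mono E1 E2) auto
  also have "\<dots> = traceC * a powr (?d / 2 - 2 * p) * I"
  proof -
    have "(2 / a) powr (2 * p) = 4 powr p * a powr (- 2 * p)"
    proof -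
      have "(2 / a) powr (2 * p) = 2 powr (2 * p) / a powr (2 * p)" using a by (simp add: powr_divide)
      also have "2 powr (2 * p) = (2 powr 2) powr p" by (rule powr_powr[symmetric])
      finally show ?thesis by (simp add: powr_minus_divide)
    qed
    hence "a powr p * (?c * (2 / a) powr (2 * p) * a powr (?d / 2 - p) * I) = ?c * 4 powr p * (a powr p * a powr (- 2 * p) * a powr (?d / 2 - p)) * I"
      by (simp only: mult_ac)
    also have "a powr p * a powr (- 2 * p) * a powr (?d / 2 - p) = a powr (?d / 2 - 2 * p)"
      unfolding powr_add[symmetric] by (rule arg_cong[of _ _ "(powr) a"]) simp
    finally have 1: "a powr p * (?c * (2 / a) powr (2 * p) * a powr (?d / 2 - p) * I) = ?c * 4 powr p * a powr (?d / 2 - 2 * p) * I" .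
    have "a powr (- p) * a powr (?d / 2 - p) = a powr (?d / 2 - 2 * p)"
      unfolding powr_add[symmetric] by (rule arg_cong[of _ _ "(powr) a"]) simp
    hence 2: "a powr (- p) * (?c * a powr (?d / 2 - p) * I) = ?c * a powr (?d / 2 - 2 * p) * I"
      by (metis mult.assoc mult.commute)
    show ?thesis unfolding 1 2 traceC_def by (simp add: algebra_simps)
  qed
  finally show ?thesis using t01 unfolding N_def l_def by (intro exI[of _ t]) auto
qed

text \<open>The factor \<open>6 a^2\<close> per eigenvalue becomes \<open>a powr (2 p)\<close>,
  which cancels against \<open>a powr (d/2 - 2 p)\<close> from the trace bound and leaves
  \<open>a powr (d/2)\<close>. The list \<open>Es\<close> may repeat an eigenvalue, as algebraic
  multiplicities demand.\<close>

lemma flag_delta_bound: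
  assumes fs: "flag K fs" and sn: "map snd fs = map (\<lambda>E. 1 / (E + of_real a)) Es"
    and Es: "\<And>E. E \<in> set Es \<Longrightarrow> norm E \<le> a \<and> E + of_real a \<noteq> 0"
  shows "(\<Sum>E\<leftarrow>Es. delta E powr p) \<le> 6 powr p * traceC * a powr (real CARD('n) / 2) * I"
proof -
  define N where "N = length fs"
  have len: "length Es = N" using sn by (metis length_map N_def)
  obtain t where t: "\<And>i. i < N \<Longrightarrow> 0 \<le> t i \<and> t i \<le> 1 / a"
    "(\<Sum>i<N. norm (snd (rev fs ! i) - of_real (t i)) powr p) \<le> traceC * a powr (real CARD('n) / 2 - 2 * p) * I"
    using flag_trace_bound[OF fs] unfolding N_def by blast
  have rn: "snd (rev fs ! i) = 1 / (rev Es ! i + of_real a)" if "i < N" for i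
  proof -
    have "map snd (rev fs) ! i = map (\<lambda>E. 1 / (E + of_real a)) (rev Es) ! i" unfolding rev_map[symmetric] sn ..
    thus ?thesis using that len by (simp add: N_def)
  qed
  have "(\<Sum>E\<leftarrow>Es. delta E powr p) = (\<Sum>E\<leftarrow>rev Es. delta E powr p)" by (simp add: rev_map[symmetric])
  also have "\<dots> = (\<Sum>i<N. delta (rev Es ! i) powr p)"
    by (simp add: sum_list_sum_nth len atLeast0LessThan)
  also have "\<dots> \<le> (\<Sum>i<N. (6 * a\<^sup>2) powr p * norm (snd (rev fs ! i) - of_real (t i)) powr p)"
  proof (rule sum_mono)
    fix i assume "i \<in> {..<N}"
    hence i: "i < N" by simp
    have "rev Es ! i \<in> set Es" using i len by (metis length_rev nth_mem set_rev)
    hence "delta (rev Es ! i) \<le> 6 * a\<^sup>2 * norm (snd (rev fs ! i) - of_real (t i))"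
      unfolding rn[OF i] using t(1)[OF i] Es by (intro delta_le_inverse_distance a) auto
    hence "delta (rev Es ! i) powr p \<le> (6 * a\<^sup>2 * norm (snd (rev fs ! i) - of_real (t i))) powr p"
      using p by (intro powr_mono2) (auto simp: delta_def infdist_nonneg)
    thus "delta (rev Es ! i) powr p \<le> (6 * a\<^sup>2) powr p * norm (snd (rev fs ! i) - of_real (t i)) powr p" by (simp only: powr_mult)
  qed
  also have "\<dots> = (6 * a\<^sup>2) powr p * (\<Sum>i<N. norm (snd (rev fs ! i) - of_real (t i)) powr p)" by (simp add: sum_distrib_left)
  also have "\<dots> \<le> (6 * a\<^sup>2) powr p * (traceC * a powr (real CARD('n) / 2 - 2 * p) * I)" by (intro mult_left_mono t(2)) auto
  also have "\<dots> = 6 powr p * traceC * (a powr (2 * p) * a powr (real CARD('n) / 2 - 2 * p)) * I"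
    unfolding powr_mult sq_powr[OF a] by (simp only: mult_ac)
  also have "a powr (2 * p) * a powr (real CARD('n) / 2 - 2 * p) = a powr (real CARD('n) / 2)"
    unfolding powr_add[symmetric] by simp
  finally show ?thesis .
qed

end

section \<open>Algebraic multiplicities\<close>

text \<open>The multiplier \<open>c\<close> separates \<open>E\<close> from the numerical range
  \<open>[0, \<infinity>)\<close> of \<open>-Delta\<close>: the real part of \<open>c\<close> times
  the form of \<open>-Delta - E\<close> is then bounded below by a multiple of the squared
  \<open>H^1\<close> norm.\<close>

lemma exists_rotation:
  assumes "E \<notin> complex_of_real ` {0..}"
  shows "\<exists>c k. Re c = 1 \<and> k > 0 \<and> Re (c * E) \<le> - k"
proof (cases "Im E = 0")
  case True
  have "Re E < 0"
  proof (rule ccontr)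
    assume "\<not> Re E < 0"
    hence "E = of_real (Re E)" "Re E \<in> {0..}" using True by (auto simp: complex_eq_iff)
    thus False using assms by blast
  qed
  thus ?thesis by (intro exI[of _ 1] exI[of _ "- Re E"]) auto
next
  case False
  have "Re (Complex 1 ((\<bar>Re E\<bar> + 1) / Im E) * E) = Re E - (\<bar>Re E\<bar> + 1)" using False by simp
  thus ?thesis by (intro exI[of _ "Complex 1 ((\<bar>Re E\<bar> + 1) / Im E)"] exI[of _ 1]) auto
qed

lemma delta_pos: assumes "E \<notin> complex_of_real ` {0..}" shows "delta E > 0"
proof -
  have "closed (complex_of_real ` {0..})"
  proof -
    have "complex_of_real ` {0..} = {z. Im z = 0 \<and> 0 \<le> Re z}"
      by (auto simp: image_iff complex_eq_iff)
    thus ?thesis by (auto intro!: closed_Collect_conj closed_Collect_eq closed_Collect_le continuous_intros)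
  qed
  thus ?thesis unfolding delta_def using assms by (subst infdist_pos_not_in_closed) auto
qed

lemma span_count_bound:
  fixes w :: "nat \<Rightarrow> 'a::chilbert"
  assumes B: "finite B" and w: "\<And>k. k < n \<Longrightarrow> w k \<in> cspan B"
    and ind: "\<And>c. (\<Sum>k<n. c k *\<^sub>C w k) = 0 \<Longrightarrow> \<forall>k<n. c k = 0"
  shows "n \<le> card B"
proof -
  have inj: "inj_on w {..<n}"
  proof (rule inj_onI, rule ccontr)
    fix i j assume ij: "i \<in> {..<n}" "j \<in> {..<n}" "w i = w j" "i \<noteq> j"
    define c where "c k = (if k = i then 1 else if k = j then -1 else 0 :: complex)" for k
    have "(\<Sum>k<n. c k *\<^sub>C w k) = (\<Sum>k\<in>{i, j}. c k *\<^sub>C w k)"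
      using ij by (intro sum.mono_neutral_right) (auto simp: c_def)
    also have "\<dots> = 0" using ij by (simp add: c_def cscale_one)
    finally have "c i = 0" using ind ij by blast
    thus False by (simp add: c_def)
  qed
  have "\<not> cvs.dependent (w ` {..<n})"
  proof (rule cvs.independent_if_scalars_zero)
    fix f x assume f: "(\<Sum>x\<in>w ` {..<n}. f x *\<^sub>C x) = 0" and x: "x \<in> w ` {..<n}"
    have "(\<Sum>k<n. f (w k) *\<^sub>C w k) = 0" using f by (simp add: sum.reindex[OF inj] o_def)
    thus "f x = 0" using ind[of "\<lambda>k. f (w k)"] x by auto
  qed simp
  from cvs.independent_span_bound[OF B this] w have "card (w ` {..<n}) \<le> card B" by blast
  thus ?thesis by (simp add: card_image[OF inj])
qed

lemma cinner_ipa: "cinner x y = ipa 1 x y" by (simp add: cinner_eq_forms ipa_def)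

context schr_potential
begin

text \<open>Form compactness of the potential. Otherwise an orthonormal family with all
  \<open>Vq\<close> at least \<epsilon> could be extended without end, while the family bound with
  \<open>a = b = 1\<close> does not depend on the number of vectors.\<close>

lemma small_off_finite_dim:
  assumes e: "\<epsilon> > 0"
  shows "\<exists>(N::nat) e. (\<forall>i<N. \<forall>j<N. cinner (e i) (e j) = (if i = j then 1 else 0)) \<and>
     (\<forall>u :: 'n h1. (\<forall>i<N. cinner u (e i) = 0) \<longrightarrow> Vq V u \<le> \<epsilon> * (norm u)\<^sup>2)"
proof (rule ccontr)
  assume neg: "\<not> ?thesis"
  have big: "\<exists>e :: nat \<Rightarrow> 'n h1. (\<forall>i<N. \<forall>j<N. cinner (e i) (e j) = (if i = j then 1 else 0)) \<and> (\<forall>i<N. Vq V (e i) \<ge> \<epsilon>)" for N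
  proof (induction N)
    case (Suc N)
    then obtain e :: "nat \<Rightarrow> 'n h1" where e1: "\<And>i j. i < N \<Longrightarrow> j < N \<Longrightarrow> cinner (e i) (e j) = (if i = j then 1 else 0)"
      and e2: "\<And>i. i < N \<Longrightarrow> Vq V (e i) \<ge> \<epsilon>" by blast
    then obtain u where u: "\<And>i. i < N \<Longrightarrow> cinner u (e i) = 0" "Vq V u > \<epsilon> * (norm u)\<^sup>2"
      using neg by (metis not_le)
    have u0: "u \<noteq> 0"
    proof
      assume "u = 0"
      hence "Vq V u = 0" using Vq_scale[of 0 u] by simp
      thus False using u(2) \<open>u = 0\<close> by simp
    qed
    define w where "w = of_real (1 / norm u) *\<^sub>C u"
    have ww: "cinner w w = 1" using u0 unfolding cinner_self w_def norm_cscale by (simp add: norm_divide)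
    have wo: "cinner w (e i) = 0" "cinner (e i) w = 0" if "i < N" for i
      using u(1)[OF that] cinner_commute[of "e i" w] by (auto simp: w_def cinner_cscale_left)
    have "Vq V w = (1 / norm u)\<^sup>2 * Vq V u" unfolding w_def Vq_scale by (simp add: norm_divide)
    also have "\<dots> \<ge> (1 / norm u)\<^sup>2 * (\<epsilon> * (norm u)\<^sup>2)" using u(2) by (intro mult_left_mono) auto
    finally have vw: "Vq V w \<ge> \<epsilon>" using u0 by (simp add: power_divide)
    show ?case
      by (rule exI[of _ "e(N := w)"]) (use e1 e2 ww wo vw in \<open>auto simp: less_Suc_eq\<close>)
  qed simp
  let ?C = "famC p (real CARD('n)) * I"
  have "real N * \<epsilon> powr p \<le> ?C" for N
  proof -
    obtain e :: "nat \<Rightarrow> 'n h1" where e: "\<And>i j. i < N \<Longrightarrow> j < N \<Longrightarrow> cinner (e i) (e j) = (if i = j then 1 else 0)"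
      "\<And>i. i < N \<Longrightarrow> Vq V (e i) \<ge> \<epsilon>" using big[of N] by blast
    have syn: "Re (ipa 1 (\<Sum>j<N. c j *\<^sub>C e j) (\<Sum>j<N. c j *\<^sub>C e j)) \<le> 1\<^sup>2 * (\<Sum>j<N. (norm (c j))\<^sup>2)" for c
    proof -
      have "cinner (e i) (\<Sum>j<N. c j *\<^sub>C e j) = cnj (c i)" if i: "i < N" for i
      proof -
        have "cinner (\<Sum>j<N. c j *\<^sub>C e j) (e i) = (\<Sum>j<N. if j = i then c j else 0)"
          unfolding cinner_sum_left cinner_cscale_left using e(1) i by (intro sum.cong) auto
        also have "\<dots> = c i" using i by simp
        finally show ?thesis by (subst cinner_commute) simp
      qed
      hence "cinner (\<Sum>j<N. c j *\<^sub>C e j) (\<Sum>j<N. c j *\<^sub>C e j) = (\<Sum>j<N. c j * cnj (c j))"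
        by (subst cinner_sum_left) (auto simp: cinner_cscale_left intro!: sum.cong)
      also have "\<dots> = of_real (\<Sum>j<N. (norm (c j))\<^sup>2)" unfolding of_real_sum complex_norm_square ..
      finally show ?thesis by (simp add: cinner_ipa)
    qed
    have "real N * \<epsilon> powr p = (\<Sum>j<N. \<epsilon> powr p)" by simp
    also have "\<dots> \<le> (\<Sum>j<N. Vq V (e j) powr p)" using e(2) \<open>\<epsilon> > 0\<close> p by (intro sum_mono powr_mono2) auto
    also have "\<dots> \<le> ?C" using h1_family_bound(2)[OF _ _ syn] by simp
    finally show ?thesis .
  qed
  moreover obtain N where "real N > ?C / \<epsilon> powr p" using reals_Archimedean2 by blast
  ultimately show False using e by (simp add: field_simps) (metis not_le)
qed

end

section \<open>Fredholm alternative, resolvent and Riesz projection\<close>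

context schr_shift
begin

text \<open>Applying \<open>c Fa\<close> turns the pencil into the form of \<open>c (H - E)\<close>.
  The penalty \<open>M Q\<close> on the finite-dimensional space where the potential is not small
  makes it coercive, and what separates this coercive operator from the given one has finite
  rank.\<close>

lemma fredholm_K:
  assumes E: "E \<notin> complex_of_real ` {0..}" and P: "bclinear P" and F: "finite F" "\<And>u. P u \<in> cspan F"
    and inj: "\<And>u. u - (E + of_real a) *\<^sub>C K u + P u = 0 \<Longrightarrow> u = 0"
  shows "bij (\<lambda>u. u - (E + of_real a) *\<^sub>C K u + P u)"
proof -
  obtain c k where c: "Re c = 1" "k > 0" "Re (c * E) \<le> - k" using exists_rotation[OF E] by blast
  have c0: "c \<noteq> 0" using c by auto
  define m where "m = min 1 k"
  have m: "m > 0" using c by (simp add: m_def)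
  \<comment> \<open>\<open>Vq_add\<close> doubles \<epsilon> and \<open>c\<close> multiplies it by
    \<open>norm c\<close>; the result \<open>m / 2\<close> is half of the free coercivity constant
    \<open>m\<close>.\<close>
  define \<epsilon> where "\<epsilon> = m / (4 * norm c)"
  have eps: "\<epsilon> > 0" using m c0 by (simp add: \<epsilon>_def)
  obtain N :: nat and e :: "nat \<Rightarrow> 'n h1" where e: "\<And>i j. i < N \<Longrightarrow> j < N \<Longrightarrow> cinner (e i) (e j) = (if i = j then 1 else 0)"
    "\<And>u. (\<forall>i<N. cinner u (e i) = 0) \<Longrightarrow> Vq V u \<le> \<epsilon> * (norm u)\<^sup>2" using small_off_finite_dim[OF eps] by blast
  define Q where "Q u = (\<Sum>i<N. cinner u (e i) *\<^sub>C e i)" for u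
  have Q: "bclinear Q" unfolding Q_def by (intro bclinear_sum bclinear_rank1)
  have Qsp: "Q u \<in> cspan (e ` {..<N})" for u unfolding Q_def by (intro cvs.span_sum cvs.span_scale cvs.span_base) auto
  have Qo: "cinner (u - Q u) (e j) = 0" if "j < N" for u j
  proof -
    have "cinner (Q u) (e j) = (\<Sum>i<N. if i = j then cinner u (e i) else 0)"
      unfolding Q_def cinner_sum_left cinner_cscale_left using e(1) that by (intro sum.cong) auto
    also have "\<dots> = cinner u (e j)" using that by simp
    finally show ?thesis by (simp add: cinner_diff_left)
  qed
  have QQ: "cinner (u - Q u) (Q u) = 0" for u
  proof -
    have "cinner (Q u) (u - Q u) = (\<Sum>i<N. cinner u (e i) * cinner (e i) (u - Q u))"
      by (subst (1) Q_def) (simp add: cinner_sum_left cinner_cscale_left)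
    also have "\<dots> = 0" using Qo[of _ u] by (intro sum.neutral ballI) (simp add: cinner_commute[of "e _" "u - Q u"])
    finally show ?thesis by (simp add: cinner_commute[of "u - Q u"])
  qed
  have pyth: "(norm u)\<^sup>2 = (norm (u - Q u))\<^sup>2 + (norm (Q u))\<^sup>2" and Qre: "Re (cinner (Q u) u) = (norm (Q u))\<^sup>2" for u
  proof -
    have o: "inner (u - Q u) (Q u) = 0" using QQ[of u] by (metis Re_cinner zero_complex.simps(1))
    have "inner u u = inner ((u - Q u) + Q u) ((u - Q u) + Q u)" by simp
    also have "\<dots> = inner (u - Q u) (u - Q u) + inner (Q u) (Q u)"
      using o inner_commute[of "Q u" "u - Q u"] by (simp only: inner_add_left inner_add_right add_0_left add_0_right)
    finally show "(norm u)\<^sup>2 = (norm (u - Q u))\<^sup>2 + (norm (Q u))\<^sup>2" by (simp only: power2_norm_eq_inner)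
    have "inner (Q u) u = inner (Q u) ((u - Q u) + Q u)" by simp
    also have "\<dots> = inner (Q u) (Q u)" using o inner_commute[of "Q u" "u - Q u"] by (simp only: inner_add_right add_0_left)
    finally show "Re (cinner (Q u) u) = (norm (Q u))\<^sup>2" by (simp only: Re_cinner power2_norm_eq_inner)
  qed
  \<comment> \<open>Outweighs the potential on the range of \<open>Q\<close>: \<open>1 + a\<close>
    bounds \<open>Vq\<close> by the squared \<open>H^1\<close> norm and the 2 stems from
    \<open>Vq_add\<close>.\<close>
  define M where "M = 2 * norm c * (1 + a)"
  have M0: "M \<ge> 0" using a by (simp add: M_def)
  define S where "S u = c *\<^sub>C Fa (u - (E + of_real a) *\<^sub>C K u)" for u
  have S: "bclinear S" unfolding S_def
    by (intro bclinear_cscale bclinear_compose[OF Fa(1)] bclinear_diff bclinear_id bclinear_K)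
  have Sform: "cinner (S u) y = c * (Gf u y - E * Lf u y + Vf V u y)" for u y
    unfolding S_def cinner_cscale_left by (simp add: bclinearD[OF Fa(1)] cinner_diff_left cinner_cscale_left Fa(2) ba_K)
      (simp add: ba_def ipa_def algebra_simps)
  define T where "T u = S u + of_real M *\<^sub>C Q u" for u
  have T: "bclinear T" unfolding T_def by (intro bclinear_add S bclinear_cscale Q)
  have co: "inner (T u) u \<ge> m / 2 * (norm u)\<^sup>2" for u
  proof -
    have q: "Vq V z \<le> (1 + a) * (norm z)\<^sup>2" for z
      using Vq_half[of z] m0(3)[of z] ipa_nonneg[OF a, of z] by linarith
    have "Vq V u = Vq V ((u - Q u) + Q u)" by simp
    also have "\<dots> \<le> 2 * Vq V (u - Q u) + 2 * Vq V (Q u)" by (rule Vq_add)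
    also have "\<dots> \<le> 2 * (\<epsilon> * (norm (u - Q u))\<^sup>2) + 2 * ((1 + a) * (norm (Q u))\<^sup>2)"
      using e(2)[of "u - Q u"] Qo q[of "Q u"] by (intro add_mono mult_left_mono) auto
    also have "\<dots> \<le> 2 * (\<epsilon> * (norm u)\<^sup>2) + 2 * ((1 + a) * (norm (Q u))\<^sup>2)"
      using eps pyth[of u] by (intro add_right_mono mult_left_mono) auto
    finally have "norm c * Vq V u \<le> norm c * (2 * (\<epsilon> * (norm u)\<^sup>2) + 2 * ((1 + a) * (norm (Q u))\<^sup>2))" by (intro mult_left_mono) auto
    also have "\<dots> = m / 2 * (norm u)\<^sup>2 + M * (norm (Q u))\<^sup>2" using c0 by (simp add: \<epsilon>_def M_def field_simps)
    finally have v: "norm c * Vq V u \<le> m / 2 * (norm u)\<^sup>2 + M * (norm (Q u))\<^sup>2" .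
    have "Re (c * Vf V u u) \<ge> - (norm c * Vq V u)"
    proof -
      have "norm (c * Vf V u u) \<le> norm c * Vq V u" unfolding norm_mult by (intro mult_left_mono Vf_self_le) auto
      thus ?thesis using abs_Re_le_cmod[of "c * Vf V u u"] by linarith
    qed
    moreover have "Re (c * (Gf u u - E * Lf u u)) \<ge> m * (norm u)\<^sup>2"
    proof -
      have "c * (Gf u u - E * Lf u u) = c * of_real (Re (Gf u u)) - c * E * of_real (Re (Lf u u))"
        using Gf_self[of u] Lf_self[of u] by (simp add: algebra_simps)
      hence "Re (c * (Gf u u - E * Lf u u)) = Re (Gf u u) - Re (c * E) * Re (Lf u u)"
        using c(1) by simp
      moreover have "k * Re (Lf u u) \<le> - Re (c * E) * Re (Lf u u)" using c(3) Lf_nonneg[of u] by (intro mult_right_mono) auto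
      moreover have "m * Re (Gf u u) \<le> 1 * Re (Gf u u)" "m * Re (Lf u u) \<le> k * Re (Lf u u)"
        by (intro mult_right_mono; simp add: m_def Gf_nonneg Lf_nonneg)+
      ultimately show ?thesis unfolding norm_sq_forms distrib_left by linarith
    qed
    moreover have "inner (T u) u = Re (c * (Gf u u - E * Lf u u)) + Re (c * Vf V u u) + M * (norm (Q u))\<^sup>2"
      unfolding Re_cinner[symmetric] T_def cinner_add_left cinner_cscale_left Sform using Qre[of u] by (simp add: algebra_simps)
    ultimately show ?thesis using v by linarith
  qed
  have bT: "bij T" by (rule lax_milgram[OF bclinearD(6)[OF T] _ co]) (use m in simp)
  define R where "R u = c *\<^sub>C Fa (P u) - of_real M *\<^sub>C Q u" for u
  have R: "bclinear R" unfolding R_def by (intro bclinear_diff bclinear_cscale bclinear_compose[OF Fa(1) P] Q)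
  interpret fa: module_hom cscale cscale Fa by (rule bclinear_module_hom[OF Fa(1)])
  have TR: "T u + R u = c *\<^sub>C Fa (u - (E + of_real a) *\<^sub>C K u + P u)" for u
    unfolding T_def R_def S_def by (simp add: bclinearD(1)[OF Fa(1)] cscale_add_right)
  have Fa0: "Fa x = 0 \<Longrightarrow> x = 0" for x using bij_is_inj[OF bij_Fa, THEN injD, of x 0] by (simp add: bclinearD[OF Fa(1)])
  have bTR: "bij (\<lambda>u. T u + R u)"
  proof (rule fredholm_finite_rank[OF T bT R])
    show "finite (Fa ` F \<union> e ` {..<N})" using F by simp
    fix u
    have "Fa (P u) \<in> cspan (Fa ` F)" using F(2)[of u] by (auto simp: fa.span_image)
    hence 1: "Fa (P u) \<in> cspan (Fa ` F \<union> e ` {..<N})" using cvs.span_mono[of "Fa ` F" "Fa ` F \<union> e ` {..<N}"] by auto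
    have 2: "Q u \<in> cspan (Fa ` F \<union> e ` {..<N})" using Qsp[of u] cvs.span_mono[of "e ` {..<N}" "Fa ` F \<union> e ` {..<N}"] by auto
    show "R u \<in> cspan (Fa ` F \<union> e ` {..<N})" unfolding R_def by (rule cvs.span_diff[OF cvs.span_scale[OF 1] cvs.span_scale[OF 2]])
  next
    fix u assume "T u + R u = 0"
    hence "Fa (u - (E + of_real a) *\<^sub>C K u + P u) = 0" unfolding TR using c0 by simp
    thus "u = 0" using Fa0 inj by blast
  qed
  show ?thesis
  proof (rule bijI)
    show "inj (\<lambda>u. u - (E + of_real a) *\<^sub>C K u + P u)"
    proof (rule injI)
      fix x y assume "x - (E + of_real a) *\<^sub>C K x + P x = y - (E + of_real a) *\<^sub>C K y + P y"
      hence "T x + R x = T y + R y" unfolding TR by simp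
      thus "x = y" by (rule injD[OF bij_is_inj[OF bTR]])
    qed
    show "surj (\<lambda>u. u - (E + of_real a) *\<^sub>C K u + P u)"
      unfolding surj_def
    proof
      fix y
      obtain x where "T x + R x = c *\<^sub>C Fa y" using surjD[OF bij_is_surj[OF bTR], of "c *\<^sub>C Fa y"] by metis
      hence "Fa (x - (E + of_real a) *\<^sub>C K x + P x) = Fa y" unfolding TR using c0 by simp
      hence "x - (E + of_real a) *\<^sub>C K x + P x = y" by (rule injD[OF bij_is_inj[OF bij_Fa]])
      thus "\<exists>x. y = x - (E + of_real a) *\<^sub>C K x + P x" by blast
    qed
  qed
qed

text \<open>Multiplying \<open>(H - z) u = f\<close> by \<open>(H + a)^-1\<close> gives
  \<open>(1 - (z + a) K) u = (H + a)^-1 f\<close>. This is the bridge between the graph of the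
  operator and the bounded pencil.\<close>

lemma graph_iff:
  assumes f: "f \<in> L2" and u: "u \<in> H1"
  shows "(u, \<lambda>x. f x + z * u x) \<in> schr_graph V \<longleftrightarrow> mk u - (z + of_real a) *\<^sub>C K (mk u) = kvec f"
proof -
  have key: "schr_form V u v = L2_inner (\<lambda>x. f x + z * u x) v \<longleftrightarrow> ba (mk u - (z + of_real a) *\<^sub>C K (mk u)) (mk v) = ba (kvec f) (mk v)"
    if v: "v \<in> H1" for v
  proof -
    have m: "ba (x - y) w = ba x w - ba y w" for x y w using ba_forms(1)[of "x - y" y w] by simp
    have 1: "ba (mk u - (z + of_real a) *\<^sub>C K (mk u)) (mk v) = schr_form V u v - z * Lf (mk u) (mk v)"
      unfolding m ba_forms(3) ba_K schr_form_mk[OF u v] by (simp add: ba_def ipa_def algebra_simps)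
    have "L2_inner f (rp (mk v)) = L2_inner f v" by (intro L2_inner_cong f rp_L2 H1_L2 v ae_eq_refl rp_mk)
    hence 2: "ba (kvec f) (mk v) = L2_inner f v" by (simp add: kvec[OF f])
    have "L2_inner (\<lambda>x. f x + z * u x) v = L2_inner f v + z * Lf (mk u) (mk v)"
      using L2_inner_add_left[OF f L2_scale[OF H1_L2[OF u], of z] H1_L2[OF v]] by (simp add: L2_inner_scale_left Lf_mk[OF u v])
    thus ?thesis unfolding 1 2 by (auto simp: algebra_simps)
  qed
  have "(u, \<lambda>x. f x + z * u x) \<in> schr_graph V \<longleftrightarrow> (\<forall>v\<in>H1. schr_form V u v = L2_inner (\<lambda>x. f x + z * u x) v)"
    using f u L2_add[OF f L2_scale[OF H1_L2[OF u], of z]] by (auto simp: schr_graph_def)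
  also have "\<dots> \<longleftrightarrow> (\<forall>y. ba (mk u - (z + of_real a) *\<^sub>C K (mk u)) y = ba (kvec f) y)"
  proof -
    have "(\<forall>v\<in>H1. Q (mk v)) \<longleftrightarrow> (\<forall>y. Q y)" for Q :: "'n h1 \<Rightarrow> bool"
    proof
      assume h: "\<forall>v\<in>H1. Q (mk v)"
      have "Q (mk (rp y))" for y using h rp_H1 by blast
      thus "\<forall>y. Q y" by simp
    qed simp
    thus ?thesis using key by simp
  qed
  also have "\<dots> \<longleftrightarrow> mk u - (z + of_real a) *\<^sub>C K (mk u) = kvec f"
    using ba_unique[of "mk u - (z + of_real a) *\<^sub>C K (mk u)" "kvec f"] by auto
  finally show ?thesis .
qed

lemma graph_H1: "(u, g) \<in> schr_graph V \<Longrightarrow> u \<in> H1" by (simp add: schr_graph_def)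

lemma kvec_zero: "kvec (\<lambda>x. 0) = 0"
  by (rule ba_unique) (use kvec[OF L2_zero] ba_forms(3)[of 0 0] in \<open>simp add: L2_inner_def\<close>)

lemma kvec_scale_rp: "kvec (\<lambda>t. c * rp x t) = c *\<^sub>C K x"
  by (rule ba_unique) (simp add: kvec L2_scale rp_L2 ba_forms ba_K Lf_def L2_inner_scale_left)

lemma resolvent_set_iff: "z \<in> schr_resolvent_set V \<longleftrightarrow> z + of_real a \<in> rset K"
proof
  assume z: "z \<in> schr_resolvent_set V"
  have ex: "\<exists>x. x - (z + of_real a) *\<^sub>C K x = kvec f" if f: "f \<in> L2" for f
  proof -
    obtain u where u: "(u, \<lambda>x. f x + z * u x) \<in> schr_graph V" using z f unfolding schr_resolvent_set_def by blast
    thus ?thesis using graph_iff[OF f graph_H1[OF u]] by blast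
  qed
  have un: "x = 0" if x: "x - (z + of_real a) *\<^sub>C K x = 0" for x
  proof -
    have 1: "(rp x, \<lambda>t. 0 + z * rp x t) \<in> schr_graph V" using graph_iff[OF L2_zero rp_H1[of x], of z] x by (simp add: kvec_zero)
    have 2: "(\<lambda>t. 0, \<lambda>t. 0 + z * 0) \<in> schr_graph V"
      using graph_iff[OF L2_zero H1_zero, of z] by (simp add: kvec_zero zero_h1_def[symmetric] bclinearD[OF bclinear_K])
    have "\<forall>f\<in>L2. \<forall>u u'. (u, (\<lambda>x. f x + z * u x)) \<in> schr_graph V \<longrightarrow>
              (u', (\<lambda>x. f x + z * u' x)) \<in> schr_graph V \<longrightarrow> ae_eq u u'" using z unfolding schr_resolvent_set_def by simp
    from this[rule_format, OF L2_zero 1 2] have "ae_eq (rp x) (\<lambda>t. 0)" .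
    hence "mk (rp x) = mk (\<lambda>t. 0)" by (subst mk_eq_iff) (auto intro: rp_H1)
    thus ?thesis by (simp add: zero_h1_def)
  qed
  show "z + of_real a \<in> rset K" unfolding rset_def
  proof (safe, rule bijI)
    show "inj (\<lambda>u. u - (z + of_real a) *\<^sub>C K u)"
    proof (rule injI)
      fix x y assume "x - (z + of_real a) *\<^sub>C K x = y - (z + of_real a) *\<^sub>C K y"
      moreover have "(x - y) - (z + of_real a) *\<^sub>C K (x - y) = (x - (z + of_real a) *\<^sub>C K x) - (y - (z + of_real a) *\<^sub>C K y)"
        by (simp add: bclinearD[OF bclinear_K] cvs.scale_right_diff_distrib)
      ultimately have "(x - y) - (z + of_real a) *\<^sub>C K (x - y) = 0" by simp
      thus "x = y" using un[of "x - y"] by simp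
    qed
    show "surj (\<lambda>u. u - (z + of_real a) *\<^sub>C K u)" unfolding surj_def
    proof
      \<comment> \<open>A general \<open>h\<close> is not of the form \<open>kvec f\<close>, but
        \<open>K h\<close> is. Seeking the solution as \<open>h + x\<close> leaves an equation for
        \<open>x\<close> with right-hand side \<open>(z + a) K h\<close>.\<close>
      fix h
      obtain x where x: "x - (z + of_real a) *\<^sub>C K x = kvec (\<lambda>t. (z + of_real a) * rp h t)" using ex[OF L2_scale[OF rp_L2]] by blast
      have "(h + x) - (z + of_real a) *\<^sub>C K (h + x) = h"
      proof -
        have "(h + x) - (z + of_real a) *\<^sub>C K (h + x) = h + (x - (z + of_real a) *\<^sub>C K x) - (z + of_real a) *\<^sub>C K h"
          by (simp only: bclinearD(1)[OF bclinear_K] cscale_add_right) (simp add: algebra_simps)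
        thus ?thesis unfolding x kvec_scale_rp by simp
      qed
      thus "\<exists>x. h = x - (z + of_real a) *\<^sub>C K x" by metis
    qed
  qed
next
  assume z: "z + of_real a \<in> rset K"
  show "z \<in> schr_resolvent_set V" unfolding schr_resolvent_set_def
  proof (intro CollectI ballI conjI allI impI)
    fix f :: "real^'n \<Rightarrow> complex" assume f: "f \<in> L2"
    show "\<exists>u. (u, \<lambda>x. f x + z * u x) \<in> schr_graph V"
      using graph_iff[OF f rp_H1[of "res K (z + of_real a) (kvec f)"], of z] res_props(1)[OF z] by auto
    fix u u' assume 1: "(u, \<lambda>x. f x + z * u x) \<in> schr_graph V" and 2: "(u', \<lambda>x. f x + z * u' x) \<in> schr_graph V"
    have "mk u = res K (z + of_real a) (kvec f)" "mk u' = res K (z + of_real a) (kvec f)"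
      using graph_iff[OF f graph_H1[OF 1]] graph_iff[OF f graph_H1[OF 2]] 1 2 res_props(2)[OF z] by blast+
    thus "ae_eq u u'" using mk_eq_iff[OF graph_H1[OF 1] graph_H1[OF 2]] by simp
  qed
qed

lemma schr_resolvent_props:
  assumes z: "z + of_real a \<in> rset K" and f: "f \<in> L2"
  shows "schr_resolvent V z f \<in> H1" "mk (schr_resolvent V z f) = res K (z + of_real a) (kvec f)"
proof -
  have "\<exists>u. (u, \<lambda>x. f x + z * u x) \<in> schr_graph V"
    using z f unfolding resolvent_set_iff[symmetric] schr_resolvent_set_def by blast
  from someI_ex[OF this] have g: "(schr_resolvent V z f, \<lambda>x. f x + z * schr_resolvent V z f x) \<in> schr_graph V"
    by (simp add: schr_resolvent_def)
  show h: "schr_resolvent V z f \<in> H1" by (rule graph_H1[OF g])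
  show "mk (schr_resolvent V z f) = res K (z + of_real a) (kvec f)"
    using g graph_iff[OF f h] res_props(2)[OF z] by blast
qed

text \<open>Pairing with \<open>g\<close> in \<open>L^2\<close> equals pairing with a representer
  \<open>j\<close> in \<open>H^1\<close>, which turns the weak integral defining
  \<open>riesz_proj\<close> into that of \<open>riesz_integral_in_flag\<close>. Elements of
  \<open>L^2\<close> are determined by their pairings up to null sets, so the choice in the
  definition must return this vector.\<close>

lemma riesz_proj_in_flag:
  assumes fs: "flag K fs" and e: "e > 0" "ball (E + of_real a) e - {E + of_real a} \<subseteq> rset K"
    and rem: "\<And>k y. (\<forall>x\<in>fspan fs. cinner x y = 0) \<Longrightarrow>
        (\<exists>h. h holomorphic_on ball (E + of_real a) e \<and> (\<forall>z\<in>ball (E + of_real a) e - {E + of_real a}. h z = cinner (res K z k) y))"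
    and r: "r > 0" "cball E r - {E} \<subseteq> schr_resolvent_set V" and f: "f \<in> L2"
  shows "\<exists>w\<in>fspan fs. riesz_proj V E r f \<in> L2 \<and> ae_eq (riesz_proj V E r f) (rp w)"
proof -
  let ?v = "E + of_real a"
  have r2: "cball ?v r - {?v} \<subseteq> rset K"
  proof
    fix z assume "z \<in> cball ?v r - {?v}"
    hence "z - of_real a \<in> cball E r - {E}" by (auto simp: dist_norm algebra_simps)
    hence "z - of_real a \<in> schr_resolvent_set V" using r by blast
    thus "z \<in> rset K" by (simp add: resolvent_set_iff)
  qed
  note ri = riesz_integral_in_flag[OF bclinear_K fs e rem r(1) r2, of "kvec f"]
  obtain w where w: "w \<in> fspan fs" "\<And>y. integral {0..2*pi} (\<lambda>t. cinner (res K (?v + of_real r * cis t) (kvec f)) y * (\<i> * of_real r * cis t)) = cinner w y"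
    using ri(2) by blast
  define c where "c = - (1 / (2 * pi * \<i>))"
  define w' where "w' = c *\<^sub>C w"
  have main: "c * (LBINT t=0..2*pi. L2_inner (schr_resolvent V (E + r * exp (\<i> * t)) f) g * (\<i> * r * exp (\<i> * t))) = L2_inner (rp w') g"
    if g: "g \<in> L2" for g
  proof -
    obtain j where j: "\<And>y. cinner j y = L2_inner g (rp y)" using L2_representer[OF g] by blast
    have j': "cinner y j = L2_inner (rp y) g" for y
      using j[of y] cinner_commute[of y j] L2_inner_commute[of "rp y" g] by simp
    have on: "?v + of_real r * cis t \<in> rset K" for t
      using r(1) by (intro subsetD[OF r2]) (auto simp: dist_norm norm_mult)
    have eq: "L2_inner (schr_resolvent V (E + r * exp (\<i> * t)) f) g * (\<i> * r * exp (\<i> * t))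
        = cinner (res K (?v + of_real r * cis t) (kvec f)) j * (\<i> * of_real r * cis t)" for t :: real
    proof -
      have z: "E + r * exp (\<i> * t) + of_real a = ?v + of_real r * cis t" by (simp add: cis_conv_exp)
      have "E + r * exp (\<i> * t) + of_real a \<in> rset K" unfolding z by (rule on)
      note sp = schr_resolvent_props[OF this f]
      have "ae_eq (rp (res K (?v + of_real r * cis t) (kvec f))) (schr_resolvent V (E + r * exp (\<i> * t)) f)"
        using rp_mk[OF sp(1)] unfolding sp(2) z .
      hence "L2_inner (rp (res K (?v + of_real r * cis t) (kvec f))) g = L2_inner (schr_resolvent V (E + r * exp (\<i> * t)) f) g"
        by (intro L2_inner_cong rp_L2 H1_L2 sp g ae_eq_refl)
      thus ?thesis by (simp add: j' cis_conv_exp)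
    qed
    let ?F = "\<lambda>t. cinner (res K (?v + of_real r * cis t) (kvec f)) j * (\<i> * of_real r * cis t)"
    have cont: "continuous_on {0..2*pi} ?F"
      by (intro continuous_intros bounded_linear.continuous_on[OF bounded_linear_cinner] ri(1))
    have si: "set_integrable lborel {0..2*pi} ?F"
      unfolding set_integrable_def by (rule borel_integrable_compact[OF compact_Icc cont])
    have "(LBINT t=ereal 0..ereal (2*pi). ?F t) = integral {0..2*pi} ?F"
      by (rule interval_integral_eq_integral[OF _ si]) simp
    hence "(LBINT t=0..2*pi. ?F t) = cinner w j" unfolding w(2) by (simp add: zero_ereal_def)
    thus ?thesis unfolding eq by (simp add: w'_def j' L2_inner_rp_cscale_left[OF g])
  qed
  have "\<exists>u. u \<in> L2 \<and> (\<forall>g \<in> L2. L2_inner u g = c * (LBINT t=0..2*pi. L2_inner (schr_resolvent V (E + r * exp (\<i> * t)) f) g * (\<i> * r * exp (\<i> * t))))"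
    using main rp_L2[of w'] by auto
  from someI_ex[OF this] have P: "riesz_proj V E r f \<in> L2"
    "\<And>g. g \<in> L2 \<Longrightarrow> L2_inner (riesz_proj V E r f) g = L2_inner (rp w') g"
    using main unfolding riesz_proj_def c_def by auto
  let ?D = "\<lambda>x. riesz_proj V E r f x - rp w' x"
  have D: "?D \<in> L2" by (intro L2_diff P rp_L2)
  have "L2_inner ?D ?D = L2_inner (riesz_proj V E r f) ?D + L2_inner (\<lambda>x. - 1 * rp w' x) ?D"
    using L2_inner_add_left[OF P(1) L2_scale[OF rp_L2[of w'], of "-1"] D] by simp
  also have "\<dots> = 0" unfolding L2_inner_scale_left P(2)[OF D] by simp
  finally have "nsq ?D = 0" using nsq_L2_inner[OF D] by simp
  hence "AE x in lborel. ?D x = 0" using AE_zero_iff_nsq[of ?D] D by (auto simp: L2_iff)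
  hence "ae_eq (riesz_proj V E r f) (rp w')" unfolding ae_eq_def by (elim eventually_mono) simp
  moreover have "w' \<in> fspan fs" unfolding w'_def by (rule cvs.span_scale[OF w(1)])
  ultimately show ?thesis using P(1) by blast
qed

text \<open>Since \<open>delta E > 0\<close>, the trace bound limits the length of flags with
  diagonal \<open>1 / (E + a)\<close>, so a longest one exists. Its maximality is what
  \<open>pencil_isolated\<close> asks for, and its span contains the range of the
  projection.\<close>

lemma alg_mult_le_flag:
  assumes E: "E \<notin> complex_of_real ` {0..}" "norm E \<le> a" "E + of_real a \<noteq> 0"
  shows "\<exists>fs. flag K fs \<and> snd ` set fs \<subseteq> {1 / (E + of_real a)} \<and> alg_mult V E \<le> enat (length fs)"
proof -
  let ?v = "E + of_real a" and ?l = "1 / (E + of_real a)"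
  let ?P = "\<lambda>fs. flag K fs \<and> snd ` set fs \<subseteq> {?l}"
  obtain B :: nat where B: "real B > 6 powr p * traceC * a powr (real CARD('n) / 2) * I / delta E powr p" using reals_Archimedean2 by blast
  have dp: "delta E powr p > 0" using delta_pos[OF E(1)] by simp
  have bound: "length fs < B" if fs: "?P fs" for fs
  proof -
    have "map snd fs = replicate (length fs) ?l" using fs by (intro replicate_eqI) auto
    hence sn: "map snd fs = map (\<lambda>E. 1 / (E + of_real a)) (replicate (length fs) E)" by simp
    have "real (length fs) * delta E powr p = (\<Sum>E\<leftarrow>replicate (length fs) E. delta E powr p)" by (simp add: sum_list_replicate)
    also have "\<dots> \<le> 6 powr p * traceC * a powr (real CARD('n) / 2) * I"
      using fs E by (intro flag_delta_bound[OF _ sn]) auto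
    finally have "real (length fs) \<le> 6 powr p * traceC * a powr (real CARD('n) / 2) * I / delta E powr p"
      using dp by (simp add: field_simps)
    thus ?thesis using B by simp
  qed
  have "?P []" by (auto intro: flag.Nil)
  from ex_has_greatest_nat[of ?P "[]" length B, OF this] have "\<exists>fs. ?P fs \<and> (\<forall>gs. ?P gs \<longrightarrow> length gs \<le> length fs)"
    using bound less_imp_le by simp
  then obtain fs where fs: "?P fs" "\<And>gs. ?P gs \<Longrightarrow> length gs \<le> length fs" by blast
  have mx: "u \<in> fspan fs" if u: "K u - ?l *\<^sub>C u \<in> fspan fs" for u
  proof (rule ccontr)
    assume "u \<notin> fspan fs"
    hence "?P ((u, ?l) # fs)" using fs(1) u by (auto intro: flag.Cons)
    from fs(2)[OF this] show False by simp
  qed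
  have "\<exists>e>0. ball ?v e - {?v} \<subseteq> rset K \<and>
     (\<forall>k y. (\<forall>x\<in>fspan fs. cinner x y = 0) \<longrightarrow>
        (\<exists>h. h holomorphic_on ball ?v e \<and> (\<forall>z\<in>ball ?v e - {?v}. h z = cinner (res K z k) y)))"
  proof (rule pencil_isolated[OF bclinear_K _ _ E(3) mx])
    show "flag K fs" "snd ` set fs \<subseteq> {?l}" using fs(1) by auto
    fix P :: "'n h1 \<Rightarrow> 'n h1" and F
    assume "bclinear P" "finite F" "\<And>u. P u \<in> cspan F" "\<And>u. u - ?v *\<^sub>C K u + P u = 0 \<Longrightarrow> u = 0"
    thus "bij (\<lambda>u. u - ?v *\<^sub>C K u + P u)" by (rule fredholm_K[OF E(1)])
  qed
  then obtain e where e: "e > 0" "ball ?v e - {?v} \<subseteq> rset K"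
    "\<And>k y. (\<forall>x\<in>fspan fs. cinner x y = 0) \<Longrightarrow>
        (\<exists>h. h holomorphic_on ball ?v e \<and> (\<forall>z\<in>ball ?v e - {?v}. h z = cinner (res K z k) y))" by blast
  \<comment> \<open>The choice of a radius in \<open>alg_mult\<close> is informative only once an
    admissible circle is known to exist.\<close>
  have "\<exists>r>0. cball E r - {E} \<subseteq> schr_resolvent_set V"
  proof (intro exI[of _ "e / 2"] conjI subsetI)
    fix z assume "z \<in> cball E (e / 2) - {E}"
    hence "z + of_real a \<in> ball ?v e - {?v}" using e(1) by (auto simp: dist_norm)
    thus "z \<in> schr_resolvent_set V" using e(2) by (auto simp: resolvent_set_iff)
  qed (use e in simp)
  hence "\<exists>r. r > 0 \<and> cball E r - {E} \<subseteq> schr_resolvent_set V" by blast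
  from someI_ex[OF this] obtain r where r: "r > 0" "cball E r - {E} \<subseteq> schr_resolvent_set V"
    and am: "alg_mult V E = riesz_rank V E r" unfolding alg_mult_def by blast
  have "riesz_rank V E r \<le> enat (length fs)" unfolding riesz_rank_def
  proof (rule Sup_least, safe)
    fix n and f :: "nat \<Rightarrow> real^'n \<Rightarrow> complex"
    assume f: "\<forall>k<n. f k \<in> L2"
      and ind: "\<forall>c. ae_eq (\<lambda>x. \<Sum>k<n. c k * riesz_proj V E r (f k) x) (\<lambda>x. 0) \<longrightarrow> (\<forall>k<n. c k = 0)"
    have "\<forall>k. \<exists>w. k < n \<longrightarrow> w \<in> fspan fs \<and> ae_eq (riesz_proj V E r (f k)) (rp w)"
      using riesz_proj_in_flag[OF conjunct1[OF fs(1)] e r] f by blast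
    then obtain w where w: "\<And>k. k < n \<Longrightarrow> w k \<in> fspan fs" "\<And>k. k < n \<Longrightarrow> ae_eq (riesz_proj V E r (f k)) (rp (w k))" by metis
    have "n \<le> card (fst ` set fs)"
    proof (rule span_count_bound)
      fix c assume c: "(\<Sum>k<n. c k *\<^sub>C w k) = 0"
      have "mk (\<lambda>t. \<Sum>k<n. c k * rp (w k) t) = mk (\<lambda>t. 0)" unfolding mk_sum_rp c zero_h1_def ..
      hence z: "ae_eq (\<lambda>t. \<Sum>k<n. c k * rp (w k) t) (\<lambda>t. 0)" by (subst (asm) mk_eq_iff) (auto intro: H1_sum_rp)
      have "AE x in lborel. \<forall>k\<in>{..<n}. riesz_proj V E r (f k) x = rp (w k) x"
        using w(2) by (intro AE_finite_allI) (auto simp: ae_eq_def)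
      hence "ae_eq (\<lambda>x. \<Sum>k<n. c k * riesz_proj V E r (f k) x) (\<lambda>t. \<Sum>k<n. c k * rp (w k) t)"
        unfolding ae_eq_def by (elim eventually_mono) (auto intro!: sum.cong)
      from ae_eq_trans[OF this z] show "\<forall>k<n. c k = 0" using ind by blast
    qed (auto intro: w)
    also have "\<dots> \<le> length fs" using card_image_le[of "set fs" fst] card_length[of fs] by simp
    finally show "enat n \<le> enat (length fs)" by simp
  qed
  thus ?thesis using fs(1) am by (intro exI[of _ fs]) auto
qed

end

section \<open>Summation over the eigenvalues\<close>

text \<open>The uniform bound on finite sums makes every level set \<open>A n\<close> finite. The
  level sets exhaust the support of \<open>f\<close>, so monotone convergence applies although the
  index set is uncountable.\<close>

lemma nn_integral_count_space_le:
  fixes f :: "'a \<Rightarrow> ennreal"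
  assumes fin: "\<And>S. finite S \<Longrightarrow> sum f S \<le> ennreal B"
  shows "(\<integral>\<^sup>+x. f x \<partial>count_space UNIV) \<le> ennreal B"
proof -
  define A where "A n = {x. f x > ennreal (1 / real (Suc n))}" for n
  have finA: "finite (A n)" for n
  proof (rule ccontr)
    assume inf: "infinite (A n)"
    obtain k :: nat where k: "real k > \<bar>B\<bar> * real (Suc n)" using reals_Archimedean2 by blast
    obtain S where S: "S \<subseteq> A n" "finite S" "card S = k" using infinite_arbitrarily_large[OF inf] by metis
    have "ennreal (real k * (1 / real (Suc n))) = (\<Sum>x\<in>S. ennreal (1 / real (Suc n)))"
      using S ennreal_mult[of "real k" "1 / real (Suc n)"] by (simp only: sum_constant ennreal_of_nat_eq_real_of_nat) simp
    also have "\<dots> \<le> sum f S" using S(1) by (intro sum_mono) (auto simp: A_def less_imp_le)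
    also have "\<dots> \<le> ennreal B" by (rule fin[OF S(2)])
    also have "\<dots> \<le> ennreal \<bar>B\<bar>" by (intro ennreal_leI) simp
    finally have "real k * (1 / real (Suc n)) \<le> \<bar>B\<bar>" by (simp del: of_nat_Suc)
    thus False using k by (simp add: field_simps del: of_nat_Suc)
  qed
  have "f x = (SUP n. f x * indicator (A n) x)" for x
  proof (cases "f x = 0")
    case False
    have "\<exists>n. x \<in> A n"
    proof (cases "f x = \<infinity>")
      case False
      then obtain r where r: "f x = ennreal r" "r > 0" using \<open>f x \<noteq> 0\<close> by (cases "f x") (auto simp: less_eq_real_def)
      obtain n where "inverse (real (Suc n)) < r" using reals_Archimedean[OF r(2)] by blast
      hence "ennreal (1 / real (Suc n)) < f x" using r by (simp add: ennreal_less_iff inverse_eq_divide)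
      thus ?thesis by (auto simp: A_def)
    qed (auto simp: A_def)
    then obtain n where "x \<in> A n" by blast
    hence "f x \<le> f x * indicator (A n) x" by simp
    also have "\<dots> \<le> (SUP n. f x * indicator (A n) x)" by (rule SUP_upper) simp
    finally have "f x \<le> (SUP n. f x * indicator (A n) x)" .
    moreover have "(SUP n. f x * indicator (A n) x) \<le> f x" by (rule SUP_least) (auto simp: indicator_def)
    ultimately show ?thesis by (rule antisym)
  qed simp
  hence "(\<integral>\<^sup>+x. f x \<partial>count_space UNIV) = (\<integral>\<^sup>+x. (SUP n. f x * indicator (A n) x) \<partial>count_space UNIV)" by simp
  also have "\<dots> = (SUP n. \<integral>\<^sup>+x. f x * indicator (A n) x \<partial>count_space UNIV)"
  proof (rule nn_integral_monotone_convergence_SUP)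
    have "A n \<subseteq> A (Suc n)" for n
    proof
      fix x assume "x \<in> A n"
      hence "ennreal (1 / real (Suc n)) < f x" by (simp only: A_def mem_Collect_eq)
      moreover have "ennreal (1 / real (Suc (Suc n))) \<le> ennreal (1 / real (Suc n))" by (intro ennreal_leI divide_left_mono) auto
      ultimately show "x \<in> A (Suc n)" unfolding A_def mem_Collect_eq by (rule le_less_trans[rotated])
    qed
    thus "incseq (\<lambda>n x. f x * indicator (A n) x)"
      by (intro incseq_SucI le_funI mult_left_mono) (auto simp: indicator_def)
  qed simp
  also have "\<dots> \<le> ennreal B"
  proof (rule SUP_least)
    fix n
    have "(\<integral>\<^sup>+x. f x * indicator (A n) x \<partial>count_space UNIV) = (\<integral>\<^sup>+x. f x \<partial>count_space (A n))"
      by (simp add: nn_integral_count_space_indicator)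
    also have "\<dots> = sum f (A n)" by (rule nn_integral_count_space_finite[OF finA])
    also have "\<dots> \<le> ennreal B" by (rule fin[OF finA])
    finally show "(\<integral>\<^sup>+x. f x * indicator (A n) x \<partial>count_space UNIV) \<le> ennreal B" .
  qed
  finally show ?thesis .
qed

definition keyC :: "real \<Rightarrow> real \<Rightarrow> real" where "keyC p d = 6 powr p * (famC p d * (4 powr p + 1))"

definition evs :: "(real^'n::finite \<Rightarrow> complex) \<Rightarrow> complex set" where
  "evs V = schr_eigenvalues V - complex_of_real ` {0..}"

context schr_shift
begin

text \<open>Coercivity makes \<open>H + a\<close> injective, so \<open>- a\<close> is not an
  eigenvalue and \<open>1 / (E + a)\<close> is a genuine quotient.\<close>

lemma eigenvalue_shift_nonzero: assumes "E \<in> evs V" shows "E + of_real a \<noteq> 0"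
proof
  assume 0: "E + of_real a = 0"
  obtain u where u: "(u, \<lambda>x. E * u x) \<in> schr_graph V" "\<not> ae_eq u (\<lambda>x. 0)"
    using assms unfolding evs_def schr_eigenvalues_def by blast
  have uH: "u \<in> H1" by (rule graph_H1[OF u(1)])
  have "(u, \<lambda>x. 0 + E * u x) \<in> schr_graph V" using u(1) by simp
  hence "mk u = 0" using graph_iff[OF L2_zero uH, of E] 0 by (simp add: kvec_zero)
  hence "mk u = mk (\<lambda>x. 0)" by (simp add: zero_h1_def)
  thus False using mk_eq_iff[OF uH H1_zero] u(2) by simp
qed

text \<open>Multiplicities are replaced by the lengths of flags, and the sum over eigenvalues
  becomes a sum over one list with repetitions. Distinct \<open>E\<close> have distinct
  \<open>1 / (E + a)\<close>, as joining the flags requires.\<close>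

lemma eigenvalue_flag_union:
  assumes "finite S" "S \<subseteq> {E \<in> evs V. norm E \<le> a}"
  shows "\<exists>fs Es. flag K fs \<and> map snd fs = map (\<lambda>E. 1 / (E + of_real a)) Es \<and> set Es \<subseteq> S \<and>
     (\<Sum>E\<in>S. ennreal_of_enat (alg_mult V E) * ennreal (delta E powr p)) \<le> ennreal (\<Sum>E\<leftarrow>Es. delta E powr p)"
  using assms
proof (induction S rule: finite_induct)
  case empty thus ?case by (intro exI[of _ "[]"]) (auto intro: flag.Nil)
next
  case (insert E S)
  then obtain fs Es where IH: "flag K fs" "map snd fs = map (\<lambda>E. 1 / (E + of_real a)) Es" "set Es \<subseteq> S"
     "(\<Sum>E\<in>S. ennreal_of_enat (alg_mult V E) * ennreal (delta E powr p)) \<le> ennreal (\<Sum>E\<leftarrow>Es. delta E powr p)" by blast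
  have E: "E \<in> evs V" "norm E \<le> a" using insert.prems by auto
  have nz: "E' + of_real a \<noteq> 0" if "E' \<in> insert E S" for E' using eigenvalue_shift_nonzero insert.prems that by blast
  obtain gs where gs: "flag K gs" "snd ` set gs \<subseteq> {1 / (E + of_real a)}" "alg_mult V E \<le> enat (length gs)"
    using alg_mult_le_flag[of E] E nz[of E] by (auto simp: evs_def)
  have notin: "1 / (E + of_real a) \<notin> snd ` set fs"
  proof
    assume "1 / (E + of_real a) \<in> snd ` set fs"
    hence "1 / (E + of_real a) \<in> (\<lambda>E. 1 / (E + of_real a)) ` set Es" using IH(2) by (metis list.set_map)
    then obtain E' where E': "E' \<in> S" "1 / (E + of_real a) = 1 / (E' + of_real a)" using IH(3) by auto
    hence "E = E'" using nz[of E] nz[of E'] by (simp add: divide_eq_eq)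
    thus False using E'(1) insert.hyps by simp
  qed
  have fl: "flag K (gs @ fs)" by (rule flag_append[OF bclinear_K IH(1) notin gs(1,2)])
  have sn: "map snd (gs @ fs) = map (\<lambda>E. 1 / (E + of_real a)) (replicate (length gs) E @ Es)"
  proof -
    have "map snd gs = replicate (length gs) (1 / (E + of_real a))" using gs(2) by (intro replicate_eqI) auto
    thus ?thesis using IH(2) by simp
  qed
  have dn: "delta E' \<ge> 0" for E' by (simp add: delta_def infdist_nonneg)
  have "ennreal_of_enat (alg_mult V E) \<le> ennreal_of_enat (enat (length gs))" using gs(3) by (simp only: ennreal_of_enat_le_iff)
  also have "\<dots> = ennreal (real (length gs))" by (simp add: ennreal_of_nat_eq_real_of_nat)
  finally have "ennreal_of_enat (alg_mult V E) * ennreal (delta E powr p) \<le> ennreal (real (length gs)) * ennreal (delta E powr p)"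
    by (intro mult_right_mono) auto
  also have "\<dots> = ennreal (real (length gs) * delta E powr p)" by (simp add: ennreal_mult)
  finally have t: "ennreal_of_enat (alg_mult V E) * ennreal (delta E powr p) \<le> ennreal (real (length gs) * delta E powr p)" .
  have "(\<Sum>E\<in>insert E S. ennreal_of_enat (alg_mult V E) * ennreal (delta E powr p))
     \<le> ennreal (real (length gs) * delta E powr p) + ennreal (\<Sum>E\<leftarrow>Es. delta E powr p)"
    using insert.hyps t IH(4) by (simp add: add_mono)
  also have "\<dots> = ennreal (\<Sum>E\<leftarrow>replicate (length gs) E @ Es. delta E powr p)"
    by (subst ennreal_plus[symmetric]) (auto intro!: sum_list_nonneg simp: sum_list_replicate)
  finally show ?case using fl sn IH(3)
    by (intro exI[of _ "gs @ fs"] exI[of _ "replicate (length gs) E @ Es"]) auto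
qed

lemma eigenvalue_sum_bound:
  "(\<integral>\<^sup>+E. (if E \<in> evs V \<and> norm E \<le> a then ennreal_of_enat (alg_mult V E) * ennreal (delta E powr p) else 0) \<partial>count_space UNIV)
    \<le> ennreal (keyC p (real CARD('n)) * a powr (real CARD('n) / 2) * I)"
proof (rule nn_integral_count_space_le)
  fix S :: "complex set" assume S: "finite S"
  let ?S = "{E \<in> S. E \<in> evs V \<and> norm E \<le> a}"
  have "(\<Sum>E\<in>S. (if E \<in> evs V \<and> norm E \<le> a then ennreal_of_enat (alg_mult V E) * ennreal (delta E powr p) else 0))
      = (\<Sum>E\<in>?S. ennreal_of_enat (alg_mult V E) * ennreal (delta E powr p))"
    using S by (simp add: sum.inter_filter)
  also have "\<dots> \<le> ennreal (keyC p (real CARD('n)) * a powr (real CARD('n) / 2) * I)"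
  proof -
    obtain fs Es where f: "flag K fs" "map snd fs = map (\<lambda>E. 1 / (E + of_real a)) Es" "set Es \<subseteq> ?S"
     "(\<Sum>E\<in>?S. ennreal_of_enat (alg_mult V E) * ennreal (delta E powr p)) \<le> ennreal (\<Sum>E\<leftarrow>Es. delta E powr p)"
      using eigenvalue_flag_union[of ?S] S by auto
    have "(\<Sum>E\<leftarrow>Es. delta E powr p) \<le> 6 powr p * traceC * a powr (real CARD('n) / 2) * I"
      using f(3) eigenvalue_shift_nonzero by (intro flag_delta_bound[OF f(1,2)]) auto
    hence "ennreal (\<Sum>E\<leftarrow>Es. delta E powr p) \<le> ennreal (keyC p (real CARD('n)) * a powr (real CARD('n) / 2) * I)"
      by (intro ennreal_leI) (simp add: keyC_def traceC_def)
    thus ?thesis using f(4) by (rule order_trans[rotated])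
  qed
  finally show "(\<Sum>E\<in>S. (if E \<in> evs V \<and> norm E \<le> a then ennreal_of_enat (alg_mult V E) * ennreal (delta E powr p) else 0))
     \<le> ennreal (keyC p (real CARD('n)) * a powr (real CARD('n) / 2) * I)" .
qed

end

lemma exists_dyadic:
  fixes x b :: real assumes b: "b > 0" "b \<le> x"
  shows "\<exists>k::nat. b * 2 ^ k \<le> x \<and> x \<le> b * 2 ^ Suc k"
proof -
  obtain n where "x / b < 2 ^ n" using real_arch_pow[of 2 "x / b"] by auto
  hence n: "x \<le> b * 2 ^ Suc n" using b by (simp add: field_simps)
  define k where "k = (LEAST n. x \<le> b * 2 ^ Suc n)"
  have k: "x \<le> b * 2 ^ Suc k" unfolding k_def by (rule LeastI[of "\<lambda>n. x \<le> b * 2 ^ Suc n", OF n])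
  have "b * 2 ^ k \<le> x"
  proof (cases k)
    case (Suc j)
    hence "\<not> x \<le> b * 2 ^ Suc j" using not_less_Least[of j "\<lambda>n. x \<le> b * 2 ^ Suc n"] by (simp add: k_def)
    thus ?thesis using Suc by simp
  qed (use b in simp)
  thus ?thesis using k by blast
qed

section \<open>From one disc to dyadic shells\<close>

context schr_potential
begin

text \<open>Solves the smallness condition of \<open>schr_shift\<close> for \<open>a\<close>: the
  power of 2 undoes \<open>(1/2) powr p\<close>, and the summand 1 keeps the threshold positive on
  the sole basis of \<open>famC >= 0\<close>.\<close>

definition "thrC = 2 powr p * famC p (real CARD('n)) + 1"

lemma keyC_nonneg: "keyC p (real CARD('n)) \<ge> 0" unfolding keyC_def using famC_nonneg[OF p] by simp

lemma schr_shiftI: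
  assumes a: "a > 0" "a powr (p - real CARD('n) / 2) \<ge> thrC * I"
  shows "schr_shift V p a"
proof (unfold_locales)
  let ?g = "p - real CARD('n) / 2"
  have ag: "a powr ?g > 0" using a by simp
  have "famC p (real CARD('n)) * I * 2 powr p \<le> thrC * I"
    unfolding thrC_def distrib_right using I_nonneg by (simp only: mult_ac mult_1)
  also have "\<dots> \<le> a powr ?g" by (rule a)
  finally have "famC p (real CARD('n)) * I / a powr ?g \<le> 1 / 2 powr p" using ag by (simp add: field_simps)
  moreover have "a powr (real CARD('n) / 2 - p) = 1 / a powr ?g" using powr_minus_divide[of a ?g] by simp
  ultimately show "famC p (real CARD('n)) * a powr (real CARD('n) / 2 - p) * I \<le> (1 / 2) powr p"
    by (simp add: powr_divide mult_ac)
qed (rule a)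

abbreviation "evterm E \<equiv> ennreal_of_enat (alg_mult V E) * ennreal (delta E powr p)"

lemma eigenvalue_sum_le:
  assumes "a > 0" "a powr (p - real CARD('n) / 2) \<ge> thrC * I"
  shows "(\<integral>\<^sup>+E. (if E \<in> evs V \<and> norm E \<le> a then evterm E else 0) \<partial>count_space UNIV)
    \<le> ennreal (keyC p (real CARD('n)) * a powr (real CARD('n) / 2) * I)"
  by (rule schr_shift.eigenvalue_sum_bound[OF schr_shiftI[OF assms]])

text \<open>In the shell \<open>b 2^k <= norm E <= b 2^(k+1)\<close> the denominator costs at most
  \<open>(b 2^k) powr (- d/2 - \<epsilon>)\<close>, while the disc bound grows only like the power
  \<open>d/2\<close> of the outer radius. The products form a geometric series of ratio
  \<open>2 powr (- \<epsilon>)\<close>; \<open>2 powr (d/2)\<close> is the price of the outer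
  radius.\<close>

lemma large_eigenvalue_sum_le:
  assumes b: "b > 0" "b powr (p - real CARD('n) / 2) \<ge> thrC * I" and \<epsilon>: "\<epsilon> > 0"
  shows "(\<integral>\<^sup>+E. (if E \<in> evs V \<and> b \<le> norm E then ennreal_of_enat (alg_mult V E) *
       ennreal (delta E powr p / norm E powr (real CARD('n) / 2 + \<epsilon>)) else 0) \<partial>count_space UNIV)
    \<le> ennreal (keyC p (real CARD('n)) * 2 powr (real CARD('n) / 2) / (1 - 2 powr (- \<epsilon>)) * I * b powr (- \<epsilon>))"
proof -
  let ?d = "real CARD('n)"
  let ?q = "?d / 2 + \<epsilon>"
  define ak where "ak k = b * 2 ^ k" for k :: nat
  have ak0: "ak k > 0" for k using b by (simp add: ak_def)
  have akg: "ak k powr (p - ?d / 2) \<ge> thrC * I" for k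
  proof -
    have "b * 1 \<le> b * 2 ^ k" using b(1) by (intro mult_left_mono) auto
    hence "b powr (p - ?d / 2) \<le> ak k powr (p - ?d / 2)" using b p unfolding ak_def by (intro powr_mono2) auto
    thus ?thesis using b(2) by linarith
  qed
  let ?T = "\<lambda>E. ennreal_of_enat (alg_mult V E) * ennreal (delta E powr p / norm E powr ?q)"
  let ?h = "\<lambda>k E. ennreal (ak k powr (- ?q)) * (if E \<in> evs V \<and> norm E \<le> ak (Suc k) then evterm E else 0)"
  have pt: "(if E \<in> evs V \<and> b \<le> norm E then ?T E else 0) \<le> (\<Sum>k. ?h k E)" for E
  proof (cases "E \<in> evs V \<and> b \<le> norm E")
    case True
    obtain k where k: "ak k \<le> norm E" "norm E \<le> ak (Suc k)" using exists_dyadic[OF b(1), of "norm E"] True unfolding ak_def by blast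
    have "norm E powr (- ?q) \<le> ak k powr (- ?q)" using k(1) ak0[of k] \<epsilon> by (intro powr_mono2') auto
    hence "delta E powr p / norm E powr ?q \<le> ak k powr (- ?q) * delta E powr p"
    proof -
      have "delta E powr p / norm E powr ?q = norm E powr (- ?q) * delta E powr p" unfolding powr_minus_divide by (simp only: times_divide_eq_left mult_1)
      thus ?thesis using mult_right_mono[of "norm E powr (- ?q)" "ak k powr (- ?q)" "delta E powr p"] \<open>norm E powr (- ?q) \<le> ak k powr (- ?q)\<close> by simp
    qed
    hence "?T E \<le> ennreal_of_enat (alg_mult V E) * ennreal (ak k powr (- ?q) * delta E powr p)"
      by (intro mult_left_mono ennreal_leI) auto
    also have "\<dots> = ?h k E" using True k by (simp add: ennreal_mult mult_ac)
    also have "\<dots> \<le> (\<Sum>k. ?h k E)"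
      using sum_le_suminf[OF summableI, of "{k}" "\<lambda>k. ?h k E"] by simp
    finally show ?thesis using True by simp
  next
    case False
    hence "(if E \<in> evs V \<and> b \<le> norm E then ?T E else 0) = 0" by (rule if_not_P)
    thus ?thesis by (simp only: zero_le)
  qed
  have "(\<integral>\<^sup>+E. (if E \<in> evs V \<and> b \<le> norm E then ?T E else 0) \<partial>count_space UNIV) \<le> (\<integral>\<^sup>+E. (\<Sum>k. ?h k E) \<partial>count_space UNIV)"
    by (intro nn_integral_mono pt)
  also have "\<dots> = (\<Sum>k. \<integral>\<^sup>+E. ?h k E \<partial>count_space UNIV)" by (rule nn_integral_suminf) simp
  also have "\<dots> \<le> (\<Sum>k. ennreal (keyC p ?d * 2 powr (?d / 2) * I * b powr (- \<epsilon>) * 2 powr (- \<epsilon> * real k)))"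
  proof (intro suminf_le summableI)
    fix k
    have "(\<integral>\<^sup>+E. ?h k E \<partial>count_space UNIV) = ennreal (ak k powr (- ?q)) * (\<integral>\<^sup>+E. (if E \<in> evs V \<and> norm E \<le> ak (Suc k) then evterm E else 0) \<partial>count_space UNIV)"
      by (rule nn_integral_cmult) simp
    also have "\<dots> \<le> ennreal (ak k powr (- ?q)) * ennreal (keyC p ?d * ak (Suc k) powr (?d / 2) * I)"
      by (intro mult_left_mono eigenvalue_sum_le ak0 akg) auto
    also have "\<dots> = ennreal (ak k powr (- ?q) * (keyC p ?d * ak (Suc k) powr (?d / 2) * I))"
      using keyC_nonneg I_nonneg by (simp add: ennreal_mult)
    also have "ak k powr (- ?q) * (keyC p ?d * ak (Suc k) powr (?d / 2) * I) = keyC p ?d * 2 powr (?d / 2) * I * b powr (- \<epsilon>) * 2 powr (- \<epsilon> * real k)"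
    proof -
      have "ak (Suc k) = 2 * ak k" by (simp add: ak_def)
      hence e1: "ak (Suc k) powr (?d / 2) = 2 powr (?d / 2) * ak k powr (?d / 2)" by (simp add: powr_mult)
      have e2: "ak k powr (- ?q) * ak k powr (?d / 2) = ak k powr (- \<epsilon>)" unfolding powr_add[symmetric] by simp
      have e3: "ak k powr (- \<epsilon>) = b powr (- \<epsilon>) * 2 powr (- \<epsilon> * real k)"
      proof -
        have "ak k = b * 2 powr real k" by (simp add: ak_def powr_realpow)
        thus ?thesis by (simp add: powr_mult powr_powr mult.commute)
      qed
      have "ak k powr (- ?q) * (keyC p ?d * ak (Suc k) powr (?d / 2) * I) = keyC p ?d * 2 powr (?d / 2) * I * (ak k powr (- ?q) * ak k powr (?d / 2))"
        unfolding e1 by (simp only: mult_ac)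
      thus ?thesis unfolding e2 e3 by (simp only: mult.assoc)
    qed
    finally show "(\<integral>\<^sup>+E. ?h k E \<partial>count_space UNIV) \<le> ennreal (keyC p ?d * 2 powr (?d / 2) * I * b powr (- \<epsilon>) * 2 powr (- \<epsilon> * real k))" .
  qed
  also have "\<dots> = ennreal (keyC p ?d * 2 powr (?d / 2) * I * b powr (- \<epsilon>) * (1 / (1 - 2 powr (- \<epsilon>))))"
    using sums_mult[OF geometric_powr(2)[OF \<epsilon>], of "keyC p ?d * 2 powr (?d / 2) * I * b powr (- \<epsilon>)"] keyC_nonneg I_nonneg
    by (intro suminf_ennreal_eq) auto
  also have "keyC p ?d * 2 powr (?d / 2) * I * b powr (- \<epsilon>) * (1 / (1 - 2 powr (- \<epsilon>))) = keyC p ?d * 2 powr (?d / 2) / (1 - 2 powr (- \<epsilon>)) * I * b powr (- \<epsilon>)"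
    by simp
  finally show ?thesis .
qed

text \<open>For \<open>I = 0\<close> every positive shift is admissible, \<open>a = norm E\<close>
  included. This settles the degenerate case of the second inequality, whose threshold is then 0 and
  excludes no eigenvalue.\<close>

lemma evterm_zero: assumes "I = 0" "E \<in> evs V" shows "evterm E = 0"
proof -
  have E0: "norm E > 0" using assms(2) by (auto simp: evs_def)
  have "evterm E = (\<integral>\<^sup>+E'. evterm E' * indicator {E} E' \<partial>count_space UNIV)"
    using nn_integral_indicator_singleton[of E "count_space UNIV" evterm] by simp
  also have "\<dots> \<le> (\<integral>\<^sup>+E'. (if E' \<in> evs V \<and> norm E' \<le> norm E then evterm E' else 0) \<partial>count_space UNIV)"
    using assms(2) by (intro nn_integral_mono) (auto simp: indicator_def)
  also have "\<dots> \<le> 0" using eigenvalue_sum_le[OF E0] assms(1) by simp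
  finally show ?thesis by simp
qed

end

section \<open>Choice of the shift and homogeneity in the integral of the potential\<close>

theorem theorem1p3:
  fixes \<gamma> :: real
  assumes "(CARD('n::finite) = 1 \<and> \<gamma> \<ge> 1/2) \<or> (CARD('n) \<ge> 2 \<and> \<gamma> > 0)"
  defines "p \<equiv> \<gamma> + real CARD('n) / 2"
  shows "\<exists>C > 0. \<exists>L :: real.
    (\<forall>V :: real^'n \<Rightarrow> complex.
       V \<in> borel_measurable lborel \<and> integrable lborel (\<lambda>x. norm (V x) powr p) \<longrightarrow>
       (let I = (\<integral>x. norm (V x) powr p \<partial>lborel);
            S = (\<integral>\<^sup>+ E. (if E \<in> schr_eigenvalues V - complex_of_real ` {0..} \<and> norm E powr \<gamma> \<le> C * I
                         then ennreal_of_enat (alg_mult V E) * ennreal (delta E powr p) else 0)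
                    \<partial>count_space UNIV)
        in S < \<infinity> \<and> enn2real S powr (\<gamma> / p) \<le> L * I)) \<and>
    (\<forall>\<epsilon>'. 0 < \<epsilon>' \<and> \<epsilon>' < \<gamma> \<longrightarrow> (\<exists>L\<epsilon> :: real.
       \<forall>(V :: real^'n \<Rightarrow> complex) (\<mu> :: real).
         V \<in> borel_measurable lborel \<and> integrable lborel (\<lambda>x. norm (V x) powr p) \<and> \<mu> \<ge> 1 \<longrightarrow>
         (let I = (\<integral>x. norm (V x) powr p \<partial>lborel);
              S = (\<integral>\<^sup>+ E. (if E \<in> schr_eigenvalues V - complex_of_real ` {0..} \<and> norm E powr \<gamma> \<ge> \<mu> * C * I
                           then ennreal_of_enat (alg_mult V E) *
                                ennreal (delta E powr p / norm E powr (real CARD('n) / 2 + \<epsilon>')) else 0)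
                      \<partial>count_space UNIV)
          in S < \<infinity> \<and> enn2real S powr (\<gamma> / (\<gamma> - \<epsilon>')) \<le> L\<epsilon> * \<mu> powr (- (\<epsilon>' / (\<gamma> - \<epsilon>'))) * I)))"
proof -
  let ?d = "real CARD('n)"
  have \<gamma>: "\<gamma> > 0" using assms(1) by auto
  have d1: "?d \<ge> 1" by (simp add: Suc_le_eq)
  have p1: "p \<ge> 1" using assms(1) unfolding p_def by auto
  have p2: "2 * p > ?d" using \<gamma> unfolding p_def by simp
  have pg: "p - ?d / 2 = \<gamma>" by (simp add: p_def)
  \<comment> \<open>Equals \<open>thrC\<close> of every potential, but is fixed before any potential
    is, as the order of quantifiers demands.\<close>
  define C where "C = 2 powr p * famC p ?d + 1"
  have C: "C > 0" unfolding C_def using famC_nonneg[OF p1 p2] by (simp add: add_nonneg_pos)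
  let ?k = "keyC p ?d"
  have k0: "?k \<ge> 0" unfolding keyC_def using famC_nonneg[OF p1 p2] by simp
  define L where "L = (?k * C powr (?d / 2 / \<gamma>)) powr (\<gamma> / p)"
  define L' where "L' e = (?k * 2 powr (?d / 2) / (1 - 2 powr (- e)) * C powr (- e / \<gamma>)) powr (\<gamma> / (\<gamma> - e))" for e
  have first: "S < \<infinity> \<and> enn2real S powr (\<gamma> / p) \<le> L * I"
    if V: "V \<in> borel_measurable lborel" "integrable lborel (\<lambda>x. norm (V x) powr p)"
      and I: "I = (\<integral>x. norm (V x) powr p \<partial>lborel)"
      and S: "S = (\<integral>\<^sup>+ E. (if E \<in> schr_eigenvalues V - complex_of_real ` {0..} \<and> norm E powr \<gamma> \<le> C * I
                         then ennreal_of_enat (alg_mult V E) * ennreal (delta E powr p) else 0)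
                    \<partial>count_space UNIV)" for V :: "real^'n \<Rightarrow> complex" and I S
  proof -
    interpret schr_potential V p using V p1 p2 by unfold_locales auto
    have II: "local.I = I" by (simp add: I_def I)
    have I0: "I \<ge> 0" using I_nonneg II by simp
    have CC: "thrC = C" by (simp add: thrC_def C_def)
    show ?thesis
    proof (cases "I = 0")
      \<comment> \<open>The condition now forces \<open>E = 0\<close>, which lies on the excluded
        half-line.\<close>
      case True
      have "(if E \<in> schr_eigenvalues V - complex_of_real ` {0..} \<and> norm E powr \<gamma> \<le> C * I then evterm E else 0) = 0" for E
      proof -
        have "0 \<in> complex_of_real ` {0..}" by (rule image_eqI[of _ _ 0]) auto
        moreover have "\<not> norm E powr \<gamma> \<le> C * I" if "E \<noteq> 0"
        proof -
          have "norm E powr \<gamma> > 0" using that by simp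
          thus ?thesis using True by simp
        qed
        ultimately show ?thesis by (cases "E = 0") auto
      qed
      hence "S = 0" unfolding S by simp
      thus ?thesis using True by simp
    next
      case False
      hence Ip: "I > 0" using I0 by simp
      \<comment> \<open>The smallest admissible shift: the threshold condition holds with
        equality.\<close>
      define a where "a = (C * I) powr (1 / \<gamma>)"
      have a0: "a > 0" using C Ip by (simp add: a_def)
      have ag: "a powr \<gamma> = C * I" using C Ip \<gamma> by (simp add: a_def powr_powr)
      have "S \<le> (\<integral>\<^sup>+E. (if E \<in> evs V \<and> norm E \<le> a then evterm E else 0) \<partial>count_space UNIV)"
        unfolding S
      proof (intro nn_integral_mono)
        fix E :: complex
        have "norm E \<le> a" if "norm E powr \<gamma> \<le> C * I"
        proof (rule ccontr)
          assume "\<not> norm E \<le> a"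
          hence "a powr \<gamma> < norm E powr \<gamma>" using a0 \<gamma> by (intro powr_less_mono2) auto
          thus False using that ag by simp
        qed
        thus "(if E \<in> schr_eigenvalues V - complex_of_real ` {0..} \<and> norm E powr \<gamma> \<le> C * I then evterm E else 0)
           \<le> (if E \<in> evs V \<and> norm E \<le> a then evterm E else 0)" by (auto simp: evs_def)
      qed
      also have "\<dots> \<le> ennreal (?k * a powr (?d / 2) * I)"
        using eigenvalue_sum_le[OF a0] by (simp add: pg ag CC II)
      finally have SB: "S \<le> ennreal (?k * a powr (?d / 2) * I)" .
      hence fin: "S < \<infinity>" by (auto intro: le_less_trans)
      have "enn2real S \<le> ?k * a powr (?d / 2) * I" using SB k0 I0 by (intro enn2real_leI) auto
      hence "enn2real S powr (\<gamma> / p) \<le> (?k * a powr (?d / 2) * I) powr (\<gamma> / p)" using \<gamma> p1 by (intro powr_mono2) auto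
      \<comment> \<open>Since \<open>a\<close> scales like \<open>I^(1/\<gamma>)\<close>, the total
        power of \<open>I\<close> is \<open>d/(2\<gamma>) + 1 = p/\<gamma>\<close>, which the outer
        exponent \<open>\<gamma>/p\<close> reduces to 1.\<close>
      also have "?k * a powr (?d / 2) * I = (?k * C powr (?d / 2 / \<gamma>)) * I powr (p / \<gamma>)"
      proof -
        have "a powr (?d / 2) = C powr (?d / 2 / \<gamma>) * I powr (?d / 2 / \<gamma>)"
          unfolding a_def by (simp add: powr_powr powr_mult mult.commute)
        moreover have "I powr (?d / 2 / \<gamma>) * I = I powr (p / \<gamma>)"
        proof -
          have "I powr (?d / 2 / \<gamma>) * I powr 1 = I powr (?d / 2 / \<gamma> + 1)" by (rule powr_add[symmetric])
          also have "?d / 2 / \<gamma> + 1 = p / \<gamma>" using \<gamma> by (simp add: p_def field_simps)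
          finally show ?thesis using Ip by simp
        qed
        ultimately show ?thesis by (simp add: mult.assoc)
      qed
      also have "((?k * C powr (?d / 2 / \<gamma>)) * I powr (p / \<gamma>)) powr (\<gamma> / p) = L * (I powr (p / \<gamma>)) powr (\<gamma> / p)"
        unfolding L_def by (rule powr_mult)
      also have "(I powr (p / \<gamma>)) powr (\<gamma> / p) = I" using Ip \<gamma> p1 by (simp add: powr_powr)
      finally show ?thesis using fin by simp
    qed
  qed
  have second: "S < \<infinity> \<and> enn2real S powr (\<gamma> / (\<gamma> - e)) \<le> L' e * \<mu> powr (- (e / (\<gamma> - e))) * I"
    if e: "0 < e" "e < \<gamma>" and V: "V \<in> borel_measurable lborel" "integrable lborel (\<lambda>x. norm (V x) powr p)" and \<mu>: "\<mu> \<ge> 1"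
      and I: "I = (\<integral>x. norm (V x) powr p \<partial>lborel)"
      and S: "S = (\<integral>\<^sup>+ E. (if E \<in> schr_eigenvalues V - complex_of_real ` {0..} \<and> norm E powr \<gamma> \<ge> \<mu> * C * I
                           then ennreal_of_enat (alg_mult V E) *
                                ennreal (delta E powr p / norm E powr (?d / 2 + e)) else 0)
                      \<partial>count_space UNIV)" for V :: "real^'n \<Rightarrow> complex" and I S e \<mu>
  proof -
    interpret schr_potential V p using V p1 p2 by unfold_locales auto
    have II: "local.I = I" by (simp add: I_def I)
    have I0: "I \<ge> 0" using I_nonneg II by simp
    have CC: "thrC = C" by (simp add: thrC_def C_def)
    show ?thesis
    proof (cases "I = 0")
      case True
      have "(if E \<in> schr_eigenvalues V - complex_of_real ` {0..} \<and> norm E powr \<gamma> \<ge> \<mu> * C * I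
                           then ennreal_of_enat (alg_mult V E) *
                                ennreal (delta E powr p / norm E powr (?d / 2 + e)) else 0) = 0" for E
        using evterm_zero[of E] True II by (auto simp: evs_def)
      hence "S = 0" unfolding S by simp
      thus ?thesis using True by simp
    next
      case False
      hence Ip: "I > 0" using I0 by simp
      \<comment> \<open>The lower edge of the region in the second sum; it is an admissible shift
        because \<open>\<mu> >= 1\<close>.\<close>
      define b where "b = (\<mu> * C * I) powr (1 / \<gamma>)"
      have mp: "\<mu> * C * I > 0" using C Ip \<mu> by simp
      have b0: "b > 0" using C Ip \<mu> unfolding b_def by simp
      have bg: "b powr \<gamma> = \<mu> * C * I" using mp \<gamma> by (simp add: b_def powr_powr)
      have bC: "b powr (p - ?d / 2) \<ge> thrC * local.I"
      proof -
        have "1 * (C * I) \<le> \<mu> * (C * I)" using \<mu> C Ip by (intro mult_right_mono) auto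
        thus ?thesis by (simp add: pg bg CC II mult.assoc)
      qed
      let ?D = "?k * 2 powr (?d / 2) / (1 - 2 powr (- e))"
      have "2 powr (- e) < 2 powr (0::real)" using e by (intro powr_less_mono) auto
      hence D0: "?D \<ge> 0" using k0 by simp
      have "S \<le> (\<integral>\<^sup>+E. (if E \<in> evs V \<and> b \<le> norm E then ennreal_of_enat (alg_mult V E) *
            ennreal (delta E powr p / norm E powr (?d / 2 + e)) else 0) \<partial>count_space UNIV)"
        unfolding S
      proof (intro nn_integral_mono)
        fix E :: complex
        have "b \<le> norm E" if "norm E powr \<gamma> \<ge> \<mu> * C * I"
        proof (rule ccontr)
          assume "\<not> b \<le> norm E"
          hence "norm E powr \<gamma> < b powr \<gamma>" using b0 \<gamma> by (intro powr_less_mono2) auto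
          thus False using that bg by simp
        qed
        thus "(if E \<in> schr_eigenvalues V - complex_of_real ` {0..} \<and> norm E powr \<gamma> \<ge> \<mu> * C * I
           then ennreal_of_enat (alg_mult V E) * ennreal (delta E powr p / norm E powr (?d / 2 + e)) else 0)
           \<le> (if E \<in> evs V \<and> b \<le> norm E then ennreal_of_enat (alg_mult V E) *
            ennreal (delta E powr p / norm E powr (?d / 2 + e)) else 0)" by (auto simp: evs_def)
      qed
      also have "\<dots> \<le> ennreal (?D * I * b powr (- e))"
        using large_eigenvalue_sum_le[OF b0 bC e(1)] by (simp add: II)
      finally have SB: "S \<le> ennreal (?D * I * b powr (- e))" .
      hence fin: "S < \<infinity>" by (auto intro: le_less_trans)
      let ?r = "\<gamma> / (\<gamma> - e)"
      have "enn2real S \<le> ?D * I * b powr (- e)" by (rule enn2real_leI[OF _ SB]) (intro mult_nonneg_nonneg D0 I0 powr_ge_zero)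
      hence "enn2real S powr ?r \<le> (?D * I * b powr (- e)) powr ?r" using \<gamma> e by (intro powr_mono2) auto
      \<comment> \<open>The factor \<open>b powr (- e)\<close> contributes
        \<open>-e/\<gamma>\<close> to the powers of both \<mu> and \<open>I\<close>. The outer
        exponent \<open>\<gamma>/(\<gamma> - e)\<close> brings \<open>I\<close> back to the first
        power and turns the exponent of \<mu> into \<open>-e/(\<gamma> - e)\<close>.\<close>
      also have "?D * I * b powr (- e) = (?D * C powr (- e / \<gamma>)) * (\<mu> powr (- e / \<gamma>) * I powr ((\<gamma> - e) / \<gamma>))"
      proof -
        have "b powr (- e) = (\<mu> * C * I) powr (- e / \<gamma>)" unfolding b_def by (simp add: powr_powr)
        also have "\<dots> = \<mu> powr (- e / \<gamma>) * C powr (- e / \<gamma>) * I powr (- e / \<gamma>)" by (simp only: powr_mult)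
        finally have "?D * I * b powr (- e) = (?D * C powr (- e / \<gamma>)) * (\<mu> powr (- e / \<gamma>) * (I powr (- e / \<gamma>) * I))" by (simp only: mult_ac)
        moreover have "I powr (- e / \<gamma>) * I = I powr ((\<gamma> - e) / \<gamma>)"
        proof -
          have "I powr (- e / \<gamma>) * I powr 1 = I powr (- e / \<gamma> + 1)" by (rule powr_add[symmetric])
          also have "- e / \<gamma> + 1 = (\<gamma> - e) / \<gamma>" using \<gamma> by (simp add: field_simps)
          finally show ?thesis using Ip by simp
        qed
        ultimately show ?thesis by (simp only:)
      qed
      also have "((?D * C powr (- e / \<gamma>)) * (\<mu> powr (- e / \<gamma>) * I powr ((\<gamma> - e) / \<gamma>))) powr ?r
         = L' e * ((\<mu> powr (- e / \<gamma>)) powr ?r * (I powr ((\<gamma> - e) / \<gamma>)) powr ?r)"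
        unfolding L'_def by (simp only: powr_mult)
      also have "(\<mu> powr (- e / \<gamma>)) powr ?r = \<mu> powr (- (e / (\<gamma> - e)))" using \<gamma> e by (simp add: powr_powr)
      also have "(I powr ((\<gamma> - e) / \<gamma>)) powr ?r = I" using Ip \<gamma> e by (simp add: powr_powr)
      finally show ?thesis using fin by (simp add: mult.assoc)
    qed
  qed
  show ?thesis
    unfolding Let_def
    by (rule exI[of _ C], rule conjI[OF C], rule exI[of _ L], rule conjI)
       (use first in blast, use second in blast)
qed

end
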